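(* Let $1\le n\le 6$ and $s\in(0,1]$. Suppose that $$\gamma\ge \min\left\{\frac n2,\ \frac{\sqrt{n^2+16n}-n}{4}\right\}=\begin{cases} n/2 & n=1\text{ or }2,\\ \frac{\sqrt{n^2+16n}-n}{4} & n\ge 3,\end{cases}$$ $$p>\max\left\{1+\frac2n,\ \frac{\sqrt{n^2+16n}+n}{2n}\right\}=\begin{cases}1+2/n & n=1\text{ or }2,\\ \frac{\sqrt{n^2+16n}+n}{2n} & n\ge 3,\end{cases}$$ and $p\le \frac{n}{n-2s}$ if $n>2s$. If $$(u_0,u_1)\in(\dot H^{-\gamma}\cap H^s)\times(\dot H^{-\gamma}\cap L^2),$$ then, for all sufficiently small $\varepsilon>0$, there is a unique mild solution $u\in C([0,\infty);H^s)$ to the Cauchy problem $$\partial_t^2u+\partial_tu-\Delta u=|u|^p\quad (x\in\mathbb R^n,\ t>0),\qquad u(0,x)=\varepsilon u_0(x),\quad \partial_tu(0,x)=\varepsilon u_1(x).$$ Furthermore, for every number $\tilde\gamma>0$ satisfying $$\tilde\gamma<\frac n2\qquad\text{and}\qquad \tilde\gamma\le\min\left\{\frac{n(p-1)}{2},\ \gamma\right\},$$ the solution $u$ satisfies the decay estimates, for all $t\ge 0$, $$\|u(t,\cdot)\|_{L^2}\le C\varepsilon(1+t)^{-\frac{\tilde\gamma}{2}}\,\|(u_0,u_1)\|_{(\dot H^{-\gamma}\cap H^s)\times(\dot H^{-\gamma}\cap L^2)},$$ $$\|u(t,\cdot)\|_{\dot H^s}\le C\varepsilon(1+t)^{-\frac{s+\tilde\gamma}{2}}\,\|(u_0,u_1)\|_{(\dot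 H^{-\gamma}\cap H^s)\times(\dot H^{-\gamma}\cap L^2)},$$ with a constant $C>0$ independent of $t$ and $\varepsilon$.
   Context: All function spaces are on $\mathbb R^n$. $\hat f$ is the Fourier transform, normalized so that $-\Delta$ has symbol $|\xi|^2$. $H^s$ is the usual inhomogeneous Sobolev space with $\|f\|_{H^s}=\|(1+|\xi|^2)^{s/2}\hat f\|_{L^2}$. For $\gamma>0$, $\|f\|_{\dot H^{-\gamma}}:=\||\xi|^{-\gamma}\hat f\|_{L^2}$ and $\dot H^{-\gamma}:=\{f:\|f\|_{\dot H^{-\gamma}}<\infty\}$; likewise $\|f\|_{\dot H^s}:=\||\xi|^s\hat f\|_{L^2}$. Intersections and products of spaces carry the sum of the norms. Mild solution: let $K(t)$ be the fundamental solution of the linear damped wave equation, i.e. $f\mapsto K(t)*f$ is the Fourier multiplier with symbol $$\hat K(t,\xi)=e^{-t/2}\sum_{k=0}^\infty\frac{(\frac14-|\xi|^2)^k}{(2k+1)!}t^{2k+1}=\begin{cases}e^{-t/2}\,\frac{\sinh\left(t\sqrt{1/4-|\xi|^2}\right)}{\sqrt{1/4-|\xi|^2}}&|\xi|<1/2,\\ t\,e^{-t/2}&|\xi|=1/2,\\ e^{-t/2}\,\frac{\sin\left(t\sqrt{|\xi|^2-1/4}\right)}{\sqrt{|\xi|^2-1/4}}&|\xi|>1/2,\end{cases}$$ and let $K'(t)=\partial_tK(t)$. A function $u$ is a mild solution of the Cauchy problem with data $(\varepsilon u_0,\varepsilon u_1)$ if for all $t\ge0$ $$u(t)=\varepsilon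 K'(t)*u_0+\varepsilon K(t)*(u_0+u_1)+\int_0^tK(t-\tau)*|u(\tau)|^p\,d\tau.$$ *)

theory Defs
  imports "HOL-Analysis.Analysis"
begin

section \<open>The Hilbert space of square integrable functions\<close>

definition square_integrable :: "('a::euclidean_space \<Rightarrow> complex) \<Rightarrow> bool" where
  "square_integrable f \<longleftrightarrow>
     f \<in> borel_measurable lborel \<and> integrable lborel (\<lambda>x. (norm (f x))\<^sup>2)"

definition L2_eq :: "('a::euclidean_space \<Rightarrow> complex) \<Rightarrow> ('a \<Rightarrow> complex) \<Rightarrow> bool" where
  "L2_eq f g \<longleftrightarrow> square_integrable f \<and> square_integrable g \<and> (AE x in lborel. f x = g x)"

lemma square_integrable_zero: "square_integrable (\<lambda>x. 0)"
  by (simp add: square_integrable_def)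

lemma square_integrable_scaleR:
  assumes "square_integrable f" shows "square_integrable (\<lambda>x. c *\<^sub>R f x)"
  using assms by (auto simp: square_integrable_def power_mult_distrib)

lemma square_integrable_add:
  assumes "square_integrable f" "square_integrable g"
  shows "square_integrable (\<lambda>x. f x + g x)"
proof -
  have [measurable]: "f \<in> borel_measurable borel" "g \<in> borel_measurable borel"
    using assms by (auto simp: square_integrable_def)
  have bd: "(norm (a + b))\<^sup>2 \<le> 2 * (norm a)\<^sup>2 + 2 * (norm b)\<^sup>2" for a b :: complex
  proof -
    have "(norm (a + b))\<^sup>2 \<le> (norm a + norm b)\<^sup>2"
      by (intro power_mono norm_triangle_ineq) auto
    also have "\<dots> \<le> 2 * (norm a)\<^sup>2 + 2 * (norm b)\<^sup>2"
      using sum_squares_bound[of "norm a" "norm b"] by (simp add: power2_sum)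
    finally show ?thesis .
  qed
  have "integrable lborel (\<lambda>x. 2 * (norm (f x))\<^sup>2 + 2 * (norm (g x))\<^sup>2)"
    using assms by (auto simp: square_integrable_def)
  then have "integrable lborel (\<lambda>x. (norm (f x + g x))\<^sup>2)"
    by (rule Bochner_Integration.integrable_bound) (auto intro!: AE_I2 bd)
  then show ?thesis by (simp add: square_integrable_def)
qed

lemma square_integrable_uminus: "square_integrable f \<Longrightarrow> square_integrable (\<lambda>x. - f x)"
  using square_integrable_scaleR[of f "-1"] by simp

lemma square_integrable_diff:
  "square_integrable f \<Longrightarrow> square_integrable g \<Longrightarrow> square_integrable (\<lambda>x. f x - g x)"
  using square_integrable_add[OF _ square_integrable_uminus, of f g] by simp

lemma integrable_inner_L2:
  assumes "square_integrable f" "square_integrable g"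
  shows "integrable lborel (\<lambda>x. f x \<bullet> g x)"
proof -
  have [measurable]: "f \<in> borel_measurable borel" "g \<in> borel_measurable borel"
    using assms by (auto simp: square_integrable_def)
  have bd: "\<bar>a \<bullet> b\<bar> \<le> (norm a)\<^sup>2 + (norm b)\<^sup>2" for a b :: complex
  proof -
    have "2 * (norm a * norm b) \<le> (norm a)\<^sup>2 + (norm b)\<^sup>2"
      using sum_squares_bound[of "norm a" "norm b"] by simp
    moreover have "norm a * norm b \<ge> 0" by simp
    ultimately show ?thesis using Cauchy_Schwarz_ineq2[of a b] by linarith
  qed
  have "integrable lborel (\<lambda>x. (norm (f x))\<^sup>2 + (norm (g x))\<^sup>2)"
    using assms by (auto simp: square_integrable_def)
  then show ?thesis
    by (rule Bochner_Integration.integrable_bound) (auto intro!: AE_I2 bd)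
qed

text \<open>Elements of \<open>'a L2\<close> are classes of Borel functions modulo equality almost everywhere.
  \<open>L2_class f\<close> is only meaningful for square integrable \<open>f\<close>;
  \<open>L2_fun u\<close> is some representative of the class \<open>u\<close>.\<close>

quotient_type (overloaded) 'a L2 = "'a::euclidean_space \<Rightarrow> complex" / partial: L2_eq
  morphisms L2_fun L2_class
proof (rule part_equivpI)
  show "\<exists>f::'a \<Rightarrow> complex. L2_eq f f"
    by (rule exI[of _ "\<lambda>x. 0"]) (simp add: L2_eq_def square_integrable_zero)
  show "symp (L2_eq :: ('a \<Rightarrow> complex) \<Rightarrow> _)"
    by (auto simp: symp_def L2_eq_def elim: eventually_mono)
  show "transp (L2_eq :: ('a \<Rightarrow> complex) \<Rightarrow> _)"
    unfolding transp_def L2_eq_def by (auto elim!: eventually_elim2)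
qed

instantiation L2 :: (euclidean_space) real_inner
begin

lift_definition zero_L2 :: "'a L2" is "\<lambda>x. 0"
  by (simp add: L2_eq_def square_integrable_zero)

lift_definition plus_L2 :: "'a L2 \<Rightarrow> 'a L2 \<Rightarrow> 'a L2" is "\<lambda>f g x. f x + g x"
  by (auto simp: L2_eq_def intro: square_integrable_add elim!: eventually_elim2)

lift_definition uminus_L2 :: "'a L2 \<Rightarrow> 'a L2" is "\<lambda>f x. - f x"
  by (auto simp: L2_eq_def intro: square_integrable_uminus elim!: eventually_mono)

lift_definition minus_L2 :: "'a L2 \<Rightarrow> 'a L2 \<Rightarrow> 'a L2" is "\<lambda>f g x. f x - g x"
  by (auto simp: L2_eq_def intro: square_integrable_diff elim!: eventually_elim2)

lift_definition scaleR_L2 :: "real \<Rightarrow> 'a L2 \<Rightarrow> 'a L2" is "\<lambda>c f x. c *\<^sub>R f x"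
  by (auto simp: L2_eq_def intro: square_integrable_scaleR elim!: eventually_mono)

lift_definition inner_L2 :: "'a L2 \<Rightarrow> 'a L2 \<Rightarrow> real" is "\<lambda>f g. LINT x|lborel. f x \<bullet> g x"
proof -
  fix f1 f2 g1 g2 :: "'a \<Rightarrow> complex"
  assume *: "L2_eq f1 f2" "L2_eq g1 g2"
  then have "integrable lborel (\<lambda>x. f1 x \<bullet> g1 x)" "integrable lborel (\<lambda>x. f2 x \<bullet> g2 x)"
    unfolding L2_eq_def using integrable_inner_L2 by blast+
  then have "(\<lambda>x. f1 x \<bullet> g1 x) \<in> borel_measurable lborel" "(\<lambda>x. f2 x \<bullet> g2 x) \<in> borel_measurable lborel"
    by (simp_all only: borel_measurable_integrable)
  moreover have "AE x in lborel. f1 x \<bullet> g1 x = f2 x \<bullet> g2 x"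
    using * by (auto simp: L2_eq_def elim!: eventually_elim2)
  ultimately show "(LINT x|lborel. f1 x \<bullet> g1 x) = (LINT x|lborel. f2 x \<bullet> g2 x)"
    by (intro integral_cong_AE)
qed

definition norm_L2 :: "'a L2 \<Rightarrow> real" where
  "norm_L2 u = sqrt (inner u u)"

definition dist_L2 :: "'a L2 \<Rightarrow> 'a L2 \<Rightarrow> real" where
  "dist_L2 u v = norm (u - v)"

definition sgn_L2 :: "'a L2 \<Rightarrow> 'a L2" where
  "sgn_L2 u = inverse (norm u) *\<^sub>R u"

definition uniformity_L2 :: "('a L2 \<times> 'a L2) filter" where
  "uniformity_L2 = (INF e\<in>{0<..}. principal {(x, y). dist x y < e})"

definition open_L2 :: "'a L2 set \<Rightarrow> bool" where
  "open_L2 U \<longleftrightarrow> (\<forall>x\<in>U. \<forall>\<^sub>F (x', y) in uniformity. x' = x \<longrightarrow> y \<in> U)"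

instance
proof
  fix a b c :: "'a L2" and r q :: real
  note L = L2_eq_def square_integrable_add square_integrable_scaleR square_integrable_zero
    square_integrable_diff square_integrable_uminus
  show "a + b + c = a + (b + c)" by transfer (auto simp: L algebra_simps)
  show "a + b = b + a" by transfer (auto simp: L algebra_simps)
  show "0 + a = a" by transfer (auto simp: L)
  show "- a + a = 0" by transfer (auto simp: L)
  show "a - b = a + - b" by transfer (auto simp: L)
  show "r *\<^sub>R (a + b) = r *\<^sub>R a + r *\<^sub>R b" by transfer (auto simp: L scaleR_add_right)
  show "(r + q) *\<^sub>R a = r *\<^sub>R a + q *\<^sub>R a" by transfer (auto simp: L scaleR_add_left)
  show "r *\<^sub>R q *\<^sub>R a = (r * q) *\<^sub>R a" by transfer (auto simp: L)
  show "1 *\<^sub>R a = a" by transfer (auto simp: L)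
  show "inner a b = inner b a" by transfer (simp add: inner_commute)
  show "inner (a + b) c = inner a c + inner b c"
    by transfer (simp add: inner_add_left integrable_inner_L2 L2_eq_def)
  show "inner (r *\<^sub>R a) b = r * inner a b" by transfer simp
  show "0 \<le> inner a a" by transfer (simp add: Bochner_Integration.integral_nonneg)
  show "inner a a = 0 \<longleftrightarrow> a = 0"
  proof transfer
    fix f :: "'a \<Rightarrow> complex" assume f: "L2_eq f f"
    then have "integrable lborel (\<lambda>x. f x \<bullet> f x)"
      by (auto simp: L2_eq_def intro: integrable_inner_L2)
    then have "(LINT x|lborel. f x \<bullet> f x) = 0 \<longleftrightarrow> (AE x in lborel. f x \<bullet> f x = 0)"
      by (intro integral_nonneg_eq_0_iff_AE) auto
    then show "(LINT x|lborel. f x \<bullet> f x) = 0 \<longleftrightarrow> L2_eq f (\<lambda>x. 0)"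
      using f by (auto simp: L2_eq_def square_integrable_zero)
  qed
qed (simp_all add: norm_L2_def dist_L2_def sgn_L2_def uniformity_L2_def open_L2_def)

end


section \<open>Fourier transform, multipliers and Sobolev spaces\<close>

text \<open>The \<open>L\<^sup>2\<close> Fourier transform, as the \<open>L\<^sup>2\<close> limit of the transforms of truncations. The phase
  \<open>exp (- i x \<bullet> \<xi>)\<close> gives the negative Laplacian the symbol \<open>\<bar>\<xi>\<bar>\<^sup>2\<close>;
  the constant makes the transform unitary.\<close>

definition fourier_cutoff :: "real \<Rightarrow> 'a::euclidean_space L2 \<Rightarrow> 'a \<Rightarrow> complex" where
  "fourier_cutoff R u \<xi> =
     of_real ((2 * pi) powr (- real DIM('a) / 2)) *
     (LINT x:cball 0 R|lborel. cis (- (x \<bullet> \<xi>)) * L2_fun u x)"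

definition fourier :: "'a::euclidean_space L2 \<Rightarrow> 'a L2" where
  "fourier u = Lim at_top (\<lambda>R. L2_class (fourier_cutoff R u))"

definition fourier_multiplier :: "('a \<Rightarrow> real) \<Rightarrow> 'a::euclidean_space L2 \<Rightarrow> 'a L2" where
  "fourier_multiplier m u =
     (THE v. AE \<xi> in lborel. L2_fun (fourier v) \<xi> = of_real (m \<xi>) * L2_fun (fourier u) \<xi>)"

definition weighted_space :: "('a \<Rightarrow> real) \<Rightarrow> 'a::euclidean_space L2 set" where
  "weighted_space w = {u. square_integrable (\<lambda>\<xi>. of_real (w \<xi>) * L2_fun (fourier u) \<xi>)}"

text \<open>Only meaningful on \<open>weighted_space w\<close>: elsewhere the Bochner integral is 0 by convention.\<close>

definition weighted_norm :: "('a \<Rightarrow> real) \<Rightarrow> 'a::euclidean_space L2 \<Rightarrow> real" where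
  "weighted_norm w u = sqrt (LINT \<xi>|lborel. (norm (of_real (w \<xi>) * L2_fun (fourier u) \<xi>))\<^sup>2)"

text \<open>The homogeneous spaces below are intersected with \<open>L\<^sup>2\<close>. The order \<open>\<sigma>\<close> may be negative; the
  value of the weight at the origin is then immaterial.\<close>

definition Hs :: "real \<Rightarrow> 'a::euclidean_space L2 set" where
  "Hs \<sigma> = weighted_space (\<lambda>\<xi>. (1 + (norm \<xi>)\<^sup>2) powr (\<sigma> / 2))"

definition norm_Hs :: "real \<Rightarrow> 'a::euclidean_space L2 \<Rightarrow> real" where
  "norm_Hs \<sigma> = weighted_norm (\<lambda>\<xi>. (1 + (norm \<xi>)\<^sup>2) powr (\<sigma> / 2))"

definition hom_Hs :: "real \<Rightarrow> 'a::euclidean_space L2 set" where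
  "hom_Hs \<sigma> = weighted_space (\<lambda>\<xi>. norm \<xi> powr \<sigma>)"

definition norm_hom_Hs :: "real \<Rightarrow> 'a::euclidean_space L2 \<Rightarrow> real" where
  "norm_hom_Hs \<sigma> = weighted_norm (\<lambda>\<xi>. norm \<xi> powr \<sigma>)"

definition data_norm :: "real \<Rightarrow> real \<Rightarrow> 'a::euclidean_space L2 \<Rightarrow> 'a L2 \<Rightarrow> real" where
  "data_norm \<gamma> s u0 u1 =
     (norm_hom_Hs (- \<gamma>) u0 + norm_Hs s u0) + (norm_hom_Hs (- \<gamma>) u1 + norm u1)"

definition continuous_Hs :: "real \<Rightarrow> (real \<Rightarrow> 'a::euclidean_space L2) \<Rightarrow> bool" where
  "continuous_Hs s u \<longleftrightarrow>
     (\<forall>t\<ge>0. u t \<in> Hs s \<and> ((\<lambda>t'. norm_Hs s (u t' - u t)) \<longlongrightarrow> 0) (at t within {0..}))"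


section \<open>The damped wave equation\<close>

definition K_hat :: "real \<Rightarrow> 'a::euclidean_space \<Rightarrow> real" where
  "K_hat t \<xi> =
     exp (- t / 2) * (\<Sum>k. (1 / 4 - (norm \<xi>)\<^sup>2) ^ k / fact (2 * k + 1) * t ^ (2 * k + 1))"

lemma sums_sinh: "(\<lambda>k. x ^ (2 * k + 1) / fact (2 * k + 1)) sums sinh x" for x :: real
proof -
  have "(\<lambda>n. (x ^ n /\<^sub>R fact n - (- x) ^ n /\<^sub>R fact n) / 2) sums ((exp x - exp (- x)) / 2)"
    by (intro sums_divide sums_diff exp_converges)
  then have "(\<lambda>k. \<Sum>n = k*2..<k*2+2. (x ^ n /\<^sub>R fact n - (- x) ^ n /\<^sub>R fact n) / 2)
      sums ((exp x - exp (- x)) / 2)"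
    by (rule sums_group) simp
  moreover have "(\<Sum>n = k*2..<k*2+2. (x ^ n /\<^sub>R fact n - (- x) ^ n /\<^sub>R fact n) / 2)
      = x ^ (2 * k + 1) / fact (2 * k + 1)" for k
  proof -
    have set: "{k*2..<k*2+2} = {2 * k, 2 * k + 1}" by auto
    have sum: "sum f {2 * k, 2 * k + 1} = f (2 * k) + f (2 * k + 1)" for f :: "nat \<Rightarrow> real"
      by simp
    have pow: "(- x) ^ (2 * k) = x ^ (2 * k)" "(- x) ^ (2 * k + 1) = - (x ^ (2 * k + 1))"
      by simp_all
    have odd: "(y /\<^sub>R c - - y /\<^sub>R c) / 2 = y / c" for y c :: real
      by (simp add: field_simps)
    show ?thesis
      unfolding set sum pow odd by (simp only: diff_self div_0 add_0)
  qed
  ultimately have "(\<lambda>k. x ^ (2 * k + 1) / fact (2 * k + 1)) sums ((exp x - exp (- x)) / 2)"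
    by (rule iffD1[OF sums_cong, rotated])
  then show ?thesis
    unfolding sinh_field_def .
qed

lemma K_hat_low:
  assumes "norm \<xi> < 1 / 2"
  shows "K_hat t \<xi> = exp (- t / 2) * (sinh (t * sqrt (1 / 4 - (norm \<xi>)\<^sup>2)) / sqrt (1 / 4 - (norm \<xi>)\<^sup>2))"
proof -
  define r where "r = sqrt (1 / 4 - (norm \<xi>)\<^sup>2)"
  have "(norm \<xi>)\<^sup>2 < (1 / 2)\<^sup>2" using assms by (intro power_strict_mono) auto
  then have r: "r > 0" "1 / 4 - (norm \<xi>)\<^sup>2 = r\<^sup>2" by (auto simp: r_def power2_eq_square)
  have "(\<lambda>k. (t * r) ^ (2 * k + 1) / fact (2 * k + 1) / r) sums (sinh (t * r) / r)"
    by (intro sums_divide sums_sinh)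
  moreover have "(t * r) ^ (2 * k + 1) / fact (2 * k + 1) / r
      = (r\<^sup>2) ^ k / fact (2 * k + 1) * t ^ (2 * k + 1)" for k
    using r(1) by (simp add: power_mult_distrib power_mult[symmetric])
  ultimately have "(\<lambda>k. (r\<^sup>2) ^ k / fact (2 * k + 1) * t ^ (2 * k + 1)) sums (sinh (t * r) / r)"
    by (rule iffD1[OF sums_cong, rotated])
  note sums_unique[OF this, symmetric]
  then show ?thesis
    unfolding r_def[symmetric] unfolding K_hat_def r(2) by (rule arg_cong)
qed

lemma K_hat_middle:
  assumes "norm \<xi> = 1 / 2"
  shows "K_hat t \<xi> = t * exp (- t / 2)"
proof -
  have "1 / 4 - (norm \<xi>)\<^sup>2 = 0" unfolding assms by (simp add: power2_eq_square)
  then show ?thesis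
    unfolding K_hat_def
    by (subst suminf_finite[where N = "{0}"]) auto
qed

lemma K_hat_high:
  assumes "norm \<xi> > 1 / 2"
  shows "K_hat t \<xi> = exp (- t / 2) * (sin (t * sqrt ((norm \<xi>)\<^sup>2 - 1 / 4)) / sqrt ((norm \<xi>)\<^sup>2 - 1 / 4))"
proof -
  define r where "r = sqrt ((norm \<xi>)\<^sup>2 - 1 / 4)"
  have "(1 / 2)\<^sup>2 < (norm \<xi>)\<^sup>2" using assms by (intro power_strict_mono) auto
  then have r: "r > 0" "1 / 4 - (norm \<xi>)\<^sup>2 = (- 1) * r\<^sup>2" by (auto simp: r_def power2_eq_square)
  have "(\<lambda>k. (- 1) ^ k / fact (2 * k + 1) * (t * r) ^ (2 * k + 1) / r) sums (sin (t * r) / r)"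
    by (intro sums_divide sin_paired)
  moreover have "(- 1) ^ k / fact (2 * k + 1) * (t * r) ^ (2 * k + 1) / r
      = ((- 1) * r\<^sup>2) ^ k / fact (2 * k + 1) * t ^ (2 * k + 1)" for k
  proof -
    have "(t * r) ^ (2 * k + 1) / r = t ^ (2 * k + 1) * (r\<^sup>2) ^ k"
      using r(1) by (simp add: power_mult_distrib power_mult[symmetric])
    moreover have "((- 1) * r\<^sup>2) ^ k = (- 1) ^ k * (r\<^sup>2) ^ k"
      by (rule power_mult_distrib)
    moreover have "a / b * c / r = a / b * (c / r)" for a b c :: real by simp
    moreover have "a / b * (c * d) = a * d / b * c" for a b c d :: real by simp
    ultimately show ?thesis by metis
  qed
  ultimately have "(\<lambda>k. ((- 1) * r\<^sup>2) ^ k / fact (2 * k + 1) * t ^ (2 * k + 1)) sums (sin (t * r) / r)"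
    by (rule iffD1[OF sums_cong, rotated])
  note sums_unique[OF this, symmetric]
  then show ?thesis
    unfolding r_def[symmetric] unfolding K_hat_def r(2) by (rule arg_cong)
qed

definition K_conv :: "real \<Rightarrow> 'a::euclidean_space L2 \<Rightarrow> 'a L2" where
  "K_conv t = fourier_multiplier (K_hat t)"

definition K'_conv :: "real \<Rightarrow> 'a::euclidean_space L2 \<Rightarrow> 'a L2" where
  "K'_conv t = fourier_multiplier (\<lambda>\<xi>. deriv (\<lambda>\<tau>. K_hat \<tau> \<xi>) t)"

definition abs_powr :: "real \<Rightarrow> 'a::euclidean_space L2 \<Rightarrow> 'a \<Rightarrow> complex" where
  "abs_powr p u x = of_real (norm (L2_fun u x) powr p)"

text \<open>The Duhamel integral is the Henstock-Kurzweil integral with values in \<open>L\<^sup>2\<close>. The nonlinearity is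
  required to be in \<open>L\<^sup>2\<close>, so that it has a class; for \<open>1 \<le> p\<close> (and \<open>p \<le> n / (n - 2 s)\<close> if
  \<open>n > 2 s\<close>) this is automatic when \<open>u \<tau> \<in> H\<^sup>s\<close>, by Sobolev embedding. The values of \<open>u\<close> at negative
  times are irrelevant.\<close>

definition mild_solution ::
  "real \<Rightarrow> real \<Rightarrow> 'a::euclidean_space L2 \<Rightarrow> 'a L2 \<Rightarrow> (real \<Rightarrow> 'a L2) \<Rightarrow> bool" where
  "mild_solution p \<epsilon> u0 u1 u \<longleftrightarrow>
     (\<forall>t\<ge>0. square_integrable (abs_powr p (u t))) \<and>
     (\<forall>t\<ge>0. \<exists>I. ((\<lambda>\<tau>. K_conv (t - \<tau>) (L2_class (abs_powr p (u \<tau>)))) has_integral I) {0..t} \<and>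
        u t = \<epsilon> *\<^sub>R K'_conv t u0 + \<epsilon> *\<^sub>R K_conv t (u0 + u1) + I)"

end

theory Submission
  imports Defs "HOL-Probability.Characteristic_Functions"
begin

text \<open>
  The contraction principle is applied in the norm
  \<open>sup\<^sub>t (1 + t)\<^bsup>\<gamma>\<^sub>0/2\<^esup> \<parallel>(1 + (1 + t)|\<xi>|\<^sup>2)\<^bsup>s/2\<^esup> F u(t, \<xi>)\<parallel>\<close> of \<open>L\<^sup>2\<close>, where \<open>F\<close> is the Fourier
  transform; it records the decay of the \<open>L\<^sup>2\<close> and of the homogeneous \<open>H\<^sup>s\<close> norm at the same time.
  Sobolev's and Hoelder's inequalities bound the nonlinearity in \<open>L\<^sup>2\<close> and, by duality, in the
  homogeneous Sobolev spaces of negative order. In the Duhamel integral the decay comes from the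
  kernel and the negative norm for \<open>\<tau> \<le> t/2\<close>, and from the \<open>L\<^sup>2\<close> norm of the nonlinearity for
  \<open>\<tau> > t/2\<close>; the conditions on \<open>\<gamma>\<close> and \<open>p\<close> make the resulting powers integrable for a suitable rate
  \<open>\<gamma>\<^sub>0\<close>. A decay rate above \<open>\<gamma>\<^sub>0\<close> is reached by inserting the decay already known into the Duhamel
  formula once. Uniqueness in \<open>C([0,\<infinity>); H\<^sup>s)\<close> needs no decay and follows from the Lipschitz bound of
  the nonlinearity in an exponentially weighted norm.

  Plancherel's theorem is proved by Gaussian regularisation, and the Sobolev embedding by splitting
  the frequencies at a level depending on the height in the layer cake formula.
\<close>

section \<open>Completeness of \<open>L\<^sup>2\<close>\<close>

text \<open>Where the exponents come from: if \<open>u\<close> has rate \<gamma>0, then |u|^p is of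
  size (1+\<tau>)^(-\<beta>) in L2 and (1+\<tau>)^(-\<beta>+\<gamma>/2) in order -\<gamma>, with
  \<beta> = n(p-1)/4 + p \<gamma>0/2, and the Duhamel integral has rate \<gamma> once \<beta> -
  \<gamma>/2 > 1. For \<gamma> = \<gamma>0 this reads (p-1)(n+2 \<gamma>0) > 4. The choice \<gamma>0
  = n/2 gives p > 1+2/n; the choice \<gamma>0 = n(p-1)/2 gives n p (p-1) > 4, whose positive root is
  (sqrt(n^2+16n)+n)/(2n), and at that root n(p-1)/2 equals (sqrt(n^2+16n)-n)/4, the threshold for
  \<gamma>. The upper limits on the rate come from duality: \<gamma> < n/2 for the Sobolev embedding
  of the test functions, \<gamma> \<le> n(p-1)/2 so that \<open>u\<close> is needed only in Lebesgue
  exponents at least 2. The value n/2 is never admissible, so a rate below it has to be used even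
  where n/2 would be natural. The obstacle in the Duhamel integral is that the kernel absorbs the
  weight at time t-\<tau>, which is not comparable with the weight at time t when \<tau> is near t;
  the surplus decay of the nonlinearity in L2 pays for the quotient.\<close>

lemma L2_class_fun [simp]: "L2_class (L2_fun u) = u"
  by (rule Quotient3_abs_rep[OF Quotient3_L2])

lemma L2_eq_refl: "square_integrable f \<Longrightarrow> L2_eq f f"
  by (simp add: L2_eq_def)

lemma L2_eq_fun_class: "square_integrable f \<Longrightarrow> L2_eq (L2_fun (L2_class f)) f"
  by (rule rep_abs_rsp_left[OF Quotient3_L2 L2_eq_refl])

lemma square_integrable_L2_fun: "square_integrable (L2_fun u)"
  using Quotient3_rep_reflp[OF Quotient3_L2, of u] by (simp add: L2_eq_def)

lemma L2_fun_measurable [measurable]: "L2_fun u \<in> borel_measurable borel"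
  using square_integrable_L2_fun[of u] by (simp add: square_integrable_def)

lemma L2_fun_class: "square_integrable f \<Longrightarrow> AE x in lborel. L2_fun (L2_class f) x = f x"
  using L2_eq_fun_class[of f] by (simp add: L2_eq_def)

lemma L2_class_eqI:
  assumes "square_integrable f" "square_integrable g" "AE x in lborel. f x = g x"
  shows "L2_class f = L2_class g"
  using assms by (intro Quotient3_rel_abs[OF Quotient3_L2]) (simp add: L2_eq_def)

lemma L2_eqI: "AE x in lborel. L2_fun u x = L2_fun v x \<Longrightarrow> u = v"
  using L2_class_eqI[of "L2_fun u" "L2_fun v"] by (simp add: square_integrable_L2_fun)

lemma L2_class_add:
  "square_integrable f \<Longrightarrow> square_integrable g \<Longrightarrow> L2_class f + L2_class g = L2_class (\<lambda>x. f x + g x)"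
  by (simp add: plus_L2.abs_eq L2_eq_refl)

lemma L2_class_diff:
  "square_integrable f \<Longrightarrow> square_integrable g \<Longrightarrow> L2_class f - L2_class g = L2_class (\<lambda>x. f x - g x)"
  by (simp add: minus_L2.abs_eq L2_eq_refl)

lemma L2_class_scaleR: "square_integrable f \<Longrightarrow> c *\<^sub>R L2_class f = L2_class (\<lambda>x. c *\<^sub>R f x)"
  by (simp add: scaleR_L2.abs_eq L2_eq_refl)

lemma L2_fun_add: "AE x in lborel. L2_fun (u + v) x = L2_fun u x + L2_fun v x"
  using L2_fun_class[OF square_integrable_add[OF square_integrable_L2_fun[of u]
    square_integrable_L2_fun[of v]]]
  by (simp add: L2_class_add[symmetric] square_integrable_L2_fun)

lemma L2_fun_diff: "AE x in lborel. L2_fun (u - v) x = L2_fun u x - L2_fun v x"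
  using L2_fun_class[OF square_integrable_diff[OF square_integrable_L2_fun[of u]
    square_integrable_L2_fun[of v]]]
  by (simp add: L2_class_diff[symmetric] square_integrable_L2_fun)

lemma L2_fun_scaleR: "AE x in lborel. L2_fun (c *\<^sub>R u) x = c *\<^sub>R L2_fun u x"
  using L2_fun_class[OF square_integrable_scaleR[OF square_integrable_L2_fun[of u]]]
  by (simp add: L2_class_scaleR[symmetric] square_integrable_L2_fun)

lemma L2_fun_zero: "AE x in lborel. L2_fun 0 x = 0"
  using L2_fun_class[OF square_integrable_zero] by (simp add: zero_L2.abs_eq)

lemma inner_L2_class:
  "square_integrable f \<Longrightarrow> square_integrable g \<Longrightarrow>
    inner (L2_class f) (L2_class g) = (LINT x|lborel. f x \<bullet> g x)"
  by (simp add: inner_L2.abs_eq L2_eq_refl)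

lemma inner_L2_fun: "inner u v = (LINT x|lborel. L2_fun u x \<bullet> L2_fun v x)"
  using inner_L2_class[of "L2_fun u" "L2_fun v"] by (simp add: square_integrable_L2_fun)

lemma norm_L2_class: "square_integrable f \<Longrightarrow> (norm (L2_class f))\<^sup>2 = (LINT x|lborel. (norm (f x))\<^sup>2)"
  by (simp add: power2_norm_eq_inner inner_L2_class)

lemma square_integrable_iff_nn_integral:
  "square_integrable f \<longleftrightarrow> f \<in> borel_measurable borel \<and> (\<integral>\<^sup>+x. ennreal ((norm (f x))\<^sup>2) \<partial>lborel) < \<infinity>"
proof (cases "f \<in> borel_measurable borel")
  case [measurable]: True
  show ?thesis
    by (auto simp: square_integrable_def integrable_iff_bounded)
qed (simp add: square_integrable_def)

lemma nn_integral_L2_class: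
  assumes "square_integrable f"
  shows "(\<integral>\<^sup>+x. ennreal ((norm (f x))\<^sup>2) \<partial>lborel) = ennreal ((norm (L2_class f))\<^sup>2)"
  using assms by (simp add: norm_L2_class square_integrable_def nn_integral_eq_integral)

lemma nn_integral_L2_fun: "(\<integral>\<^sup>+x. ennreal ((norm (L2_fun u x))\<^sup>2) \<partial>lborel) = ennreal ((norm u)\<^sup>2)"
  using nn_integral_L2_class[of "L2_fun u"] by (simp add: square_integrable_L2_fun)

lemma norm_L2_class_le:
  assumes "f \<in> borel_measurable borel" "(\<integral>\<^sup>+x. ennreal ((norm (f x))\<^sup>2) \<partial>lborel) \<le> ennreal (B\<^sup>2)"
    "B \<ge> 0"
  shows "square_integrable f" "norm (L2_class f) \<le> B"
proof -
  show f: "square_integrable f"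
    using assms by (auto simp: square_integrable_iff_nn_integral intro: le_less_trans)
  have "(norm (L2_class f))\<^sup>2 \<le> B\<^sup>2"
    using assms nn_integral_L2_class[OF f] by simp
  then show "norm (L2_class f) \<le> B" using assms(3) by (rule power2_le_imp_le)
qed

lemma norm_L2_mono:
  assumes "square_integrable g" "f \<in> borel_measurable borel"
    "AE x in lborel. norm (f x) \<le> norm (g x)"
  shows "square_integrable f" "norm (L2_class f) \<le> norm (L2_class g)"
proof -
  have "(\<integral>\<^sup>+x. ennreal ((norm (f x))\<^sup>2) \<partial>lborel) \<le> (\<integral>\<^sup>+x. ennreal ((norm (g x))\<^sup>2) \<partial>lborel)"
    using assms(3) by (intro nn_integral_mono_AE)
      (auto elim!: eventually_mono intro!: power_mono ennreal_leI)
  also have "\<dots> = ennreal ((norm (L2_class g))\<^sup>2)"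
    by (rule nn_integral_L2_class[OF assms(1)])
  finally have *: "(\<integral>\<^sup>+x. ennreal ((norm (f x))\<^sup>2) \<partial>lborel) \<le> ennreal ((norm (L2_class g))\<^sup>2)" .
  from norm_L2_class_le[OF assms(2) *] show "square_integrable f"
    "norm (L2_class f) \<le> norm (L2_class g)"
    by auto
qed

text \<open>Fatou's lemma, applied to differences with one index fixed, bounds the distance of the
  pointwise limit from a late member of the sequence by the Cauchy modulus. It identifies L2 limits
  with known pointwise limits, both for completeness and for the Fourier integral.\<close>

lemma L2_AE_limit:
  fixes f :: "nat \<Rightarrow> 'a::euclidean_space \<Rightarrow> complex"
  assumes sq: "\<And>i. square_integrable (f i)"
    and Cau: "Cauchy (\<lambda>i. L2_class (f i))"
    and lim: "AE x in lborel. (\<lambda>i. f i x) \<longlonglongrightarrow> g x"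
    and meas: "g \<in> borel_measurable borel"
  shows "square_integrable g" "(\<lambda>i. L2_class (f i)) \<longlonglongrightarrow> L2_class g"
proof -
  have [measurable]: "\<And>i. f i \<in> borel_measurable borel" "g \<in> borel_measurable borel"
    using sq meas by (auto simp: square_integrable_def)
  have bound: "square_integrable (\<lambda>x. g x - f i x) \<and> norm (L2_class (\<lambda>x. g x - f i x)) \<le> e"
    if e: "e > 0" and i: "\<And>j. j \<ge> i \<Longrightarrow> norm (L2_class (f j) - L2_class (f i)) < e" for e i
  proof -
    have "(\<integral>\<^sup>+x. ennreal ((norm (g x - f i x))\<^sup>2) \<partial>lborel)
        = (\<integral>\<^sup>+x. liminf (\<lambda>j. ennreal ((norm (f j x - f i x))\<^sup>2)) \<partial>lborel)"
    proof (rule nn_integral_cong_AE, use lim in eventually_elim)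
      fix x assume "(\<lambda>i. f i x) \<longlonglongrightarrow> g x"
      then have "(\<lambda>j. ennreal ((norm (f j x - f i x))\<^sup>2)) \<longlonglongrightarrow> ennreal ((norm (g x - f i x))\<^sup>2)"
        by (intro tendsto_intros tendsto_ennrealI)
      from lim_imp_Liminf[OF _ this]
      show "ennreal ((norm (g x - f i x))\<^sup>2) = liminf (\<lambda>j. ennreal ((norm (f j x - f i x))\<^sup>2))"
        by simp
    qed
    also have "\<dots> \<le> liminf (\<lambda>j. \<integral>\<^sup>+x. ennreal ((norm (f j x - f i x))\<^sup>2) \<partial>lborel)"
      by (intro nn_integral_liminf) measurable
    also have "\<dots> \<le> ennreal (e\<^sup>2)"
    proof (rule Liminf_le)
      show "\<forall>\<^sub>F j in sequentially. (\<integral>\<^sup>+x. ennreal ((norm (f j x - f i x))\<^sup>2) \<partial>lborel)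
        \<le> ennreal (e\<^sup>2)"
        using eventually_ge_at_top[of i]
      proof eventually_elim
        case (elim j)
        have "(\<integral>\<^sup>+x. ennreal ((norm (f j x - f i x))\<^sup>2) \<partial>lborel)
          = ennreal ((norm (L2_class (f j) - L2_class (f i)))\<^sup>2)"
          by (simp add: nn_integral_L2_class square_integrable_diff sq L2_class_diff)
        also have "\<dots> \<le> ennreal (e\<^sup>2)"
          using i[OF elim] by (intro ennreal_leI power_mono) auto
        finally show ?case .
      qed
    qed simp
    finally show ?thesis
      using norm_L2_class_le[of "\<lambda>x. g x - f i x" e] e by auto
  qed
  obtain i0 where "\<And>m n. m \<ge> i0 \<Longrightarrow> n \<ge> i0 \<Longrightarrow> norm (L2_class (f m) - L2_class (f n)) < 1"
    using CauchyD[OF Cau, of 1] by auto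
  then have "square_integrable (\<lambda>x. g x - f i0 x)"
    using bound[of 1 i0] by auto
  from square_integrable_add[OF this sq[of i0]] show g: "square_integrable g" by simp
  show "(\<lambda>i. L2_class (f i)) \<longlonglongrightarrow> L2_class g"
  proof (rule LIMSEQ_I)
    fix r :: real assume r: "r > 0"
    obtain i0 where i0: "\<And>m n. m \<ge> i0 \<Longrightarrow> n \<ge> i0 \<Longrightarrow> norm (L2_class (f m) - L2_class (f n)) < r / 2"
      using CauchyD[OF Cau, of "r/2"] r by auto
    have "norm (L2_class (f n) - L2_class g) < r" if "n \<ge> i0" for n
    proof -
      have "norm (L2_class (\<lambda>x. g x - f n x)) \<le> r / 2"
        using bound[of "r/2" n] r i0 that by auto
      then show ?thesis using r by (simp add: L2_class_diff[symmetric] g sq norm_minus_commute)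
    qed
    then show "\<exists>no. \<forall>n\<ge>no. norm (L2_class (f n) - L2_class g) < r" by blast
  qed
qed

text \<open>The squared increments have integrals at most 16^(-i), so even with the weight 4^i they
  are summable. Almost everywhere the weighted squares are therefore bounded and the increments
  decay like 2^(-i). Working with squares avoids an infinite Minkowski inequality.\<close>

lemma L2_fast_Cauchy_AE_convergent:
  fixes f :: "nat \<Rightarrow> 'a::euclidean_space \<Rightarrow> complex"
  assumes sq: "\<And>i. square_integrable (f i)"
    and fast: "\<And>i. norm (L2_class (f (Suc i)) - L2_class (f i)) \<le> (1 / 4) ^ i"
  shows "AE x in lborel. convergent (\<lambda>i. f i x)"
proof -
  have [measurable]: "\<And>i. f i \<in> borel_measurable borel"
    using sq by (auto simp: square_integrable_def)
  define S where "S x = (\<Sum>i. ennreal (4 ^ i * (norm (f (Suc i) x - f i x))\<^sup>2))" for x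
  have "(\<integral>\<^sup>+x. S x \<partial>lborel) = (\<Sum>i. \<integral>\<^sup>+x. ennreal (4 ^ i * (norm (f (Suc i) x - f i x))\<^sup>2) \<partial>lborel)"
    unfolding S_def by (intro nn_integral_suminf) measurable
  also have "\<dots> \<le> (\<Sum>i. ennreal ((1 / 4) ^ i))"
  proof (intro suminf_le)
    fix i
    have "(\<integral>\<^sup>+x. ennreal (4 ^ i * (norm (f (Suc i) x - f i x))\<^sup>2) \<partial>lborel)
       = ennreal (4 ^ i) * (\<integral>\<^sup>+x. ennreal ((norm (f (Suc i) x - f i x))\<^sup>2) \<partial>lborel)"
      by (simp add: ennreal_mult' nn_integral_cmult)
    also have "\<dots> = ennreal (4 ^ i * (norm (L2_class (f (Suc i)) - L2_class (f i)))\<^sup>2)"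
      by (simp add: nn_integral_L2_class square_integrable_diff sq L2_class_diff ennreal_mult')
    also have "\<dots> \<le> ennreal (4 ^ i * ((1 / 4) ^ i)\<^sup>2)"
      using fast[of i] by (intro ennreal_leI mult_left_mono power_mono) auto
    also have "4 ^ i * ((1 / 4) ^ i)\<^sup>2 = (1 / 4 :: real) ^ i"
      by (simp add: power2_eq_square power_mult_distrib[symmetric] field_simps)
    finally show "(\<integral>\<^sup>+x. ennreal (4 ^ i * (norm (f (Suc i) x - f i x))\<^sup>2) \<partial>lborel)
      \<le> ennreal ((1 / 4) ^ i)" .
  qed auto
  also have "\<dots> < \<infinity>"
    using summable_geometric[of "1 / 4 :: real"] by (simp add: suminf_ennreal2 ennreal_less_top)
  finally have "(\<integral>\<^sup>+x. S x \<partial>lborel) \<noteq> \<infinity>" by simp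
  then have "AE x in lborel. S x \<noteq> \<infinity>"
    by (intro nn_integral_PInf_AE) (auto simp: S_def[abs_def])
  then show ?thesis
  proof eventually_elim
    case (elim x)
    let ?a = "\<lambda>i. 4 ^ i * (norm (f (Suc i) x - f i x))\<^sup>2"
    have "summable ?a"
      using elim unfolding S_def by (intro summable_suminf_not_top) auto
    \<comment> \<open>The series is used only through the boundedness of its terms, which becomes a
      geometric bound for the increments.\<close>
    then have "Bseq ?a" by (intro convergent_imp_Bseq)
      (auto dest: summable_LIMSEQ_zero simp: convergent_def)
    then obtain B where B: "B > 0" "\<And>i. ?a i \<le> B" by (auto simp: Bseq_def)
    have "norm (f (Suc i) x - f i x) \<le> sqrt B * (1 / 2) ^ i" for i
    proof (rule power2_le_imp_le)
      have "(norm (f (Suc i) x - f i x))\<^sup>2 \<le> B / 4 ^ i"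
        using B(2)[of i] by (simp add: field_simps)
      also have "\<dots> = (sqrt B * (1 / 2) ^ i)\<^sup>2"
        using B(1) by (simp add: power_mult_distrib power2_eq_square power_mult_distrib[symmetric]
          power_divide)
      finally show "(norm (f (Suc i) x - f i x))\<^sup>2 \<le> (sqrt B * (1 / 2) ^ i)\<^sup>2" .
    qed (use B(1) in auto)
    note le = this
    have "summable (\<lambda>i. sqrt B * (1 / 2) ^ i)"
      by (intro summable_mult summable_geometric) simp
    then have "summable (\<lambda>i. f (Suc i) x - f i x)"
      by (rule summable_comparison_test'[where N=0]) (rule le)
    then have "convergent (\<lambda>n. \<Sum>i<n. f (Suc i) x - f i x)"
      by (simp only: summable_iff_convergent)
    moreover have "(\<Sum>i<n. f (Suc i) x - f i x) = f n x - f 0 x" for n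
      by (rule sum_lessThan_telescope)
    ultimately have "convergent (\<lambda>n. f n x - f 0 x)"
      by (simp only:)
    from convergent_add[OF this convergent_const[of "f 0 x"]] show ?case by simp
  qed
qed

lemma Cauchy_fast_subseq:
  fixes X :: "nat \<Rightarrow> 'b::metric_space"
  assumes "Cauchy X"
  shows "\<exists>r. strict_mono r \<and> (\<forall>i. dist (X (r (Suc i))) (X (r i)) \<le> (1 / 4) ^ i)"
proof -
  have "\<exists>N. \<forall>m\<ge>N. \<forall>n\<ge>N. dist (X m) (X n) < (1 / 4) ^ i" for i :: nat
    using assms unfolding Cauchy_def by simp
  then obtain N where N: "\<And>i m n. m \<ge> N i \<Longrightarrow> n \<ge> N i \<Longrightarrow> dist (X m) (X n) < (1 / 4) ^ i"
    by metis
  \<comment> \<open>Summing the successors makes \<open>r\<close> strictly increasing and keeps it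
    above \<open>N\<close>.\<close>
  define r where "r i = (\<Sum>j\<le>i. Suc (N j))" for i
  have "strict_mono r" unfolding strict_mono_Suc_iff r_def by simp
  moreover have "N i \<le> r i" for i
    unfolding r_def by (cases i) auto
  moreover have "r i \<le> r (Suc i)" for i unfolding r_def by simp
  ultimately have "dist (X (r (Suc i))) (X (r i)) < (1 / 4) ^ i" for i
    using N[of i "r (Suc i)" "r i"] by (meson order_trans)
  with \<open>strict_mono r\<close> show ?thesis
    by (intro exI[of _ r]) (auto intro: less_imp_le)
qed

instance L2 :: (euclidean_space) banach
proof
  fix X :: "nat \<Rightarrow> 'a L2" assume X: "Cauchy X"
  obtain r where r: "strict_mono r" "\<And>i. dist (X (r (Suc i))) (X (r i)) \<le> (1 / 4) ^ i"
    using Cauchy_fast_subseq[OF X] by auto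
  define f where "f i = L2_fun (X (r i))" for i
  have sq: "square_integrable (f i)" for i
    by (simp add: f_def square_integrable_L2_fun)
  have [measurable]: "f i \<in> borel_measurable borel" for i by (simp add: f_def)
  have cls: "L2_class (f i) = X (r i)" for i by (simp add: f_def)
  have "AE x in lborel. convergent (\<lambda>i. f i x)"
    using r(2) by (intro L2_fast_Cauchy_AE_convergent sq) (simp add: cls dist_norm)
  then have "AE x in lborel. (\<lambda>i. f i x) \<longlonglongrightarrow> lim (\<lambda>i. f i x)"
    by (simp add: convergent_LIMSEQ_iff)
  moreover have "Cauchy (\<lambda>i. L2_class (f i))"
    unfolding cls using Cauchy_subseq_Cauchy[OF X r(1)] by (simp add: comp_def)
  \<comment> \<open>\<open>lim\<close> is unspecified where the sequence diverges; that set is null,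
    and the function is Borel measurable all the same.\<close>
  ultimately have "(\<lambda>i. L2_class (f i)) \<longlonglongrightarrow> L2_class (\<lambda>x. lim (\<lambda>i. f i x))"
    by (intro L2_AE_limit(2)[OF sq] borel_measurable_lim_metric) simp_all
  then have "(X \<circ> r) \<longlonglongrightarrow> L2_class (\<lambda>x. lim (\<lambda>i. f i x))"
    by (simp add: cls comp_def)
  from Cauchy_converges_subseq[OF X r(1) this] show "convergent X"
    by (rule convergentI)
qed

text \<open>The majorant is imposed on the squares, so that scalar dominated convergence applies to
  the squared difference with majorant \<open>4 * w\<close>.\<close>

lemma L2_LIMSEQ_dominated:
  fixes f :: "nat \<Rightarrow> 'a::euclidean_space \<Rightarrow> complex"
  assumes meas: "\<And>i. f i \<in> borel_measurable borel" "g \<in> borel_measurable borel"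
    and w: "integrable lborel w"
    and bound: "\<And>i. AE x in lborel. (norm (f i x))\<^sup>2 \<le> w x"
    and lim: "AE x in lborel. (\<lambda>i. f i x) \<longlonglongrightarrow> g x"
  shows "square_integrable g" "\<And>i. square_integrable (f i)" "(\<lambda>i. L2_class (f i)) \<longlonglongrightarrow> L2_class g"
proof -
  note [measurable] = meas
  have [measurable]: "w \<in> borel_measurable borel" using w by auto
  have AE_bound: "AE x in lborel. \<forall>i. (norm (f i x))\<^sup>2 \<le> w x"
    unfolding AE_all_countable using bound by blast
  have bg: "AE x in lborel. (norm (g x))\<^sup>2 \<le> w x"
    using AE_bound lim
  proof eventually_elim
    case (elim x)
    then have "(\<lambda>i. (norm (f i x))\<^sup>2) \<longlonglongrightarrow> (norm (g x))\<^sup>2" by (intro tendsto_intros)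
    then show ?case by (rule LIMSEQ_le_const2) (use elim(1) in blast)
  qed
  have aux: "square_integrable k" if "k \<in> borel_measurable borel"
    "AE x in lborel. (norm (k x))\<^sup>2 \<le> w x"
    for k :: "'a \<Rightarrow> complex"
  proof -
    have "integrable lborel (\<lambda>x. (norm (k x))\<^sup>2)"
    proof (rule Bochner_Integration.integrable_bound[OF w])
      show "AE x in lborel. norm ((norm (k x))\<^sup>2) \<le> norm (w x)"
        using that(2) by eventually_elim auto
    qed (use that(1) in measurable)
    then show ?thesis using that by (simp add: square_integrable_def)
  qed
  show g: "square_integrable g" by (rule aux) (auto intro: bg)
  show f: "square_integrable (f i)" for i by (rule aux) (auto intro: bound)
  have "(\<lambda>i. LINT x|lborel. (norm (f i x - g x))\<^sup>2) \<longlonglongrightarrow> (LINT x::'a|lborel. (0::real))"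
  proof (rule integral_dominated_convergence)
    show "AE x in lborel. (\<lambda>i. (norm (f i x - g x))\<^sup>2) \<longlonglongrightarrow> 0"
      using lim
    proof eventually_elim
      case (elim x)
      then have "(\<lambda>i. (norm (f i x - g x))\<^sup>2) \<longlonglongrightarrow> (norm (g x - g x))\<^sup>2"
        by (intro tendsto_intros)
      then show ?case by simp
    qed
    show "AE x in lborel. norm ((norm (f i x - g x))\<^sup>2) \<le> 4 * w x" for i
      using bound[of i] bg
    proof eventually_elim
      case (elim x)
      have "(norm (f i x - g x))\<^sup>2 \<le> (norm (f i x) + norm (g x))\<^sup>2"
        by (intro power_mono norm_triangle_ineq4) auto
      also have "\<dots> \<le> 2 * (norm (f i x))\<^sup>2 + 2 * (norm (g x))\<^sup>2"
        using sum_squares_bound[of "norm (f i x)" "norm (g x)"] by (simp add: power2_sum)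
      finally show ?case using elim by simp
    qed
  qed (use w in auto)
  then have "(\<lambda>i. (norm (L2_class (f i) - L2_class g))\<^sup>2) \<longlonglongrightarrow> 0"
    by (simp add: L2_class_diff f g norm_L2_class square_integrable_diff)
  then have "(\<lambda>i. sqrt ((norm (L2_class (f i) - L2_class g))\<^sup>2)) \<longlonglongrightarrow> sqrt 0"
    by (rule tendsto_real_sqrt)
  then show "(\<lambda>i. L2_class (f i)) \<longlonglongrightarrow> L2_class g"
    by (simp add: LIM_zero_iff tendsto_norm_zero_iff)
qed

section \<open>The Fourier transform on \<open>L\<^sup>2\<close>\<close>

lemma lborel_integral_affine:
  fixes f :: "'a::euclidean_space \<Rightarrow> 'b::{banach, second_countable_topology}"
  assumes [measurable]: "f \<in> borel_measurable borel" and c: "c \<noteq> 0"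
  shows "(\<integral>x. f x \<partial>lborel) = \<bar>c\<bar> ^ DIM('a) *\<^sub>R (\<integral>x. f (t + c *\<^sub>R x) \<partial>lborel)"
  by (subst lborel_affine[OF c, of t]) (simp add: integral_density integral_distr)

lemma lborel_nn_integral_affine:
  fixes f :: "'a::euclidean_space \<Rightarrow> ennreal"
  assumes [measurable]: "f \<in> borel_measurable borel" and c: "c \<noteq> 0"
  shows "(\<integral>\<^sup>+x. f x \<partial>lborel) = ennreal (\<bar>c\<bar> ^ DIM('a)) * (\<integral>\<^sup>+x. f (t + c *\<^sub>R x) \<partial>lborel)"
  by (subst lborel_affine[OF c, of t])
    (simp add: nn_integral_density nn_integral_distr nn_integral_cmult)

lemma lborel_integrable_affine:
  fixes f :: "'a::euclidean_space \<Rightarrow> 'b::{banach, second_countable_topology}"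
  assumes f: "integrable lborel f" and c: "c \<noteq> 0"
  shows "integrable lborel (\<lambda>x. f (t + c *\<^sub>R x))"
proof -
  have [measurable]: "f \<in> borel_measurable borel" using f by auto
  have "ennreal (\<bar>c\<bar> ^ DIM('a)) * (\<integral>\<^sup>+x. ennreal (norm (f (t + c *\<^sub>R x))) \<partial>lborel) < \<infinity>"
    using f lborel_nn_integral_affine[OF _ c, of "\<lambda>x. ennreal (norm (f x))" t]
    by (simp add: integrable_iff_bounded)
  then have "(\<integral>\<^sup>+x. ennreal (norm (f (t + c *\<^sub>R x))) \<partial>lborel) < \<infinity>"
    using c by (auto simp: ennreal_mult_less_top)
  then show ?thesis by (simp add: integrable_iff_bounded)
qed

lemma AE_lborel_uminus:
  assumes "AE x in (lborel :: 'a::euclidean_space measure). P x"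
  shows "AE x in (lborel :: 'a measure). P (- x)"
proof -
  obtain N where N: "{x. \<not> P x} \<subseteq> N" "N \<in> null_sets (lborel :: 'a measure)"
    using assms by (auto simp: eventually_ae_filter)
  then have N': "emeasure lborel N = 0" and [measurable]: "N \<in> sets borel" by auto
  have "emeasure lborel {x::'a. - x \<in> N}
    = (\<integral>\<^sup>+x. indicator N (0 + (-1) *\<^sub>R x) \<partial>(lborel :: 'a measure))"
  proof -
    have [measurable]: "{x::'a. - x \<in> N} \<in> sets lborel"
      using measurable_sets[of uminus "borel::'a measure" borel N] by (simp add: vimage_def)
    have "emeasure lborel {x::'a. - x \<in> N}
      = (\<integral>\<^sup>+x. indicator {x. - x \<in> N} x \<partial>(lborel :: 'a measure))"
      by simp
    also have "\<dots> = (\<integral>\<^sup>+x. indicator N (0 + (-1) *\<^sub>R x) \<partial>(lborel :: 'a measure))"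
      by (intro nn_integral_cong) (simp add: indicator_def)
    finally show ?thesis .
  qed
  also have "\<dots> = (\<integral>\<^sup>+x. indicator N x \<partial>lborel)"
    using lborel_nn_integral_affine[of "indicator N" "-1" 0] by simp
  also have "\<dots> = 0" using N' by simp
  finally have "{x. - x \<in> N} \<in> null_sets lborel" by (auto simp: null_sets_def)
  then show ?thesis by (rule AE_I') (use N in auto)
qed

lemma integrable_lborel_pair_mult:
  fixes f :: "'a::euclidean_space \<Rightarrow> complex" and g :: "'b::euclidean_space \<Rightarrow> complex"
  assumes f: "integrable lborel f" and g: "integrable lborel g"
    and k [measurable]: "(\<lambda>(x, y). k x y) \<in> borel_measurable (lborel \<Otimes>\<^sub>M lborel)"
    and k1: "\<And>x y. norm (k x y) \<le> 1"
  shows "integrable (lborel \<Otimes>\<^sub>M lborel) (\<lambda>(x, y). k x y * (f x * g y))"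
proof -
  have [measurable]: "f \<in> borel_measurable lborel" "g \<in> borel_measurable lborel" using f g by auto
  have *: "integrable (lborel \<Otimes>\<^sub>M lborel) (\<lambda>(x, y). f x * g y)"
    using f g by (intro lborel_pair.Fubini_integrable) (auto simp: norm_mult)
  show ?thesis
  proof (rule Bochner_Integration.integrable_bound[OF *])
    show "(\<lambda>(x, y). k x y * (f x * g y)) \<in> borel_measurable (lborel \<Otimes>\<^sub>M lborel)"
      by measurable
    show "AE x in lborel \<Otimes>\<^sub>M lborel. norm (case x of (x, y) \<Rightarrow> k x y * (f x * g y))
      \<le> norm (case x of (x, y) \<Rightarrow> f x * g y)"
      using k1 by (auto simp: norm_mult intro!: AE_I2 mult_left_le_one_le)
  qed
qed

text \<open>A kernel of modulus at most 1, in practice a phase \<open>cis\<close>, leaves absolute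
  integrability to the two factors. Each side keeps its inner transform as a unit, which suits both
  the regularised Plancherel identity and the adjoint formula.\<close>

lemma integral_swap_mult:
  fixes f :: "'a::euclidean_space \<Rightarrow> complex" and g :: "'b::euclidean_space \<Rightarrow> complex"
  assumes "integrable lborel f" "integrable lborel g"
    and "(\<lambda>(x, y). k x y) \<in> borel_measurable (lborel \<Otimes>\<^sub>M lborel)" "\<And>x y. norm (k x y) \<le> 1"
  shows "(LINT y|lborel. (LINT x|lborel. k x y * f x) * g y)
    = (LINT x|lborel. f x * (LINT y|lborel. k x y * g y))"
proof -
  have "(LINT y|lborel. LINT x|lborel. k x y * (f x * g y))
    = (LINT x|lborel. LINT y|lborel. k x y * (f x * g y))"
    using integrable_lborel_pair_mult[OF assms] by (rule lborel_pair.Fubini_integral)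
  moreover have "(LINT x|lborel. k x y * (f x * g y)) = (LINT x|lborel. k x y * f x) * g y" for y
    by (subst integral_mult_left_zero[symmetric]) (simp add: mult_ac)
  moreover have "(LINT y|lborel. k x y * (f x * g y)) = f x * (LINT y|lborel. k x y * g y)" for x
    by (subst integral_mult_right_zero[symmetric]) (simp add: mult_ac)
  ultimately show ?thesis by simp
qed

lemma integrable_cis_mult:
  assumes "integrable lborel f" and [measurable]: "l \<in> borel_measurable borel"
  shows "integrable lborel (\<lambda>x. cis (l x) * f x)"
proof (rule Bochner_Integration.integrable_bound[OF assms(1)])
  have [measurable]: "f \<in> borel_measurable borel" using assms by auto
  show "(\<lambda>x. cis (l x) * f x) \<in> borel_measurable lborel"
    unfolding cis_conv_exp by measurable
qed (auto simp: norm_mult)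

lemma measurable_cis [measurable]: "cis \<in> borel_measurable borel"
  unfolding cis_conv_exp by measurable

section \<open>Gaussian integrals, from the characteristic function of the normal
  distribution\<close>

lemma gaussian_integral_real:
  "integrable lborel (\<lambda>y::real. complex_of_real (exp (- (y\<^sup>2) / 2)) * cis (y * t))"
  "(LINT y|lborel. complex_of_real (exp (- (y\<^sup>2) / 2)) * cis (y * t)) =
     complex_of_real (sqrt (2 * pi) * exp (- (t\<^sup>2) / 2))"
proof -
  have "integrable lborel (\<lambda>y::real. exp (- (y\<^sup>2) / 2))"
    using integrable_mult_right[of "sqrt (2 * pi)", OF integrable_normal_density[of 1 0]]
    by (simp add: normal_density_def)
  then have "integrable lborel (\<lambda>y::real. complex_of_real (exp (- (y\<^sup>2) / 2)))" by simp
  from integrable_cis_mult[OF this, of "\<lambda>y. y * t"]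
  show int: "integrable lborel (\<lambda>y::real. complex_of_real (exp (- (y\<^sup>2) / 2)) * cis (y * t))"
    by (simp add: mult.commute)
  have "complex_of_real (exp (- (t\<^sup>2) / 2)) = char std_normal_distribution t"
    by (simp add: char_std_normal_distribution)
  also have "\<dots> = (LINT y|lborel. std_normal_density y *\<^sub>R iexp (t * y))"
    unfolding char_def by (subst integral_density) (auto simp: normal_density_nonneg)
  also have
    "\<dots> = (LINT y|lborel. complex_of_real (1 / sqrt (2 * pi))
    * (complex_of_real (exp (- (y\<^sup>2) / 2)) * cis (y * t)))"
    by (intro Bochner_Integration.integral_cong)
      (simp_all add: std_normal_density_def scaleR_conv_of_real cis_conv_exp mult_ac)
  also have "\<dots> = complex_of_real (1 / sqrt (2 * pi))
    * (LINT y|lborel. complex_of_real (exp (- (y\<^sup>2) / 2)) * cis (y * t))"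
    by (rule integral_mult_right_zero)
  finally show "(LINT y|lborel. complex_of_real (exp (- (y\<^sup>2) / 2)) * cis (y * t)) =
     complex_of_real (sqrt (2 * pi) * exp (- (t\<^sup>2) / 2))"
    by (simp add: field_simps)
qed

text \<open>Lebesgue measure is the image of the product measure over \<open>Basis\<close> under the
  coordinate map (\<open>lborel_eq\<close>), which reduces both claims to finite products of
  one-dimensional integrals.\<close>

lemma
  fixes f :: "'a::euclidean_space \<Rightarrow> real \<Rightarrow> complex"
  assumes f: "\<And>b. b \<in> Basis \<Longrightarrow> integrable lborel (f b)"
  shows integrable_lborel_prod_Basis: "integrable lborel (\<lambda>x::'a. \<Prod>b\<in>Basis. f b (x \<bullet> b))"
    and integral_lborel_prod_Basis:
      "(LINT x|lborel. (\<Prod>b\<in>Basis. f b (x \<bullet> b))) = (\<Prod>b\<in>(Basis::'a set). LINT y|lborel. f b y)"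
proof -
  interpret product_sigma_finite "\<lambda>_::'a. lborel :: real measure" by standard
  have [measurable]: "f b \<in> borel_measurable borel" if "b \<in> Basis" for b using f[OF that] by auto
  have inner: "(\<Sum>b\<in>Basis. g b *\<^sub>R b) \<bullet> i = g i" if "i \<in> Basis" for g and i :: 'a
    using that by (simp add: inner_sum_left inner_Basis if_distrib cong: if_cong)
  have eq: "(\<Prod>b\<in>Basis. f b ((\<Sum>b\<in>Basis. g b *\<^sub>R b) \<bullet> b)) = (\<Prod>b\<in>Basis. f b (g b))" for g
    by (intro prod.cong) (simp_all add: inner)
  show "integrable lborel (\<lambda>x::'a. \<Prod>b\<in>Basis. f b (x \<bullet> b))"
    unfolding lborel_eq[where 'a='a]
    by (subst integrable_distr_eq) (simp_all add: eq product_integrable_prod f)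
  show "(LINT x|lborel. (\<Prod>b\<in>Basis. f b (x \<bullet> b))) = (\<Prod>b\<in>(Basis::'a set). LINT y|lborel. f b y)"
    unfolding lborel_eq[where 'a='a]
    by (subst integral_distr) (simp_all add: eq product_integral_prod f)
qed

lemma cis_sum: "cis (\<Sum>i\<in>A. f i) = (\<Prod>i\<in>A. cis (f i))"
  by (induction A rule: infinite_finite_induct) (simp_all add: cis_mult[symmetric])

lemma gaussian_integral:
  fixes z :: "'a::euclidean_space"
  shows "integrable lborel (\<lambda>x::'a. complex_of_real (exp (- (norm x)\<^sup>2 / 2)) * cis (x \<bullet> z))"
    and "(LINT x|lborel. complex_of_real (exp (- (norm x)\<^sup>2 / 2)) * cis (x \<bullet> z)) =
      complex_of_real ((2 * pi) powr (real DIM('a) / 2) * exp (- (norm z)\<^sup>2 / 2))"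
proof -
  have nrm: "exp (- (norm x)\<^sup>2 / 2) = (\<Prod>b\<in>Basis. exp (- (x \<bullet> b)\<^sup>2 / 2))" for x :: 'a
    unfolding power2_norm_eq_inner euclidean_inner[of x x]
    by (simp add: exp_sum[symmetric] sum_negf sum_divide_distrib[symmetric] power2_eq_square)
  have eq: "complex_of_real (exp (- (norm x)\<^sup>2 / 2)) * cis (x \<bullet> z) =
      (\<Prod>b\<in>Basis. complex_of_real (exp (- (x \<bullet> b)\<^sup>2 / 2)) * cis ((x \<bullet> b) * (z \<bullet> b)))" for x
    unfolding nrm euclidean_inner[of x z] cis_sum prod.distrib by simp
  show "integrable lborel (\<lambda>x::'a. complex_of_real (exp (- (norm x)\<^sup>2 / 2)) * cis (x \<bullet> z))"
    unfolding eq by (rule integrable_lborel_prod_Basis) (rule gaussian_integral_real)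
  have "(LINT x|lborel. complex_of_real (exp (- (norm x)\<^sup>2 / 2)) * cis (x \<bullet> z)) =
     (\<Prod>b\<in>(Basis::'a set). complex_of_real (sqrt (2 * pi) * exp (- (z \<bullet> b)\<^sup>2 / 2)))"
    unfolding eq by (subst integral_lborel_prod_Basis) (simp_all only: gaussian_integral_real)
  also have "\<dots> = complex_of_real (sqrt (2 * pi) ^ DIM('a) * exp (- (norm z)\<^sup>2 / 2))"
    by (simp only: of_real_mult of_real_prod prod.distrib nrm prod_constant of_real_power)
  also have "sqrt (2 * pi) ^ DIM('a) = (2 * pi) powr (real DIM('a) / 2)"
    by (simp add: powr_half_sqrt[symmetric] powr_realpow[symmetric] powr_powr)
  finally show "(LINT x|lborel. complex_of_real (exp (- (norm x)\<^sup>2 / 2)) * cis (x \<bullet> z)) =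
      complex_of_real ((2 * pi) powr (real DIM('a) / 2) * exp (- (norm z)\<^sup>2 / 2))" .
qed

lemma gaussian_integral_scaled:
  fixes z :: "'a::euclidean_space"
  assumes d: "d > 0"
  shows "integrable lborel (\<lambda>x::'a. complex_of_real (exp (- (d * norm x)\<^sup>2 / 2)) * cis (x \<bullet> z))"
    and "(LINT x|lborel. complex_of_real (exp (- (d * norm x)\<^sup>2 / 2)) * cis (x \<bullet> z)) =
      complex_of_real ((1 / d) ^ DIM('a) *
        ((2 * pi) powr (real DIM('a) / 2) * exp (- (norm z / d)\<^sup>2 / 2)))"
proof -
  have nx: "norm (0 + d *\<^sub>R x) = d * norm x" for x :: 'a using d by simp
  have ix: "(0 + d *\<^sub>R x) \<bullet> (z /\<^sub>R d) = x \<bullet> z" for x :: 'a using d by simp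
  have d0: "d \<noteq> 0" using d by simp
  show "integrable lborel (\<lambda>x::'a. complex_of_real (exp (- (d * norm x)\<^sup>2 / 2)) * cis (x \<bullet> z))"
    using lborel_integrable_affine[OF gaussian_integral(1)[of "z /\<^sub>R d"] d0, of 0] unfolding nx ix .
  have meas: "(\<lambda>x. complex_of_real (exp (- (norm x)\<^sup>2 / 2)) * cis (x \<bullet> (z /\<^sub>R d)))
    \<in> borel_measurable borel"
    using borel_measurable_integrable[OF gaussian_integral(1)[of "z /\<^sub>R d"]] by simp
  have nz: "norm (z /\<^sub>R d) = norm z / d"
    using d by (simp add: divide_inverse)
  have cancel: "B = (1 / d) ^ n *\<^sub>R A" if "A = \<bar>d\<bar> ^ n *\<^sub>R B" for A B :: complex and n
  proof -
    have "(1 / d) ^ n * \<bar>d\<bar> ^ n = 1" using d by (simp add: power_one_over)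
    then show ?thesis unfolding that scaleR_scaleR by (simp only: scaleR_one)
  qed
  have "complex_of_real ((2 * pi) powr (real DIM('a) / 2) * exp (- (norm z / d)\<^sup>2 / 2)) =
     \<bar>d\<bar> ^ DIM('a) *\<^sub>R (LINT x|lborel. complex_of_real (exp (- (d * norm x)\<^sup>2 / 2)) * cis (x \<bullet> z))"
    using lborel_integral_affine[OF meas d0, of 0] unfolding nx ix gaussian_integral(2) nz .
  from cancel[OF this]
  show "(LINT x|lborel. complex_of_real (exp (- (d * norm x)\<^sup>2 / 2)) * cis (x \<bullet> z)) =
      complex_of_real ((1 / d) ^ DIM('a) *
        ((2 * pi) powr (real DIM('a) / 2) * exp (- (norm z / d)\<^sup>2 / 2)))"
    by (simp only: scaleR_conv_of_real of_real_mult)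
qed

section \<open>The Fourier integral, and Plancherel's identity for compact support\<close>

lemma measurable_cnj [measurable]: "cnj \<in> borel_measurable borel"
  by (intro borel_measurable_continuous_onI continuous_intros)

lemma measurable_complex_of_real [measurable]: "complex_of_real \<in> borel_measurable borel"
  by (intro borel_measurable_continuous_onI continuous_intros)

text \<open>The integral formula on functions instead of classes. It is applied to functions
  supported in a ball, for which square integrability implies integrability.\<close>

definition fourier_integral :: "('a::euclidean_space \<Rightarrow> complex) \<Rightarrow> 'a \<Rightarrow> complex" where
  "fourier_integral f \<xi> = complex_of_real ((2 * pi) powr (- real DIM('a) / 2))
    * (LINT x|lborel. cis (- (x \<bullet> \<xi>)) * f x)"

lemma fourier_integral_measurable [measurable]:
  assumes [measurable]: "f \<in> borel_measurable borel"
  shows "fourier_integral f \<in> borel_measurable borel"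
  unfolding fourier_integral_def[abs_def] by measurable

lemma fourier_integral_diff:
  assumes "integrable lborel f" "integrable lborel g"
  shows "fourier_integral (\<lambda>x. f x - g x) \<xi> = fourier_integral f \<xi> - fourier_integral g \<xi>"
  using assms by (simp add: fourier_integral_def right_diff_distrib integrable_cis_mult)

lemma fourier_integral_add:
  assumes "integrable lborel f" "integrable lborel g"
  shows "fourier_integral (\<lambda>x. f x + g x) \<xi> = fourier_integral f \<xi> + fourier_integral g \<xi>"
  using assms by (simp add: fourier_integral_def distrib_left integrable_cis_mult)

lemma fourier_integral_scaleR: "fourier_integral (\<lambda>x. c *\<^sub>R f x) \<xi> = c *\<^sub>R fourier_integral f \<xi>"
  by (simp add: fourier_integral_def)

lemma norm_fourier_integral_le:
  fixes f :: "'a::euclidean_space \<Rightarrow> complex"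
  shows "norm (fourier_integral f \<xi>)
    \<le> (2 * pi) powr (- real DIM('a) / 2) * (LINT x|lborel. norm (f x))"
proof -
  have "norm (LINT x|lborel. cis (- (x \<bullet> \<xi>)) * f x) \<le> (LINT x|lborel. norm (cis (- (x \<bullet> \<xi>)) * f x))"
    by (rule integral_norm_bound)
  then show ?thesis
    by (simp add: fourier_integral_def norm_mult mult_left_mono)
qed

text \<open>A Gaussian in \<xi> makes the triple integral over x, y and \<xi> absolutely convergent.
  Integrating in \<xi> first gives a Gaussian in (y-x)/d, and y = x + d z turns it into an average
  of \<open>f\<close> around \<open>x\<close> with no power of \<open>d\<close> left over.
  Plancherel's identity is the limit of this formula as \<open>d\<close> tends to 0.\<close>

lemma fourier_integral_regularised:
  fixes f :: "'a::euclidean_space \<Rightarrow> complex"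
  assumes f: "integrable lborel f" and d: "d > 0"
  shows "(LINT \<xi>|lborel. complex_of_real ((norm (fourier_integral f \<xi>))\<^sup>2
    * exp (- (d * norm \<xi>)\<^sup>2 / 2))) =
     complex_of_real ((2 * pi) powr (- real DIM('a) / 2)) *
       (LINT x|lborel. f x * (LINT z|lborel. cnj (f (x + d *\<^sub>R z)) * complex_of_real
         (exp (- (norm z)\<^sup>2 / 2))))"
proof -
  have [measurable]: "f \<in> borel_measurable borel" using f by auto
  let ?c = "complex_of_real ((2 * pi) powr (- real DIM('a) / 2))"
  let ?g = "\<lambda>\<xi>::'a. complex_of_real (exp (- (d * norm \<xi>)\<^sup>2 / 2))"
  \<comment> \<open>The conjugate transform together with the Gaussian; integrable, because the
    transform of an integrable function is bounded.\<close>
  define G where "G \<xi> = cnj (fourier_integral f \<xi>) * ?g \<xi>" for \<xi>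
  have gi: "integrable lborel ?g"
    using gaussian_integral_scaled(1)[OF d, of 0] by simp
  have Gi: "integrable lborel G"
  proof (rule Bochner_Integration.integrable_bound[OF integrable_mult_right[OF gi]])
    show "G \<in> borel_measurable lborel" unfolding G_def[abs_def] by measurable
    let ?B = "complex_of_real ((2 * pi) powr (- real DIM('a) / 2) * (LINT x|lborel. norm (f x)))"
    have "norm ?B = (2 * pi) powr (- real DIM('a) / 2) * (LINT x|lborel. norm (f x))"
      by (simp add: norm_mult)
    then show "AE \<xi> in lborel. norm (G \<xi>) \<le> norm (?B * ?g \<xi>)"
      unfolding G_def norm_mult complex_mod_cnj using norm_fourier_integral_le[of f]
        by (auto intro!: AE_I2 mult_right_mono)
  qed
  have cnjF: "cnj (fourier_integral f \<xi>) = ?c * (LINT y|lborel. cis (y \<bullet> \<xi>) * cnj (f y))" for \<xi>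
  proof -
    have "cnj (LINT x|lborel. cis (- (x \<bullet> \<xi>)) * f x) = (LINT x|lborel. cnj (cis (- (x \<bullet> \<xi>)) * f x))"
      by (rule Bochner_Integration.integral_cnj[symmetric])
    also have "\<dots> = (LINT y|lborel. cis (y \<bullet> \<xi>) * cnj (f y))"
      by (simp add: cis_cnj del: Bochner_Integration.integral_cnj)
    finally show ?thesis unfolding fourier_integral_def by simp
  qed
  have cg: "integrable lborel (\<lambda>\<xi>. cis (- (x \<bullet> \<xi>)) * ?g \<xi>)" for x
    by (intro integrable_cis_mult gi) measurable
  have inner: "(LINT \<xi>|lborel. cis (- (x \<bullet> \<xi>)) * G \<xi>) =
     (LINT z|lborel. cnj (f (x + d *\<^sub>R z)) * complex_of_real (exp (- (norm z)\<^sup>2 / 2)))" for x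
  proof -
    have "(LINT \<xi>|lborel. cis (- (x \<bullet> \<xi>)) * G \<xi>) =
        (LINT \<xi>|lborel. ?c * ((LINT y|lborel. cis (y \<bullet> \<xi>) * cnj (f y)) * (cis (- (x \<bullet> \<xi>)) * ?g \<xi>)))"
      unfolding G_def cnjF by (simp only: mult_ac)
    also have
      "\<dots> = ?c * (LINT \<xi>|lborel. (LINT y|lborel. cis (y \<bullet> \<xi>) * cnj (f y))
      * (cis (- (x \<bullet> \<xi>)) * ?g \<xi>))"
      by (rule integral_mult_right_zero)
    also have
      "(LINT \<xi>|lborel. (LINT y|lborel. cis (y \<bullet> \<xi>) * cnj (f y)) * (cis (- (x \<bullet> \<xi>)) * ?g \<xi>)) =
        (LINT y|lborel. cnj (f y) * (LINT \<xi>|lborel. cis (y \<bullet> \<xi>) * (cis (- (x \<bullet> \<xi>)) * ?g \<xi>)))"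
      by (rule integral_swap_mult) (use f cg in auto)
    also have "(\<lambda>y. LINT \<xi>|lborel. cis (y \<bullet> \<xi>) * (cis (- (x \<bullet> \<xi>)) * ?g \<xi>)) =
       (\<lambda>y. complex_of_real ((1 / d) ^ DIM('a) *
         ((2 * pi) powr (real DIM('a) / 2) * exp (- (norm (y - x) / d)\<^sup>2 / 2))))"
    proof
      fix y
      have "(LINT \<xi>|lborel. cis (y \<bullet> \<xi>) * (cis (- (x \<bullet> \<xi>)) * ?g \<xi>))
        = (LINT \<xi>|lborel. ?g \<xi> * cis (\<xi> \<bullet> (y - x)))"
        by (simp add: mult.assoc[symmetric] cis_mult inner_diff_right inner_commute mult.commute)
      then show "(LINT \<xi>|lborel. cis (y \<bullet> \<xi>) * (cis (- (x \<bullet> \<xi>)) * ?g \<xi>)) =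
        complex_of_real ((1 / d) ^ DIM('a) *
          ((2 * pi) powr (real DIM('a) / 2) * exp (- (norm (y - x) / d)\<^sup>2 / 2)))"
        by (simp only: gaussian_integral_scaled(2)[OF d])
    qed
    also have
      "(LINT y|lborel. cnj (f y) * complex_of_real ((1 / d) ^ DIM('a)
      * ((2 * pi) powr (real DIM('a) / 2) * exp (- (norm (y - x) / d)\<^sup>2 / 2)))) =
      \<bar>d\<bar> ^ DIM('a) *\<^sub>R (LINT z|lborel. cnj (f (x + d *\<^sub>R z)) * complex_of_real
        ((1 / d) ^ DIM('a) * ((2 * pi) powr (real DIM('a) / 2) * exp
        (- (norm ((x + d *\<^sub>R z) - x) / d)\<^sup>2 / 2))))"
      using d by (intro lborel_integral_affine) auto
    also have
      "(LINT z|lborel. cnj (f (x + d *\<^sub>R z))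
      * complex_of_real ((1 / d) ^ DIM('a) *
      ((2 * pi) powr (real DIM('a) / 2) * exp (- (norm ((x + d *\<^sub>R z) - x) / d)\<^sup>2 / 2)))) =
      (LINT z|lborel. complex_of_real ((1 / d) ^ DIM('a) * (2 * pi) powr (real DIM('a) / 2)) *
        (cnj (f (x + d *\<^sub>R z)) * complex_of_real (exp (- (norm z)\<^sup>2 / 2))))"
      using d by (intro Bochner_Integration.integral_cong refl) (simp add: mult_ac)
    also have "\<dots> = complex_of_real ((1 / d) ^ DIM('a) * (2 * pi) powr (real DIM('a) / 2))
      * (LINT z|lborel. cnj (f (x + d *\<^sub>R z)) * complex_of_real (exp (- (norm z)\<^sup>2 / 2)))"
      by (rule integral_mult_right_zero)
    finally have *: "(LINT \<xi>|lborel. cis (- (x \<bullet> \<xi>)) * G \<xi>)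
      = ?c * (\<bar>d\<bar> ^ DIM('a) *\<^sub>R (complex_of_real
      ((1 / d) ^ DIM('a) * (2 * pi) powr (real DIM('a) / 2)) *
      (LINT z|lborel. cnj (f (x + d *\<^sub>R z)) * complex_of_real (exp (- (norm z)\<^sup>2 / 2)))))" .
    \<comment> \<open>The Jacobian d^n cancels the d^(-n) of the Gaussian transform, and (2
      pi)^(n/2) cancels the normalisation of one of the two transforms. The normalisation of the
      other remains as the factor in front of the claim.\<close>
    have "(2 * pi) powr (- real DIM('a) / 2)
      * (\<bar>d\<bar> ^ DIM('a) * ((1 / d) ^ DIM('a) * (2 * pi) powr (real DIM('a) / 2))) = 1"
      using d by (simp add: power_one_over powr_minus field_simps)
    then have one:
      "?c * (complex_of_real (\<bar>d\<bar> ^ DIM('a))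
      * complex_of_real ((1 / d) ^ DIM('a) * (2 * pi) powr (real DIM('a) / 2))) = 1"
      by (metis of_real_mult of_real_1)
    show ?thesis
      unfolding * scaleR_conv_of_real mult.assoc[symmetric] using one by (simp add: mult.assoc)
  qed
  have "(LINT \<xi>|lborel. complex_of_real ((norm (fourier_integral f \<xi>))\<^sup>2
    * exp (- (d * norm \<xi>)\<^sup>2 / 2))) =
    (LINT \<xi>|lborel. ?c * ((LINT x|lborel. cis (- (x \<bullet> \<xi>)) * f x) * G \<xi>))"
  proof (intro Bochner_Integration.integral_cong refl)
    fix \<xi> :: 'a
    have "complex_of_real ((norm (fourier_integral f \<xi>))\<^sup>2 * exp (- (d * norm \<xi>)\<^sup>2 / 2))
      = fourier_integral f \<xi> * G \<xi>"
      unfolding G_def of_real_mult complex_norm_square by (simp only: mult_ac)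
    then show "complex_of_real ((norm (fourier_integral f \<xi>))\<^sup>2 * exp (- (d * norm \<xi>)\<^sup>2 / 2))
      = ?c * ((LINT x|lborel. cis (- (x \<bullet> \<xi>)) * f x) * G \<xi>)"
      by (simp only: fourier_integral_def mult.assoc)
  qed
  also have "\<dots> = ?c * (LINT \<xi>|lborel. (LINT x|lborel. cis (- (x \<bullet> \<xi>)) * f x) * G \<xi>)"
    by (rule integral_mult_right_zero)
  also have "(LINT \<xi>|lborel. (LINT x|lborel. cis (- (x \<bullet> \<xi>)) * f x) * G \<xi>)
    = (LINT x|lborel. f x * (LINT \<xi>|lborel. cis (- (x \<bullet> \<xi>)) * G \<xi>))"
    by (rule integral_swap_mult) (use f Gi in auto)
  finally show ?thesis unfolding inner .
qed

lemma continuous_compact_support_facts: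
  fixes f :: "'a::euclidean_space \<Rightarrow> complex"
  assumes cont: "continuous_on UNIV f" and supp: "\<And>x. R \<le> norm x \<Longrightarrow> f x = 0"
  obtains M where "M \<ge> 0" "\<And>x. norm (f x) \<le> M" "f \<in> borel_measurable borel" "integrable lborel f"
    "square_integrable f"
proof -
  have "compact (f ` cball 0 R)"
    by (intro compact_continuous_image continuous_on_subset[OF cont]) auto
  then obtain M where M: "\<And>x. x \<in> cball 0 R \<Longrightarrow> norm (f x) \<le> M"
    using compact_imp_bounded bounded_iff by (metis imageI)
  define M' where "M' = max M 0"
  have b: "norm (f x) \<le> M' * indicator (cball 0 R) x" for x
    using M[of x] supp[of x] by (cases "norm x \<le> R") (auto simp: M'_def)
  have [measurable]: "f \<in> borel_measurable borel" using cont
    by (rule borel_measurable_continuous_onI)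
  have fin: "integrable lborel (indicator (cball 0 R) :: 'a \<Rightarrow> real)"
    by (rule integrable_real_indicator) (simp, rule emeasure_lborel_cball_finite)
  show ?thesis
  proof
    show "M' \<ge> 0" by (simp add: M'_def)
    show "norm (f x) \<le> M'" for x
      using b[of x] \<open>M' \<ge> 0\<close> by (cases "norm x \<le> R") auto
    show "integrable lborel f"
      by (rule Bochner_Integration.integrable_bound[OF integrable_mult_right[OF fin, of M']])
        (auto intro!: AE_I2 order_trans[OF b abs_ge_self])
    have "(norm (f x))\<^sup>2 \<le> M'\<^sup>2 * indicator (cball 0 R) x" for x
      using b[of x] by (auto simp: indicator_def intro: power_mono split: if_splits)
    then have "integrable lborel (\<lambda>x. (norm (f x))\<^sup>2)"
      by (intro Bochner_Integration.integrable_bound[OF integrable_mult_right[OF fin, of "M'\<^sup>2"]])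
        (auto intro!: AE_I2)
    then show "square_integrable f" by (simp add: square_integrable_def)
  qed fact
qed

text \<open>The parameter of the regularised identity tends to 0. On the right, continuity of
  \<open>f\<close> gives dominated convergence in both integrals. On the left, square integrability
  of the transform is not known yet, hence the formulation with nonnegative integrals: Fatou gives
  one inequality, and the Gaussian being at most 1 gives the other.\<close>

lemma fourier_integral_isometry_continuous:
  fixes f :: "'a::euclidean_space \<Rightarrow> complex"
  assumes cont: "continuous_on UNIV f" and supp: "\<And>x. R \<le> norm x \<Longrightarrow> f x = 0"
  shows "(\<integral>\<^sup>+\<xi>. ennreal ((norm (fourier_integral f \<xi>))\<^sup>2) \<partial>lborel)
    = (\<integral>\<^sup>+x. ennreal ((norm (f x))\<^sup>2) \<partial>lborel)"
proof -
  obtain M where M: "M \<ge> 0" "\<And>x. norm (f x) \<le> M" and [measurable]: "f \<in> borel_measurable borel"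
    and fi: "integrable lborel f" and fsq: "square_integrable f"
    using continuous_compact_support_facts[OF cont supp] by metis
  let ?c = "complex_of_real ((2 * pi) powr (- real DIM('a) / 2))"
  let ?C = "complex_of_real ((2 * pi) powr (real DIM('a) / 2))"
  let ?g = "\<lambda>z::'a. complex_of_real (exp (- (norm z)\<^sup>2 / 2))"
  define d where "d k = inverse (real (Suc k))" for k
  have d: "d k > 0" for k by (simp add: d_def)
  have d0: "d \<longlonglongrightarrow> 0" unfolding d_def by (rule LIMSEQ_inverse_real_of_nat)
  have gi: "integrable lborel ?g"
    using gaussian_integral(1)[of 0] by simp
  have gI: "(LINT z|lborel. ?g z) = ?C"
    using gaussian_integral(2)[where z="0::'a"] by simp
  have inner: "(\<lambda>k. LINT z|lborel. cnj (f (x + d k *\<^sub>R z)) * ?g z)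
    \<longlonglongrightarrow> (LINT z|lborel. cnj (f x) * ?g z)" for x
  proof (rule integral_dominated_convergence)
    show "integrable lborel (\<lambda>z. M * norm (?g z))"
      by (intro integrable_mult_right integrable_norm gi)
    show "AE z in lborel. (\<lambda>k. cnj (f (x + d k *\<^sub>R z)) * ?g z) \<longlonglongrightarrow> cnj (f x) * ?g z"
    proof (rule AE_I2)
      fix z :: 'a
      have "(\<lambda>k. x + d k *\<^sub>R z) \<longlonglongrightarrow> x + 0 *\<^sub>R z" by (intro tendsto_intros d0)
      then have "(\<lambda>k. f (x + d k *\<^sub>R z)) \<longlonglongrightarrow> f x"
        using cont by (intro isCont_tendsto_compose[of x f])
          (auto simp: continuous_on_eq_continuous_at)
      then show "(\<lambda>k. cnj (f (x + d k *\<^sub>R z)) * ?g z) \<longlonglongrightarrow> cnj (f x) * ?g z"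
        by (intro tendsto_intros)
    qed
    show "AE z in lborel. norm (cnj (f (x + d k *\<^sub>R z)) * ?g z) \<le> M * norm (?g z)" for k
      unfolding norm_mult complex_mod_cnj using M by (auto intro!: AE_I2 mult_right_mono)
  qed measurable
  define N where "N = M * (LINT z|lborel. norm (?g z))"
  have outer: "(\<lambda>k. LINT x|lborel. f x * (LINT z|lborel. cnj (f (x + d k *\<^sub>R z)) * ?g z))
    \<longlonglongrightarrow> (LINT x|lborel. f x * (LINT z|lborel. cnj (f x) * ?g z))"
  proof (rule integral_dominated_convergence)
    show "integrable lborel (\<lambda>x. norm (f x) * N)" by (intro integrable_mult_left integrable_norm fi)
    show "AE x in lborel. (\<lambda>k. f x * (LINT z|lborel. cnj (f (x + d k *\<^sub>R z)) * ?g z))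
      \<longlonglongrightarrow> f x * (LINT z|lborel. cnj (f x) * ?g z)"
      by (intro AE_I2 tendsto_intros inner)
    show "AE x in lborel. norm (f x * (LINT z|lborel. cnj (f (x + d k *\<^sub>R z)) * ?g z))
      \<le> norm (f x) * N" for k
    proof (rule AE_I2)
      fix x :: 'a
      have "norm (LINT z|lborel. cnj (f (x + d k *\<^sub>R z)) * ?g z)
        \<le> (LINT z|lborel. norm (cnj (f (x + d k *\<^sub>R z)) * ?g z))"
        by (rule integral_norm_bound)
      also have "\<dots> \<le> (LINT z|lborel. M * norm (?g z))"
      proof (rule integral_mono)
        show "integrable lborel (\<lambda>z. norm (cnj (f (x + d k *\<^sub>R z)) * ?g z))"
        proof (rule Bochner_Integration.integrable_bound[OF
          integrable_mult_right[OF integrable_norm[OF gi]]])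
          show "AE z in lborel. norm (norm (cnj (f (x + d k *\<^sub>R z)) * ?g z))
            \<le> norm (M * norm (?g z))"
            using M by (auto intro!: AE_I2 mult_right_mono simp: norm_mult)
        qed measurable
        show "integrable lborel (\<lambda>z. M * norm (?g z))"
          by (intro integrable_mult_right integrable_norm gi)
        show "norm (cnj (f (x + d k *\<^sub>R z)) * ?g z) \<le> M * norm (?g z)" for z
          unfolding norm_mult complex_mod_cnj using M by (intro mult_right_mono) auto
      qed
      also have "\<dots> = N" unfolding N_def by (rule integral_mult_right_zero)
      finally show "norm (f x * (LINT z|lborel. cnj (f (x + d k *\<^sub>R z)) * ?g z)) \<le> norm (f x) * N"
        unfolding norm_mult by (rule mult_left_mono) simp
    qed
  qed measurable
  have "f x * (LINT z|lborel. cnj (f x) * ?g z) = ?C * complex_of_real ((norm (f x))\<^sup>2)" for x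
    unfolding integral_mult_right_zero gI complex_norm_square by (simp only: mult_ac)
  then have "(LINT x|lborel. f x * (LINT z|lborel. cnj (f x) * ?g z))
    = ?C * complex_of_real (LINT x|lborel. (norm (f x))\<^sup>2)"
    by (simp only: integral_mult_right_zero integral_complex_of_real)
  with outer have "(\<lambda>k. ?c * (LINT x|lborel. f x * (LINT z|lborel. cnj (f (x + d k *\<^sub>R z)) * ?g z)))
    \<longlonglongrightarrow> ?c * (?C * complex_of_real (LINT x|lborel. (norm (f x))\<^sup>2))"
    by (intro tendsto_intros) simp
  moreover have "?c * (?C * w) = w" for w
  proof -
    have "(2 * pi) powr (- real DIM('a) / 2) * (2 * pi) powr (real DIM('a) / 2) = 1"
      by (simp add: powr_add[symmetric])
    then have "?c * ?C = 1" by (metis of_real_mult of_real_1)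
    then show ?thesis by (simp add: mult.assoc[symmetric])
  qed
  ultimately have
    "(\<lambda>k. LINT \<xi>|lborel. complex_of_real ((norm (fourier_integral f \<xi>))\<^sup>2
    * exp (- (d k * norm \<xi>)\<^sup>2 / 2))) \<longlonglongrightarrow> complex_of_real (LINT x|lborel. (norm (f x))\<^sup>2)"
    by (simp only: fourier_integral_regularised[OF fi d])
  then have lim:
    "(\<lambda>k. LINT \<xi>|lborel. (norm (fourier_integral f \<xi>))\<^sup>2 * exp (- (d k * norm \<xi>)\<^sup>2 / 2))
    \<longlonglongrightarrow> (LINT x|lborel. (norm (f x))\<^sup>2)"
    unfolding integral_complex_of_real tendsto_of_real_iff .
  define J
    where "J k
    = (\<integral>\<^sup>+\<xi>. ennreal ((norm (fourier_integral f \<xi>))\<^sup>2 * exp (- (d k * norm \<xi>)\<^sup>2 / 2))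
    \<partial>lborel)" for k
  have "J k = ennreal (LINT \<xi>|lborel. (norm (fourier_integral f \<xi>))\<^sup>2
    * exp (- (d k * norm \<xi>)\<^sup>2 / 2))" for k
    unfolding J_def
  proof (rule nn_integral_eq_integral)
    define B where "B = (2 * pi) powr (- real DIM('a) / 2) * (LINT x|lborel. norm (f x))"
    have "integrable lborel (\<lambda>\<xi>::'a. exp (- (d k * norm \<xi>)\<^sup>2 / 2))"
      using gaussian_integral_scaled(1)[OF d[of k], where z="0::'a"] by (auto dest: integrable_norm)
    then have i: "integrable lborel (\<lambda>\<xi>::'a. B\<^sup>2 * exp (- (d k * norm \<xi>)\<^sup>2 / 2))"
      by (rule integrable_mult_right)
    show "integrable lborel (\<lambda>\<xi>. (norm (fourier_integral f \<xi>))\<^sup>2 * exp (- (d k * norm \<xi>)\<^sup>2 / 2))"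
      by (rule Bochner_Integration.integrable_bound[OF i])
        (auto intro!: AE_I2 mult_right_mono power_mono norm_fourier_integral_le[of f, folded B_def])
  qed auto
  then have
    "J = (\<lambda>k. ennreal (LINT \<xi>|lborel. (norm (fourier_integral f \<xi>))\<^sup>2
    * exp (- (d k * norm \<xi>)\<^sup>2 / 2)))"
    by blast
  with lim have J: "J \<longlonglongrightarrow> (\<integral>\<^sup>+x. ennreal ((norm (f x))\<^sup>2) \<partial>lborel)"
    using fsq by (simp add: square_integrable_def nn_integral_eq_integral tendsto_ennrealI)
  show ?thesis
  proof (rule antisym)
    have "(\<integral>\<^sup>+\<xi>. ennreal ((norm (fourier_integral f \<xi>))\<^sup>2) \<partial>lborel)
      = (\<integral>\<^sup>+\<xi>. liminf (\<lambda>k. ennreal ((norm (fourier_integral f \<xi>))\<^sup>2 * exp (- (d k * norm \<xi>)\<^sup>2 / 2)))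
      \<partial>lborel)"
    proof (intro nn_integral_cong)
      fix \<xi> :: 'a
      have "(\<lambda>k. ennreal ((norm (fourier_integral f \<xi>))\<^sup>2 * exp (- (d k * norm \<xi>)\<^sup>2 / 2)))
        \<longlonglongrightarrow> ennreal ((norm (fourier_integral f \<xi>))\<^sup>2 * exp (- (0 * norm \<xi>)\<^sup>2 / 2))"
        by (intro tendsto_ennrealI tendsto_intros d0) simp
      from lim_imp_Liminf[OF _ this] show
        "ennreal ((norm (fourier_integral f \<xi>))\<^sup>2)
        = liminf (\<lambda>k. ennreal ((norm (fourier_integral f \<xi>))\<^sup>2 * exp (- (d k * norm \<xi>)\<^sup>2 / 2)))"
        by simp
    qed
    also have "\<dots> \<le> liminf J"
      unfolding J_def[abs_def] by (intro nn_integral_liminf) measurable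
    also have "\<dots> = (\<integral>\<^sup>+x. ennreal ((norm (f x))\<^sup>2) \<partial>lborel)"
      by (rule lim_imp_Liminf[OF _ J]) simp
    finally show "(\<integral>\<^sup>+\<xi>. ennreal ((norm (fourier_integral f \<xi>))\<^sup>2) \<partial>lborel)
      \<le> (\<integral>\<^sup>+x. ennreal ((norm (f x))\<^sup>2) \<partial>lborel)" .
    have "J k \<le> (\<integral>\<^sup>+\<xi>. ennreal ((norm (fourier_integral f \<xi>))\<^sup>2) \<partial>lborel)" for k
      unfolding J_def by (intro nn_integral_mono ennreal_leI mult_left_le) auto
    then show "(\<integral>\<^sup>+x. ennreal ((norm (f x))\<^sup>2) \<partial>lborel)
      \<le> (\<integral>\<^sup>+\<xi>. ennreal ((norm (fourier_integral f \<xi>))\<^sup>2) \<partial>lborel)"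
      by (intro LIMSEQ_le_const2[OF J]) auto
  qed
qed

text \<open>The height of \<open>f\<close> is truncated, and the truncated function is an almost
  everywhere limit of the continuous functions contained in \<open>measurable_on\<close>. Clipping
  their values and cutting them off radially keeps them continuous and provides a majorant. The
  limit is unchanged, since the truncated function is below the clipping height and vanishes beyond
  \<open>R\<close>.\<close>

lemma L2_approx_continuous:
  fixes f :: "'a::euclidean_space \<Rightarrow> complex"
  assumes f: "square_integrable f" and supp: "\<And>x. R < norm x \<Longrightarrow> f x = 0" and e: "e > 0"
  shows "\<exists>h. continuous_on UNIV h \<and> (\<forall>x. R + 1 \<le> norm x \<longrightarrow> h x = 0)
    \<and> norm (L2_class h - L2_class f) < e"
proof -
  have [measurable]: "f \<in> borel_measurable borel" using f by (simp add: square_integrable_def)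
  define b where "b k x = (if norm (f x) \<le> real k then f x else 0)" for k :: nat and x
  have bm [measurable]: "b k \<in> borel_measurable borel" for k unfolding b_def[abs_def] by measurable
  have "AE x in lborel. (\<lambda>k. b k x) \<longlonglongrightarrow> f x"
  proof (rule AE_I2)
    fix x
    obtain k0 :: nat where "norm (f x) \<le> real k0" using real_arch_simple by blast
    then have "\<forall>\<^sub>F k in sequentially. b k x = f x"
      by (intro eventually_sequentiallyI[of k0]) (auto simp: b_def)
    then show "(\<lambda>k. b k x) \<longlonglongrightarrow> f x" by (rule tendsto_eventually)
  qed
  note blim = this
  have bb: "AE x in lborel. (norm (b k x))\<^sup>2 \<le> (norm (f x))\<^sup>2" for k
    by (rule AE_I2) (simp add: b_def)
  have "integrable lborel (\<lambda>x. (norm (f x))\<^sup>2)"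
    using f by (simp add: square_integrable_def)
  from L2_LIMSEQ_dominated(3)[OF bm _ this bb blim]
  have blim: "(\<lambda>k. L2_class (b k)) \<longlonglongrightarrow> L2_class f" by simp
  obtain k where k: "norm (L2_class (b k) - L2_class f) < e / 2"
    using LIMSEQ_D[OF blim, of "e/2"] e by auto
  \<comment> \<open>At least 1, so that \<open>clip\<close> divides by a positive number even for
    \<open>k = 0\<close>.\<close>
  define K where "K = max 1 (real k)"
  have K: "K > 0" "real k \<le> K" by (auto simp: K_def)
  have "b k \<in> borel_measurable (lebesgue_on UNIV)"
    using bm[of k] by (simp add: lebesgue_on_UNIV_eq measurable_completion)
  then have "b k measurable_on UNIV" by (simp add: measurable_on_iff_borel_measurable)
  then obtain N g where N: "negligible N" and g: "\<And>n. continuous_on UNIV (g n)"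
    and lim: "\<And>x. x \<notin> N \<Longrightarrow> (\<lambda>n. g n x) \<longlonglongrightarrow> b k x"
    unfolding measurable_on_def by auto
  define cut where "cut x = max 0 (min 1 (R + 1 - norm x))" for x :: 'a
  define clip where "clip z = (K / max K (norm z)) *\<^sub>R z" for z :: complex
  have clip_cont: "continuous_on UNIV clip"
    unfolding clip_def[abs_def] using K by (intro continuous_intros) (auto simp: max_def)
  have clip_le: "norm (clip z) \<le> K" for z
    using K by (auto simp: clip_def max_def field_simps)
  have clip_id: "clip z = z" if "norm z \<le> K" for z
    using K that by (simp add: clip_def max_def)
  define h where "h n x = cut x *\<^sub>R clip (g n x)" for n x
  have h_cont: "continuous_on UNIV (h n)" for n
    unfolding h_def[abs_def] cut_def
    by (intro continuous_intros continuous_on_compose2[OF clip_cont g]) auto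
  have h_supp: "h n x = 0" if "R + 1 \<le> norm x" for n x
    using that by (simp add: h_def cut_def)
  have h_meas [measurable]: "h n \<in> borel_measurable borel" for n
    using h_cont by (rule borel_measurable_continuous_onI)
  have h_le: "(norm (h n x))\<^sup>2 \<le> K\<^sup>2 * indicator (cball 0 (R + 1)) x" for n x
  proof (cases "R + 1 \<le> norm x")
    case False
    have "norm (h n x) \<le> 1 * K"
      unfolding h_def norm_scaleR by (intro mult_mono clip_le) (auto simp: cut_def)
    then have "(norm (h n x))\<^sup>2 \<le> K\<^sup>2" by (intro power_mono) auto
    then show ?thesis using False by simp
  qed (simp add: h_supp)
  have "integrable lborel (indicator (cball 0 (R + 1)) :: 'a \<Rightarrow> real)"
    by (rule integrable_real_indicator) (simp, rule emeasure_lborel_cball_finite)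
  then have w: "integrable lborel (\<lambda>x::'a. K\<^sup>2 * indicator (cball 0 (R + 1)) x)"
    by (rule integrable_mult_right)
  have "AE x in lborel. x \<notin> N"
    using N AE_not_in[of N lebesgue] by (simp add: negligible_iff_null_sets AE_completion_iff)
  then have "AE x in lborel. (\<lambda>n. h n x) \<longlonglongrightarrow> b k x"
  proof eventually_elim
    case (elim x)
    have "(\<lambda>n. clip (g n x)) \<longlonglongrightarrow> clip (b k x)"
      using clip_cont by (intro isCont_tendsto_compose[OF _ lim[OF elim]])
        (auto simp: continuous_on_eq_continuous_at)
    then have "(\<lambda>n. h n x) \<longlonglongrightarrow> cut x *\<^sub>R clip (b k x)"
      unfolding h_def by (intro tendsto_intros)
    also have "clip (b k x) = b k x" using K by (intro clip_id) (auto simp: b_def)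
    also have "cut x *\<^sub>R b k x = b k x"
      by (cases "R < norm x") (auto simp: b_def supp cut_def)
    finally show ?case .
  qed
  from L2_LIMSEQ_dominated(3)[OF h_meas bm w AE_I2[OF h_le] this]
  have "(\<lambda>n. L2_class (h n)) \<longlonglongrightarrow> L2_class (b k)" .
  from LIMSEQ_D[OF this, of "e/2"] obtain n
    where n: "norm (L2_class (h n) - L2_class (b k)) < e / 2"
    using e by auto
  have "norm (L2_class (h n) - L2_class f) \<le> norm (L2_class (h n) - L2_class (b k))
    + norm (L2_class (b k) - L2_class f)"
    using norm_triangle_ineq[of "L2_class (h n) - L2_class (b k)" "L2_class (b k) - L2_class f"]
      by simp
  also have "\<dots> < e" using n k by simp
  finally show ?thesis using h_cont h_supp by (intro exI[of _ "h n"]) auto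
qed

text \<open>Cauchy-Schwarz against the indicator of the ball.\<close>

lemma L1_le_L2:
  fixes f :: "'a::euclidean_space \<Rightarrow> complex"
  assumes f: "square_integrable f" and supp: "\<And>x. R < norm x \<Longrightarrow> f x = 0"
  shows "integrable lborel f"
    and "(LINT x|lborel. norm (f x)) \<le> sqrt (measure lborel (cball (0::'a) R)) * norm (L2_class f)"
proof -
  have [measurable]: "f \<in> borel_measurable borel" using f by (simp add: square_integrable_def)
  let ?i = "\<lambda>x::'a. complex_of_real (indicator (cball 0 R) x)"
  let ?f = "\<lambda>x. complex_of_real (norm (f x))"
  have fin: "integrable lborel (indicator (cball 0 R) :: 'a \<Rightarrow> real)"
    by (rule integrable_real_indicator) (simp, rule emeasure_lborel_cball_finite)
  have isq: "(norm (?i x))\<^sup>2 = indicator (cball 0 R) x" for x by (simp add: indicator_def)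
  have i: "square_integrable ?i"
    unfolding square_integrable_def isq using fin by simp
  have f': "square_integrable ?f"
    using f by (simp add: square_integrable_def)
  have eq: "?f x \<bullet> ?i x = norm (f x)" for x
    using supp[of x] by (cases "norm x \<le> R") (auto simp: inner_complex_def)
  have "integrable lborel (\<lambda>x. norm (f x))"
    using integrable_inner_L2[OF f' i] unfolding eq .
  then show "integrable lborel f" by (simp add: integrable_norm_iff)
  have n: "norm (L2_class ?f) = norm (L2_class f)"
    by (rule power2_eq_imp_eq) (use f f' in \<open>simp_all add: norm_L2_class\<close>)
  have "(norm (L2_class ?i))\<^sup>2 = measure lborel (cball (0::'a) R)"
    unfolding norm_L2_class[OF i] isq by simp
  then have ni: "norm (L2_class ?i) = sqrt (measure lborel (cball (0::'a) R))"
    by (metis norm_ge_zero real_sqrt_unique)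
  have "(LINT x|lborel. norm (f x)) = inner (L2_class ?f) (L2_class ?i)"
    unfolding inner_L2_class[OF f' i] eq ..
  also have "\<dots> \<le> norm (L2_class ?f) * norm (L2_class ?i)" by (rule norm_cauchy_schwarz)
  finally show "(LINT x|lborel. norm (f x))
    \<le> sqrt (measure lborel (cball (0::'a) R)) * norm (L2_class f)"
    unfolding n ni by (simp add: mult.commute)
qed

text \<open>Density of continuous functions. The approximants share one support ball, so L2
  convergence implies L1 convergence and with it pointwise convergence of the transforms, while the
  isometry makes the transforms Cauchy in L2. \<open>L2_AE_limit\<close> says that both limits
  agree.\<close>

lemma fourier_integral_isometry_compact:
  fixes f :: "'a::euclidean_space \<Rightarrow> complex"
  assumes f: "square_integrable f" and supp: "\<And>x. R < norm x \<Longrightarrow> f x = 0"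
  shows "square_integrable (fourier_integral f)"
    "norm (L2_class (fourier_integral f)) = norm (L2_class f)"
proof -
  have "\<exists>h. continuous_on UNIV h \<and> (\<forall>x. R + 1 \<le> norm x \<longrightarrow> h x = 0)
    \<and> norm (L2_class h - L2_class f) < inverse (real (Suc j))" for j
    by (rule L2_approx_continuous[OF f supp]) simp_all
  then obtain h where h: "\<And>j. continuous_on UNIV (h j)" "\<And>j x. R + 1 \<le> norm x \<Longrightarrow> h j x = 0"
    and hf: "\<And>j. norm (L2_class (h j) - L2_class f) < inverse (real (Suc j))"
    by metis
  have hsq: "square_integrable (h j)" and hi: "integrable lborel (h j)" for j
    using continuous_compact_support_facts[OF h(1)[of j] h(2)] by metis+
  have [measurable]: "f \<in> borel_measurable borel" using f by (simp add: square_integrable_def)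
  have fi: "integrable lborel f" by (rule L1_le_L2[OF f supp])
  have lim: "(\<lambda>j. L2_class (h j)) \<longlonglongrightarrow> L2_class f"
  proof (rule LIM_zero_cancel, rule Lim_null_comparison)
    show "\<forall>\<^sub>F j in sequentially. norm (L2_class (h j) - L2_class f) \<le> inverse (real (Suc j))"
      by (rule always_eventually) (use hf less_imp_le in blast)
  qed (rule LIMSEQ_inverse_real_of_nat)
  have iso: "square_integrable (fourier_integral k)
    \<and> norm (L2_class (fourier_integral k)) = norm (L2_class k)"
    if "continuous_on UNIV k" "\<And>x. R + 1 \<le> norm x \<Longrightarrow> k x = 0" for k :: "'a \<Rightarrow> complex"
  proof -
    have ksq: "square_integrable k" and km: "k \<in> borel_measurable borel"
      using continuous_compact_support_facts[OF that] by metis+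
    have eq: "(\<integral>\<^sup>+\<xi>. ennreal ((norm (fourier_integral k \<xi>))\<^sup>2) \<partial>lborel)
      = ennreal ((norm (L2_class k))\<^sup>2)"
      using fourier_integral_isometry_continuous[OF that] nn_integral_L2_class[OF ksq] by simp
    then have sq: "square_integrable (fourier_integral k)"
      by (simp add: square_integrable_iff_nn_integral km fourier_integral_measurable)
    have "ennreal ((norm (L2_class (fourier_integral k)))\<^sup>2) = ennreal ((norm (L2_class k))\<^sup>2)"
      using eq nn_integral_L2_class[OF sq] by simp
    then show ?thesis using sq by (simp add: power2_eq_iff_nonneg)
  qed
  have Fsq: "square_integrable (fourier_integral (h j))" for j using iso[OF h] by blast
  have Fn: "norm (L2_class (fourier_integral (h j))) = norm (L2_class (h j))" for j using iso[OF h]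
    by blast
  have diff: "norm (L2_class (fourier_integral (h i)) - L2_class (fourier_integral (h j)))
    = norm (L2_class (h i) - L2_class (h j))" for i j
  proof -
    have "norm (L2_class (fourier_integral (\<lambda>x. h i x - h j x)))
      = norm (L2_class (\<lambda>x. h i x - h j x))"
      using iso[of "\<lambda>x. h i x - h j x"] h by (auto intro: continuous_intros)
    moreover have "fourier_integral (\<lambda>x. h i x - h j x)
      = (\<lambda>\<xi>. fourier_integral (h i) \<xi> - fourier_integral (h j) \<xi>)"
      by (intro ext fourier_integral_diff hi)
    ultimately show ?thesis by (simp add: L2_class_diff Fsq hsq)
  qed
  have Cau: "Cauchy (\<lambda>j. L2_class (fourier_integral (h j)))"
    using LIMSEQ_imp_Cauchy[OF lim] by (simp add: Cauchy_def dist_norm diff)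
  define A
    where "A = (2 * pi) powr (- real DIM('a) / 2) * sqrt (measure lborel (cball (0::'a) (R + 1)))"
  have pw: "(\<lambda>j. fourier_integral (h j) \<xi>) \<longlonglongrightarrow> fourier_integral f \<xi>" for \<xi>
  proof (rule LIM_zero_cancel, rule Lim_null_comparison)
    show "\<forall>\<^sub>F j in sequentially. norm (fourier_integral (h j) \<xi> - fourier_integral f \<xi>)
      \<le> A * inverse (real (Suc j))"
    proof (rule always_eventually, rule allI)
      fix j
      have s: "square_integrable (\<lambda>x. h j x - f x)" by (intro square_integrable_diff hsq f)
      have "norm (fourier_integral (\<lambda>x. h j x - f x) \<xi>)
        \<le> (2 * pi) powr (- real DIM('a) / 2) * (LINT x|lborel. norm (h j x - f x))"
        by (rule norm_fourier_integral_le)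
      also have "(LINT x|lborel. norm (h j x - f x))
        \<le> sqrt (measure lborel (cball (0::'a) (R + 1))) * norm (L2_class (\<lambda>x. h j x - f x))"
        using L1_le_L2(2)[OF s, of "R + 1"] h(2)[of _ j] supp by simp
      also have "norm (L2_class (\<lambda>x. h j x - f x)) = norm (L2_class (h j) - L2_class f)"
        by (simp add: L2_class_diff hsq f)
      also have "\<dots> \<le> inverse (real (Suc j))" using hf[of j] by simp
      finally show "norm (fourier_integral (h j) \<xi> - fourier_integral f \<xi>)
        \<le> A * inverse (real (Suc j))"
        by (simp add: fourier_integral_diff hi fi A_def mult_left_mono mult.assoc)
    qed
    have "(\<lambda>j. A * inverse (real (Suc j))) \<longlonglongrightarrow> A * 0"
      by (intro tendsto_intros LIMSEQ_inverse_real_of_nat)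
    then show "(\<lambda>j. A * inverse (real (Suc j))) \<longlonglongrightarrow> 0" by simp
  qed
  note L = L2_AE_limit[OF Fsq Cau AE_I2[OF pw] fourier_integral_measurable]
  show "square_integrable (fourier_integral f)" by (rule L) measurable
  have "(\<lambda>j. L2_class (fourier_integral (h j))) \<longlonglongrightarrow> L2_class (fourier_integral f)"
    by (rule L) measurable
  then have "(\<lambda>j. norm (L2_class (h j))) \<longlonglongrightarrow> norm (L2_class (fourier_integral f))"
    unfolding Fn[symmetric] by (rule tendsto_norm)
  then show "norm (L2_class (fourier_integral f)) = norm (L2_class f)"
    using tendsto_norm[OF lim] LIMSEQ_unique by blast
qed

section \<open>Extension to all of L2 along truncations to balls\<close>

definition trunc :: "real \<Rightarrow> 'a::euclidean_space L2 \<Rightarrow> 'a \<Rightarrow> complex" where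
  "trunc R u x = indicator (cball 0 R) x *\<^sub>R L2_fun u x"

lemma trunc_outside: "R < norm x \<Longrightarrow> trunc R u x = 0"
  by (simp add: trunc_def)

lemma trunc_measurable [measurable]: "trunc R u \<in> borel_measurable borel"
  unfolding trunc_def[abs_def]
  by (intro borel_measurable_scaleR borel_measurable_indicator L2_fun_measurable) simp

lemma square_integrable_trunc: "square_integrable (trunc R u)"
  by (rule norm_L2_mono(1)[OF square_integrable_L2_fun[of u]])
    (auto intro!: AE_I2 simp: trunc_def indicator_def)

lemma fourier_cutoff_eq: "fourier_cutoff R u = fourier_integral (trunc R u)"
  by (rule ext) (simp add: fourier_cutoff_def fourier_integral_def trunc_def
    set_lebesgue_integral_def mult_scaleR_right)

lemma square_integrable_fourier_cutoff: "square_integrable (fourier_cutoff R u)"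
  unfolding fourier_cutoff_eq
    by (rule fourier_integral_isometry_compact[OF square_integrable_trunc trunc_outside])

lemma norm_fourier_cutoff: "norm (L2_class (fourier_cutoff R u)) = norm (L2_class (trunc R u))"
  unfolding fourier_cutoff_eq
    by (rule fourier_integral_isometry_compact[OF square_integrable_trunc trunc_outside])

lemma trunc_tendsto:
  fixes u :: "'a::euclidean_space L2"
  shows "((\<lambda>R. L2_class (trunc R u)) \<longlongrightarrow> u) at_top"
proof (rule tendsto_at_topI_sequentially)
  fix X :: "nat \<Rightarrow> real" assume X: "filterlim X at_top sequentially"
  have "(\<lambda>n. L2_class (trunc (X n) u)) \<longlonglongrightarrow> L2_class (L2_fun u)"
  proof (rule L2_LIMSEQ_dominated(3)[where w="\<lambda>x. (norm (L2_fun u x))\<^sup>2"])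
    show "integrable lborel (\<lambda>x. (norm (L2_fun u x))\<^sup>2)"
      using square_integrable_L2_fun[of u] by (simp add: square_integrable_def)
    show "AE x in lborel. (norm (trunc (X i) u x))\<^sup>2 \<le> (norm (L2_fun u x))\<^sup>2" for i
      by (auto intro!: AE_I2 simp: trunc_def indicator_def)
    show "AE x in lborel. (\<lambda>i. trunc (X i) u x) \<longlonglongrightarrow> L2_fun u x"
    proof (rule AE_I2)
      fix x :: 'a
      have "\<forall>\<^sub>F i in sequentially. norm x \<le> X i" using X by (simp add: filterlim_at_top)
      then have "\<forall>\<^sub>F i in sequentially. trunc (X i) u x = L2_fun u x"
        by eventually_elim (simp add: trunc_def)
      then show "(\<lambda>i. trunc (X i) u x) \<longlonglongrightarrow> L2_fun u x" by (rule tendsto_eventually)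
    qed
  qed measurable
  then show "(\<lambda>n. L2_class (trunc (X n) u)) \<longlonglongrightarrow> u" by simp
qed

lemma integrable_trunc: "integrable lborel (trunc R u)"
  by (rule L1_le_L2[OF square_integrable_trunc trunc_outside])

lemma norm_fourier_cutoff_diff:
  "norm (L2_class (fourier_cutoff R u) - L2_class (fourier_cutoff R' u))
    = norm (L2_class (trunc R u) - L2_class (trunc R' u))"
proof -
  have s: "square_integrable (\<lambda>x. trunc R u x - trunc R' u x)"
    by (intro square_integrable_diff square_integrable_trunc)
  have "trunc R u x - trunc R' u x = 0" if "max R R' < norm x" for x
    using that by (simp add: trunc_outside)
  from fourier_integral_isometry_compact(2)[OF s this]
  have "norm (L2_class (fourier_integral (\<lambda>x. trunc R u x - trunc R' u x)))
    = norm (L2_class (\<lambda>x. trunc R u x - trunc R' u x))" .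
  moreover have "fourier_integral (\<lambda>x. trunc R u x - trunc R' u x)
    = (\<lambda>\<xi>. fourier_cutoff R u \<xi> - fourier_cutoff R' u \<xi>)"
    unfolding fourier_cutoff_eq by (intro ext fourier_integral_diff integrable_trunc)
  ultimately show ?thesis
    by (simp add: L2_class_diff square_integrable_trunc square_integrable_fourier_cutoff)
qed

text \<open>\<open>Lim\<close> in the definition of \<open>fourier\<close> denotes something even
  without convergence; here convergence is established. Differences of cutoffs are transforms of
  compactly supported functions, so their distances are those of the truncations. Completeness gives
  a limit along the integers, which is then compared with all real radii.\<close>

lemma fourier_tendsto: "((\<lambda>R. L2_class (fourier_cutoff R u)) \<longlongrightarrow> fourier u) at_top"
proof -
  have real: "filterlim real at_top sequentially" by (rule filterlim_real_sequentially)
  have t: "(\<lambda>n. L2_class (trunc (real n) u)) \<longlonglongrightarrow> u"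
    by (rule filterlim_compose[OF trunc_tendsto real])
  have "Cauchy (\<lambda>n. L2_class (fourier_cutoff (real n) u))"
    using LIMSEQ_imp_Cauchy[OF t] by (simp add: Cauchy_def dist_norm norm_fourier_cutoff_diff)
  then obtain L where L: "(\<lambda>n. L2_class (fourier_cutoff (real n) u)) \<longlonglongrightarrow> L"
    by (auto simp: Cauchy_convergent_iff convergent_def)
  have "norm (L2_class (fourier_cutoff R u) - L) = norm (L2_class (trunc R u) - u)" for R
  proof (rule LIMSEQ_unique)
    show "(\<lambda>n. norm (L2_class (fourier_cutoff R u) - L2_class (fourier_cutoff (real n) u)))
      \<longlonglongrightarrow> norm (L2_class (fourier_cutoff R u) - L)"
      by (intro tendsto_intros L)
    show "(\<lambda>n. norm (L2_class (fourier_cutoff R u) - L2_class (fourier_cutoff (real n) u)))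
      \<longlonglongrightarrow> norm (L2_class (trunc R u) - u)"
      unfolding norm_fourier_cutoff_diff by (intro tendsto_intros t)
  qed
  moreover have "((\<lambda>R. norm (L2_class (trunc R u) - u)) \<longlongrightarrow> norm (u - u)) at_top"
    by (intro tendsto_intros trunc_tendsto)
  ultimately have "((\<lambda>R. norm (L2_class (fourier_cutoff R u) - L)) \<longlongrightarrow> 0) at_top" by simp
  then have "((\<lambda>R. L2_class (fourier_cutoff R u)) \<longlongrightarrow> L) at_top"
    by (simp add: LIM_zero_iff tendsto_norm_zero_iff)
  moreover from this have "fourier u = L"
    unfolding fourier_def by (intro tendsto_Lim) auto
  ultimately show ?thesis by simp
qed

lemma norm_fourier [simp]: "norm (fourier u) = norm u"
proof (rule tendsto_unique[OF trivial_limit_at_top_linorder])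
  show "((\<lambda>R. norm (L2_class (fourier_cutoff R u))) \<longlongrightarrow> norm (fourier u)) at_top"
    by (intro tendsto_norm fourier_tendsto)
  show "((\<lambda>R. norm (L2_class (fourier_cutoff R u))) \<longlongrightarrow> norm u) at_top"
    unfolding norm_fourier_cutoff by (intro tendsto_norm trunc_tendsto)
qed

lemma fourier_integral_cong_AE:
  assumes "f \<in> borel_measurable borel" "g \<in> borel_measurable borel" "AE x in lborel. f x = g x"
  shows "fourier_integral f = fourier_integral g"
proof
  fix \<xi>
  note [measurable] = assms(1,2)
  have "(LINT x|lborel. cis (- (x \<bullet> \<xi>)) * f x) = (LINT x|lborel. cis (- (x \<bullet> \<xi>)) * g x)"
    by (rule integral_cong_AE) (use assms(3) in \<open>auto elim: eventually_mono\<close>)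
  then show "fourier_integral f \<xi> = fourier_integral g \<xi>" by (simp add: fourier_integral_def)
qed

lemma fourier_add: "fourier (u + v) = fourier u + fourier v"
proof (rule tendsto_unique[OF trivial_limit_at_top_linorder fourier_tendsto])
  have "AE x in lborel. trunc R (u + v) x = trunc R u x + trunc R v x" for R
    using L2_fun_add[of u v] by eventually_elim (simp add: trunc_def scaleR_add_right)
  then have "fourier_cutoff R (u + v) = (\<lambda>\<xi>. fourier_cutoff R u \<xi> + fourier_cutoff R v \<xi>)" for R
    unfolding fourier_cutoff_eq
      by (subst fourier_integral_cong_AE[where g="\<lambda>x. trunc R u x + trunc R v x"])
      (auto intro!: ext fourier_integral_add integrable_trunc)
  then have "L2_class (fourier_cutoff R (u + v)) = L2_class (fourier_cutoff R u)
    + L2_class (fourier_cutoff R v)" for R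
    by (simp add: L2_class_add square_integrable_fourier_cutoff)
  then show "((\<lambda>R. L2_class (fourier_cutoff R (u + v))) \<longlongrightarrow> fourier u + fourier v) at_top"
    by (simp add: tendsto_add fourier_tendsto)
qed

lemma fourier_scaleR: "fourier (c *\<^sub>R u) = c *\<^sub>R fourier u"
proof (rule tendsto_unique[OF trivial_limit_at_top_linorder fourier_tendsto])
  have "AE x in lborel. trunc R (c *\<^sub>R u) x = c *\<^sub>R trunc R u x" for R
    using L2_fun_scaleR[of c u] by eventually_elim (simp add: trunc_def)
  then have "fourier_cutoff R (c *\<^sub>R u) = (\<lambda>\<xi>. c *\<^sub>R fourier_cutoff R u \<xi>)" for R
    unfolding fourier_cutoff_eq by (subst fourier_integral_cong_AE[where g="\<lambda>x. c *\<^sub>R trunc R u x"])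
      (auto intro!: ext fourier_integral_scaleR)
  then have "L2_class (fourier_cutoff R (c *\<^sub>R u)) = c *\<^sub>R L2_class (fourier_cutoff R u)" for R
    by (simp add: L2_class_scaleR square_integrable_fourier_cutoff)
  then show "((\<lambda>R. L2_class (fourier_cutoff R (c *\<^sub>R u))) \<longlongrightarrow> c *\<^sub>R fourier u) at_top"
    by (simp add: tendsto_scaleR fourier_tendsto)
qed

lemma bounded_linear_fourier: "bounded_linear fourier"
  by (rule bounded_linear_intro[where K=1]) (simp_all add: fourier_add fourier_scaleR)

lemma fourier_diff: "fourier (u - v) = fourier u - fourier v"
  by (rule linear_diff[OF bounded_linear.linear[OF bounded_linear_fourier]])

text \<open>The class of the cutoff transform no longer changes once the radius exceeds
  \<open>R\<close>.\<close>

lemma fourier_L2_class: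
  assumes f: "square_integrable f" and supp: "\<And>x. R < norm x \<Longrightarrow> f x = 0"
  shows "fourier (L2_class f) = L2_class (fourier_integral f)"
proof (rule tendsto_unique[OF trivial_limit_at_top_linorder fourier_tendsto])
  have "\<forall>\<^sub>F R' in at_top. L2_class (fourier_cutoff R' (L2_class f)) = L2_class (fourier_integral f)"
    using eventually_ge_at_top[of R]
  proof eventually_elim
    case (elim R')
    have "AE x in lborel. trunc R' (L2_class f) x = f x"
      using L2_fun_class[OF f]
    proof eventually_elim
      case (elim x)
      then show ?case using supp[of x] \<open>R \<le> R'\<close> by (cases "norm x \<le> R'") (auto simp: trunc_def)
    qed
    then have "fourier_integral (trunc R' (L2_class f)) = fourier_integral f"
      using f by (intro fourier_integral_cong_AE) (auto simp: square_integrable_def)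
    then show ?case by (simp add: fourier_cutoff_eq)
  qed
  then show "((\<lambda>R'. L2_class (fourier_cutoff R' (L2_class f)))
    \<longlongrightarrow> L2_class (fourier_integral f)) at_top"
    by (rule tendsto_eventually)
qed

section \<open>Reflection, adjoint and inversion\<close>

definition reflect :: "'a::euclidean_space L2 \<Rightarrow> 'a L2" where
  "reflect u = L2_class (\<lambda>x. L2_fun u (- x))"

lemma nn_integral_reflect:
  fixes f :: "'a::euclidean_space \<Rightarrow> ennreal"
  assumes "f \<in> borel_measurable borel"
  shows "(\<integral>\<^sup>+x. f (- x) \<partial>lborel) = (\<integral>\<^sup>+x. f x \<partial>lborel)"
  using lborel_nn_integral_affine[OF assms, of "-1" 0] by simp

lemma square_integrable_reflect:
  fixes f :: "'a::euclidean_space \<Rightarrow> complex"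
  assumes f: "square_integrable f"
  shows "square_integrable (\<lambda>x. f (- x))" "norm (L2_class (\<lambda>x. f (- x))) = norm (L2_class f)"
proof -
  have [measurable]: "f \<in> borel_measurable borel" using f by (simp add: square_integrable_def)
  have eq: "(\<integral>\<^sup>+x. ennreal ((norm (f (- x)))\<^sup>2) \<partial>lborel) = ennreal ((norm (L2_class f))\<^sup>2)"
    using nn_integral_reflect[of "\<lambda>x. ennreal ((norm (f x))\<^sup>2)"] nn_integral_L2_class[OF f] by simp
  then show sq: "square_integrable (\<lambda>x. f (- x))"
    by (simp add: square_integrable_iff_nn_integral)
  have "ennreal ((norm (L2_class (\<lambda>x. f (- x))))\<^sup>2) = ennreal ((norm (L2_class f))\<^sup>2)"
    using eq nn_integral_L2_class[OF sq] by simp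
  then show "norm (L2_class (\<lambda>x. f (- x))) = norm (L2_class f)" by (simp add: power2_eq_iff_nonneg)
qed

lemma reflect_L2_class:
  assumes f: "square_integrable f"
  shows "reflect (L2_class f) = L2_class (\<lambda>x. f (- x))"
  unfolding reflect_def
  by (rule L2_class_eqI[OF square_integrable_reflect(1)[OF square_integrable_L2_fun]
        square_integrable_reflect(1)[OF f] AE_lborel_uminus[OF L2_fun_class[OF f]]])

lemma norm_reflect [simp]: "norm (reflect u) = norm u"
  unfolding reflect_def using square_integrable_reflect(2)[OF square_integrable_L2_fun[of u]]
    by simp

lemma reflect_diff: "reflect (u - v) = reflect u - reflect v"
proof -
  have s: "square_integrable (\<lambda>x. L2_fun w (- x))" for w :: "'a L2"
    by (rule square_integrable_reflect(1)[OF square_integrable_L2_fun])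
  have "reflect u - reflect v = L2_class (\<lambda>x. L2_fun u (- x) - L2_fun v (- x))"
    unfolding reflect_def by (rule L2_class_diff[OF s s])
  also have "\<dots> = reflect (u - v)"
    unfolding reflect_def
    by (rule L2_class_eqI[OF square_integrable_diff[OF s s] s])
      (use AE_lborel_uminus[OF L2_fun_diff[of u v]] in \<open>auto elim: eventually_mono\<close>)
  finally show ?thesis ..
qed

lemma tendsto_reflect: "(f \<longlongrightarrow> u) F \<Longrightarrow> ((\<lambda>x. reflect (f x)) \<longlongrightarrow> reflect u) F"
  by (subst (asm) tendsto_dist_iff, subst tendsto_dist_iff)
    (simp add: dist_norm reflect_diff[symmetric])

lemma integrable_mult_L2:
  assumes "square_integrable f" "square_integrable g"
  shows "integrable lborel (\<lambda>x. f x * g x :: complex)"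
proof -
  have [measurable]: "f \<in> borel_measurable borel" "g \<in> borel_measurable borel"
    using assms by (auto simp: square_integrable_def)
  have "integrable lborel (\<lambda>x. (norm (f x))\<^sup>2 + (norm (g x))\<^sup>2)"
    using assms by (auto simp: square_integrable_def)
  then show ?thesis
  proof (rule Bochner_Integration.integrable_bound)
    show "AE x in lborel. norm (f x * g x) \<le> norm ((norm (f x))\<^sup>2 + (norm (g x))\<^sup>2)"
    proof (rule AE_I2)
      fix x
      have "2 * (norm (f x) * norm (g x)) \<le> (norm (f x))\<^sup>2 + (norm (g x))\<^sup>2"
        using sum_squares_bound[of "norm (f x)" "norm (g x)"] by simp
      moreover have "0 \<le> norm (f x) * norm (g x)" by simp
      ultimately have "norm (f x) * norm (g x) \<le> (norm (f x))\<^sup>2 + (norm (g x))\<^sup>2" by linarith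
      then show "norm (f x * g x) \<le> norm ((norm (f x))\<^sup>2 + (norm (g x))\<^sup>2)"
        by (simp add: norm_mult)
    qed
  qed measurable
qed

lemma square_integrable_cnj: "square_integrable f \<Longrightarrow> square_integrable (\<lambda>x. cnj (f x))"
  by (auto simp: square_integrable_def)

lemma inner_L2_Re:
  assumes "square_integrable f" "square_integrable g"
  shows "inner (L2_class f) (L2_class g) = Re (LINT x|lborel. f x * cnj (g x))"
proof -
  have "f x \<bullet> g x = Re (f x * cnj (g x))" for x
    by (simp add: inner_complex_def)
  then have "inner (L2_class f) (L2_class g) = (LINT x|lborel. Re (f x * cnj (g x)))"
    unfolding inner_L2_class[OF assms] by simp
  also have "\<dots> = Re (LINT x|lborel. f x * cnj (g x))"
    by (intro integral_Re integrable_mult_L2 square_integrable_cnj assms)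
  finally show ?thesis .
qed

lemma fourier_integral_adjoint:
  fixes f g :: "'a::euclidean_space \<Rightarrow> complex"
  assumes f: "square_integrable f" and fs: "\<And>x. R < norm x \<Longrightarrow> f x = 0"
    and g: "square_integrable g" and gs: "\<And>x. R < norm x \<Longrightarrow> g x = 0"
  shows "inner (L2_class (fourier_integral f)) (L2_class g)
    = inner (L2_class f) (L2_class (fourier_integral (\<lambda>x. g (- x))))"
proof -
  let ?c = "complex_of_real ((2 * pi) powr (- real DIM('a) / 2))"
  have [measurable]: "g \<in> borel_measurable borel" using g by (simp add: square_integrable_def)
  have fi: "integrable lborel f" and gi: "integrable lborel g"
    using L1_le_L2(1)[OF f fs] L1_le_L2(1)[OF g gs] by auto
  have gr: "square_integrable (\<lambda>x. g (- x))" by (rule square_integrable_reflect[OF g])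
  have Fgr: "square_integrable (fourier_integral (\<lambda>x. g (- x)))"
    by (rule fourier_integral_isometry_compact(1)[OF gr, of R]) (simp add: gs)
  have cnjF: "cnj (fourier_integral (\<lambda>x. g (- x)) x)
    = ?c * (LINT y|lborel. cis (- (x \<bullet> y)) * cnj (g y))" for x
  proof -
    have "(LINT y|lborel. cis (- (y \<bullet> x)) * g (- y)) = (LINT y|lborel. cis (y \<bullet> x) * g y)"
      using lborel_integral_affine[of "\<lambda>y. cis (y \<bullet> x) * g y" "-1" 0] by simp
    then have "cnj (fourier_integral (\<lambda>x. g (- x)) x) = ?c * cnj (LINT y|lborel. cis (y \<bullet> x) * g y)"
      by (simp add: fourier_integral_def)
    also have "cnj (LINT y|lborel. cis (y \<bullet> x) * g y) = (LINT y|lborel. cnj (cis (y \<bullet> x) * g y))"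
      by (rule Bochner_Integration.integral_cnj[symmetric])
    also have "\<dots> = (LINT y|lborel. cis (- (x \<bullet> y)) * cnj (g y))"
      by (simp add: cis_cnj inner_commute del: Bochner_Integration.integral_cnj)
    finally show ?thesis .
  qed
  have "(LINT \<xi>|lborel. fourier_integral f \<xi> * cnj (g \<xi>))
    = ?c * (LINT \<xi>|lborel. (LINT x|lborel. cis (- (x \<bullet> \<xi>)) * f x) * cnj (g \<xi>))"
    unfolding fourier_integral_def by (simp only: mult.assoc integral_mult_right_zero)
  also have "(LINT \<xi>|lborel. (LINT x|lborel. cis (- (x \<bullet> \<xi>)) * f x) * cnj (g \<xi>))
    = (LINT x|lborel. f x * (LINT \<xi>|lborel. cis (- (x \<bullet> \<xi>)) * cnj (g \<xi>)))"
    by (rule integral_swap_mult) (use fi gi in auto)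
  also have "?c * \<dots> = (LINT x|lborel. f x * cnj (fourier_integral (\<lambda>x. g (- x)) x))"
    unfolding cnjF by (subst integral_mult_right_zero[symmetric]) (simp only: mult_ac)
  finally show ?thesis
    using f g Fgr fourier_integral_isometry_compact(1)[OF f fs] by (simp add: inner_L2_Re)
qed

text \<open>Moving the transform across the Hermitian product conjugates the phase, which amounts to
  a reflection of the second argument. Truncation reduces the identity to Fubini for integrable
  functions.\<close>

lemma fourier_adjoint: "inner (fourier u) v = inner u (fourier (reflect v))"
proof (rule tendsto_unique[OF trivial_limit_at_top_linorder])
  have cont: "(f \<longlongrightarrow> l) F \<Longrightarrow> ((\<lambda>x. fourier (f x)) \<longlongrightarrow> fourier l) F" for f l and F :: "real filter"
    by (rule bounded_linear.tendsto[OF bounded_linear_fourier])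
  show "((\<lambda>R. inner (fourier (L2_class (trunc R u))) (L2_class (trunc R v)))
    \<longlongrightarrow> inner (fourier u) v) at_top"
    by (intro tendsto_intros cont trunc_tendsto)
  have "inner (fourier (L2_class (trunc R u))) (L2_class (trunc R v)) =
      inner (L2_class (trunc R u)) (fourier (reflect (L2_class (trunc R v))))" for R
  proof -
    have "fourier (reflect (L2_class (trunc R v)))
      = L2_class (fourier_integral (\<lambda>x. trunc R v (- x)))"
      unfolding reflect_L2_class[OF square_integrable_trunc]
      by (rule fourier_L2_class[where R=R, OF
        square_integrable_reflect(1)[OF square_integrable_trunc]]) (simp add: trunc_outside)
    moreover have "fourier (L2_class (trunc R u)) = L2_class (fourier_integral (trunc R u))"
      by (intro fourier_L2_class[where R=R] square_integrable_trunc trunc_outside)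
    ultimately show ?thesis
      by (simp add: fourier_integral_adjoint[where R=R] square_integrable_trunc trunc_outside)
  qed
  then show "((\<lambda>R. inner (fourier (L2_class (trunc R u))) (L2_class (trunc R v)))
    \<longlongrightarrow> inner u (fourier (reflect v))) at_top"
    by (simp only:) (intro tendsto_intros cont trunc_tendsto tendsto_reflect)
qed

lemma inner_fourier [simp]: "inner (fourier u) (fourier v) = inner u v"
proof -
  have "4 * inner x y = (norm (x + y))\<^sup>2 - (norm (x - y))\<^sup>2" for x y :: "'b::real_inner"
    by (simp add: power2_norm_eq_inner inner_simps inner_commute)
  from this[of "fourier u" "fourier v"] this[of u v] show ?thesis
    by (simp add: fourier_add[symmetric] fourier_diff[symmetric])
qed

lemma inner_reflect: "inner (reflect u) (reflect v) = inner u v"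
proof -
  have n: "norm (reflect u - reflect v) = norm (u - v)"
    by (simp add: reflect_diff[symmetric])
  have "2 * inner x y = (norm x)\<^sup>2 + (norm y)\<^sup>2 - (norm (x - y))\<^sup>2" for x y :: "'b::real_inner"
    by (simp add: power2_norm_eq_inner inner_simps inner_commute)
  from this[of "reflect u" "reflect v"] this[of u v] show ?thesis by (simp add: n)
qed

definition inv_fourier :: "'a::euclidean_space L2 \<Rightarrow> 'a L2" where
  "inv_fourier v = fourier (reflect v)"

text \<open>Surjectivity without a pointwise inversion formula: by the adjoint identity and the
  isometries \<open>inner_fourier\<close> and \<open>inner_reflect\<close>, both sides have the same
  inner product with every \<open>w\<close>.\<close>

lemma fourier_inv_fourier [simp]: "fourier (inv_fourier v) = v"
proof -
  have "inner (fourier (inv_fourier v)) w = inner v w" for w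
    unfolding inv_fourier_def
    by (simp only: fourier_adjoint[of "fourier (reflect v)" w] inner_fourier inner_reflect)
  then have "inner (fourier (inv_fourier v) - v) (fourier (inv_fourier v) - v) = 0"
    by (simp add: inner_diff_left)
  then show ?thesis by simp
qed

lemma fourier_eq_iff: "fourier u = fourier v \<longleftrightarrow> u = v"
proof
  assume "fourier u = fourier v"
  then have "norm (fourier (u - v)) = 0" by (simp add: fourier_diff)
  then show "u = v" by simp
qed simp

lemma inv_fourier_fourier [simp]: "inv_fourier (fourier u) = u"
  by (simp add: fourier_eq_iff[symmetric])

lemma inv_fourier_L2_class:
  assumes f: "square_integrable f" and supp: "\<And>x. R < norm x \<Longrightarrow> f x = 0"
  shows "inv_fourier (L2_class f) = L2_class (fourier_integral (\<lambda>x. f (- x)))"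
  unfolding inv_fourier_def reflect_L2_class[OF f]
  by (rule fourier_L2_class[where R=R, OF square_integrable_reflect(1)[OF f]]) (simp add: supp)

section \<open>Fourier multipliers\<close>

lemma weighted_space_iff:
  "u \<in> weighted_space m \<longleftrightarrow> square_integrable (\<lambda>\<xi>. of_real (m \<xi>) * L2_fun (fourier u) \<xi>)"
  by (simp add: weighted_space_def)

text \<open>Inversion supplies an element with the prescribed transform and injectivity makes it
  unique, so the definite description in \<open>fourier_multiplier\<close> denotes on
  \<open>weighted_space m\<close>.\<close>

lemma fourier_fourier_multiplier:
  assumes "u \<in> weighted_space m"
  shows "fourier (fourier_multiplier m u) = L2_class (\<lambda>\<xi>. of_real (m \<xi>) * L2_fun (fourier u) \<xi>)"
proof -
  let ?f = "\<lambda>\<xi>. of_real (m \<xi>) * L2_fun (fourier u) \<xi>"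
  have sq: "square_integrable ?f" using assms by (simp add: weighted_space_iff)
  have "fourier_multiplier m u = inv_fourier (L2_class ?f)"
    unfolding fourier_multiplier_def
  proof (rule the_equality)
    show "AE \<xi> in lborel. L2_fun (fourier (inv_fourier (L2_class ?f))) \<xi> = ?f \<xi>"
      using L2_fun_class[OF sq] by simp
    fix v assume "AE \<xi> in lborel. L2_fun (fourier v) \<xi> = ?f \<xi>"
    then have "L2_class (L2_fun (fourier v)) = L2_class ?f"
      by (intro L2_class_eqI sq square_integrable_L2_fun)
    then show "v = inv_fourier (L2_class ?f)"
      by (metis L2_class_fun inv_fourier_fourier)
  qed
  then show ?thesis by simp
qed

lemma fourier_multiplier_AE:
  assumes "u \<in> weighted_space m"
  shows "AE \<xi> in lborel. L2_fun (fourier (fourier_multiplier m u)) \<xi>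
    = of_real (m \<xi>) * L2_fun (fourier u) \<xi>"
  unfolding fourier_fourier_multiplier[OF assms]
  using assms by (intro L2_fun_class) (simp add: weighted_space_iff)

lemma norm_fourier_multiplier:
  assumes "u \<in> weighted_space m"
  shows "norm (fourier_multiplier m u) = weighted_norm m u"
proof -
  have "(norm (fourier (fourier_multiplier m u)))\<^sup>2
    = (LINT \<xi>|lborel. (norm (of_real (m \<xi>) * L2_fun (fourier u) \<xi>))\<^sup>2)"
    using assms unfolding fourier_fourier_multiplier[OF assms]
    by (intro norm_L2_class) (simp add: weighted_space_iff)
  then show ?thesis
    unfolding weighted_norm_def norm_fourier by (metis norm_ge_zero real_sqrt_unique)
qed

lemma norm_fourier_multiplier_class:
  assumes "u \<in> weighted_space m"
  shows "norm (fourier_multiplier m u) = norm (L2_class (\<lambda>\<xi>. of_real (m \<xi>) * L2_fun (fourier u) \<xi>))"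
  using norm_fourier[of "fourier_multiplier m u"] fourier_fourier_multiplier[OF assms] by simp

lemma weighted_space_measurable:
  assumes [measurable]: "m \<in> borel_measurable borel"
  shows "(\<lambda>\<xi>. of_real (m \<xi>) * L2_fun u \<xi> :: complex) \<in> borel_measurable borel"
  by measurable

lemma fourier_multiplier_eqI:
  assumes u: "u \<in> weighted_space m"
    and "AE \<xi> in lborel. L2_fun (fourier v) \<xi> = of_real (m \<xi>) * L2_fun (fourier u) \<xi>"
  shows "v = fourier_multiplier m u"
proof -
  have "AE \<xi> in lborel. L2_fun (fourier v) \<xi> = L2_fun (fourier (fourier_multiplier m u)) \<xi>"
    using assms(2) fourier_multiplier_AE[OF u] by eventually_elim simp
  then show ?thesis by (metis L2_eqI fourier_eq_iff)
qed

lemma fourier_multiplier_mono: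
  assumes u: "u \<in> weighted_space m2" and m1: "m1 \<in> borel_measurable borel"
    and le: "AE \<xi> in lborel. \<bar>m1 \<xi>\<bar> \<le> \<bar>m2 \<xi>\<bar>"
  shows "u \<in> weighted_space m1" "norm (fourier_multiplier m1 u) \<le> norm (fourier_multiplier m2 u)"
proof -
  have le': "AE \<xi> in lborel. norm (of_real (m1 \<xi>) * L2_fun (fourier u) \<xi>)
    \<le> norm (of_real (m2 \<xi>) * L2_fun (fourier u) \<xi>)"
    using le by eventually_elim (simp add: norm_mult mult_right_mono)
  note * = norm_L2_mono[OF u[unfolded weighted_space_iff] weighted_space_measurable[OF m1] le']
  show u1: "u \<in> weighted_space m1" using *(1) by (simp add: weighted_space_iff)
  show "norm (fourier_multiplier m1 u) \<le> norm (fourier_multiplier m2 u)"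
    using *(2) by (simp add: norm_fourier_multiplier_class u u1)
qed

lemma weighted_space_add:
  assumes m: "m \<in> borel_measurable borel" and u: "u \<in> weighted_space m"
    and v: "v \<in> weighted_space m"
  shows "u + v \<in> weighted_space m" "fourier_multiplier m (u + v)
    = fourier_multiplier m u + fourier_multiplier m v"
proof -
  have "AE \<xi> in lborel. L2_fun (fourier (u + v)) \<xi> = L2_fun (fourier u) \<xi> + L2_fun (fourier v) \<xi>"
    unfolding fourier_add by (rule L2_fun_add)
  then have ae: "AE \<xi> in lborel. of_real (m \<xi>) * L2_fun (fourier (u + v)) \<xi> =
      of_real (m \<xi>) * L2_fun (fourier u) \<xi> + of_real (m \<xi>) * L2_fun (fourier v) \<xi>"
    by eventually_elim (simp add: distrib_left)
  have sq: "square_integrable (\<lambda>\<xi>. of_real (m \<xi>) * L2_fun (fourier u) \<xi>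
    + of_real (m \<xi>) * L2_fun (fourier v) \<xi>)"
    using u v by (intro square_integrable_add) (simp_all add: weighted_space_iff)
  have sq': "square_integrable (\<lambda>\<xi>. of_real (m \<xi>) * L2_fun (fourier (u + v)) \<xi>)"
    by (rule norm_L2_mono(1)[OF sq weighted_space_measurable[OF m]])
      (use ae in \<open>auto elim: eventually_mono\<close>)
  then show uv: "u + v \<in> weighted_space m" by (simp add: weighted_space_iff)
  have "L2_class (\<lambda>\<xi>. of_real (m \<xi>) * L2_fun (fourier (u + v)) \<xi>) =
    L2_class (\<lambda>\<xi>. of_real (m \<xi>) * L2_fun (fourier u) \<xi> + of_real (m \<xi>) * L2_fun (fourier v) \<xi>)"
    by (rule L2_class_eqI[OF sq' sq ae])
  then have "fourier (fourier_multiplier m (u + v))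
    = fourier (fourier_multiplier m u + fourier_multiplier m v)"
    using u v unfolding fourier_add[of "fourier_multiplier m u"] fourier_fourier_multiplier[OF uv]
      fourier_fourier_multiplier[OF u] fourier_fourier_multiplier[OF v]
    by (simp add: L2_class_add weighted_space_iff)
  then show "fourier_multiplier m (u + v) = fourier_multiplier m u + fourier_multiplier m v"
    by (simp add: fourier_eq_iff)
qed

lemma weighted_space_scaleR:
  assumes m: "m \<in> borel_measurable borel" and u: "u \<in> weighted_space m"
  shows "c *\<^sub>R u \<in> weighted_space m" "fourier_multiplier m (c *\<^sub>R u) = c *\<^sub>R fourier_multiplier m u"
proof -
  have "AE \<xi> in lborel. L2_fun (fourier (c *\<^sub>R u)) \<xi> = c *\<^sub>R L2_fun (fourier u) \<xi>"
    unfolding fourier_scaleR by (rule L2_fun_scaleR)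
  then have ae: "AE \<xi> in lborel. of_real (m \<xi>) * L2_fun (fourier (c *\<^sub>R u)) \<xi> =
      c *\<^sub>R (of_real (m \<xi>) * L2_fun (fourier u) \<xi>)"
    by eventually_elim simp
  have sq: "square_integrable (\<lambda>\<xi>. c *\<^sub>R (of_real (m \<xi>) * L2_fun (fourier u) \<xi>))"
    using u by (intro square_integrable_scaleR) (simp add: weighted_space_iff)
  have sq': "square_integrable (\<lambda>\<xi>. of_real (m \<xi>) * L2_fun (fourier (c *\<^sub>R u)) \<xi>)"
    by (rule norm_L2_mono(1)[OF sq weighted_space_measurable[OF m]])
      (use ae in \<open>auto elim: eventually_mono\<close>)
  then show uv: "c *\<^sub>R u \<in> weighted_space m" by (simp add: weighted_space_iff)
  have "L2_class (\<lambda>\<xi>. of_real (m \<xi>) * L2_fun (fourier (c *\<^sub>R u)) \<xi>) =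
    L2_class (\<lambda>\<xi>. c *\<^sub>R (of_real (m \<xi>) * L2_fun (fourier u) \<xi>))"
    by (rule L2_class_eqI[OF sq' sq ae])
  then have "fourier (fourier_multiplier m (c *\<^sub>R u)) = fourier (c *\<^sub>R fourier_multiplier m u)"
    using u unfolding fourier_scaleR[of c "fourier_multiplier m u"]
      fourier_fourier_multiplier[OF uv]
      fourier_fourier_multiplier[OF u]
    by (simp add: L2_class_scaleR weighted_space_iff)
  then show "fourier_multiplier m (c *\<^sub>R u) = c *\<^sub>R fourier_multiplier m u"
    by (simp add: fourier_eq_iff)
qed

lemma weighted_space_diff:
  assumes m: "m \<in> borel_measurable borel" and u: "u \<in> weighted_space m"
    and v: "v \<in> weighted_space m"
  shows "u - v \<in> weighted_space m" "fourier_multiplier m (u - v)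
    = fourier_multiplier m u - fourier_multiplier m v"
  using weighted_space_add[OF m u weighted_space_scaleR(1)[OF m v, of "-1"]]
    weighted_space_scaleR(2)[OF m v, of "-1"]
  by simp_all

lemma fourier_multiplier_compose:
  assumes m2: "m2 \<in> borel_measurable borel" and m1: "m1 \<in> borel_measurable borel"
    and u: "u \<in> weighted_space m1"
  shows "fourier_multiplier m1 u \<in> weighted_space m2 \<longleftrightarrow> u \<in> weighted_space (\<lambda>\<xi>. m2 \<xi> * m1 \<xi>)"
    and "u \<in> weighted_space (\<lambda>\<xi>. m2 \<xi> * m1 \<xi>) \<Longrightarrow>
      fourier_multiplier m2 (fourier_multiplier m1 u) = fourier_multiplier (\<lambda>\<xi>. m2 \<xi> * m1 \<xi>) u"
proof -
  let ?a = "\<lambda>\<xi>. of_real (m2 \<xi>) * L2_fun (fourier (fourier_multiplier m1 u)) \<xi>"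
  let ?b = "\<lambda>\<xi>. of_real (m2 \<xi> * m1 \<xi>) * L2_fun (fourier u) \<xi>"
  have ae: "AE \<xi> in lborel. ?a \<xi> = ?b \<xi>"
    using fourier_multiplier_AE[OF u] by eventually_elim simp
  have a: "?a \<in> borel_measurable borel" by (rule weighted_space_measurable[OF m2])
  have b: "?b \<in> borel_measurable borel"
    by (rule weighted_space_measurable) (use m1 m2 in measurable)
  have ab: "AE \<xi> in lborel. norm (?a \<xi>) \<le> norm (?b \<xi>)" "AE \<xi> in lborel. norm (?b \<xi>) \<le> norm (?a \<xi>)"
    using ae by (auto elim!: eventually_mono simp del: of_real_mult)
  have "square_integrable ?a \<longleftrightarrow> square_integrable ?b"
    using norm_L2_mono(1)[OF _ a ab(1)] norm_L2_mono(1)[OF _ b ab(2)] by blast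
  then show iff: "fourier_multiplier m1 u \<in> weighted_space m2
    \<longleftrightarrow> u \<in> weighted_space (\<lambda>\<xi>. m2 \<xi> * m1 \<xi>)"
    by (simp add: weighted_space_iff)
  assume u2: "u \<in> weighted_space (\<lambda>\<xi>. m2 \<xi> * m1 \<xi>)"
  show "fourier_multiplier m2 (fourier_multiplier m1 u) = fourier_multiplier (\<lambda>\<xi>. m2 \<xi> * m1 \<xi>) u"
  proof (rule fourier_multiplier_eqI[OF u2])
    show "AE \<xi> in lborel. L2_fun (fourier (fourier_multiplier m2 (fourier_multiplier m1 u))) \<xi>
      = ?b \<xi>"
      using fourier_multiplier_AE[of "fourier_multiplier m1 u" m2] ae u2
        by (simp only: iff) (auto elim: eventually_elim2)
  qed
qed

lemma weighted_space_one: "u \<in> weighted_space (\<lambda>\<xi>. 1)" "fourier_multiplier (\<lambda>\<xi>. 1) u = u"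
proof -
  show 1: "u \<in> weighted_space (\<lambda>\<xi>. 1)" by (simp add: weighted_space_iff square_integrable_L2_fun)
  show "fourier_multiplier (\<lambda>\<xi>. 1) u = u"
    by (rule fourier_multiplier_eqI[OF 1, symmetric]) simp
qed

lemma weighted_space_const: "u \<in> weighted_space (\<lambda>\<xi>. c)" "fourier_multiplier (\<lambda>\<xi>. c) u = c *\<^sub>R u"
proof -
  show 1: "u \<in> weighted_space (\<lambda>\<xi>. c)"
    using square_integrable_scaleR[OF square_integrable_L2_fun[of "fourier u"], of c]
    by (simp add: weighted_space_iff scaleR_conv_of_real)
  show "fourier_multiplier (\<lambda>\<xi>. c) u = c *\<^sub>R u"
    by (rule fourier_multiplier_eqI[OF 1, symmetric])
      (use L2_fun_scaleR[where c=c and u="fourier u"] in \<open>simp add: fourier_scaleR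
        scaleR_conv_of_real\<close>)
qed

lemma weighted_space_cmult:
  assumes m: "m \<in> borel_measurable borel" and u: "u \<in> weighted_space m"
  shows "u \<in> weighted_space (\<lambda>\<xi>. c * m \<xi>)"
    "fourier_multiplier (\<lambda>\<xi>. c * m \<xi>) u = c *\<^sub>R fourier_multiplier m u"
  using fourier_multiplier_compose[OF _ m u, of "\<lambda>_. c"]
    weighted_space_const[where u="fourier_multiplier m u" and c=c] by auto

lemma bounded_multiplier:
  assumes m: "m \<in> borel_measurable borel" and B: "\<And>\<xi>. \<bar>m \<xi>\<bar> \<le> B"
  shows "u \<in> weighted_space m" "norm (fourier_multiplier m u) \<le> B * norm u"
proof -
  have B0: "B \<ge> 0" using B[of 0] by linarith
  have le: "AE \<xi> in lborel. \<bar>m \<xi>\<bar> \<le> \<bar>B\<bar>" using B B0 by auto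
  note * = fourier_multiplier_mono[OF weighted_space_const(1) m le, of u]
  show "u \<in> weighted_space m" by (rule *)
  show "norm (fourier_multiplier m u) \<le> B * norm u"
    using *(2) B0 by (simp add: weighted_space_const)
qed

lemma bounded_linear_multiplier:
  assumes m: "m \<in> borel_measurable borel" and B: "\<And>\<xi>. \<bar>m \<xi>\<bar> \<le> B"
  shows "bounded_linear (fourier_multiplier m)"
proof (rule bounded_linear_intro[where K=B])
  note b = bounded_multiplier[OF m B]
  show "norm (fourier_multiplier m u) \<le> norm u * B" for u
    using b(2)[of u] by (simp add: mult.commute)
qed (auto intro: weighted_space_add(2)[OF m] weighted_space_scaleR(2)[OF m]
  bounded_multiplier[OF m B])

lemma weighted_space_plus:
  assumes m1: "m1 \<in> borel_measurable borel" and m2: "m2 \<in> borel_measurable borel"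
    and u1: "u \<in> weighted_space m1" and u2: "u \<in> weighted_space m2"
  shows "u \<in> weighted_space (\<lambda>\<xi>. m1 \<xi> + m2 \<xi>)"
    and "fourier_multiplier (\<lambda>\<xi>. m1 \<xi> + m2 \<xi>) u = fourier_multiplier m1 u + fourier_multiplier m2 u"
proof -
  show u12: "u \<in> weighted_space (\<lambda>\<xi>. m1 \<xi> + m2 \<xi>)"
    using square_integrable_add[OF u1[unfolded weighted_space_iff] u2[unfolded weighted_space_iff]]
    by (simp add: weighted_space_iff distrib_right)
  show "fourier_multiplier (\<lambda>\<xi>. m1 \<xi> + m2 \<xi>) u = fourier_multiplier m1 u + fourier_multiplier m2 u"
  proof (rule fourier_multiplier_eqI[OF u12, symmetric])
    show "AE \<xi> in lborel. L2_fun (fourier (fourier_multiplier m1 u + fourier_multiplier m2 u)) \<xi> =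
        of_real (m1 \<xi> + m2 \<xi>) * L2_fun (fourier u) \<xi>"
      using fourier_multiplier_AE[OF u1] fourier_multiplier_AE[OF u2]
        L2_fun_add[of "fourier (fourier_multiplier m1 u)" "fourier (fourier_multiplier m2 u)"]
      unfolding fourier_add by eventually_elim (simp add: distrib_right)
  qed
qed

text \<open>This turns a pointwise bound of a symbol by two weights into a norm bound. The kernel
  bounds have this shape, with a weight singular at the origin for low frequencies and a regular one
  for high frequencies. Passing to \<open>\<bar>m1 \<xi>\<bar>\<close> and
  \<open>\<bar>m2 \<xi>\<bar>\<close> first makes the sum of the two symbols a majorant of
  \<open>m\<close>.\<close>

lemma fourier_multiplier_le_add:
  assumes m: "m \<in> borel_measurable borel" and m1: "m1 \<in> borel_measurable borel"
    and m2: "m2 \<in> borel_measurable borel"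
    and u1: "u \<in> weighted_space m1" and u2: "u \<in> weighted_space m2"
    and le: "AE \<xi> in lborel. \<bar>m \<xi>\<bar> \<le> A * \<bar>m1 \<xi>\<bar> + B * \<bar>m2 \<xi>\<bar>" and A: "A \<ge> 0" "B \<ge> 0"
  shows "u \<in> weighted_space m"
    and "norm (fourier_multiplier m u) \<le> A * norm (fourier_multiplier m1 u)
      + B * norm (fourier_multiplier m2 u)"
proof -
  note [measurable] = m m1 m2
  have a1: "u \<in> weighted_space (\<lambda>\<xi>. \<bar>m1 \<xi>\<bar>)"
    "norm (fourier_multiplier (\<lambda>\<xi>. \<bar>m1 \<xi>\<bar>) u) \<le> norm (fourier_multiplier m1 u)"
    using fourier_multiplier_mono[OF u1, of "\<lambda>\<xi>. \<bar>m1 \<xi>\<bar>"] by simp_all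
  have a2: "u \<in> weighted_space (\<lambda>\<xi>. \<bar>m2 \<xi>\<bar>)"
    "norm (fourier_multiplier (\<lambda>\<xi>. \<bar>m2 \<xi>\<bar>) u) \<le> norm (fourier_multiplier m2 u)"
    using fourier_multiplier_mono[OF u2, of "\<lambda>\<xi>. \<bar>m2 \<xi>\<bar>"] by simp_all
  have c1: "u \<in> weighted_space (\<lambda>\<xi>. A * \<bar>m1 \<xi>\<bar>)"
    "fourier_multiplier (\<lambda>\<xi>. A * \<bar>m1 \<xi>\<bar>) u = A *\<^sub>R fourier_multiplier (\<lambda>\<xi>. \<bar>m1 \<xi>\<bar>) u"
    using weighted_space_cmult[OF _ a1(1), of A] by simp_all
  have c2: "u \<in> weighted_space (\<lambda>\<xi>. B * \<bar>m2 \<xi>\<bar>)"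
    "fourier_multiplier (\<lambda>\<xi>. B * \<bar>m2 \<xi>\<bar>) u = B *\<^sub>R fourier_multiplier (\<lambda>\<xi>. \<bar>m2 \<xi>\<bar>) u"
    using weighted_space_cmult[OF _ a2(1), of B] by simp_all
  have s: "u \<in> weighted_space (\<lambda>\<xi>. A * \<bar>m1 \<xi>\<bar> + B * \<bar>m2 \<xi>\<bar>)"
     "fourier_multiplier (\<lambda>\<xi>. A * \<bar>m1 \<xi>\<bar> + B * \<bar>m2 \<xi>\<bar>) u = A *\<^sub>R fourier_multiplier (\<lambda>\<xi>. \<bar>m1 \<xi>\<bar>) u
       + B *\<^sub>R fourier_multiplier (\<lambda>\<xi>. \<bar>m2 \<xi>\<bar>) u"
    using weighted_space_plus[OF _ _ c1(1) c2(1)] by (simp_all add: c1(2) c2(2))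
  have le': "AE \<xi> in lborel. \<bar>m \<xi>\<bar> \<le> \<bar>A * \<bar>m1 \<xi>\<bar> + B * \<bar>m2 \<xi>\<bar>\<bar>"
    using le by eventually_elim simp
  show "u \<in> weighted_space m" by (rule fourier_multiplier_mono(1)[OF s(1) m le'])
  have "norm (fourier_multiplier m u)
    \<le> norm (A *\<^sub>R fourier_multiplier (\<lambda>\<xi>. \<bar>m1 \<xi>\<bar>) u + B *\<^sub>R fourier_multiplier (\<lambda>\<xi>. \<bar>m2 \<xi>\<bar>) u)"
    unfolding s(2)[symmetric] by (rule fourier_multiplier_mono(2)[OF s(1) m le'])
  also have "\<dots> \<le> A * norm (fourier_multiplier (\<lambda>\<xi>. \<bar>m1 \<xi>\<bar>) u)
    + B * norm (fourier_multiplier (\<lambda>\<xi>. \<bar>m2 \<xi>\<bar>) u)"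
    using A by (intro norm_triangle_le) simp
  also have "\<dots> \<le> A * norm (fourier_multiplier m1 u) + B * norm (fourier_multiplier m2 u)"
    using A a1 a2 by (intro add_mono mult_left_mono)
  finally show "norm (fourier_multiplier m u) \<le> A * norm (fourier_multiplier m1 u)
    + B * norm (fourier_multiplier m2 u)" .
qed

text \<open>The symbols converge only pointwise, so the operators need not converge in norm.
  Dominated convergence on the Fourier side treats a fixed argument, and the uniform bound
  \<open>B\<close> treats the change of the argument.\<close>

lemma continuous_on_fourier_multiplier:
  fixes m :: "'p::metric_space \<Rightarrow> 'a::euclidean_space \<Rightarrow> real"
  assumes meas: "\<And>p. m p \<in> borel_measurable borel"
    and B: "\<And>p \<xi>. p \<in> S \<Longrightarrow> \<bar>m p \<xi>\<bar> \<le> B"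
    and cont: "\<And>\<xi>. continuous_on S (\<lambda>p. m p \<xi>)"
    and z: "continuous_on S z"
  shows "continuous_on S (\<lambda>p. fourier_multiplier (m p) (z p))"
  unfolding continuous_on_sequentially comp_def
proof (intro allI ballI impI)
  fix x :: "nat \<Rightarrow> 'p" and a assume a: "a \<in> S" and "(\<forall>n. x n \<in> S) \<and> x \<longlonglongrightarrow> a"
  then have x: "\<And>n. x n \<in> S" and lim: "x \<longlonglongrightarrow> a" by auto
  let ?T = "\<lambda>p. fourier_multiplier (m p)"
  note b = bounded_multiplier[OF meas B]
  have B0: "B \<ge> 0" using B[OF a, of 0] by linarith
  have zlim: "(\<lambda>n. z (x n)) \<longlonglongrightarrow> z a"
    using z a x lim unfolding continuous_on_sequentially comp_def by blast
  have "(\<lambda>n. L2_class (\<lambda>\<xi>. of_real (m (x n) \<xi>) * L2_fun (fourier (z a)) \<xi>)) \<longlonglongrightarrow>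
      L2_class (\<lambda>\<xi>. of_real (m a \<xi>) * L2_fun (fourier (z a)) \<xi>)"
  proof (rule L2_LIMSEQ_dominated(3))
    show "integrable lborel (\<lambda>\<xi>. B\<^sup>2 * (norm (L2_fun (fourier (z a)) \<xi>))\<^sup>2)"
      using square_integrable_L2_fun[of "fourier (z a)"] by (simp add: square_integrable_def)
    show "AE \<xi> in lborel. (norm (of_real (m (x n) \<xi>) * L2_fun (fourier (z a)) \<xi>))\<^sup>2
      \<le> B\<^sup>2 * (norm (L2_fun (fourier (z a)) \<xi>))\<^sup>2" for n
      using B[OF x[of n]] B0
      by (auto intro!: AE_I2 mult_right_mono simp: norm_mult power_mult_distrib
        power2_le_iff_abs_le)
    show "AE \<xi> in lborel. (\<lambda>n. of_real (m (x n) \<xi>) * L2_fun (fourier (z a)) \<xi>)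
      \<longlonglongrightarrow> of_real (m a \<xi>) * L2_fun (fourier (z a)) \<xi>"
    proof (rule AE_I2)
      fix \<xi>
      have "(\<lambda>n. m (x n) \<xi>) \<longlonglongrightarrow> m a \<xi>"
        using cont[of \<xi>] a x lim unfolding continuous_on_sequentially comp_def by blast
      then show "(\<lambda>n. of_real (m (x n) \<xi>) * L2_fun (fourier (z a)) \<xi>)
        \<longlonglongrightarrow> of_real (m a \<xi>) * L2_fun (fourier (z a)) \<xi>"
        by (intro tendsto_intros)
    qed
  qed (auto intro: weighted_space_measurable[OF meas])
  then have "(\<lambda>n. fourier (?T (x n) (z a))) \<longlonglongrightarrow> fourier (?T a (z a))"
    by (simp add: fourier_fourier_multiplier b(1)[OF x] b(1)[OF a])
  then have 1: "(\<lambda>n. ?T (x n) (z a)) \<longlonglongrightarrow> ?T a (z a)"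
    unfolding tendsto_dist_iff[of _ "fourier _"] tendsto_dist_iff[of _ "?T a (z a)"] dist_norm
      fourier_diff[symmetric] norm_fourier .
  have 2: "(\<lambda>n. ?T (x n) (z (x n) - z a)) \<longlonglongrightarrow> 0"
  proof (rule Lim_null_comparison)
    show "\<forall>\<^sub>F n in sequentially. norm (?T (x n) (z (x n) - z a)) \<le> B * norm (z (x n) - z a)"
      using b(2)[OF x] by (intro always_eventually allI)
    have "(\<lambda>n. B * norm (z (x n) - z a)) \<longlonglongrightarrow> B * norm (z a - z a)" by (intro tendsto_intros zlim)
    then show "(\<lambda>n. B * norm (z (x n) - z a)) \<longlonglongrightarrow> 0" by simp
  qed
  have "?T (x n) (z (x n)) = ?T (x n) (z (x n) - z a) + ?T (x n) (z a)" for n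
    using weighted_space_diff(2)[OF meas[of "x n"] b(1)[OF x[of n]] b(1)[OF x[of n]]] by simp
  then show "(\<lambda>n. ?T (x n) (z (x n))) \<longlonglongrightarrow> ?T a (z a)"
    using tendsto_add[OF 2 1] by simp
qed

section \<open>The Sobolev embedding\<close>

lemma nn_integral_powr_interval:
  assumes "b > 0" "L \<ge> 0"
  shows "(\<integral>\<^sup>+l. ennreal (l powr (b - 1)) * indicator {0..L} l \<partial>lborel) = ennreal (L powr b / b)"
  using nn_integral_has_integral_lebesgue'[OF _ has_integral_powr_from_0[of "b - 1" L]] assms
    by simp

text \<open>Balls of radius A/2^k replace polar coordinates. A nonzero point of the large ball has a
  last such ball that contains it; there the integrand is at most the next radius to the power -a.
  The resulting series is geometric with ratio (1/2)^(n-a) < 1.\<close>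

lemma nn_integral_powr_ball:
  assumes a: "0 \<le> a" "a < real DIM('a)"
  shows "\<exists>K>0. \<forall>A>0. (\<integral>\<^sup>+\<xi>. ennreal (indicator (cball (0::'a::euclidean_space) A) \<xi>
    * norm \<xi> powr (- a)) \<partial>lborel)
     \<le> ennreal (K * A powr (real DIM('a) - a))"
proof -
  let ?n = "real DIM('a)" and ?v = "unit_ball_vol (real DIM('a))"
  define q where "q = (1 / 2 :: real) powr (?n - a)"
  have q: "0 < q" "q < 1"
    using a powr_less_mono2[of "?n - a" "1 / 2" 1] by (auto simp: q_def)
  \<comment> \<open>The added 1 gives positivity of \<open>K\<close> from nonnegativity of the other
    summand alone.\<close>
  define K where "K = 2 powr a * ?v / (1 - q) + 1"
  have v0: "?v \<ge> 0" by simp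
  have K0: "K > 0" using q v0 unfolding K_def
    by (intro add_nonneg_pos divide_nonneg_nonneg mult_nonneg_nonneg) auto
  have "(\<integral>\<^sup>+\<xi>. ennreal (indicator (cball (0::'a) A) \<xi> * norm \<xi> powr (- a)) \<partial>lborel)
    \<le> ennreal (K * A powr (?n - a))"
    if A: "A > 0" for A
  proof -
    define \<rho> where "\<rho> k = A * (1 / 2) ^ k" for k :: nat
    have \<rho>0: "\<rho> k > 0" for k using A by (simp add: \<rho>_def)
    have pw: "ennreal (indicator (cball 0 A) \<xi> * norm \<xi> powr (- a)) \<le>
        (\<Sum>k. ennreal (\<rho> (Suc k) powr (- a)) * indicator (cball 0 (\<rho> k)) \<xi>)" (is "_ \<le> (\<Sum>k. ?t k)")
      if \<xi>0: "\<xi> \<noteq> 0" for \<xi> :: 'a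
    proof (cases "norm \<xi> \<le> A")
      case True
      have "(\<lambda>k. A * (1 / 2) ^ k) \<longlonglongrightarrow> A * 0" by (intro tendsto_intros LIMSEQ_power_zero) auto
      then have "\<forall>\<^sub>F k in sequentially. A * (1 / 2) ^ k < norm \<xi>"
        using \<xi>0 by (intro order_tendstoD(2)) auto
      then have ex: "\<exists>k. \<rho> k < norm \<xi>" unfolding \<rho>_def by (auto simp: eventually_sequentially)
      define k where "k = (LEAST k. \<rho> k < norm \<xi>)"
      have k: "\<rho> k < norm \<xi>" unfolding k_def by (rule LeastI_ex[OF ex])
      have "k \<noteq> 0"
      proof
        assume "k = 0"
        then show False using k True unfolding \<rho>_def by simp
      qed
      then obtain j where j: "k = Suc j" by (cases k) auto
      have "\<not> \<rho> j < norm \<xi>" using not_less_Least[of j "\<lambda>k. \<rho> k < norm \<xi>"] j unfolding k_def by auto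
      then have "\<xi> \<in> cball 0 (\<rho> j)" by simp
      moreover have "norm \<xi> powr (- a) \<le> \<rho> (Suc j) powr (- a)"
        using k j \<rho>0[of "Suc j"] a by (intro powr_mono2') auto
      ultimately have "ennreal (indicator (cball 0 A) \<xi> * norm \<xi> powr (- a)) \<le> ?t j"
        using True by (simp add: ennreal_leI)
      also have "?t j = sum ?t {j}"
        by (subst sum.insert) (simp_all only: finite.emptyI empty_iff not_False_eq_True sum.empty
          add_0_right)
      also have "\<dots> \<le> (\<Sum>k. ?t k)"
        by (rule sum_le_suminf) auto
      finally show ?thesis .
    qed simp
    have scal: "\<rho> (Suc k) powr (- a) * (?v * \<rho> k ^ DIM('a))
      = 2 powr a * ?v * A powr (?n - a) * q ^ k" for k
    proof -
      have "\<rho> (Suc k) = (1 / 2) * \<rho> k" by (simp add: \<rho>_def)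
      moreover have "((1 / 2) * \<rho> k) powr (- a) = (1 / 2) powr (- a) * \<rho> k powr (- a)"
        by (rule powr_mult)
      ultimately have "\<rho> (Suc k) powr (- a) = (1 / 2) powr (- a) * \<rho> k powr (- a)"
        by (simp only:)
      moreover have "(1 / 2) powr (- a) = (2 powr a :: real)" by (simp add: powr_divide powr_minus)
      moreover have "\<rho> k ^ DIM('a) = \<rho> k powr ?n" using \<rho>0[of k] by (simp add: powr_realpow)
      moreover have "\<rho> k powr (- a) * \<rho> k powr ?n = \<rho> k powr (?n - a)"
        by (simp add: powr_add[symmetric])
      moreover have "\<rho> k powr (?n - a) = A powr (?n - a) * q ^ k"
      proof -
        have "((1 / 2) ^ k) powr (?n - a) = q ^ k"
          unfolding q_def by (simp add: powr_realpow[symmetric] powr_powr mult.commute powr_power)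
        then show ?thesis using A by (simp add: \<rho>_def powr_mult)
      qed
      ultimately show ?thesis by (simp add: mult_ac)
    qed
    have summ: "summable (\<lambda>k. 2 powr a * ?v * A powr (?n - a) * q ^ k)"
      using q by (intro summable_mult summable_geometric) auto
    have "AE \<xi>::'a in lborel. \<xi> \<noteq> 0" by (rule AE_lborel_singleton)
    then have "(\<integral>\<^sup>+\<xi>. ennreal (indicator (cball (0::'a) A) \<xi> * norm \<xi> powr (- a)) \<partial>lborel) \<le>
        (\<integral>\<^sup>+\<xi>. (\<Sum>k. ennreal (\<rho> (Suc k) powr (- a)) * indicator (cball (0::'a) (\<rho> k)) \<xi>) \<partial>lborel)"
      by (intro nn_integral_mono_AE) (erule eventually_mono, rule pw)
    also have
      "\<dots> = (\<Sum>k. \<integral>\<^sup>+\<xi>. ennreal (\<rho> (Suc k) powr (- a)) * indicator (cball (0::'a) (\<rho> k)) \<xi> \<partial>lborel)"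
    proof (rule nn_integral_suminf)
      show "(\<lambda>\<xi>. ennreal (\<rho> (Suc k) powr (- a)) * indicator (cball (0::'a) (\<rho> k)) \<xi>)
        \<in> borel_measurable lborel" for k
        by (intro borel_measurable_times_ennreal borel_measurable_indicator borel_measurable_const)
          simp
    qed
    also have "\<dots> = (\<Sum>k. ennreal (2 powr a * ?v * A powr (?n - a) * q ^ k))"
    proof (intro suminf_cong)
      fix k
      have "(\<integral>\<^sup>+\<xi>. ennreal (\<rho> (Suc k) powr (- a)) * indicator (cball (0::'a) (\<rho> k)) \<xi> \<partial>lborel) =
          ennreal (\<rho> (Suc k) powr (- a)) * emeasure lborel (cball (0::'a) (\<rho> k))"
        by (subst nn_integral_cmult_indicator) auto
      also have "\<dots> = ennreal (\<rho> (Suc k) powr (- a) * (?v * \<rho> k ^ DIM('a)))"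
        using \<rho>0[of k] by (subst emeasure_cball) (auto simp: ennreal_mult[symmetric] less_imp_le)
      finally show
        "(\<integral>\<^sup>+\<xi>. ennreal (\<rho> (Suc k) powr (- a)) * indicator (cball (0::'a) (\<rho> k)) \<xi> \<partial>lborel) =
         ennreal (2 powr a * ?v * A powr (?n - a) * q ^ k)" unfolding scal .
    qed
    also have "\<dots> = ennreal (\<Sum>k. 2 powr a * ?v * A powr (?n - a) * q ^ k)"
      using q v0 by (intro suminf_ennreal2 summ) auto
    also have "(\<Sum>k. 2 powr a * ?v * A powr (?n - a) * q ^ k)
      = 2 powr a * ?v * A powr (?n - a) * (1 / (1 - q))"
      using q by (subst suminf_mult) (auto simp: suminf_geometric)
    also have "\<dots> = (K - 1) * A powr (?n - a)" by (simp add: K_def)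
    also have "ennreal \<dots> \<le> ennreal (K * A powr (?n - a))"
      by (intro ennreal_leI mult_right_mono) auto
    finally show ?thesis .
  qed
  with K0 show ?thesis by blast
qed

lemma nn_integral_cmult_L2_fun:
  "c \<ge> 0 \<Longrightarrow> (\<integral>\<^sup>+x. ennreal (c * (norm (L2_fun u x))\<^sup>2) \<partial>lborel) = ennreal (c * (norm u)\<^sup>2)"
  by (simp only: ennreal_mult' nn_integral_L2_fun[symmetric]) (rule nn_integral_cmult, measurable)

text \<open>On the ball of radius A the transform of \<open>u\<close> is |\<xi>|^(-\<sigma>) times a
  function of L2 norm at most 1, so Cauchy-Schwarz bounds its L1 norm, and the L1 norm bounds the
  inverse transform. The condition 2 \<sigma> < n makes the singular factor square integrable at the
  origin.\<close>

lemma low_frequency_bound: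
  assumes \<sigma>: "0 < \<sigma>" "\<sigma> < real DIM('a) / 2"
  shows "\<exists>K>0. \<forall>A>0. \<forall>u::'a::euclidean_space L2. u \<in> hom_Hs \<sigma> \<and> norm_hom_Hs \<sigma> u \<le> 1 \<longrightarrow>
     (AE x in lborel. norm (L2_fun (inv_fourier (L2_class (trunc A (fourier u)))) x) \<le> K * A powr
       (real DIM('a) / 2 - \<sigma>))"
proof -
  let ?n = "real DIM('a)"
  obtain K where K: "K > 0" and Kb: "\<And>A. A > 0 \<Longrightarrow>
      (\<integral>\<^sup>+\<xi>. ennreal (indicator (cball (0::'a) A) \<xi> * norm \<xi> powr (- (2 * \<sigma>))) \<partial>lborel) \<le> ennreal
        (K * A powr (?n - 2 * \<sigma>))"
    using nn_integral_powr_ball[of "2 * \<sigma>", where 'a='a] \<sigma> by auto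
  define c where "c = (2 * pi) powr (- ?n / 2)"
  have c: "c > 0" by (simp add: c_def)
  have "AE x in lborel. norm (L2_fun (inv_fourier (L2_class (trunc A (fourier u)))) x)
    \<le> (c * sqrt K) * A powr (?n / 2 - \<sigma>)"
    if A: "A > 0" and u: "u \<in> hom_Hs \<sigma>" "norm_hom_Hs \<sigma> u \<le> 1" for A and u :: "'a L2"
  proof -
    let ?f = "trunc A (fourier u)"
    let ?a = "\<lambda>\<xi>::'a. complex_of_real (indicator (cball 0 A) \<xi> * norm \<xi> powr (- \<sigma>))"
    let ?b = "\<lambda>\<xi>. complex_of_real (norm (of_real (norm \<xi> powr \<sigma>) * L2_fun (fourier u) \<xi>))"
    have hw: "u \<in> weighted_space (\<lambda>\<xi>. norm \<xi> powr \<sigma>)" using u(1) by (simp add: hom_Hs_def)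
    then have bsq0: "square_integrable (\<lambda>\<xi>. of_real (norm \<xi> powr \<sigma>) * L2_fun (fourier u) \<xi>)"
      by (simp add: weighted_space_iff)
    then have bsq: "square_integrable ?b" by (simp add: square_integrable_def)
    have bn: "norm (L2_class ?b) \<le> 1"
    proof -
      have "norm (L2_class ?b)
        = norm (L2_class (\<lambda>\<xi>. of_real (norm \<xi> powr \<sigma>) * L2_fun (fourier u) \<xi>))"
        by (rule power2_eq_imp_eq) (simp_all add: norm_L2_class bsq bsq0)
      also have "\<dots> = norm_hom_Hs \<sigma> u"
        unfolding norm_hom_Hs_def using norm_fourier_multiplier[OF hw]
          norm_fourier_multiplier_class[OF hw] by simp
      finally show ?thesis using u(2) by simp
    qed
    have a2: "(norm (?a \<xi>))\<^sup>2 = indicator (cball 0 A) \<xi> * norm \<xi> powr (- (2 * \<sigma>))" for \<xi>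
      by (simp add: indicator_def norm_mult power2_eq_square powr_add[symmetric])
    have am: "?a \<in> borel_measurable borel"
      by (intro measurable_compose[OF _ measurable_complex_of_real] borel_measurable_times
        borel_measurable_indicator) auto
    have "sqrt (K * A powr (?n - 2 * \<sigma>)) = sqrt K * A powr (?n / 2 - \<sigma>)"
      by (simp add: real_sqrt_mult powr_half_sqrt[symmetric] powr_powr field_simps)
    moreover have "(sqrt (K * A powr (?n - 2 * \<sigma>)))\<^sup>2 = K * A powr (?n - 2 * \<sigma>)"
      using K by simp
    ultimately have "(\<integral>\<^sup>+\<xi>. ennreal ((norm (?a \<xi>))\<^sup>2) \<partial>lborel)
      \<le> ennreal ((sqrt K * A powr (?n / 2 - \<sigma>))\<^sup>2)"
      unfolding a2 using Kb[OF A] by simp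
    from norm_L2_class_le[OF am this] K
    have asq: "square_integrable ?a" and an: "norm (L2_class ?a) \<le> sqrt K * A powr (?n / 2 - \<sigma>)"
      by auto
    have "AE \<xi> in lborel. norm (?f \<xi>) = ?a \<xi> \<bullet> ?b \<xi>"
      using AE_lborel_singleton[of "0::'a"]
    proof eventually_elim
      case (elim \<xi>)
      have "norm \<xi> powr (- \<sigma>) * norm \<xi> powr \<sigma> = 1" using elim by (simp add: powr_add[symmetric])
      then have "norm (?f \<xi>) = indicator (cball 0 A) \<xi> * (norm \<xi> powr (- \<sigma>) * norm \<xi> powr \<sigma>)
        * norm (L2_fun (fourier u) \<xi>)"
        by (simp add: trunc_def)
      then show ?case by (simp add: inner_complex_def norm_mult mult_ac)
    qed
    then have "(LINT \<xi>|lborel. norm (?f \<xi>)) = (LINT \<xi>|lborel. ?a \<xi> \<bullet> ?b \<xi>)"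
      using integrable_inner_L2[OF asq bsq] by (intro integral_cong_AE borel_measurable_norm) auto
    also have "\<dots> = inner (L2_class ?a) (L2_class ?b)"
      by (rule inner_L2_class[OF asq bsq, symmetric])
    also have "\<dots> \<le> norm (L2_class ?a) * norm (L2_class ?b)" by (rule norm_cauchy_schwarz)
    also have "\<dots> \<le> (sqrt K * A powr (?n / 2 - \<sigma>)) * 1"
      using an bn K by (intro mult_mono) auto
    finally have L1: "(LINT \<xi>|lborel. norm (?f \<xi>)) \<le> sqrt K * A powr (?n / 2 - \<sigma>)" by simp
    have fsq: "square_integrable (\<lambda>x. ?f (- x))"
      by (rule square_integrable_reflect(1)[OF square_integrable_trunc])
    have "norm (fourier_integral (\<lambda>x. ?f (- x)) x) \<le> c * (LINT \<xi>|lborel. norm (?f \<xi>))" for x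
    proof -
      have "(LINT \<xi>|lborel. norm (?f (- \<xi>))) = (LINT \<xi>|lborel. norm (?f \<xi>))"
        using lborel_integral_affine[of "\<lambda>\<xi>. norm (?f \<xi>)" "-1" 0] by simp
      then show ?thesis using norm_fourier_integral_le[of "\<lambda>x. ?f (- x)" x] unfolding c_def by simp
    qed
    from order_trans[OF this mult_left_mono[OF L1 less_imp_le[OF c]]]
    have pw: "norm (fourier_integral (\<lambda>x. ?f (- x)) x) \<le> c * sqrt K * A powr (?n / 2 - \<sigma>)" for x
      by (simp only: mult.assoc)
    have "inv_fourier (L2_class ?f) = L2_class (fourier_integral (\<lambda>x. ?f (- x)))"
      by (rule inv_fourier_L2_class[OF square_integrable_trunc trunc_outside])
    moreover have "square_integrable (fourier_integral (\<lambda>x. ?f (- x)))"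
      by (rule fourier_integral_isometry_compact(1)[OF fsq, of A]) (simp add: trunc_outside)
    ultimately have "AE x in lborel. L2_fun (inv_fourier (L2_class ?f)) x
      = fourier_integral (\<lambda>x. ?f (- x)) x"
      using L2_fun_class by metis
    then show ?thesis by eventually_elim (simp add: pw)
  qed
  moreover have "c * sqrt K > 0" using c K by simp
  ultimately show ?thesis by blast
qed

text \<open>The splitting frequency A is chosen so that the low part stays below l/2 almost
  everywhere. Where |u| \<ge> l, the high part is then at least l/2, and Chebyshev with Plancherel
  gives the bound. The restriction |\<xi>| > A is relaxed to a condition on \<open>l\<close> for
  given \<xi>, so that the layer cake integral can be carried out in \<open>l\<close> first.\<close>

lemma distribution_function_bound:
  assumes \<sigma>: "0 < \<sigma>" "\<sigma> < real DIM('a) / 2"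
  shows "\<exists>D>0. \<forall>l>0. \<forall>u::'a::euclidean_space L2. u \<in> hom_Hs \<sigma> \<and> norm_hom_Hs \<sigma> u \<le> 1 \<longrightarrow>
     (\<integral>\<^sup>+x. indicator {0..norm (L2_fun u x)} l \<partial>lborel) \<le>
     (\<integral>\<^sup>+\<xi>. ennreal (4 / l\<^sup>2 * (norm (L2_fun (fourier u) \<xi>))\<^sup>2) * indicator
       {0..D * norm \<xi> powr (real DIM('a) / 2 - \<sigma>)} l \<partial>lborel)"
proof -
  let ?n = "real DIM('a)"
  obtain K where K: "K > 0" and Kb: "\<And>A u::'a L2. A > 0 \<Longrightarrow> u \<in> hom_Hs \<sigma> \<Longrightarrow> norm_hom_Hs \<sigma> u \<le> 1 \<Longrightarrow>
     AE x in lborel. norm (L2_fun (inv_fourier (L2_class (trunc A (fourier u)))) x) \<le> K * A powr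
       (?n / 2 - \<sigma>)"
    using low_frequency_bound[OF \<sigma>] by blast
  define D where "D = 2 * K"
  have D: "D > 0" using K by (simp add: D_def)
  have "(\<integral>\<^sup>+x. indicator {0..norm (L2_fun u x)} l \<partial>lborel) \<le>
     (\<integral>\<^sup>+\<xi>. ennreal (4 / l\<^sup>2 * (norm (L2_fun (fourier u) \<xi>))\<^sup>2) * indicator
       {0..D * norm \<xi> powr (?n / 2 - \<sigma>)} l \<partial>lborel)"
    if l: "l > 0" and u: "u \<in> hom_Hs \<sigma>" "norm_hom_Hs \<sigma> u \<le> 1" for l and u :: "'a L2"
  proof -
    define e where "e = ?n / 2 - \<sigma>"
    have e: "e > 0" using \<sigma> by (simp add: e_def)
    define A where "A = (l / D) powr (1 / e)"
    have A: "A > 0" using l D by (simp add: A_def)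
    have Ae: "A powr e = l / D" using l D e by (simp add: A_def powr_powr)
    define low where "low = inv_fourier (L2_class (trunc A (fourier u)))"
    define high where "high = u - low"
    have lowb: "AE x in lborel. norm (L2_fun low x) \<le> l / 2"
    proof -
      have "K * A powr (?n / 2 - \<sigma>) = l / 2"
        unfolding e_def[symmetric] Ae using K by (simp add: D_def)
      note eq = this
      show ?thesis using Kb[OF A u] unfolding low_def eq .
    qed
    have "AE x in lborel. indicator {0..norm (L2_fun u x)} l
      \<le> ennreal (4 / l\<^sup>2 * (norm (L2_fun high x))\<^sup>2)"
      using lowb L2_fun_diff[of u low]
    proof eventually_elim
      case (elim x)
      show ?case
      proof (cases "l \<le> norm (L2_fun u x)")
        case True
        have "norm (L2_fun u x) \<le> norm (L2_fun high x) + norm (L2_fun low x)"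
          using elim(2) norm_triangle_sub[of "L2_fun u x" "L2_fun low x"] by (simp add: high_def)
        then have "l / 2 \<le> norm (L2_fun high x)" using True elim(1) by linarith
        then have "(l / 2)\<^sup>2 \<le> (norm (L2_fun high x))\<^sup>2" using l by (intro power_mono) auto
        then have "1 \<le> 4 / l\<^sup>2 * (norm (L2_fun high x))\<^sup>2" using l
          by (simp add: field_simps power2_eq_square)
        then show ?thesis using True l by simp
      qed simp
    qed
    then have "(\<integral>\<^sup>+x. indicator {0..norm (L2_fun u x)} l \<partial>lborel)
      \<le> (\<integral>\<^sup>+x. ennreal (4 / l\<^sup>2 * (norm (L2_fun high x))\<^sup>2) \<partial>lborel)"
      by (rule nn_integral_mono_AE)
    also have "\<dots> = ennreal (4 / l\<^sup>2 * (norm (fourier high))\<^sup>2)"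
      by (simp only: nn_integral_cmult_L2_fun norm_fourier divide_nonneg_nonneg zero_le_numeral
        zero_le_power2)
    also have "\<dots> = (\<integral>\<^sup>+\<xi>. ennreal (4 / l\<^sup>2 * (norm (L2_fun (fourier high) \<xi>))\<^sup>2) \<partial>lborel)"
      by (simp only: nn_integral_cmult_L2_fun divide_nonneg_nonneg zero_le_numeral zero_le_power2)
    also have
      "\<dots> \<le> (\<integral>\<^sup>+\<xi>. ennreal (4 / l\<^sup>2 * (norm (L2_fun (fourier u) \<xi>))\<^sup>2)
      * indicator {0..D * norm \<xi> powr e} l \<partial>lborel)"
    proof (rule nn_integral_mono_AE)
      have fh: "fourier high = fourier u - L2_class (trunc A (fourier u))"
        by (simp add: high_def low_def fourier_diff)
      show "AE \<xi> in lborel. ennreal (4 / l\<^sup>2 * (norm (L2_fun (fourier high) \<xi>))\<^sup>2) \<le>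
          ennreal (4 / l\<^sup>2 * (norm (L2_fun (fourier u) \<xi>))\<^sup>2) * indicator {0..D * norm \<xi> powr e} l"
        using L2_fun_diff[of "fourier u" "L2_class (trunc A (fourier u))"]
          L2_fun_class[OF square_integrable_trunc[of A "fourier u"]]
        unfolding fh
      proof eventually_elim
        case (elim \<xi>)
        show ?case
        proof (cases "norm \<xi> \<le> A")
          case True
          then show ?thesis using elim by (simp add: trunc_def)
        next
          case False
          then have "A powr e \<le> norm \<xi> powr e" using A e by (intro powr_mono2) auto
          then have "l \<le> D * norm \<xi> powr e" using D by (simp add: Ae field_simps)
          then show ?thesis using elim False l by (simp add: trunc_def)
        qed
      qed
    qed
    finally show ?thesis unfolding e_def .
  qed
  with D show ?thesis by blast
qed

text \<open>Layer cake for the power \<open>r\<close>, the distribution bound and Fubini leave, for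
  each \<xi>, the integral of l^(r-3) up to D|\<xi>|^(n/2-\<sigma>). Its exponent
  (n/2-\<sigma>)(r-2) = 2 \<sigma> recovers exactly the square of the homogeneous norm; this
  identity is what determines \<open>r\<close>.\<close>

lemma Sobolev_normalised:
  fixes \<sigma> :: real
  assumes \<sigma>: "0 < \<sigma>" "\<sigma> < real DIM('a) / 2"
  defines "r \<equiv> 2 * real DIM('a) / (real DIM('a) - 2 * \<sigma>)"
  shows "\<exists>C>0. \<forall>u::'a::euclidean_space L2. u \<in> hom_Hs \<sigma> \<and> norm_hom_Hs \<sigma> u \<le> 1 \<longrightarrow>
     (\<integral>\<^sup>+x. ennreal (norm (L2_fun u x) powr r) \<partial>lborel) \<le> ennreal C"
proof -
  let ?n = "real DIM('a)"
  define e where "e = ?n / 2 - \<sigma>"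
  have e: "e > 0" using \<sigma> by (simp add: e_def)
  have re: "r = ?n / e" unfolding r_def e_def using \<sigma> by (simp add: field_simps)
  have r2: "r > 2" unfolding re using e \<sigma> by (simp add: e_def field_simps)
  have er: "e * (r - 2) = 2 * \<sigma>" unfolding re using e
    by (simp add: field_simps) (simp add: e_def field_simps)
  obtain D where D: "D > 0" and Db: "\<And>l u::'a L2. l > 0 \<Longrightarrow> u \<in> hom_Hs \<sigma> \<Longrightarrow> norm_hom_Hs \<sigma> u \<le> 1 \<Longrightarrow>
     (\<integral>\<^sup>+x. indicator {0..norm (L2_fun u x)} l \<partial>lborel) \<le>
     (\<integral>\<^sup>+\<xi>. ennreal (4 / l\<^sup>2 * (norm (L2_fun (fourier u) \<xi>))\<^sup>2) * indicator {0..D * norm \<xi> powr e} l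
       \<partial>lborel)"
    using distribution_function_bound[OF \<sigma>] unfolding e_def by blast
  define C where "C = 4 * r * D powr (r - 2) / (r - 2)"
  have C: "C > 0" using r2 D by (simp add: C_def)
  have "(\<integral>\<^sup>+x. ennreal (norm (L2_fun u x) powr r) \<partial>lborel) \<le> ennreal C"
    if u: "u \<in> hom_Hs \<sigma>" "norm_hom_Hs \<sigma> u \<le> 1" for u :: "'a L2"
  proof -
    let ?U = "\<lambda>\<xi>. L2_fun (fourier u) \<xi>"
    have hw: "u \<in> weighted_space (\<lambda>\<xi>. norm \<xi> powr \<sigma>)" using u(1) by (simp add: hom_Hs_def)
    have "ennreal (norm (L2_fun u x) powr r)
      = (\<integral>\<^sup>+l. ennreal (r * l powr (r - 1)) * indicator {0..norm (L2_fun u x)} l \<partial>lborel)" for x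
    proof -
      have "(\<integral>\<^sup>+l. ennreal (r * l powr (r - 1)) * indicator {0..norm (L2_fun u x)} l \<partial>lborel) =
          ennreal r * (\<integral>\<^sup>+l. ennreal (l powr (r - 1)) * indicator {0..norm (L2_fun u x)} l \<partial>lborel)"
        using r2 by (simp add: ennreal_mult' mult.assoc nn_integral_cmult)
      also have "\<dots> = ennreal (norm (L2_fun u x) powr r)"
        using r2 by (subst nn_integral_powr_interval) (auto simp: ennreal_mult[symmetric])
      finally show ?thesis ..
    qed
    then have "(\<integral>\<^sup>+x. ennreal (norm (L2_fun u x) powr r) \<partial>lborel) =
        (\<integral>\<^sup>+x. \<integral>\<^sup>+l. ennreal (r * l powr (r - 1)) * indicator {0..norm (L2_fun u x)} l \<partial>lborel
          \<partial>lborel)"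
      by simp
    also have
      "\<dots> = (\<integral>\<^sup>+l. \<integral>\<^sup>+x. ennreal (r * l powr (r - 1))
      * indicator {0..norm (L2_fun u x)} l \<partial>lborel \<partial>lborel)"
      by (rule lborel_pair.Fubini') (simp add: indicator_def, measurable)
    also have
      "\<dots> \<le> (\<integral>\<^sup>+l. \<integral>\<^sup>+\<xi>. ennreal (4 * r * (norm (?U \<xi>))\<^sup>2)
      * (ennreal (l powr (r - 2 - 1)) * indicator {0..D * norm \<xi> powr e} l) \<partial>lborel \<partial>lborel)"
    proof (rule nn_integral_mono)
      fix l :: real
      show "(\<integral>\<^sup>+x. ennreal (r * l powr (r - 1)) * indicator {0..norm (L2_fun u x)} l \<partial>lborel) \<le>
        (\<integral>\<^sup>+\<xi>. ennreal (4 * r * (norm (?U \<xi>))\<^sup>2) *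
          (ennreal (l powr (r - 2 - 1)) * indicator {0..D * norm \<xi> powr e} l) \<partial>lborel)"
      proof (cases "l > 0")
        case True
        have "(\<integral>\<^sup>+x. ennreal (r * l powr (r - 1)) * indicator {0..norm (L2_fun u x)} l \<partial>lborel) =
            ennreal (r * l powr (r - 1)) * (\<integral>\<^sup>+x. indicator {0..norm (L2_fun u x)} l \<partial>lborel)"
          by (rule nn_integral_cmult) (simp add: indicator_def)
        also have "\<dots> \<le> ennreal (r * l powr (r - 1))
          * (\<integral>\<^sup>+\<xi>. ennreal (4 / l\<^sup>2 * (norm (?U \<xi>))\<^sup>2) * indicator {0..D * norm \<xi> powr e} l
          \<partial>lborel)"
          by (intro mult_left_mono Db True u) simp
        also have
          "\<dots> = (\<integral>\<^sup>+\<xi>. ennreal (r * l powr (r - 1))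
          * (ennreal (4 / l\<^sup>2 * (norm (?U \<xi>))\<^sup>2) * indicator {0..D * norm \<xi> powr e} l) \<partial>lborel)"
          by (rule nn_integral_cmult[symmetric]) (simp add: indicator_def)
        also have
          "\<dots> = (\<integral>\<^sup>+\<xi>. ennreal (4 * r * (norm (?U \<xi>))\<^sup>2)
          * (ennreal (l powr (r - 2 - 1)) * indicator {0..D * norm \<xi> powr e} l) \<partial>lborel)"
        proof (rule nn_integral_cong)
          fix \<xi> :: 'a
          have "l powr (r - 1) = l powr (r - 2 - 1) * l\<^sup>2"
            using True powr_add[of l "r - 2 - 1" 2] by simp
          then have "r * l powr (r - 1) * (4 / l\<^sup>2 * (norm (?U \<xi>))\<^sup>2)
            = 4 * r * (norm (?U \<xi>))\<^sup>2 * l powr (r - 2 - 1)"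
            using True by (simp add: field_simps)
          then have "ennreal (r * l powr (r - 1)) * ennreal (4 / l\<^sup>2 * (norm (?U \<xi>))\<^sup>2)
            = ennreal (4 * r * (norm (?U \<xi>))\<^sup>2) * ennreal (l powr (r - 2 - 1))"
            using r2 by (simp add: ennreal_mult[symmetric])
          then show "ennreal (r * l powr (r - 1))
            * (ennreal (4 / l\<^sup>2 * (norm (?U \<xi>))\<^sup>2) * indicator {0..D * norm \<xi> powr e} l) =
             ennreal (4 * r * (norm (?U \<xi>))\<^sup>2) *
               (ennreal (l powr (r - 2 - 1)) * indicator {0..D * norm \<xi> powr e} l)"
            by (simp only: mult.assoc[symmetric])
        qed
        finally show ?thesis .
      next
        case False
        then have "ennreal (r * l powr (r - 1)) * indicator {0..norm (L2_fun u x)} l = 0" for x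
          by (cases "l = 0") auto
        then show ?thesis by (simp only: nn_integral_const mult_zero_left zero_le)
      qed
    qed
    also have
      "\<dots> = (\<integral>\<^sup>+\<xi>. \<integral>\<^sup>+l. ennreal (4 * r * (norm (?U \<xi>))\<^sup>2)
      * (ennreal (l powr (r - 2 - 1)) * indicator {0..D * norm \<xi> powr e} l) \<partial>lborel \<partial>lborel)"
      by (rule lborel_pair.Fubini'[symmetric]) (simp add: indicator_def, measurable)
    also have "\<dots> = (\<integral>\<^sup>+\<xi>. ennreal C * ennreal ((norm (of_real (norm \<xi> powr \<sigma>) * ?U \<xi>))\<^sup>2) \<partial>lborel)"
    proof (rule nn_integral_cong)
      fix \<xi> :: 'a
      have "(\<integral>\<^sup>+l. ennreal (4 * r * (norm (?U \<xi>))\<^sup>2)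
        * (ennreal (l powr (r - 2 - 1)) * indicator {0..D * norm \<xi> powr e} l) \<partial>lborel) =
          ennreal (4 * r * (norm (?U \<xi>))\<^sup>2) * ennreal ((D * norm \<xi> powr e) powr (r - 2) / (r - 2))"
        using nn_integral_powr_interval[of "r - 2" "D * norm \<xi> powr e"] r2 D
          by (simp add: nn_integral_cmult)
      also have "(D * norm \<xi> powr e) powr (r - 2) = D powr (r - 2) * norm \<xi> powr (2 * \<sigma>)"
        using D by (simp add: powr_mult powr_powr er)
      also have "ennreal (4 * r * (norm (?U \<xi>))\<^sup>2)
        * ennreal (D powr (r - 2) * norm \<xi> powr (2 * \<sigma>) / (r - 2)) =
          ennreal (4 * r * (norm (?U \<xi>))\<^sup>2 * (D powr (r - 2) * norm \<xi> powr (2 * \<sigma>) / (r - 2)))"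
        using r2 by (intro ennreal_mult[symmetric]) auto
      also have "4 * r * (norm (?U \<xi>))\<^sup>2 * (D powr (r - 2) * norm \<xi> powr (2 * \<sigma>) / (r - 2))
        = C * (norm (of_real (norm \<xi> powr \<sigma>) * ?U \<xi>))\<^sup>2"
      proof -
        have "norm \<xi> powr (2 * \<sigma>) = (norm \<xi> powr \<sigma>)\<^sup>2"
          by (simp add: power2_eq_square powr_add[symmetric])
        then show ?thesis by (simp add: C_def norm_mult power_mult_distrib)
      qed
      also have "ennreal \<dots> = ennreal C * ennreal ((norm (of_real (norm \<xi> powr \<sigma>) * ?U \<xi>))\<^sup>2)"
        using C by (intro ennreal_mult) auto
      finally show
        "(\<integral>\<^sup>+l. ennreal (4 * r * (norm (?U \<xi>))\<^sup>2)
        * (ennreal (l powr (r - 2 - 1)) * indicator {0..D * norm \<xi> powr e} l) \<partial>lborel) =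
          ennreal C * ennreal ((norm (of_real (norm \<xi> powr \<sigma>) * ?U \<xi>))\<^sup>2)" .
    qed
    also have "\<dots> = ennreal C * (\<integral>\<^sup>+\<xi>. ennreal ((norm (of_real (norm \<xi> powr \<sigma>) * ?U \<xi>))\<^sup>2) \<partial>lborel)"
      by (rule nn_integral_cmult) measurable
    also have "(\<integral>\<^sup>+\<xi>. ennreal ((norm (of_real (norm \<xi> powr \<sigma>) * ?U \<xi>))\<^sup>2) \<partial>lborel)
      = ennreal ((norm_hom_Hs \<sigma> u)\<^sup>2)"
      using hw norm_fourier_multiplier[OF hw] norm_fourier_multiplier_class[OF hw]
      by (subst nn_integral_L2_class) (auto simp: weighted_space_iff norm_hom_Hs_def)
    also have "ennreal C * ennreal ((norm_hom_Hs \<sigma> u)\<^sup>2) \<le> ennreal C * ennreal 1"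
    proof (intro mult_left_mono ennreal_leI)
      have "norm_hom_Hs \<sigma> u \<ge> 0"
        unfolding norm_hom_Hs_def norm_fourier_multiplier[OF hw, symmetric] by simp
      then show "(norm_hom_Hs \<sigma> u)\<^sup>2 \<le> 1" using u(2) by (simp add: power_le_one)
    qed simp
    finally show ?thesis by simp
  qed
  with C show ?thesis by blast
qed

text \<open>For \<open>h = 1\<close> the usual weight of order \<open>s\<close>, for
  \<open>h = 1 + t\<close> the weight of the solution norm at time t. The parameter stays free
  because the kernel at time t-\<tau> goes with 1+t-\<tau>, and because the Sobolev bounds then show
  the decay as a power of \<open>h\<close>.\<close>

definition wt :: "real \<Rightarrow> real \<Rightarrow> 'a::euclidean_space \<Rightarrow> real" where
  "wt s h \<xi> = (1 + h * (norm \<xi>)\<^sup>2) powr (s / 2)"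

abbreviation nH :: "real \<Rightarrow> real \<Rightarrow> 'a::euclidean_space L2 \<Rightarrow> real" where
  "nH s h u \<equiv> norm (fourier_multiplier (wt s h) u)"

lemma wt_measurable [measurable]: "wt s h \<in> borel_measurable borel"
  unfolding wt_def[abs_def] by measurable

lemma wt_pos: "h \<ge> 0 \<Longrightarrow> wt s h \<xi> > 0"
  unfolding wt_def by (simp add: add_pos_nonneg powr_gt_zero[THEN iffD2] less_imp_neq[symmetric])

lemma wt_ge_1: "h \<ge> 0 \<Longrightarrow> s \<ge> 0 \<Longrightarrow> wt s h \<xi> \<ge> 1"
  unfolding wt_def by (intro ge_one_powr_ge_zero) auto

lemma wt_mono: "0 \<le> h \<Longrightarrow> h \<le> h' \<Longrightarrow> s \<ge> 0 \<Longrightarrow> wt s h \<xi> \<le> wt s h' \<xi>"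
  unfolding wt_def by (intro powr_mono2) (auto intro: mult_right_mono)

text \<open>The quotient of the weights is controlled by the quotient of the parameters, from 1 + h'
  x \<le> (h'/h)(1 + h x). The factor is harmless while \<open>h\<close> and \<open>h'\<close> are
  comparable, which fails in the Duhamel integral for \<tau> near t.\<close>

lemma wt_scale:
  assumes "0 < h" "h \<le> h'" "s \<ge> 0"
  shows "wt s h' \<xi> \<le> (h' / h) powr (s / 2) * wt s h \<xi>"
proof -
  have "1 + h' * (norm \<xi>)\<^sup>2 \<le> (h' / h) * (1 + h * (norm \<xi>)\<^sup>2)"
    using assms by (simp add: field_simps)
  then have "wt s h' \<xi> \<le> ((h' / h) * (1 + h * (norm \<xi>)\<^sup>2)) powr (s / 2)"
    unfolding wt_def using assms by (intro powr_mono2) (auto intro!: add_nonneg_nonneg)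
  also have "\<dots> = (h' / h) powr (s / 2) * wt s h \<xi>"
    unfolding wt_def by (rule powr_mult)
  finally show ?thesis .
qed

lemma Hs_eq: "Hs s = weighted_space (wt s 1)" "norm_Hs s = weighted_norm (wt s 1)"
  by (simp_all add: Hs_def norm_Hs_def wt_def[abs_def])

lemma Hs_weighted_space:
  fixes u :: "'a::euclidean_space L2"
  assumes "u \<in> Hs s" "h \<ge> 1" "s \<ge> 0"
  shows "u \<in> weighted_space (wt s h)"
proof -
  have u: "u \<in> weighted_space (\<lambda>\<xi>. h powr (s / 2) * wt s 1 \<xi>)"
    using assms by (intro weighted_space_cmult) (simp_all add: Hs_eq)
  show ?thesis
  proof (rule fourier_multiplier_mono(1)[OF u])
    show "AE \<xi>::'a in lborel. \<bar>wt s h \<xi>\<bar> \<le> \<bar>h powr (s / 2) * wt s 1 \<xi>\<bar>"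
    proof (rule AE_I2)
      fix \<xi> :: 'a
      have "\<bar>wt s h \<xi>\<bar> \<le> h powr (s / 2) * wt s 1 \<xi>"
        using wt_scale[of 1 h s \<xi>] wt_pos[of h s \<xi>] assms by simp
      then show "\<bar>wt s h \<xi>\<bar> \<le> \<bar>h powr (s / 2) * wt s 1 \<xi>\<bar>"
        by (rule order_trans[OF _ abs_ge_self])
    qed
  qed measurable
qed

lemma norm_Hs_eq: "u \<in> Hs s \<Longrightarrow> norm_Hs s u = nH s 1 u"
  by (simp add: Hs_eq norm_fourier_multiplier)

text \<open>Comparison with the single summand h|\<xi>|^2 inside the weight. The factor
  h^(-\<sigma>/2) is where decay of the intermediate norms comes from.\<close>

lemma norm_powr_le_wt:
  assumes "0 \<le> \<sigma>" "\<sigma> \<le> s" "h > 0"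
  shows "norm \<xi> powr \<sigma> \<le> h powr (- \<sigma> / 2) * wt s h \<xi>"
proof -
  have "(h * (norm \<xi>)\<^sup>2) powr (\<sigma> / 2) \<le> (1 + h * (norm \<xi>)\<^sup>2) powr (\<sigma> / 2)"
    using assms by (intro powr_mono2) auto
  also have "\<dots> \<le> wt s h \<xi>"
    unfolding wt_def using assms by (intro powr_mono) auto
  finally have *: "(h * (norm \<xi>)\<^sup>2) powr (\<sigma> / 2) \<le> wt s h \<xi>" .
  have "((norm \<xi>)\<^sup>2) powr (\<sigma> / 2) = norm \<xi> powr \<sigma>"
  proof (cases "\<xi> = 0")
    case False
    then have "(norm \<xi>)\<^sup>2 = norm \<xi> powr 2" by simp
    then show ?thesis by (simp only: powr_powr) simp
  qed simp
  then have "(h * (norm \<xi>)\<^sup>2) powr (\<sigma> / 2) = h powr (\<sigma> / 2) * norm \<xi> powr \<sigma>"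
    by (simp add: powr_mult)
  then have "h powr (- \<sigma> / 2) * (h powr (\<sigma> / 2) * norm \<xi> powr \<sigma>) \<le> h powr (- \<sigma> / 2) * wt s h \<xi>"
    using * by (simp add: mult_left_mono)
  moreover have "h powr (- \<sigma> / 2) * (h powr (\<sigma> / 2) * norm \<xi> powr \<sigma>) = norm \<xi> powr \<sigma>"
    using assms(3) by (simp add: mult.assoc[symmetric] powr_add[symmetric])
  ultimately show ?thesis by (simp only:)
qed

lemma norm_hom_Hs_le:
  fixes u :: "'a::euclidean_space L2"
  assumes u: "u \<in> Hs s" and \<sigma>: "0 \<le> \<sigma>" "\<sigma> \<le> s" and h: "h \<ge> 1"
  shows "u \<in> hom_Hs \<sigma>" "norm_hom_Hs \<sigma> u \<le> h powr (- \<sigma> / 2) * nH s h u"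
proof -
  have uw: "u \<in> weighted_space (wt s h)" using Hs_weighted_space[OF u h] \<sigma> by simp
  note c = weighted_space_cmult[OF wt_measurable uw, of "h powr (- \<sigma> / 2)"]
  have le: "AE \<xi>::'a in lborel. \<bar>norm \<xi> powr \<sigma>\<bar> \<le> \<bar>h powr (- \<sigma> / 2) * wt s h \<xi>\<bar>"
  proof (rule AE_I2)
    fix \<xi> :: 'a
    have "norm \<xi> powr \<sigma> \<le> h powr (- \<sigma> / 2) * wt s h \<xi>" using h by (intro norm_powr_le_wt \<sigma>) auto
    then have "\<bar>norm \<xi> powr \<sigma>\<bar> \<le> h powr (- \<sigma> / 2) * wt s h \<xi>" by simp
    then show "\<bar>norm \<xi> powr \<sigma>\<bar> \<le> \<bar>h powr (- \<sigma> / 2) * wt s h \<xi>\<bar>"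
      by (rule order_trans[OF _ abs_ge_self])
  qed
  have m: "(\<lambda>\<xi>::'a. norm \<xi> powr \<sigma>) \<in> borel_measurable borel" by measurable
  note * = fourier_multiplier_mono[OF c(1) m le]
  show "u \<in> hom_Hs \<sigma>" using *(1) by (simp add: hom_Hs_def)
  show "norm_hom_Hs \<sigma> u \<le> h powr (- \<sigma> / 2) * nH s h u"
    using *(2) unfolding c(2) norm_fourier_multiplier[OF *(1)] norm_hom_Hs_def by simp
qed

lemma norm_le_nH:
  assumes u: "u \<in> Hs s" and s: "s \<ge> 0" and h: "h \<ge> 1"
  shows "norm u \<le> nH s h u"
proof -
  have "norm (fourier_multiplier (\<lambda>\<xi>. 1) u) \<le> nH s h u"
    using wt_ge_1[of h s] s h
    by (intro fourier_multiplier_mono(2) Hs_weighted_space u AE_I2)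
      (auto intro: order_trans[OF _ abs_ge_self])
  then show ?thesis by (simp add: weighted_space_one)
qed

text \<open>Scaling removes the normalisation of \<open>Sobolev_normalised\<close>. The conditional
  hypothesis lets one statement include the endpoint \<sigma> = 0, where r = 2 and the bound is one
  on the L2 norm of \<open>u\<close> itself.\<close>

lemma Lr_hom_bound:
  assumes \<sigma>: "0 \<le> \<sigma>" "\<sigma> < real DIM('a) / 2"
  defines "r \<equiv> 2 * real DIM('a) / (real DIM('a) - 2 * \<sigma>)"
  shows "\<exists>C>0. \<forall>A>0. \<forall>u::'a::euclidean_space L2. u \<in> hom_Hs \<sigma> \<and> norm_hom_Hs \<sigma> u \<le> A
    \<and> norm u \<le> (if \<sigma> = 0 then A else norm u) \<longrightarrow>
     (\<integral>\<^sup>+x. ennreal (norm (L2_fun u x) powr r) \<partial>lborel) \<le> ennreal ((C * A) powr r)"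
proof (cases "\<sigma> = 0")
  case True
  have "(\<integral>\<^sup>+x. ennreal (norm (L2_fun u x) powr r) \<partial>lborel) \<le> ennreal ((1 * A) powr r)"
    if "A > 0" "norm u \<le> A" for A and u :: "'a L2"
  proof -
    have "r = 2" using True by (simp add: r_def)
    moreover have "norm z powr 2 = (norm z)\<^sup>2" for z :: complex by (cases "z = 0") simp_all
    ultimately show ?thesis using that by (simp add: nn_integral_L2_fun ennreal_leI power_mono)
  qed
  then show ?thesis using True by (intro exI[of _ 1]) auto
next
  case False
  then have \<sigma>': "0 < \<sigma>" using \<sigma> by simp
  obtain C where C: "C > 0" and Cb: "\<And>u::'a L2. u \<in> hom_Hs \<sigma> \<Longrightarrow> norm_hom_Hs \<sigma> u \<le> 1 \<Longrightarrow>
     (\<integral>\<^sup>+x. ennreal (norm (L2_fun u x) powr r) \<partial>lborel) \<le> ennreal C"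
    using Sobolev_normalised[OF \<sigma>' \<sigma>(2)] unfolding r_def by blast
  have r: "r > 0" unfolding r_def using \<sigma> by simp
  have "(\<integral>\<^sup>+x. ennreal (norm (L2_fun u x) powr r) \<partial>lborel) \<le> ennreal ((C powr (1 / r) * A) powr r)"
    if A: "A > 0" and u: "u \<in> hom_Hs \<sigma>" "norm_hom_Hs \<sigma> u \<le> A" for A and u :: "'a L2"
  proof -
    define v where "v = (1 / A) *\<^sub>R u"
    have m: "(\<lambda>\<xi>::'a. norm \<xi> powr \<sigma>) \<in> borel_measurable borel" by measurable
    have uw: "u \<in> weighted_space (\<lambda>\<xi>. norm \<xi> powr \<sigma>)" using u(1) by (simp add: hom_Hs_def)
    note vw = weighted_space_scaleR[OF m uw, of "1 / A", folded v_def]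
    have "norm_hom_Hs \<sigma> v = 1 / A * norm_hom_Hs \<sigma> u"
      using norm_fourier_multiplier[OF uw] norm_fourier_multiplier[OF vw(1)] A
        by (simp add: norm_hom_Hs_def vw(2))
    also have "\<dots> \<le> 1" using u(2) A by simp
    finally have vb: "(\<integral>\<^sup>+x. ennreal (norm (L2_fun v x) powr r) \<partial>lborel) \<le> ennreal C"
      using vw(1) by (intro Cb) (simp_all add: hom_Hs_def)
    have "AE x in lborel. ennreal (norm (L2_fun u x) powr r)
      = ennreal (A powr r) * ennreal (norm (L2_fun v x) powr r)"
      using L2_fun_scaleR[where c="1 / A" and u=u]
    proof eventually_elim
      case (elim x)
      then have "norm (L2_fun u x) = A * norm (L2_fun v x)" using A by (simp add: v_def)
      then show ?case by (simp add: powr_mult ennreal_mult)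
    qed
    then have "(\<integral>\<^sup>+x. ennreal (norm (L2_fun u x) powr r) \<partial>lborel)
      = (\<integral>\<^sup>+x. ennreal (A powr r) * ennreal (norm (L2_fun v x) powr r) \<partial>lborel)"
      by (rule nn_integral_cong_AE)
    also have "\<dots> = ennreal (A powr r) * (\<integral>\<^sup>+x. ennreal (norm (L2_fun v x) powr r) \<partial>lborel)"
      by (rule nn_integral_cmult) measurable
    also have "\<dots> \<le> ennreal (A powr r) * ennreal C" by (intro mult_left_mono vb) simp
    also have "\<dots> = ennreal ((C powr (1 / r) * A) powr r)"
      using C r A by (simp add: powr_mult powr_powr ennreal_mult[symmetric] mult.commute)
    finally show ?thesis .
  qed
  then show ?thesis using C False by (intro exI[of _ "C powr (1 / r)"]) auto
qed

text \<open>\<sigma> is the order whose Sobolev exponent is \<open>r\<close>; \<sigma> \<le> s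
  allows the weight to control it, and \<open>norm_hom_Hs_le\<close> yields the gain
  h^(-\<sigma>/2).\<close>

lemma Lr_bound:
  assumes r: "r \<ge> 2" and \<sigma>s: "real DIM('a) / 2 - real DIM('a) / r \<le> s" and s: "s \<ge> 0"
  defines "\<sigma> \<equiv> real DIM('a) / 2 - real DIM('a) / r"
  shows "\<exists>C>0. \<forall>h\<ge>1. \<forall>M>0. \<forall>u::'a::euclidean_space L2. u \<in> Hs s \<and> nH s h u \<le> M \<longrightarrow>
     (\<integral>\<^sup>+x. ennreal (norm (L2_fun u x) powr r) \<partial>lborel) \<le> ennreal
       ((C * (h powr (- \<sigma> / 2) * M)) powr r)"
proof -
  let ?n = "real DIM('a)"
  have n: "?n > 0" by simp
  have \<sigma>: "0 \<le> \<sigma>" "\<sigma> < ?n / 2" "\<sigma> \<le> s"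
    using r n \<sigma>s unfolding \<sigma>_def by (auto simp: field_simps)
  have "?n - 2 * \<sigma> = 2 * ?n / r" unfolding \<sigma>_def by simp
  then have req: "2 * ?n / (?n - 2 * \<sigma>) = r" using r n by simp
  obtain C where C: "C > 0" and Cb: "\<And>A u::'a L2. A > 0 \<Longrightarrow> u \<in> hom_Hs \<sigma> \<Longrightarrow> norm_hom_Hs \<sigma> u \<le> A
    \<Longrightarrow> norm u \<le> (if \<sigma> = 0 then A else norm u) \<Longrightarrow>
     (\<integral>\<^sup>+x. ennreal (norm (L2_fun u x) powr r) \<partial>lborel) \<le> ennreal ((C * A) powr r)"
    using Lr_hom_bound[OF \<sigma>(1,2)] unfolding req by metis
  have "(\<integral>\<^sup>+x. ennreal (norm (L2_fun u x) powr r) \<partial>lborel)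
    \<le> ennreal ((C * (h powr (- \<sigma> / 2) * M)) powr r)"
    if h: "h \<ge> 1" and M: "M > 0" and u: "u \<in> Hs s" "nH s h u \<le> M" for h M and u :: "'a L2"
  proof (rule Cb)
    show "h powr (- \<sigma> / 2) * M > 0" using h M by simp
    show "u \<in> hom_Hs \<sigma>" by (rule norm_hom_Hs_le(1)[OF u(1) \<sigma>(1,3) h])
    show "norm_hom_Hs \<sigma> u \<le> h powr (- \<sigma> / 2) * M"
      using norm_hom_Hs_le(2)[OF u(1) \<sigma>(1,3) h] mult_left_mono[OF u(2), of "h powr (- \<sigma> / 2)"]
        by simp
    show "norm u \<le> (if \<sigma> = 0 then h powr (- \<sigma> / 2) * M else norm u)"
      using norm_le_nH[OF u(1) s h] u(2) h by simp
  qed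
  with C show ?thesis by blast
qed

text \<open>Mean value theorem, with t^(p-1) nondecreasing. The sum of both powers removes the
  distinction which argument is the larger.\<close>

lemma powr_diff_bound:
  fixes x y p :: real
  assumes "x \<ge> 0" "y \<ge> 0" "p \<ge> 1"
  shows "\<bar>x powr p - y powr p\<bar> \<le> p * \<bar>x - y\<bar> * (x powr (p - 1) + y powr (p - 1))"
proof -
  have aux: "x powr p - y powr p \<le> p * (x - y) * x powr (p - 1)" if xy: "0 \<le> y" "y < x"
    for x y :: real
  proof -
    have "\<exists>l z. y < z \<and> z < x \<and> ((\<lambda>t. t powr p) has_real_derivative l) (at z)
      \<and> x powr p - y powr p = (x - y) * l"
    proof (rule MVT[OF xy(2)])
      show "continuous_on {y..x} (\<lambda>t. t powr p)"
        using xy assms(3) by (intro continuous_on_powr' continuous_intros) auto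
      show "(\<lambda>t. t powr p) differentiable (at z)" if "y < z" "z < x" for z
        using has_real_derivative_powr[of z p] that xy by (auto simp: real_differentiable_def)
    qed
    then obtain l z where z: "y < z" "z < x" "((\<lambda>t. t powr p) has_real_derivative l) (at z)"
      "x powr p - y powr p = (x - y) * l"
      by blast
    have "l = p * z powr (p - 1)"
      using has_real_derivative_powr[of z p] z xy by (intro DERIV_unique[OF z(3)]) auto
    also have "\<dots> \<le> p * x powr (p - 1)"
      using z xy assms(3) by (intro mult_left_mono powr_mono2) auto
    finally have "(x - y) * l \<le> (x - y) * (p * x powr (p - 1))"
      using xy by (intro mult_left_mono) auto
    then show ?thesis using z(4) by (simp add: mult_ac)
  qed
  consider "x = y" | "y < x" | "x < y" by linarith
  then show ?thesis
  proof cases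
    case 2
    have "y powr p \<le> x powr p" using 2 assms by (intro powr_mono2) auto
    moreover have "p * (x - y) * x powr (p - 1) \<le> p * (x - y) * (x powr (p - 1) + y powr (p - 1))"
      using 2 assms by (intro mult_left_mono) auto
    ultimately show ?thesis using order_trans[OF aux[OF assms(2) 2]] 2 by simp
  next
    case 3
    have "x powr p \<le> y powr p" using 3 assms by (intro powr_mono2) auto
    moreover have "p * (y - x) * y powr (p - 1) \<le> p * (y - x) * (x powr (p - 1) + y powr (p - 1))"
      using 3 assms by (intro mult_left_mono) auto
    ultimately show ?thesis using order_trans[OF aux[OF assms(1) 3]] 3 by (simp add: add.commute)
  qed simp
qed

section \<open>The nonlinearity\<close>

text \<open>Hoelder's inequality with a non-optimal constant: after normalisation, a product of powers with
  total weight 1 is at most the largest of the factors.\<close>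

lemma powr_weighted_le:
  fixes x M a k :: real
  assumes "x \<ge> 0" "x powr k \<le> M" "k > 0" "a \<ge> 0"
  shows "x powr a \<le> M powr (a / k)"
proof -
  have "x powr a = (x powr k) powr (a / k)" using assms by (simp add: powr_powr)
  also have "\<dots> \<le> M powr (a / k)" using assms by (intro powr_mono2) auto
  finally show ?thesis .
qed

lemma triple_product_le:
  fixes x y z k m p :: real
  assumes "x \<ge> 0" "y \<ge> 0" "z \<ge> 0" "k > 0" "m > 0" "p \<ge> 1" and e: "1 / k + p / m = 1"
  shows "x * (y * z powr (p - 1)) \<le> x powr k + y powr m + z powr m"
proof -
  define M where "M = x powr k + y powr m + z powr m"
  have M: "x powr k \<le> M" "y powr m \<le> M" "z powr m \<le> M" by (auto simp: M_def)
  then have M0: "M \<ge> 0" using powr_ge_zero[of x k] by linarith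
  have "x * (y * z powr (p - 1)) = x powr 1 * (y powr 1 * z powr (p - 1))" using assms by simp
  also have "\<dots> \<le> M powr (1 / k) * (M powr (1 / m) * M powr ((p - 1) / m))"
    using assms M by (intro mult_mono powr_weighted_le) auto
  also have "\<dots> = M powr (1 / k + (1 / m + (p - 1) / m))" by (simp add: powr_add)
  also have "1 / k + (1 / m + (p - 1) / m) = 1" using e by (simp add: add_divide_distrib[symmetric])
  also have "M powr 1 = M" using M0 by simp
  finally show ?thesis unfolding M_def .
qed

lemma square_product_le:
  fixes y z p :: real
  assumes "y \<ge> 0" "z \<ge> 0" "p \<ge> 1"
  shows "(y * z powr (p - 1))\<^sup>2 \<le> y powr (2 * p) + z powr (2 * p)"
proof -
  define M where "M = y powr (2 * p) + z powr (2 * p)"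
  have M: "y powr (2 * p) \<le> M" "z powr (2 * p) \<le> M" by (auto simp: M_def)
  then have M0: "M \<ge> 0" using powr_ge_zero[of y "2 * p"] by linarith
  have "y * z powr (p - 1) = y powr 1 * z powr (p - 1)" using assms by simp
  also have "\<dots> \<le> M powr (1 / (2 * p)) * M powr ((p - 1) / (2 * p))"
    using assms M by (intro mult_mono powr_weighted_le) auto
  also have "\<dots> = M powr (1 / 2)"
    using assms by (simp add: powr_add[symmetric] add_divide_distrib[symmetric])
  finally have "(y * z powr (p - 1))\<^sup>2 \<le> (M powr (1 / 2))\<^sup>2"
    using assms by (intro power_mono) auto
  also have "(M powr (1 / 2))\<^sup>2 = M" using M0 by (simp add: powr_half_sqrt)
  finally show ?thesis unfolding M_def .
qed

lemma nn_integral_normalise: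
  fixes f :: "'a \<Rightarrow> real"
  assumes [measurable]: "f \<in> borel_measurable M" and nn: "\<And>x. f x \<ge> 0"
    and le: "(\<integral>\<^sup>+x. ennreal (f x powr k) \<partial>M) \<le> ennreal (A powr k)" and A: "A > 0"
  shows "(\<integral>\<^sup>+x. ennreal ((f x / A) powr k) \<partial>M) \<le> 1"
proof -
  have "(\<integral>\<^sup>+x. ennreal ((f x / A) powr k) \<partial>M)
    = (\<integral>\<^sup>+x. ennreal (1 / A powr k) * ennreal (f x powr k) \<partial>M)"
    using A nn by (intro nn_integral_cong) (simp add: powr_divide ennreal_mult[symmetric])
  also have "\<dots> = ennreal (1 / A powr k) * (\<integral>\<^sup>+x. ennreal (f x powr k) \<partial>M)"
    by (rule nn_integral_cmult) measurable
  also have "\<dots> \<le> ennreal (1 / A powr k) * ennreal (A powr k)" by (intro mult_left_mono le) simp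
  also have "\<dots> = 1" using A by (simp add: ennreal_mult[symmetric])
  finally show ?thesis .
qed

text \<open>In the application \<open>f\<close> is a test function in L^k, \<open>g\<close> a
  difference in L^m, and \<open>z\<close> an amplitude in L^m that enters with power p-1. After
  division by \<open>A\<close>, \<open>B\<close>, \<open>D\<close> the product is at most the sum of
  three powers of integral at most 1; hence the constant 3.\<close>

lemma Holder_triple:
  fixes f g z :: "'a \<Rightarrow> real"
  assumes [measurable]: "f \<in> borel_measurable M" "g \<in> borel_measurable M" "z \<in> borel_measurable M"
    and nn: "\<And>x. f x \<ge> 0" "\<And>x. g x \<ge> 0" "\<And>x. z x \<ge> 0"
    and e: "k > 0" "m > 0" "p \<ge> 1" "1 / k + p / m = 1" and pos: "A > 0" "B > 0" "D > 0"
    and f: "(\<integral>\<^sup>+x. ennreal (f x powr k) \<partial>M) \<le> ennreal (A powr k)"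
    and g: "(\<integral>\<^sup>+x. ennreal (g x powr m) \<partial>M) \<le> ennreal (B powr m)"
    and z: "(\<integral>\<^sup>+x. ennreal (z x powr m) \<partial>M) \<le> ennreal (D powr m)"
  shows "(\<integral>\<^sup>+x. ennreal (f x * (g x * z x powr (p - 1))) \<partial>M)
    \<le> ennreal (3 * (A * (B * D powr (p - 1))))"
proof -
  let ?c = "A * (B * D powr (p - 1))"
  have c: "?c > 0" using pos by simp
  have "(\<integral>\<^sup>+x. ennreal (f x * (g x * z x powr (p - 1))) \<partial>M) \<le>
      (\<integral>\<^sup>+x. ennreal ?c * (ennreal ((f x / A) powr k) + ennreal ((g x / B) powr m) + ennreal
        ((z x / D) powr m)) \<partial>M)"
  proof (rule nn_integral_mono)
    fix x
    have "(f x / A) * ((g x / B) * (z x / D) powr (p - 1)) \<le> (f x / A) powr k + (g x / B) powr m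
      + (z x / D) powr m"
      using nn pos e by (intro triple_product_le) auto
    moreover have "f x * (g x * z x powr (p - 1))
      = ?c * ((f x / A) * ((g x / B) * (z x / D) powr (p - 1)))"
      using nn pos by (simp add: powr_divide)
    ultimately have "f x * (g x * z x powr (p - 1))
      \<le> ?c * ((f x / A) powr k + (g x / B) powr m + (z x / D) powr m)"
      using c by (simp only: mult_left_mono less_imp_le)
    then have "ennreal (f x * (g x * z x powr (p - 1)))
      \<le> ennreal (?c * ((f x / A) powr k + (g x / B) powr m + (z x / D) powr m))"
      by (rule ennreal_leI)
    also have "\<dots> = ennreal ?c * (ennreal ((f x / A) powr k) + ennreal ((g x / B) powr m)
      + ennreal ((z x / D) powr m))"
      using c by (simp only: ennreal_mult' ennreal_plus powr_ge_zero add_nonneg_nonneg less_imp_le)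
    finally show "ennreal (f x * (g x * z x powr (p - 1)))
      \<le> ennreal ?c * (ennreal ((f x / A) powr k) + ennreal ((g x / B) powr m) + ennreal
      ((z x / D) powr m))" .
  qed
  also have "\<dots> = ennreal ?c * ((\<integral>\<^sup>+x. ennreal ((f x / A) powr k) \<partial>M)
    + (\<integral>\<^sup>+x. ennreal ((g x / B) powr m) \<partial>M) + (\<integral>\<^sup>+x. ennreal ((z x / D) powr m) \<partial>M))"
    by (subst nn_integral_cmult, measurable) (subst nn_integral_add, measurable)+
  also have "\<dots> \<le> ennreal ?c * (1 + 1 + 1)"
    by (intro mult_left_mono add_mono nn_integral_normalise nn f g z pos) auto
  also have "(1 + 1 + 1 :: ennreal) = ennreal 3" by simp
  also have "ennreal ?c * ennreal 3 = ennreal (3 * ?c)"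
    using c by (subst ennreal_mult[symmetric]) (auto simp: mult.commute)
  finally show ?thesis .
qed

lemma Holder_square:
  fixes g z :: "'a \<Rightarrow> real"
  assumes [measurable]: "g \<in> borel_measurable M" "z \<in> borel_measurable M"
    and nn: "\<And>x. g x \<ge> 0" "\<And>x. z x \<ge> 0" and e: "p \<ge> 1" and pos: "B > 0" "D > 0"
    and g: "(\<integral>\<^sup>+x. ennreal (g x powr (2 * p)) \<partial>M) \<le> ennreal (B powr (2 * p))"
    and z: "(\<integral>\<^sup>+x. ennreal (z x powr (2 * p)) \<partial>M) \<le> ennreal (D powr (2 * p))"
  shows "(\<integral>\<^sup>+x. ennreal ((g x * z x powr (p - 1))\<^sup>2) \<partial>M) \<le> ennreal (2 * (B * D powr (p - 1))\<^sup>2)"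
proof -
  let ?c = "(B * D powr (p - 1))\<^sup>2"
  have c: "?c > 0" using pos by simp
  have "(\<integral>\<^sup>+x. ennreal ((g x * z x powr (p - 1))\<^sup>2) \<partial>M) \<le>
      (\<integral>\<^sup>+x. ennreal ?c * (ennreal ((g x / B) powr (2 * p)) + ennreal ((z x / D) powr (2 * p))) \<partial>M)"
  proof (rule nn_integral_mono)
    fix x
    have "((g x / B) * (z x / D) powr (p - 1))\<^sup>2 \<le> (g x / B) powr (2 * p) + (z x / D) powr (2 * p)"
      using nn pos e by (intro square_product_le) auto
    moreover have "g x * z x powr (p - 1)
      = (B * D powr (p - 1)) * ((g x / B) * (z x / D) powr (p - 1))"
      using nn pos by (simp add: powr_divide)
    then have "(g x * z x powr (p - 1))\<^sup>2 = ?c * ((g x / B) * (z x / D) powr (p - 1))\<^sup>2"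
      by (simp only: power_mult_distrib)
    ultimately have "(g x * z x powr (p - 1))\<^sup>2
      \<le> ?c * ((g x / B) powr (2 * p) + (z x / D) powr (2 * p))"
      using c by (simp only: mult_left_mono less_imp_le)
    then have "ennreal ((g x * z x powr (p - 1))\<^sup>2)
      \<le> ennreal (?c * ((g x / B) powr (2 * p) + (z x / D) powr (2 * p)))"
      by (rule ennreal_leI)
    also have "\<dots> = ennreal ?c * (ennreal ((g x / B) powr (2 * p))
      + ennreal ((z x / D) powr (2 * p)))"
      using c by (simp only: ennreal_mult' ennreal_plus powr_ge_zero add_nonneg_nonneg less_imp_le)
    finally show "ennreal ((g x * z x powr (p - 1))\<^sup>2)
      \<le> ennreal ?c * (ennreal ((g x / B) powr (2 * p)) + ennreal ((z x / D) powr (2 * p)))" .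
  qed
  also have "\<dots> = ennreal ?c * ((\<integral>\<^sup>+x. ennreal ((g x / B) powr (2 * p)) \<partial>M)
    + (\<integral>\<^sup>+x. ennreal ((z x / D) powr (2 * p)) \<partial>M))"
    by (subst nn_integral_cmult, measurable) (subst nn_integral_add, measurable)
  also have "\<dots> \<le> ennreal ?c * (1 + 1)"
    by (intro mult_left_mono add_mono nn_integral_normalise nn g z pos) auto
  also have "(1 + 1 :: ennreal) = ennreal 2" by simp
  also have "ennreal ?c * ennreal 2 = ennreal (2 * ?c)"
    using c by (subst ennreal_mult[symmetric]) (auto simp: mult.commute)
  finally show ?thesis .
qed

section \<open>Difference estimates for the nonlinearity in L2 and in negative order\<close>

definition nonlin :: "real \<Rightarrow> 'a::euclidean_space L2 \<Rightarrow> 'a L2" where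
  "nonlin p u = L2_class (abs_powr p u)"

lemma abs_powr_measurable [measurable]: "abs_powr p u \<in> borel_measurable borel"
  unfolding abs_powr_def[abs_def] by measurable

lemma multiplier_selfadjoint:
  assumes m: "m \<in> borel_measurable borel" and B: "\<And>\<xi>. \<bar>m \<xi>\<bar> \<le> B"
  shows "inner (fourier_multiplier m u) v = inner u (fourier_multiplier m v)"
proof -
  note b = bounded_multiplier(1)[OF m B]
  have "inner (fourier (fourier_multiplier m u)) (fourier v)
    = inner (fourier u) (fourier (fourier_multiplier m v))"
    unfolding inner_L2_fun
  proof (rule integral_cong_AE)
    show "AE \<xi> in lborel. L2_fun (fourier (fourier_multiplier m u)) \<xi> \<bullet> L2_fun (fourier v) \<xi> =
       L2_fun (fourier u) \<xi> \<bullet> L2_fun (fourier (fourier_multiplier m v)) \<xi>"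
      using fourier_multiplier_AE[OF b[of u]] fourier_multiplier_AE[OF b[of v]]
      by eventually_elim (simp add: inner_complex_def algebra_simps)
  qed measurable
  then show ?thesis by simp
qed

text \<open>The hypothesis on \<open>s\<close> says that n/2 - n/(2p), the order with Sobolev
  exponent 2p, is at most \<open>s\<close>. It is the upper bound p \<le> n/(n-2s) in a form that
  needs no distinction on the sign of n-2s.\<close>

lemma nonlin_facts:
  fixes p s :: real
  assumes p: "p > 1" and ps: "real DIM('a) * (p - 1) / (2 * p) \<le> s"
    and u: "(u::'a::euclidean_space L2) \<in> Hs s"
  shows "square_integrable (abs_powr p u)"
proof -
  have s: "s \<ge> 0" using ps p by (smt (verit) divide_nonneg_nonneg mult_nonneg_nonneg
    of_nat_0_le_iff)
  have "real DIM('a) / 2 - real DIM('a) / (2 * p) \<le> s"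
    using ps p by (simp add: field_simps)
  from Lr_bound[OF _ this s] p obtain C
    where C: "\<And>h M u. h \<ge> 1 \<Longrightarrow> M > 0 \<Longrightarrow> (u::'a L2) \<in> Hs s \<Longrightarrow> nH s h u \<le> M \<Longrightarrow>
     (\<integral>\<^sup>+x. ennreal (norm (L2_fun u x) powr (2 * p)) \<partial>lborel) \<le> ennreal
       ((C * (h powr (- (real DIM('a) / 2 - real DIM('a) / (2 * p)) / 2) * M)) powr (2 * p))"
    by fastforce
  have "(\<integral>\<^sup>+x. ennreal ((norm (abs_powr p u x))\<^sup>2) \<partial>lborel)
    = (\<integral>\<^sup>+x. ennreal (norm (L2_fun u x) powr (2 * p)) \<partial>lborel)"
    by (intro nn_integral_cong) (simp add: abs_powr_def power2_eq_square powr_add[symmetric])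
  also have "\<dots> < \<infinity>"
  proof (rule le_less_trans)
    \<comment> \<open>The Sobolev bound is stated for positive \<open>M\<close>, and the norm of
      \<open>u\<close> may vanish.\<close>
    have "nH s 1 u + 1 > 0" by (intro add_nonneg_pos) auto
    then show "(\<integral>\<^sup>+x. ennreal (norm (L2_fun u x) powr (2 * p)) \<partial>lborel) \<le>
        ennreal ((C * (1 powr (- (real DIM('a) / 2 - real DIM('a) / (2 * p)) / 2) * (nH s 1 u + 1)))
          powr (2 * p))"
      by (intro C u) auto
  qed simp
  finally show ?thesis by (simp add: square_integrable_iff_nn_integral)
qed

lemma nonlin_diff_AE:
  fixes u v :: "'a::euclidean_space L2"
  assumes "square_integrable (abs_powr p u)" "square_integrable (abs_powr p v)" and p: "p \<ge> 1"
  shows "AE x in lborel. norm (L2_fun (nonlin p u - nonlin p v) x) \<le>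
    p * (norm (L2_fun (u - v) x) * norm (L2_fun u x) powr (p - 1)) + p *
      (norm (L2_fun (u - v) x) * norm (L2_fun v x) powr (p - 1))"
  using L2_fun_diff[of "nonlin p u" "nonlin p v"] L2_fun_class[OF assms(1)]
    L2_fun_class[OF assms(2)] L2_fun_diff[of u v]
proof eventually_elim
  case (elim x)
  have "norm (L2_fun (nonlin p u - nonlin p v) x) = \<bar>norm (L2_fun u x) powr p
    - norm (L2_fun v x) powr p\<bar>"
    using elim by (simp add: nonlin_def abs_powr_def of_real_diff[symmetric] del: of_real_diff)
  also have "\<dots> \<le> p * \<bar>norm (L2_fun u x)
    - norm (L2_fun v x)\<bar> * (norm (L2_fun u x) powr (p - 1) + norm (L2_fun v x) powr (p - 1))"
    by (intro powr_diff_bound p) auto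
  also have "\<dots> \<le> p * norm (L2_fun (u - v) x) * (norm (L2_fun u x) powr (p - 1)
    + norm (L2_fun v x) powr (p - 1))"
    using p norm_triangle_ineq3[of "L2_fun u x" "L2_fun v x"] elim
    by (intro mult_right_mono mult_left_mono) auto
  finally show ?case by (simp add: algebra_simps)
qed

text \<open>In L2 the product of |u-v| with |u|^(p-1) is controlled by norms in L^(2p). The total
  homogeneity is p, each degree contributes h^(-\<sigma>/2), and p \<sigma> = n(p-1)/2; this gives
  the exponent n(p-1)/4. The difference has its own bound \<open>d\<close>, so that the estimate is
  linear in it and can serve for a contraction.\<close>

lemma nonlin_L2_estimate:
  fixes p s :: real
  assumes p: "p > 1" and ps: "real DIM('a) * (p - 1) / (2 * p) \<le> s"
  shows "\<exists>C>0. \<forall>h\<ge>1. \<forall>M>0. \<forall>d>0. \<forall>u v::'a::euclidean_space L2.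
     u \<in> Hs s \<and> v \<in> Hs s \<and> nH s h u \<le> M \<and> nH s h v \<le> M \<and> nH s h (u - v) \<le> d \<longrightarrow>
     norm (nonlin p u - nonlin p v) \<le> C * h powr (- (real DIM('a) * (p - 1) / 4)) *
       (d * M powr (p - 1))"
proof -
  let ?n = "real DIM('a)"
  have s: "s \<ge> 0" using ps p by (smt (verit) divide_nonneg_nonneg mult_nonneg_nonneg
    of_nat_0_le_iff)
  define \<sigma> where "\<sigma> = ?n / 2 - ?n / (2 * p)"
  have \<sigma>s: "\<sigma> \<le> s" using ps p by (simp add: \<sigma>_def field_simps)
  have \<sigma>p: "\<sigma> * p = ?n * (p - 1) / 2" using p by (simp add: \<sigma>_def field_simps)
  obtain C where C: "C > 0" and Cb: "\<And>h M u. h \<ge> 1 \<Longrightarrow> M > 0 \<Longrightarrow> (u::'a L2) \<in> Hs s \<Longrightarrow> nH s h u \<le> M \<Longrightarrow>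
     (\<integral>\<^sup>+x. ennreal (norm (L2_fun u x) powr (2 * p)) \<partial>lborel) \<le> ennreal
       ((C * (h powr (- \<sigma> / 2) * M)) powr (2 * p))"
    using Lr_bound[of "2 * p" s, where 'a='a] p \<sigma>s s unfolding \<sigma>_def by auto
  define K where "K = 2 * p * sqrt 2 * C powr p"
  have K: "K > 0" using p C by (simp add: K_def)
  have "norm (nonlin p u - nonlin p v) \<le> K * h powr (- (?n * (p - 1) / 4)) * (d * M powr (p - 1))"
    if h: "h \<ge> 1" and M: "M > 0" and d: "d > 0" and u: "u \<in> Hs s" and v: "v \<in> Hs s"
      and nu: "nH s h u \<le> M" and nv: "nH s h v \<le> M" and nd: "nH s h (u - v) \<le> d" for h M d
        and u v :: "'a L2"
  proof -
    let ?w = "u - v"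
    have w: "?w \<in> Hs s" using weighted_space_diff(1)[OF wt_measurable[of s 1]] u v
      by (simp add: Hs_eq)
    define q where "q = h powr (- \<sigma> / 2)"
    have q: "q > 0" using h by (simp add: q_def)
    define B where "B = (C * (q * d)) * (C * (q * M)) powr (p - 1)"
    have B0: "B \<ge> 0" using C q d by (simp add: B_def)
    define F where "F z x = complex_of_real (norm (L2_fun ?w x) * norm (L2_fun z x) powr (p - 1))"
      for z x
    have Fm [measurable]: "F z \<in> borel_measurable borel" for z unfolding F_def[abs_def]
      by measurable
    have Fb: "square_integrable (F z) \<and> norm (L2_class (F z)) \<le> sqrt 2 * B"
      if z: "z \<in> Hs s" "nH s h z \<le> M" for z
    proof -
      have "(\<integral>\<^sup>+x. ennreal ((norm (L2_fun ?w x) * norm (L2_fun z x) powr (p - 1))\<^sup>2) \<partial>lborel)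
        \<le> ennreal (2 * B\<^sup>2)"
        unfolding B_def
        by (rule Holder_square) (use p C q d M Cb[OF h d w nd] Cb[OF h M z] in \<open>simp_all add:
          q_def\<close>)
      then have "(\<integral>\<^sup>+x. ennreal ((norm (F z x))\<^sup>2) \<partial>lborel) \<le> ennreal ((sqrt 2 * B)\<^sup>2)"
        by (simp only: F_def norm_of_real power2_abs) (simp add: power_mult_distrib)
      from norm_L2_class_le[OF Fm this] B0 show ?thesis by auto
    qed
    note su = nonlin_facts[OF p ps u] and sv = nonlin_facts[OF p ps v]
    define G where "G x = p *\<^sub>R F u x + p *\<^sub>R F v x" for x
    have sG: "square_integrable G"
      unfolding G_def[abs_def] using Fb[OF u nu] Fb[OF v nv]
        by (intro square_integrable_add square_integrable_scaleR) auto
    have "AE x in lborel. norm (L2_fun (nonlin p u - nonlin p v) x) \<le> norm (G x)"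
      using nonlin_diff_AE[OF su sv less_imp_le[OF p]]
    proof eventually_elim
      case (elim x)
      have "G x = complex_of_real (p * (norm (L2_fun ?w x) * norm (L2_fun u x) powr (p - 1))
        + p * (norm (L2_fun ?w x) * norm (L2_fun v x) powr (p - 1)))"
        by (simp add: G_def F_def scaleR_conv_of_real)
      then have "norm (G x) = p * (norm (L2_fun ?w x) * norm (L2_fun u x) powr (p - 1))
        + p * (norm (L2_fun ?w x) * norm (L2_fun v x) powr (p - 1))"
        using p by (simp only: norm_of_real) (simp add: add_nonneg_nonneg)
      with elim show ?case by simp
    qed
    from norm_L2_mono(2)[OF sG L2_fun_measurable this]
    have "norm (nonlin p u - nonlin p v) \<le> norm (L2_class G)" by simp
    also have "L2_class G = p *\<^sub>R L2_class (F u) + p *\<^sub>R L2_class (F v)"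
      unfolding G_def[abs_def] using Fb[OF u nu] Fb[OF v nv]
      by (simp add: L2_class_add L2_class_scaleR square_integrable_scaleR)
    also have "norm \<dots> \<le> p * norm (L2_class (F u)) + p * norm (L2_class (F v))"
      using p by (intro norm_triangle_le) simp
    also have "\<dots> \<le> p * (sqrt 2 * B) + p * (sqrt 2 * B)"
      using p Fb[OF u nu] Fb[OF v nv] by (intro add_mono mult_left_mono) auto
    also have "\<dots> = 2 * p * sqrt 2 * B" by simp
    also have "B = C powr p * q powr p * (d * M powr (p - 1))"
    proof -
      have "C powr p = C * C powr (p - 1)" "q powr p = q * q powr (p - 1)"
        using C q powr_add[of C 1 "p - 1"] powr_add[of q 1 "p - 1"] by simp_all
      then show ?thesis unfolding B_def by (simp add: powr_mult)
    qed
    also have "q powr p = h powr (- (?n * (p - 1) / 4))"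
      unfolding q_def powr_powr using \<sigma>p by (intro arg_cong[where f="\<lambda>a. h powr a"]) simp
    finally show ?thesis by (simp add: K_def mult.assoc)
  qed
  with K show ?thesis by blast
qed

text \<open>Membership in the space of negative order is not known beforehand. Cutting the weight
  off near the origin makes the symbol bounded, and Fatou removes the cutoff.\<close>

lemma weighted_norm_limit:
  fixes f :: "'a::euclidean_space L2"
  assumes B: "B \<ge> 0"
    and b: "\<And>k::nat. norm (fourier_multiplier (\<lambda>\<xi>. indicator {\<xi>. 1 / real (Suc k) \<le> norm \<xi>} \<xi>
      * norm \<xi> powr (- a)) f) \<le> B"
    and a: "a > 0"
  shows "f \<in> hom_Hs (- a)" "norm_hom_Hs (- a) f \<le> B"
proof -
  let ?m = "\<lambda>k \<xi>::'a. indicator {\<xi>. 1 / real (Suc k) \<le> norm \<xi>} \<xi> * norm \<xi> powr (- a)"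
  let ?F = "L2_fun (fourier f)"
  have mm [measurable]: "?m k \<in> borel_measurable borel" for k by measurable
  have mb: "\<bar>?m k \<xi>\<bar> \<le> (1 / real (Suc k)) powr (- a)" for k \<xi>
    using a by (auto simp: indicator_def intro!: powr_mono2')
  have "(\<integral>\<^sup>+\<xi>. ennreal ((norm (of_real (norm \<xi> powr (- a)) * ?F \<xi>))\<^sup>2) \<partial>lborel) =
     (\<integral>\<^sup>+\<xi>. liminf (\<lambda>k. ennreal ((norm (of_real (?m k \<xi>) * ?F \<xi>))\<^sup>2)) \<partial>lborel)"
  proof (rule nn_integral_cong_AE, use AE_lborel_singleton[of "0::'a"] in eventually_elim)
    fix \<xi> :: 'a assume \<xi>: "\<xi> \<noteq> 0"
    then obtain k0 where k0: "1 / real (Suc k0) < norm \<xi>"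
      using reals_Archimedean[of "norm \<xi>"] by (auto simp: inverse_eq_divide)
    have "\<forall>\<^sub>F k in sequentially. ennreal ((norm (of_real (?m k \<xi>) * ?F \<xi>))\<^sup>2)
      = ennreal ((norm (of_real (norm \<xi> powr (- a)) * ?F \<xi>))\<^sup>2)"
      using eventually_ge_at_top[of k0]
    proof eventually_elim
      case (elim k)
      then have "1 / real (Suc k) \<le> 1 / real (Suc k0)" by (intro divide_left_mono) auto
      then show ?case using k0 by simp
    qed
    then have "(\<lambda>k. ennreal ((norm (of_real (?m k \<xi>) * ?F \<xi>))\<^sup>2))
      \<longlonglongrightarrow> ennreal ((norm (of_real (norm \<xi> powr (- a)) * ?F \<xi>))\<^sup>2)"
      by (rule tendsto_eventually)
    from lim_imp_Liminf[OF _ this]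
    show "ennreal ((norm (of_real (norm \<xi> powr (- a)) * ?F \<xi>))\<^sup>2)
      = liminf (\<lambda>k. ennreal ((norm (of_real (?m k \<xi>) * ?F \<xi>))\<^sup>2))"
      by simp
  qed
  also have "\<dots> \<le> liminf (\<lambda>k. \<integral>\<^sup>+\<xi>. ennreal ((norm (of_real (?m k \<xi>) * ?F \<xi>))\<^sup>2) \<partial>lborel)"
    by (intro nn_integral_liminf) measurable
  also have "\<dots> \<le> ennreal (B\<^sup>2)"
  proof (rule Liminf_le)
    have "(\<integral>\<^sup>+\<xi>. ennreal ((norm (of_real (?m k \<xi>) * ?F \<xi>))\<^sup>2) \<partial>lborel) \<le> ennreal (B\<^sup>2)" for k
    proof -
      have w: "f \<in> weighted_space (?m k)" by (rule bounded_multiplier(1)[OF mm mb])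
      have "(\<integral>\<^sup>+\<xi>. ennreal ((norm (of_real (?m k \<xi>) * ?F \<xi>))\<^sup>2) \<partial>lborel)
        = ennreal ((norm (fourier_multiplier (?m k) f))\<^sup>2)"
        unfolding norm_fourier_multiplier_class[OF w]
          by (rule nn_integral_L2_class[OF w[unfolded weighted_space_iff]])
      also have "\<dots> \<le> ennreal (B\<^sup>2)" using b[of k] by (intro ennreal_leI power_mono) auto
      finally show ?thesis .
    qed
    then show "\<forall>\<^sub>F k in sequentially. (\<integral>\<^sup>+\<xi>. ennreal ((norm (of_real (?m k \<xi>) * ?F \<xi>))\<^sup>2) \<partial>lborel)
      \<le> ennreal (B\<^sup>2)"
      by (intro always_eventually allI)
  qed simp
  finally have *: "(\<integral>\<^sup>+\<xi>. ennreal ((norm (of_real (norm \<xi> powr (- a)) * ?F \<xi>))\<^sup>2) \<partial>lborel)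
    \<le> ennreal (B\<^sup>2)" .
  have m: "(\<lambda>\<xi>. of_real (norm \<xi> powr (- a)) * ?F \<xi>) \<in> borel_measurable borel" by measurable
  note ** = norm_L2_class_le[OF m * B]
  show f: "f \<in> hom_Hs (- a)" using **(1) by (simp add: hom_Hs_def weighted_space_iff)
  then show "norm_hom_Hs (- a) f \<le> B"
    using **(2) by (simp add: hom_Hs_def norm_hom_Hs_def norm_fourier_multiplier[symmetric]
      norm_fourier_multiplier_class)
qed

lemma inner_le_nn_integral:
  assumes "(\<integral>\<^sup>+x. ennreal (norm (L2_fun g x) * norm (L2_fun f x)) \<partial>lborel) \<le> ennreal B" "B \<ge> 0"
  shows "inner g f \<le> B"
proof -
  have "ennreal (norm (inner g f)) \<le> (\<integral>\<^sup>+x. ennreal (norm (L2_fun g x \<bullet> L2_fun f x)) \<partial>lborel)"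
    unfolding inner_L2_fun by (intro integral_norm_bound_ennreal integrable_inner_L2
      square_integrable_L2_fun)
  also have "\<dots> \<le> (\<integral>\<^sup>+x. ennreal (norm (L2_fun g x) * norm (L2_fun f x)) \<partial>lborel)"
    by (intro nn_integral_mono ennreal_leI) (simp add: Cauchy_Schwarz_ineq2)
  also have "\<dots> \<le> ennreal B" by (rule assms)
  finally have "norm (inner g f) \<le> B" using assms(2) by (simp add: ennreal_le_iff)
  then show ?thesis by simp
qed

text \<open>Duality with test functions of order \<gamma>, which lie in L^k by Sobolev; Hoelder then
  asks for \<open>u\<close> and \<open>v\<close> in L^m with 1/k + p/m = 1. Here \<gamma> < n/2
  makes \<open>k\<close> finite, and \<gamma> \<le> n(p-1)/2 is the same as m \<ge> 2. The order
  \<sigma> belonging to \<open>m\<close> satisfies p \<sigma> = n(p-1)/2 - \<gamma>, so that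
  compared with the L2 bound exactly the factor h^(\<gamma>/2) is lost.\<close>

lemma nonlin_negative_estimate:
  fixes p s \<gamma> :: real
  assumes p: "p > 1" and ps: "real DIM('a) * (p - 1) / (2 * p) \<le> s"
    and \<gamma>: "0 < \<gamma>" "\<gamma> < real DIM('a) / 2" "\<gamma> \<le> real DIM('a) * (p - 1) / 2"
  shows "\<exists>C>0. \<forall>h\<ge>1. \<forall>M>0. \<forall>d>0. \<forall>u v::'a::euclidean_space L2.
     u \<in> Hs s \<and> v \<in> Hs s \<and> nH s h u \<le> M \<and> nH s h v \<le> M \<and> nH s h (u - v) \<le> d \<longrightarrow>
     nonlin p u - nonlin p v \<in> hom_Hs (- \<gamma>) \<and>
     norm_hom_Hs (- \<gamma>) (nonlin p u - nonlin p v) \<le> C * h powr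
       (- (real DIM('a) * (p - 1) / 4) + \<gamma> / 2) * (d * M powr (p - 1))"
proof -
  let ?n = "real DIM('a)"
  have n: "?n > 0" by simp
  have s: "s \<ge> 0" using ps p by (smt (verit) divide_nonneg_nonneg mult_nonneg_nonneg
    of_nat_0_le_iff)
  define k where "k = 2 * ?n / (?n - 2 * \<gamma>)"
  define m where "m = 2 * ?n * p / (?n + 2 * \<gamma>)"
  define \<sigma> where "\<sigma> = ?n / 2 - ?n / m"
  have nm: "?n / m = (?n + 2 * \<gamma>) / (2 * p)" using n p \<gamma> by (simp add: m_def field_simps)
  have k: "k > 0" unfolding k_def using \<gamma> n by simp
  have m2: "m \<ge> 2" using \<gamma> n p by (simp add: m_def field_simps)
  have e: "1 / k + p / m = 1" using n p \<gamma> by (simp add: k_def m_def field_simps)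
  have "\<sigma> \<le> ?n * (p - 1) / (2 * p)"
    using \<gamma> p by (simp add: \<sigma>_def nm field_simps)
  then have \<sigma>s: "\<sigma> \<le> s" using ps by simp
  have \<sigma>p: "\<sigma> * p = ?n * (p - 1) / 2 - \<gamma>" using p by (simp add: \<sigma>_def nm field_simps)
  obtain C1 where C1: "C1 > 0" and C1b: "\<And>A u::'a L2. A > 0 \<Longrightarrow> u \<in> hom_Hs \<gamma> \<Longrightarrow> norm_hom_Hs \<gamma> u \<le> A \<Longrightarrow>
     (\<integral>\<^sup>+x. ennreal (norm (L2_fun u x) powr k) \<partial>lborel) \<le> ennreal ((C1 * A) powr k)"
  proof -
    have ne: "(\<gamma> = 0) = False" using \<gamma> by simp
    show ?thesis
      using Lr_hom_bound[of \<gamma>, where 'a='a, folded k_def, unfolded ne if_False] \<gamma> that by auto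
  qed
  obtain C2 where C2: "C2 > 0" and C2b: "\<And>h M u. h \<ge> 1 \<Longrightarrow> M > 0 \<Longrightarrow> (u::'a L2) \<in> Hs s \<Longrightarrow> nH s h u \<le> M \<Longrightarrow>
     (\<integral>\<^sup>+x. ennreal (norm (L2_fun u x) powr m) \<partial>lborel) \<le> ennreal
       ((C2 * (h powr (- \<sigma> / 2) * M)) powr m)"
    using Lr_bound[of m s, where 'a='a] m2 \<sigma>s s unfolding \<sigma>_def by auto
  define K where "K = 6 * p * C1 * C2 powr p"
  have K: "K > 0" using p C1 C2 by (simp add: K_def)
  have "nonlin p u - nonlin p v \<in> hom_Hs (- \<gamma>) \<and>
     norm_hom_Hs (- \<gamma>) (nonlin p u - nonlin p v) \<le> K * h powr (- (?n * (p - 1) / 4) + \<gamma> / 2) *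
       (d * M powr (p - 1))"
    if h: "h \<ge> 1" and M: "M > 0" and d: "d > 0" and u: "u \<in> Hs s" and v: "v \<in> Hs s"
      and nu: "nH s h u \<le> M" and nv: "nH s h v \<le> M" and nd: "nH s h (u - v) \<le> d" for h M d
        and u v :: "'a L2"
  proof -
    let ?w = "u - v" and ?f = "nonlin p u - nonlin p v"
    have w: "?w \<in> Hs s" using weighted_space_diff(1)[OF wt_measurable[of s 1]] u v
      by (simp add: Hs_eq)
    define q where "q = h powr (- \<sigma> / 2)"
    have q: "q > 0" using h by (simp add: q_def)
    define B where "B = (C2 * (q * d)) * (C2 * (q * M)) powr (p - 1)"
    have B0: "B > 0" using C2 q d M by (simp add: B_def)
    have Beq: "B = C2 powr p * q powr p * (d * M powr (p - 1))"
    proof -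
      have "C2 powr p = C2 * C2 powr (p - 1)" "q powr p = q * q powr (p - 1)"
        using C2 q powr_add[of C2 1 "p - 1"] powr_add[of q 1 "p - 1"] by simp_all
      then show ?thesis unfolding B_def by (simp add: powr_mult)
    qed
    have qp: "q powr p = h powr (- (?n * (p - 1) / 4) + \<gamma> / 2)"
      unfolding q_def powr_powr using \<sigma>p
        by (intro arg_cong[where f="\<lambda>a. h powr a"]) (simp add: diff_divide_distrib)
    note su = nonlin_facts[OF p ps u] and sv = nonlin_facts[OF p ps v]
    have pair: "(\<integral>\<^sup>+x. ennreal (norm (L2_fun g x) * norm (L2_fun ?f x)) \<partial>lborel)
      \<le> ennreal (6 * p * (C1 * A * B))"
      if A: "A > 0" and g: "g \<in> hom_Hs \<gamma>" "norm_hom_Hs \<gamma> g \<le> A" for g A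
    proof -
      define I
        where "I z x = norm (L2_fun g x) * (norm (L2_fun ?w x) * norm (L2_fun z x) powr (p - 1))"
        for z x
      have [measurable]: "I z \<in> borel_measurable borel" for z unfolding I_def[abs_def] by measurable
      have I0: "I z x \<ge> 0" for z x by (simp add: I_def)
      have Ib: "(\<integral>\<^sup>+x. ennreal (I z x) \<partial>lborel) \<le> ennreal (3 * (C1 * A * B))"
        if z: "z \<in> Hs s" "nH s h z \<le> M" for z
        unfolding I_def B_def
        by (rule Holder_triple[where k=k and m=m])
          (use p k m2 e C1 A C2 q d M C1b[OF A g] C2b[OF h d w nd] C2b[OF h M z] in \<open>simp_all add:
            q_def\<close>)
      have "(\<integral>\<^sup>+x. ennreal (norm (L2_fun g x) * norm (L2_fun ?f x)) \<partial>lborel)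
        \<le> (\<integral>\<^sup>+x. ennreal p * ennreal (I u x) + ennreal p * ennreal (I v x) \<partial>lborel)"
      proof (rule nn_integral_mono_AE, use nonlin_diff_AE[OF su sv less_imp_le[OF p]] in
        eventually_elim)
        fix x assume "norm (L2_fun ?f x) \<le> p * (norm (L2_fun ?w x) * norm (L2_fun u x) powr (p - 1))
          + p * (norm (L2_fun ?w x) * norm (L2_fun v x) powr (p - 1))"
        from mult_left_mono[OF this norm_ge_zero[of "L2_fun g x"]]
        have "norm (L2_fun g x) * norm (L2_fun ?f x) \<le> p * I u x + p * I v x"
          unfolding I_def by (simp only: distrib_left mult_ac)
        then have "ennreal (norm (L2_fun g x) * norm (L2_fun ?f x))
          \<le> ennreal (p * I u x + p * I v x)" by (rule ennreal_leI)
        also have "\<dots> = ennreal p * ennreal (I u x) + ennreal p * ennreal (I v x)"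
          using p I0 by (subst ennreal_plus) (auto simp: ennreal_mult)
        finally show "ennreal (norm (L2_fun g x) * norm (L2_fun ?f x)) \<le> ennreal p * ennreal (I u x)
          + ennreal p * ennreal (I v x)" .
      qed
      also have "\<dots> = ennreal p * (\<integral>\<^sup>+x. ennreal (I u x) \<partial>lborel)
        + ennreal p * (\<integral>\<^sup>+x. ennreal (I v x) \<partial>lborel)"
        by (subst nn_integral_add, measurable) (subst nn_integral_cmult, measurable)+
      also have "\<dots> \<le> ennreal p * ennreal (3 * (C1 * A * B))
        + ennreal p * ennreal (3 * (C1 * A * B))"
        by (intro add_mono mult_left_mono Ib u v nu nv) auto
      also have "\<dots> = ennreal (6 * p * (C1 * A * B))"
        using p C1 A B0 by (simp add: ennreal_mult[symmetric] ennreal_plus[symmetric] del: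
          ennreal_plus)
      finally show ?thesis .
    qed
    have bound:
      "norm (fourier_multiplier (\<lambda>\<xi>. indicator {\<xi>. 1 / real (Suc j) \<le> norm \<xi>} \<xi>
      * norm \<xi> powr (- \<gamma>)) ?f) \<le> 6 * p * C1 * B" for j
    proof -
      define \<mu> :: "'a \<Rightarrow> real" where
        "\<mu> \<xi> = indicator {\<xi>. 1 / real (Suc j) \<le> norm \<xi>} \<xi> * norm \<xi> powr (- \<gamma>)" for \<xi>
      have \<mu>m [measurable]: "\<mu> \<in> borel_measurable borel" unfolding \<mu>_def[abs_def] by measurable
      have \<mu>b: "\<bar>\<mu> \<xi>\<bar> \<le> (1 / real (Suc j)) powr (- \<gamma>)" for \<xi>
        unfolding \<mu>_def using \<gamma> by (auto simp: indicator_def intro!: powr_mono2')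
      let ?T = "fourier_multiplier \<mu>"
      \<comment> \<open>The test function that makes duality sharp: its pairing with
        \<open>?f\<close> is the square of the norm of \<open>?T ?f\<close>, while its norm of order
        \<gamma> is at most the norm of \<open>?T ?f\<close>, because |\<xi>|^\<gamma> cancels one
        factor \<open>\<mu>\<close> up to an indicator.\<close>
      define g where "g = ?T (?T ?f)"
      define Q where "Q = norm (?T ?f)"
      have idem: "norm \<xi> powr \<gamma> * \<mu> \<xi> = indicator {\<xi>. 1 / real (Suc j) \<le> norm \<xi>} \<xi>" for \<xi> :: 'a
      proof (cases "1 / real (Suc j) \<le> norm \<xi>")
        case True
        moreover have "0 < 1 / real (Suc j)" by simp
        ultimately have "norm \<xi> > 0" by linarith
        then show ?thesis by (simp add: \<mu>_def powr_add[symmetric])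
      qed (simp add: \<mu>_def)
      have nm: "(\<lambda>\<xi>::'a. norm \<xi> powr \<gamma>) \<in> borel_measurable borel" by measurable
      have im: "(\<lambda>\<xi>::'a. indicator {\<xi>. 1 / real (Suc j) \<le> norm \<xi>} \<xi> :: real)
        \<in> borel_measurable borel" by measurable
      have ib: "\<bar>indicator {\<xi>. 1 / real (Suc j) \<le> norm \<xi>} \<xi> :: real\<bar> \<le> 1" for \<xi> :: 'a
        by (simp add: indicator_def)
      note bm = bounded_multiplier[OF \<mu>m \<mu>b] and bi = bounded_multiplier[OF im ib]
      note cmp = fourier_multiplier_compose[OF nm \<mu>m bm(1), of "?T ?f", folded g_def, unfolded idem]
      have gh: "g \<in> hom_Hs \<gamma>" unfolding hom_Hs_def using cmp(1) bi(1) by blast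
      have "norm_hom_Hs \<gamma> g
        = norm (fourier_multiplier (\<lambda>\<xi>. indicator {\<xi>. 1 / real (Suc j) \<le> norm \<xi>} \<xi>) (?T ?f))"
        unfolding norm_hom_Hs_def using norm_fourier_multiplier gh[unfolded hom_Hs_def]
          cmp(2)[OF bi(1)] by metis
      also have "\<dots> \<le> Q" unfolding Q_def using bi(2)[of "?T ?f"] by simp
      finally have gQ: "norm_hom_Hs \<gamma> g \<le> Q" .
      have QQ: "inner g ?f = Q * Q"
        unfolding g_def multiplier_selfadjoint[OF \<mu>m \<mu>b, of "?T ?f" ?f] Q_def
        by (simp add: power2_norm_eq_inner[symmetric] power2_eq_square)
      have "Q \<le> 6 * p * C1 * B"
      proof (cases "Q = 0")
        case True
        then show ?thesis using p C1 B0 by simp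
      next
        case False
        then have Q: "Q > 0" by (simp add: Q_def)
        have "Q * Q \<le> 6 * p * (C1 * Q * B)"
          unfolding QQ[symmetric] using p C1 Q B0 by (intro inner_le_nn_integral pair Q gh gQ) auto
        then have "Q * Q \<le> (6 * p * C1 * B) * Q" by (simp add: mult_ac)
        then show ?thesis using Q by (simp only: mult_le_cancel_right_pos)
      qed
      then show ?thesis unfolding Q_def \<mu>_def .
    qed
    have K': "6 * p * C1 * B = K * h powr (- (?n * (p - 1) / 4) + \<gamma> / 2) * (d * M powr (p - 1))"
      unfolding Beq qp K_def by (simp only: mult_ac)
    have "6 * p * C1 * B \<ge> 0" using p C1 B0 by simp
    from weighted_norm_limit[OF this bound \<gamma>(1)] show ?thesis unfolding K' by blast
  qed
  with K show ?thesis by blast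
qed

section \<open>Decay of the kernel\<close>

text \<open>The time derivative of \<open>K_hat\<close> plus half of \<open>K_hat\<close>: the
  hyperbolic or trigonometric sine is replaced by the cosine, and the division by the root
  disappears. At |\<xi>| = 1/2 the second branch gives cos 0 = 1, which is the right value
  there.\<close>

definition E_hat :: "real \<Rightarrow> 'a::euclidean_space \<Rightarrow> real" where
  "E_hat t \<xi> = exp (- t / 2) *
     (if norm \<xi> < 1 / 2 then cosh (t * sqrt (1 / 4 - (norm \<xi>)\<^sup>2))
      else cos (t * sqrt ((norm \<xi>)\<^sup>2 - 1 / 4)))"

lemma E_hat_measurable [measurable]: "E_hat t \<in> borel_measurable borel"
  unfolding E_hat_def[abs_def] cosh_field_def by measurable

lemma K_hat_measurable [measurable]: "K_hat t \<in> borel_measurable borel"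
  unfolding K_hat_def[abs_def] by measurable

lemma K_hat_has_derivative:
  "((\<lambda>t. K_hat t \<xi>) has_real_derivative (E_hat t \<xi> - K_hat t \<xi> / 2)) (at t)"
proof -
  consider "norm \<xi> < 1 / 2" | "norm \<xi> = 1 / 2" | "norm \<xi> > 1 / 2" by linarith
  then show ?thesis
  proof cases
    case 1
    define r where "r = sqrt (1 / 4 - (norm \<xi>)\<^sup>2)"
    have "(norm \<xi>)\<^sup>2 < (1 / 2)\<^sup>2" using 1 by (intro power_strict_mono) auto
    then have r: "r > 0" by (simp add: r_def power2_eq_square)
    have K: "(\<lambda>t. K_hat t \<xi>) = (\<lambda>t. exp (- t / 2) * (sinh (t * r) / r))"
      unfolding r_def by (rule ext) (rule K_hat_low[OF 1])
    show ?thesis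
      unfolding K fun_cong[OF K, of t] E_hat_def r_def[symmetric] using 1 r
      by (auto intro!: derivative_eq_intros simp: field_simps)
  next
    case 2
    have K: "(\<lambda>t. K_hat t \<xi>) = (\<lambda>t. t * exp (- t / 2))"
      by (rule ext) (rule K_hat_middle[OF 2])
    have E: "E_hat t \<xi> = exp (- t / 2)" unfolding E_hat_def 2 by (simp add: power2_eq_square)
    show ?thesis
      unfolding K fun_cong[OF K, of t] E
      by (auto intro!: derivative_eq_intros simp: field_simps)
  next
    case 3
    define r where "r = sqrt ((norm \<xi>)\<^sup>2 - 1 / 4)"
    have "(1 / 2)\<^sup>2 < (norm \<xi>)\<^sup>2" using 3 by (intro power_strict_mono) auto
    then have r: "r > 0" by (simp add: r_def power2_eq_square)
    have K: "(\<lambda>t. K_hat t \<xi>) = (\<lambda>t. exp (- t / 2) * (sin (t * r) / r))"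
      unfolding r_def by (rule ext) (rule K_hat_high[OF 3])
    show ?thesis
      unfolding K fun_cong[OF K, of t] E_hat_def r_def[symmetric] using 3 r
      by (auto intro!: derivative_eq_intros simp: field_simps)
  qed
qed

lemma deriv_K_hat: "deriv (\<lambda>\<tau>. K_hat \<tau> \<xi>) t = E_hat t \<xi> - K_hat t \<xi> / 2"
  by (rule DERIV_imp_deriv) (rule K_hat_has_derivative)

lemma continuous_K_hat: "continuous_on S (\<lambda>t. K_hat t \<xi>)"
  using K_hat_has_derivative by (auto intro!: continuous_at_imp_continuous_on DERIV_isCont)

lemma continuous_E_hat: "continuous_on S (\<lambda>t. E_hat t \<xi>)"
  unfolding E_hat_def by (cases "norm \<xi> < 1 / 2") (auto intro!: continuous_intros)

lemma K_hat_0: "K_hat 0 \<xi> = 0"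
  unfolding K_hat_def by simp

section \<open>Pointwise kernel bounds below and above |\<xi>| = 1/2\<close>

lemma sinh_le_mult_exp: "y \<ge> 0 \<Longrightarrow> sinh y \<le> y * exp (y::real)"
proof -
  assume "y \<ge> 0"
  have "1 + (- 2 * y) \<le> exp (- 2 * y)" by (rule exp_ge_add_one_self)
  then have "exp y * (1 - 2 * y) \<le> exp y * exp (- 2 * y)" by (intro mult_left_mono) auto
  also have "\<dots> = exp (- y)" by (simp add: exp_add[symmetric])
  finally show ?thesis by (simp add: sinh_field_def algebra_simps)
qed

text \<open>The upper bound, whose square exceeds that of the root by x^4, turns exp(-t/2) exp(t r)
  into at most exp(-t x^2): at low frequencies the kernel is dominated by a heat kernel.\<close>

lemma low_root_bounds:
  fixes x :: real
  assumes "0 \<le> x" "x < 1 / 2"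
  shows "0 < sqrt (1 / 4 - x\<^sup>2)" "sqrt (1 / 4 - x\<^sup>2) \<le> 1 / 2 - x\<^sup>2"
proof -
  have "x\<^sup>2 < (1 / 2)\<^sup>2" using assms by (intro power_strict_mono) auto
  then have x: "x\<^sup>2 < 1 / 4" by (simp add: power2_eq_square)
  then show "0 < sqrt (1 / 4 - x\<^sup>2)" by simp
  have "(1 / 2 - x\<^sup>2)\<^sup>2 = 1 / 4 - x\<^sup>2 + (x\<^sup>2)\<^sup>2" by (simp add: power2_eq_square algebra_simps)
  then have "1 / 4 - x\<^sup>2 \<le> (1 / 2 - x\<^sup>2)\<^sup>2" by simp
  then show "sqrt (1 / 4 - x\<^sup>2) \<le> 1 / 2 - x\<^sup>2" using x by (intro real_le_lsqrt) auto
qed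

lemma E_hat_low_bound:
  assumes "norm \<xi> < 1 / 2" "t \<ge> 0"
  shows "\<bar>E_hat t \<xi>\<bar> \<le> exp (- t * (norm \<xi>)\<^sup>2 / 2)"
proof -
  define r where "r = sqrt (1 / 4 - (norm \<xi>)\<^sup>2)"
  have r: "0 < r" "r \<le> 1 / 2 - (norm \<xi>)\<^sup>2"
    unfolding r_def using low_root_bounds[of "norm \<xi>"] assms by auto
  have "cosh (t * r) \<le> exp (t * r)"
    using assms r by (simp add: cosh_field_def)
  then have "\<bar>E_hat t \<xi>\<bar> \<le> exp (- t / 2) * exp (t * r)"
    using assms by (simp add: E_hat_def r_def[symmetric] abs_mult)
  also have "\<dots> = exp (- t / 2 + t * r)" by (rule exp_add[symmetric])
  also have "\<dots> \<le> exp (- t * (norm \<xi>)\<^sup>2 / 2)"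
  proof -
    have "t * r \<le> t * (1 / 2 - (norm \<xi>)\<^sup>2)" using r assms by (intro mult_left_mono) auto
    moreover have "0 \<le> t * (norm \<xi>)\<^sup>2" using assms by simp
    ultimately show ?thesis by (simp add: algebra_simps)
  qed
  finally show ?thesis .
qed

text \<open>The division by \<open>r\<close> is delicate only near |\<xi>| = 1/2. For r \<ge> 1/4 it
  costs a constant. For smaller \<open>r\<close>, sinh y \<le> y exp y cancels \<open>r\<close> at
  the price of a factor t, absorbed by t \<le> 8 exp(t/8). What remains is exp(-t/8), and since
  |\<xi>|^2 \<le> 1/4 this is at most exp(-t|\<xi>|^2/2): hence the constant 8 and the halved heat
  exponent.\<close>

lemma K_hat_low_bound:
  assumes "norm \<xi> < 1 / 2" "t \<ge> 0"
  shows "\<bar>K_hat t \<xi>\<bar> \<le> 8 * exp (- t * (norm \<xi>)\<^sup>2 / 2)"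
proof -
  define r where "r = sqrt (1 / 4 - (norm \<xi>)\<^sup>2)"
  have r: "0 < r" "r \<le> 1 / 2 - (norm \<xi>)\<^sup>2"
    unfolding r_def using low_root_bounds[of "norm \<xi>"] assms by auto
  have K: "\<bar>K_hat t \<xi>\<bar> = exp (- t / 2) * (sinh (t * r) / r)"
    unfolding K_hat_low[OF assms(1)] r_def[symmetric] using r assms by (simp add: abs_mult)
  have x: "(norm \<xi>)\<^sup>2 \<le> 1 / 4"
    using power_mono[of "norm \<xi>" "1 / 2" 2] assms by (simp add: power2_eq_square)
  show ?thesis
  proof (cases "r \<ge> 1 / 4")
    case True
    have "sinh (t * r) \<le> exp (t * r) / 2" by (simp add: sinh_field_def)
    then have "sinh (t * r) / r \<le> (exp (t * r) / 2) / (1 / 4)"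
      using True r by (intro frac_le) auto
    then have "\<bar>K_hat t \<xi>\<bar> \<le> exp (- t / 2) * (2 * exp (t * r))"
      unfolding K by (intro mult_left_mono) auto
    also have "\<dots> = 2 * exp (- t / 2 + t * r)" by (simp only: exp_add mult_ac)
    also have "\<dots> \<le> 8 * exp (- t * (norm \<xi>)\<^sup>2 / 2)"
    proof (intro mult_mono)
      have "t * r \<le> t * (1 / 2 - (norm \<xi>)\<^sup>2)" using r assms by (intro mult_left_mono) auto
      moreover have "0 \<le> t * (norm \<xi>)\<^sup>2" using assms by simp
      ultimately show "exp (- t / 2 + t * r) \<le> exp (- t * (norm \<xi>)\<^sup>2 / 2)"
        by (simp add: algebra_simps)
    qed auto
    finally show ?thesis .
  next
    case False
    have "sinh (t * r) \<le> t * r * exp (t * r)" using r assms by (intro sinh_le_mult_exp) simp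
    then have "sinh (t * r) / r \<le> t * exp (t * r)" using r by (simp add: field_simps)
    also have "t * r \<le> t * (1 / 4)" using False assms by (intro mult_left_mono) auto
    then have "t * exp (t * r) \<le> t * exp (t / 4)" using assms by (intro mult_left_mono) auto
    finally have "\<bar>K_hat t \<xi>\<bar> \<le> exp (- t / 2) * (t * exp (t / 4))"
      unfolding K by (intro mult_left_mono) auto
    also have "\<dots> = t * exp (- t / 4)" by (simp add: exp_add[symmetric])
    also have "t \<le> 8 * exp (t / 8)" using exp_ge_add_one_self[of "t / 8"] by linarith
    then have "t * exp (- t / 4) \<le> 8 * exp (t / 8) * exp (- t / 4)" by (intro mult_right_mono) auto
    also have "\<dots> = 8 * exp (- t / 8)" by (simp add: exp_add[symmetric])
    also have "\<dots> \<le> 8 * exp (- t * (norm \<xi>)\<^sup>2 / 2)"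
      using mult_left_mono[OF x, of t] assms by simp
    finally show ?thesis .
  qed
qed

lemma E_hat_high_bound: "norm \<xi> \<ge> 1 / 2 \<Longrightarrow> \<bar>E_hat t \<xi>\<bar> \<le> exp (- t / 2)"
  unfolding E_hat_def by (simp add: abs_mult)

text \<open>The kernel gains one derivative at high frequencies, which is what lets
  \<open>u1\<close> lie merely in L2 and limits \<open>s\<close> to at most 1. Up to |\<xi>| = 1 the
  quotient sin(t r)/r is bounded by t; beyond that, \<open>r\<close> is comparable with the square
  root on the left.\<close>

lemma K_hat_high_bound:
  assumes "norm \<xi> \<ge> 1 / 2" "t \<ge> 0"
  shows "sqrt (1 + (norm \<xi>)\<^sup>2) * \<bar>K_hat t \<xi>\<bar> \<le> 2 * (1 + t) * exp (- t / 2)"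
proof (cases "norm \<xi> = 1 / 2")
  case True
  have "sqrt (1 + (norm \<xi>)\<^sup>2) \<le> 2" unfolding True
    by (intro real_le_lsqrt) (auto simp: power2_eq_square)
  then have "sqrt (1 + (norm \<xi>)\<^sup>2) * (t * exp (- t / 2)) \<le> 2 * ((1 + t) * exp (- t / 2))"
    using assms by (intro mult_mono mult_right_mono) auto
  then show ?thesis using assms by (simp add: K_hat_middle[OF True])
next
  case False
  then have gt: "norm \<xi> > 1 / 2" using assms by simp
  define r where "r = sqrt ((norm \<xi>)\<^sup>2 - 1 / 4)"
  have "(1 / 2)\<^sup>2 < (norm \<xi>)\<^sup>2" using gt by (intro power_strict_mono) auto
  then have r: "r > 0" by (simp add: r_def power2_eq_square)
  have K: "\<bar>K_hat t \<xi>\<bar> = exp (- t / 2) * (\<bar>sin (t * r)\<bar> / r)"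
    unfolding K_hat_high[OF gt] r_def[symmetric] using r by (simp add: abs_mult)
  have "sqrt (1 + (norm \<xi>)\<^sup>2) * (\<bar>sin (t * r)\<bar> / r) \<le> 2 * (1 + t)"
  proof (cases "norm \<xi> \<le> 1")
    case True
    have "(norm \<xi>)\<^sup>2 \<le> 1" using True by (simp add: power_le_one)
    then have "sqrt (1 + (norm \<xi>)\<^sup>2) \<le> 2" by (intro real_le_lsqrt) auto
    moreover have "\<bar>sin (t * r)\<bar> \<le> t * r" using abs_sin_x_le_abs_x[of "t * r"] assms r by simp
    then have "\<bar>sin (t * r)\<bar> / r \<le> t" using r by (simp add: field_simps)
    ultimately have "sqrt (1 + (norm \<xi>)\<^sup>2) * (\<bar>sin (t * r)\<bar> / r) \<le> 2 * t"
      using r by (intro mult_mono) auto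
    then show ?thesis by simp
  next
    case False
    have "1 \<le> (norm \<xi>)\<^sup>2" using False by (simp add: one_le_power)
    then have "1 + (norm \<xi>)\<^sup>2 \<le> 4 * ((norm \<xi>)\<^sup>2 - 1 / 4)" by simp
    then have "sqrt (1 + (norm \<xi>)\<^sup>2) \<le> sqrt (4 * ((norm \<xi>)\<^sup>2 - 1 / 4))" by simp
    also have "\<dots> = 2 * r" unfolding r_def real_sqrt_mult by simp
    finally have "sqrt (1 + (norm \<xi>)\<^sup>2) / r \<le> 2" using r by (simp add: field_simps)
    moreover have "\<bar>sin (t * r)\<bar> \<le> 1" by simp
    ultimately have "(sqrt (1 + (norm \<xi>)\<^sup>2) / r) * \<bar>sin (t * r)\<bar> \<le> 2 * 1"
      by (intro mult_mono) auto
    then show ?thesis using assms by simp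
  qed
  from mult_right_mono[OF this, of "exp (- t / 2)"] show ?thesis unfolding K by (simp add: mult_ac)
qed

section \<open>Weighted kernel bounds with algebraic decay\<close>

lemma poly_exp_bounded:
  assumes "b \<ge> 0"
  shows "\<exists>C>0. \<forall>y\<ge>0::real. (1 + y) powr b * exp (- y / 2) \<le> C"
proof -
  \<comment> \<open>Chosen for \<open>b * d\<close> \<le> 1/2: then ln(d(1+y)) \<le> d(1+y) - 1
    bounds b ln(1+y) by (1+y)/2 plus a constant.\<close>
  define d where "d = 1 / (2 * (b + 1))"
  have d: "d > 0" using assms by (simp add: d_def)
  define C where "C = exp (1 / 2 - b * ln d)"
  have "(1 + y) powr b * exp (- y / 2) \<le> C" if "y \<ge> 0" for y :: real
  proof -
    have "ln (d * (1 + y)) \<le> d * (1 + y) - 1" using d that by (intro ln_le_minus_one) simp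
    then have "ln (1 + y) \<le> d * (1 + y) - ln d" using d that by (simp add: ln_mult)
    then have "b * ln (1 + y) \<le> b * (d * (1 + y) - ln d)" using assms by (intro mult_left_mono)
    also have "\<dots> = (b * d) * (1 + y) - b * ln d" by (simp add: algebra_simps)
    also have "\<dots> \<le> (1 / 2) * (1 + y) - b * ln d"
    proof -
      have "b * d \<le> 1 / 2" using assms by (simp add: d_def field_simps)
      then show ?thesis using that by (intro diff_right_mono mult_right_mono) auto
    qed
    finally have "b * ln (1 + y) - y / 2 \<le> 1 / 2 - b * ln d" by (simp add: field_simps)
    then have "exp (b * ln (1 + y) - y / 2) \<le> C" unfolding C_def by simp
    moreover have "(1 + y) powr b * exp (- y / 2) = exp (b * ln (1 + y) - y / 2)"
      using that by (simp add: powr_def exp_add[symmetric])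
    ultimately show ?thesis by (simp only:)
  qed
  moreover have "C > 0" by (simp add: C_def)
  ultimately show ?thesis by blast
qed

text \<open>With X = (1+t)|\<xi>|^2 everything becomes a power of 1+X times exp(-X/2); exchanging t
  for 1+t in the exponent costs at most a factor 2, because |\<xi>| < 1/2. The auxiliary factor
  (1+X)^(a/2) is estimated from below by 1 for the first claim and by X^(a/2) for the second. The
  latter trades a singularity |\<xi>|^(-a) for the decay (1+t)^(-a/2).\<close>

lemma low_weight_bound:
  assumes a: "a \<ge> 0" and s: "0 \<le> s" "s \<le> 1"
  shows "\<exists>C>0. \<forall>t\<ge>0. \<forall>\<xi>::'a::euclidean_space. norm \<xi> < 1 / 2 \<longrightarrow>
    wt s (1 + t) \<xi> * exp (- t * (norm \<xi>)\<^sup>2 / 2) \<le> C \<and>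
    (\<xi> \<noteq> 0 \<longrightarrow> wt s (1 + t) \<xi> * exp (- t * (norm \<xi>)\<^sup>2 / 2) \<le> C * (1 + t) powr (- a / 2) * norm \<xi> powr
      (- a))"
proof -
  obtain C where C: "C > 0" and Cb: "\<And>y. y \<ge> 0 \<Longrightarrow> (1 + y) powr (1 + a / 2) * exp (- y / 2) \<le> C"
    using poly_exp_bounded[of "1 + a / 2"] a by auto
  have main: "wt s (1 + t) \<xi> * exp (- t * (norm \<xi>)\<^sup>2 / 2) * (1 + (1 + t) * (norm \<xi>)\<^sup>2) powr (a / 2)
    \<le> 2 * C"
    if t: "t \<ge> 0" and x: "norm \<xi> < 1 / 2" for t and \<xi> :: 'a
  proof -
    define X where "X = (1 + t) * (norm \<xi>)\<^sup>2"
    have X: "X \<ge> 0" using t by (simp add: X_def)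
    have x2: "(norm \<xi>)\<^sup>2 \<le> 1 / 4"
      using power_mono[of "norm \<xi>" "1 / 2" 2] x by (simp add: power2_eq_square)
    have "exp ((norm \<xi>)\<^sup>2 / 2) \<le> 2"
    proof -
      have "exp ((norm \<xi>)\<^sup>2 / 2) \<le> exp (1 / 8)" using x2 by simp
      also have "\<dots> \<le> 2" using exp_bound[of "1 / 8"] by (simp add: power2_eq_square)
      finally show ?thesis .
    qed
    moreover have "exp (- t * (norm \<xi>)\<^sup>2 / 2) = exp (- X / 2) * exp ((norm \<xi>)\<^sup>2 / 2)"
      by (simp add: X_def exp_add[symmetric] algebra_simps add_divide_distrib[symmetric])
    ultimately have e: "exp (- t * (norm \<xi>)\<^sup>2 / 2) \<le> exp (- X / 2) * 2"
      by (simp only: mult_left_mono exp_ge_zero)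
    have "wt s (1 + t) \<xi> \<le> (1 + X) powr 1"
      unfolding wt_def X_def[symmetric] using X s by (intro powr_mono) auto
    then have "wt s (1 + t) \<xi> * exp (- t * (norm \<xi>)\<^sup>2 / 2) * (1 + X) powr (a / 2)
      \<le> (1 + X) powr 1 * (exp (- X / 2) * 2) * (1 + X) powr (a / 2)"
      using e wt_pos[of "1 + t" s \<xi>] t by (intro mult_right_mono mult_mono) auto
    also have "\<dots> = 2 * ((1 + X) powr (1 + a / 2) * exp (- X / 2))"
      using X by (simp add: powr_add mult_ac)
    also have "\<dots> \<le> 2 * C" using Cb[OF X] by simp
    finally show ?thesis unfolding X_def .
  qed
  have "wt s (1 + t) \<xi> * exp (- t * (norm \<xi>)\<^sup>2 / 2) \<le> 2 * C \<and>
    (\<xi> \<noteq> 0 \<longrightarrow> wt s (1 + t) \<xi> * exp (- t * (norm \<xi>)\<^sup>2 / 2) \<le> 2 * C * (1 + t) powr (- a / 2) * norm \<xi>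
      powr (- a))"
    if t: "t \<ge> 0" and x: "norm \<xi> < 1 / 2" for t and \<xi> :: 'a
  proof -
    let ?Y = "wt s (1 + t) \<xi> * exp (- t * (norm \<xi>)\<^sup>2 / 2)"
    have Y: "?Y \<ge> 0" using wt_pos[of "1 + t" s \<xi>] t by simp
    have g: "(1 + (1 + t) * (norm \<xi>)\<^sup>2) powr (a / 2) \<ge> 1" using t a
      by (intro ge_one_powr_ge_zero) auto
    have 1: "?Y \<le> 2 * C" using mult_left_mono[OF g Y] main[OF t x] by simp
    have 2: "?Y \<le> 2 * C * (1 + t) powr (- a / 2) * norm \<xi> powr (- a)" if \<xi>: "\<xi> \<noteq> 0"
    proof -
      have "(norm \<xi>)\<^sup>2 = norm \<xi> powr 2" using \<xi> by simp
      then have "((norm \<xi>)\<^sup>2) powr (a / 2) = norm \<xi> powr a" by (simp only: powr_powr) simp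
      then have "(1 + t) powr (a / 2) * norm \<xi> powr a = ((1 + t) * (norm \<xi>)\<^sup>2) powr (a / 2)"
        by (simp add: powr_mult)
      also have "\<dots> \<le> (1 + (1 + t) * (norm \<xi>)\<^sup>2) powr (a / 2)" using t a by (intro powr_mono2) auto
      finally have "?Y * ((1 + t) powr (a / 2) * norm \<xi> powr a) \<le> 2 * C"
        using mult_left_mono[OF _ Y] main[OF t x] by (meson order_trans)
      then have "?Y * ((1 + t) powr (a / 2) * norm \<xi> powr a)
        * ((1 + t) powr (- a / 2) * norm \<xi> powr (- a)) \<le> 2 * C *
        ((1 + t) powr (- a / 2) * norm \<xi> powr (- a))"
        by (intro mult_right_mono) auto
      moreover have "((1 + t) powr (a / 2) * norm \<xi> powr a)
        * ((1 + t) powr (- a / 2) * norm \<xi> powr (- a)) = 1"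
      proof -
        have "(1 + t) powr (a / 2) * (1 + t) powr (- a / 2) = 1" using t
          by (simp add: powr_add[symmetric])
        moreover have "norm \<xi> powr a * norm \<xi> powr (- a) = 1" using \<xi>
          by (simp add: powr_add[symmetric])
        ultimately show ?thesis by (metis (no_types, lifting) mult.assoc mult.left_commute
          mult_1_right)
      qed
      ultimately show ?thesis by (simp only: mult.assoc mult_1_right)
    qed
    from 1 2 show ?thesis by blast
  qed
  then show ?thesis using C by (intro exI[of _ "2 * C"]) auto
qed

text \<open>The exponent 3/2 collects the factor 1+t of the high-frequency kernel bound and
  (1+t)^(1/2) from replacing the weight at time t by that at time 0.\<close>

lemma high_exp_bound:
  fixes a :: real
  assumes a: "a \<ge> 0"
  shows "\<exists>C>0. \<forall>t\<ge>0. (1 + t) powr (3 / 2) * exp (- t / 2) \<le> C * (1 + t) powr (- a / 2)"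
proof -
  obtain C where C: "C > 0" and Cb: "\<And>y. y \<ge> 0 \<Longrightarrow> (1 + y) powr (3 / 2 + a / 2) * exp (- y / 2) \<le> C"
    using poly_exp_bounded[of "3 / 2 + a / 2"] a by auto
  have "(1 + t) powr (3 / 2) * exp (- t / 2) \<le> C * (1 + t) powr (- a / 2)" if "t \<ge> 0" for t :: real
  proof -
    have "(1 + t) powr (3 / 2 + a / 2) * (1 + t) powr (- a / 2) = (1 + t) powr (3 / 2)"
      using that by (simp add: powr_add[symmetric])
    then have "(1 + t) powr (3 / 2) * exp (- t / 2)
      = ((1 + t) powr (3 / 2 + a / 2) * exp (- t / 2)) * (1 + t) powr (- a / 2)"
      by (simp add: mult_ac)
    also have "\<dots> \<le> C * (1 + t) powr (- a / 2)" by (intro mult_right_mono Cb that) simp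
    finally show ?thesis .
  qed
  with C show ?thesis by blast
qed

lemma wt_high_bound:
  assumes s: "0 \<le> s" "s \<le> 1" and t: "t \<ge> 0"
  shows "wt s (1 + t) \<xi> \<le> (1 + t) powr (1 / 2) * sqrt (1 + (norm \<xi>)\<^sup>2)"
    and "wt s (1 + t) \<xi> \<le> (1 + t) powr (1 / 2) * wt s 1 \<xi>"
proof -
  have "wt s (1 + t) \<xi> \<le> (1 + t) powr (s / 2) * wt s 1 \<xi>"
    using wt_scale[of 1 "1 + t" s \<xi>] s t by simp
  also have "\<dots> \<le> (1 + t) powr (1 / 2) * wt s 1 \<xi>"
    using wt_pos[of 1 s \<xi>] s t by (intro mult_right_mono powr_mono) auto
  finally show *: "wt s (1 + t) \<xi> \<le> (1 + t) powr (1 / 2) * wt s 1 \<xi>" .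
  have "wt s 1 \<xi> \<le> (1 + (norm \<xi>)\<^sup>2) powr (1 / 2)"
    unfolding wt_def using s by (simp add: powr_mono)
  also have "\<dots> = sqrt (1 + (norm \<xi>)\<^sup>2)" by (simp add: powr_half_sqrt)
  finally have "wt s 1 \<xi> \<le> sqrt (1 + (norm \<xi>)\<^sup>2)" .
  then show "wt s (1 + t) \<xi> \<le> (1 + t) powr (1 / 2) * sqrt (1 + (norm \<xi>)\<^sup>2)"
    using * by (meson mult_left_mono order_trans powr_ge_zero)
qed

text \<open>The two regimes of the Duhamel integral use one bound each: the uniform one when \<tau>
  is close to t, the decaying one otherwise. In the decaying bound |\<xi>|^(-a) pays for low
  frequencies, and the summand 1 for high ones, where the kernel decays exponentially.\<close>

lemma K_hat_weighted_bound:
  assumes a: "a \<ge> 0" and s: "0 \<le> s" "s \<le> 1"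
  shows "\<exists>C>0. \<forall>t\<ge>0. \<forall>\<xi>::'a::euclidean_space.
    wt s (1 + t) \<xi> * \<bar>K_hat t \<xi>\<bar> \<le> C \<and>
    (\<xi> \<noteq> 0 \<longrightarrow> wt s (1 + t) \<xi> * \<bar>K_hat t \<xi>\<bar> \<le> C * (1 + t) powr (- a / 2) * (norm \<xi> powr (- a) + 1))"
proof -
  obtain C1 where C1: "C1 > 0" and C1b: "\<And>t \<xi>::'a. t \<ge> 0 \<Longrightarrow> norm \<xi> < 1 / 2 \<Longrightarrow>
    wt s (1 + t) \<xi> * exp (- t * (norm \<xi>)\<^sup>2 / 2) \<le> C1 \<and>
    (\<xi> \<noteq> 0 \<longrightarrow> wt s (1 + t) \<xi> * exp (- t * (norm \<xi>)\<^sup>2 / 2) \<le> C1 * (1 + t) powr (- a / 2) * norm \<xi> powr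
      (- a))"
    using low_weight_bound[OF a s, where 'a='a] by blast
  obtain C2 where C2: "C2 > 0" and C2b: "\<And>t. t \<ge> 0
    \<Longrightarrow> (1 + t) powr (3 / 2) * exp (- t / 2) \<le> C2 * (1 + t) powr (- a / 2)"
    using high_exp_bound[OF a] by blast
  define C where "C = 8 * C1 + 2 * C2"
  have "wt s (1 + t) \<xi> * \<bar>K_hat t \<xi>\<bar> \<le> C \<and>
    (\<xi> \<noteq> 0 \<longrightarrow> wt s (1 + t) \<xi> * \<bar>K_hat t \<xi>\<bar> \<le> C * (1 + t) powr (- a / 2) * (norm \<xi> powr (- a) + 1))"
    if t: "t \<ge> 0" for t and \<xi> :: 'a
  proof (cases "norm \<xi> < 1 / 2")
    case True
    have w: "wt s (1 + t) \<xi> \<ge> 0" using wt_pos[of "1 + t" s \<xi>] t by simp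
    have le: "wt s (1 + t) \<xi> * \<bar>K_hat t \<xi>\<bar> \<le> 8 * (wt s (1 + t) \<xi> * exp (- t * (norm \<xi>)\<^sup>2 / 2))"
      using mult_left_mono[OF K_hat_low_bound[OF True t] w] by simp
    have 1: "wt s (1 + t) \<xi> * \<bar>K_hat t \<xi>\<bar> \<le> C"
      using le C1b[OF t True] C2 unfolding C_def by linarith
    have 2: "wt s (1 + t) \<xi> * \<bar>K_hat t \<xi>\<bar> \<le> C * (1 + t) powr (- a / 2) * (norm \<xi> powr (- a) + 1)"
      if "\<xi> \<noteq> 0"
    proof -
      have "8 * (wt s (1 + t) \<xi> * exp (- t * (norm \<xi>)\<^sup>2 / 2))
        \<le> 8 * (C1 * (1 + t) powr (- a / 2) * norm \<xi> powr (- a))"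
        using C1b[OF t True] that by simp
      also have "\<dots> = 8 * C1 * (1 + t) powr (- a / 2) * norm \<xi> powr (- a)" by simp
      also have "\<dots> \<le> C * (1 + t) powr (- a / 2) * (norm \<xi> powr (- a) + 1)"
        using C1 C2 by (intro mult_mono) (auto simp: C_def)
      finally show ?thesis using le by linarith
    qed
    from 1 2 show ?thesis by blast
  next
    case False
    have "wt s (1 + t) \<xi> * \<bar>K_hat t \<xi>\<bar>
      \<le> (1 + t) powr (1 / 2) * (sqrt (1 + (norm \<xi>)\<^sup>2) * \<bar>K_hat t \<xi>\<bar>)"
      using mult_right_mono[OF wt_high_bound(1)[OF s t, of \<xi>], of "\<bar>K_hat t \<xi>\<bar>"]
        by (simp add: mult.assoc)
    also have "\<dots> \<le> (1 + t) powr (1 / 2) * (2 * (1 + t) * exp (- t / 2))"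
      using False t by (intro mult_left_mono K_hat_high_bound) auto
    also have "\<dots> = 2 * ((1 + t) powr (3 / 2) * exp (- t / 2))"
      using t powr_add[of "1 + t" "1 / 2" 1] by simp
    also have "\<dots> \<le> 2 * (C2 * (1 + t) powr (- a / 2))" using C2b[OF t] by simp
    also have "\<dots> \<le> C * (1 + t) powr (- a / 2)" using C1 by (simp add: C_def algebra_simps)
    finally have *: "wt s (1 + t) \<xi> * \<bar>K_hat t \<xi>\<bar> \<le> C * (1 + t) powr (- a / 2)" .
    have C: "C > 0" using C1 C2 by (simp add: C_def)
    have "(1 + t) powr (- a / 2) \<le> (1 + t) powr 0" using t a by (intro powr_mono) auto
    then have "C * (1 + t) powr (- a / 2) \<le> C" using C t by simp
    moreover have "C * (1 + t) powr (- a / 2) * 1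
      \<le> C * (1 + t) powr (- a / 2) * (norm \<xi> powr (- a) + 1)"
      using C by (intro mult_left_mono) auto
    ultimately show ?thesis using * by linarith
  qed
  moreover have "C > 0" using C1 C2 by (simp add: C_def)
  ultimately show ?thesis by blast
qed

text \<open>In contrast to \<open>K_hat\<close>, this symbol gains no derivative. The weight of
  order \<open>s\<close> therefore remains on the right, and it is applied to data in H^s.\<close>

lemma E_hat_weighted_bound:
  assumes a: "a \<ge> 0" and s: "0 \<le> s" "s \<le> 1"
  shows "\<exists>C>0. \<forall>t\<ge>0. \<forall>\<xi>::'a::euclidean_space.
    wt s (1 + t) \<xi> * \<bar>E_hat t \<xi>\<bar> \<le> C * wt s 1 \<xi> \<and>
    (\<xi> \<noteq> 0 \<longrightarrow> wt s (1 + t) \<xi> * \<bar>E_hat t \<xi>\<bar> \<le> C * (1 + t) powr (- a / 2) *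
      (norm \<xi> powr (- a) + wt s 1 \<xi>))"
proof -
  obtain C1 where C1: "C1 > 0" and C1b: "\<And>t \<xi>::'a. t \<ge> 0 \<Longrightarrow> norm \<xi> < 1 / 2 \<Longrightarrow>
    wt s (1 + t) \<xi> * exp (- t * (norm \<xi>)\<^sup>2 / 2) \<le> C1 \<and>
    (\<xi> \<noteq> 0 \<longrightarrow> wt s (1 + t) \<xi> * exp (- t * (norm \<xi>)\<^sup>2 / 2) \<le> C1 * (1 + t) powr (- a / 2) * norm \<xi> powr
      (- a))"
    using low_weight_bound[OF a s, where 'a='a] by blast
  obtain C2 where C2: "C2 > 0" and C2b: "\<And>t. t \<ge> 0
    \<Longrightarrow> (1 + t) powr (3 / 2) * exp (- t / 2) \<le> C2 * (1 + t) powr (- a / 2)"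
    using high_exp_bound[OF a] by blast
  define C where "C = C1 + C2"
  have C: "C > 0" using C1 C2 by (simp add: C_def)
  have "wt s (1 + t) \<xi> * \<bar>E_hat t \<xi>\<bar> \<le> C * wt s 1 \<xi> \<and>
    (\<xi> \<noteq> 0 \<longrightarrow> wt s (1 + t) \<xi> * \<bar>E_hat t \<xi>\<bar> \<le> C * (1 + t) powr (- a / 2) *
      (norm \<xi> powr (- a) + wt s 1 \<xi>))"
    if t: "t \<ge> 0" for t and \<xi> :: 'a
  proof (cases "norm \<xi> < 1 / 2")
    case True
    have w: "wt s (1 + t) \<xi> \<ge> 0" using wt_pos[of "1 + t" s \<xi>] t by simp
    have w1: "wt s 1 \<xi> \<ge> 1" using wt_ge_1[of 1 s \<xi>] s by simp
    have le: "wt s (1 + t) \<xi> * \<bar>E_hat t \<xi>\<bar> \<le> wt s (1 + t) \<xi> * exp (- t * (norm \<xi>)\<^sup>2 / 2)"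
      using mult_left_mono[OF E_hat_low_bound[OF True t] w] by simp
    have "C1 \<le> C * 1" using C2 by (simp add: C_def)
    also have "\<dots> \<le> C * wt s 1 \<xi>" using w1 C by (intro mult_left_mono) auto
    finally have 1: "wt s (1 + t) \<xi> * \<bar>E_hat t \<xi>\<bar> \<le> C * wt s 1 \<xi>"
      using le C1b[OF t True] by linarith
    have 2: "wt s (1 + t) \<xi> * \<bar>E_hat t \<xi>\<bar>
      \<le> C * (1 + t) powr (- a / 2) * (norm \<xi> powr (- a) + wt s 1 \<xi>)" if "\<xi> \<noteq> 0"
    proof -
      have "wt s (1 + t) \<xi> * exp (- t * (norm \<xi>)\<^sup>2 / 2)
        \<le> C1 * (1 + t) powr (- a / 2) * norm \<xi> powr (- a)"
        using C1b[OF t True] that by simp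
      also have "\<dots> \<le> C * (1 + t) powr (- a / 2) * (norm \<xi> powr (- a) + wt s 1 \<xi>)"
        using C1 C2 w1 by (intro mult_mono) (auto simp: C_def)
      finally show ?thesis using le by linarith
    qed
    from 1 2 show ?thesis by blast
  next
    case False
    have w1: "wt s 1 \<xi> \<ge> 0" using wt_pos[of 1 s \<xi>] by simp
    have "wt s (1 + t) \<xi> * \<bar>E_hat t \<xi>\<bar> \<le> ((1 + t) powr (1 / 2) * wt s 1 \<xi>) * exp (- t / 2)"
      using False w1 by (intro mult_mono wt_high_bound s t E_hat_high_bound) auto
    also have "\<dots> \<le> ((1 + t) powr (3 / 2) * wt s 1 \<xi>) * exp (- t / 2)"
      using t w1 by (intro mult_right_mono powr_mono) auto
    also have "\<dots> = ((1 + t) powr (3 / 2) * exp (- t / 2)) * wt s 1 \<xi>" by simp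
    also have "\<dots> \<le> (C2 * (1 + t) powr (- a / 2)) * wt s 1 \<xi>" using w1
      by (intro mult_right_mono C2b t)
    also have "\<dots> \<le> (C * (1 + t) powr (- a / 2)) * wt s 1 \<xi>" using C1 w1
      by (intro mult_right_mono) (auto simp: C_def)
    finally have *: "wt s (1 + t) \<xi> * \<bar>E_hat t \<xi>\<bar> \<le> C * (1 + t) powr (- a / 2) * wt s 1 \<xi>" .
    have "(1 + t) powr (- a / 2) \<le> (1 + t) powr 0" using t a by (intro powr_mono) auto
    then have "C * (1 + t) powr (- a / 2) * wt s 1 \<xi> \<le> C * wt s 1 \<xi>"
      using C t w1 by (intro mult_right_mono) auto
    moreover have "C * (1 + t) powr (- a / 2) * wt s 1 \<xi>
      \<le> C * (1 + t) powr (- a / 2) * (norm \<xi> powr (- a) + wt s 1 \<xi>)"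
      using C by (intro mult_left_mono) auto
    ultimately show ?thesis using * by linarith
  qed
  with C show ?thesis by blast
qed

lemma inverse_wt_bounds:
  assumes "s \<ge> 0" "h \<ge> 0"
  shows "\<bar>1 / wt s h \<xi>\<bar> \<le> 1"
  using wt_ge_1[OF assms(2,1), of \<xi>] by simp

lemma wt_ratio_bounds:
  assumes "s \<ge> 0" "h \<ge> 1"
  shows "\<bar>wt s h \<xi> / wt s 1 \<xi>\<bar> \<le> h powr (s / 2)" "\<bar>wt s 1 \<xi> / wt s h \<xi>\<bar> \<le> 1"
  using wt_scale[of 1 h s \<xi>] wt_mono[of 1 h s \<xi>] wt_pos[of 1 s \<xi>] wt_pos[of h s \<xi>] assms
  by (simp_all add: field_simps)

lemma continuous_wt: "continuous_on {0..} (\<lambda>t. wt s (1 + t) \<xi>)"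
  unfolding wt_def by (intro continuous_on_powr continuous_intros) (auto simp: add_nonneg_eq_0_iff)

lemma wt_times_K_bounded:
  assumes s: "0 \<le> s" "s \<le> 1"
  obtains C where "C > 0" "\<And>t \<xi>::'a::euclidean_space. t \<ge> 0 \<Longrightarrow> \<bar>wt s 1 \<xi> * K_hat t \<xi>\<bar> \<le> C"
proof -
  obtain C where C: "C > 0" "\<And>t \<xi>::'a. t \<ge> 0 \<Longrightarrow> wt s (1 + t) \<xi> * \<bar>K_hat t \<xi>\<bar> \<le> C"
    using K_hat_weighted_bound[of 0 s, where 'a='a] s by auto
  have "\<bar>wt s 1 \<xi> * K_hat t \<xi>\<bar> \<le> C" if "t \<ge> 0" for t and \<xi> :: 'a
  proof -
    have "\<bar>wt s 1 \<xi> * K_hat t \<xi>\<bar> = wt s 1 \<xi> * \<bar>K_hat t \<xi>\<bar>"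
      using wt_pos[of 1 s \<xi>] by (simp add: abs_mult)
    also have "\<dots> \<le> wt s (1 + t) \<xi> * \<bar>K_hat t \<xi>\<bar>"
      using that s by (intro mult_right_mono wt_mono) auto
    finally show ?thesis using C(2)[OF that, of \<xi>] by linarith
  qed
  with C(1) show ?thesis by (rule that)
qed

lemma E_hat_bounded: "t \<ge> 0 \<Longrightarrow> \<bar>E_hat t \<xi>\<bar> \<le> 1"
proof (cases "norm \<xi> < 1 / 2")
  case True
  assume "t \<ge> 0"
  then have "\<bar>E_hat t \<xi>\<bar> \<le> exp (- t * (norm \<xi>)\<^sup>2 / 2)" using True by (intro E_hat_low_bound)
  also have "\<dots> \<le> 1" using \<open>t \<ge> 0\<close> by simp
  finally show ?thesis .
next
  case False
  assume "t \<ge> 0"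
  have "\<bar>E_hat t \<xi>\<bar> \<le> exp (- t / 2)" using False by (intro E_hat_high_bound) simp
  also have "\<dots> \<le> 1" using \<open>t \<ge> 0\<close> by simp
  finally show ?thesis .
qed

section \<open>The Duhamel integral\<close>

lemma continuous_on_atLeastI:
  fixes f :: "real \<Rightarrow> 'b::topological_space"
  assumes "\<And>T. T \<ge> 0 \<Longrightarrow> continuous_on {0..T} f"
  shows "continuous_on {0..} f"
  unfolding continuous_on_eq_continuous_within
proof
  fix x :: real assume x: "x \<in> {0..}"
  have "continuous (at x within {0..x+1}) f"
    using assms[of "x + 1"] x by (auto simp: continuous_on_eq_continuous_within)
  moreover have "at x within {0..x+1} = at x within {0..}"
    by (rule at_within_nhd[of x "{..<x+1}"]) auto
  ultimately show "continuous (at x within {0..}) f" by simp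
qed

lemma fourier_multiplier_zero: "fourier_multiplier (\<lambda>\<xi>. 0) u = 0"
  using weighted_space_const(2)[of 0 u] by simp

lemma bounded_multiplier_compose:
  assumes m2: "m2 \<in> borel_measurable borel" and m1: "m1 \<in> borel_measurable borel"
    and B1: "\<And>\<xi>. \<bar>m1 \<xi>\<bar> \<le> B1" and B: "\<And>\<xi>. \<bar>m2 \<xi> * m1 \<xi>\<bar> \<le> B"
  shows "fourier_multiplier m1 u \<in> weighted_space m2"
    and "fourier_multiplier m2 (fourier_multiplier m1 u) = fourier_multiplier (\<lambda>\<xi>. m2 \<xi> * m1 \<xi>) u"
proof -
  have u1: "u \<in> weighted_space m1" by (rule bounded_multiplier(1)[OF m1 B1])
  have u2: "u \<in> weighted_space (\<lambda>\<xi>. m2 \<xi> * m1 \<xi>)"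
    by (rule bounded_multiplier(1)[OF _ B]) (use m1 m2 in measurable)
  show "fourier_multiplier m1 u \<in> weighted_space m2"
    using fourier_multiplier_compose(1)[OF m2 m1 u1] u2 by simp
  show "fourier_multiplier m2 (fourier_multiplier m1 u) = fourier_multiplier (\<lambda>\<xi>. m2 \<xi> * m1 \<xi>) u"
    by (rule fourier_multiplier_compose(2)[OF m2 m1 u1 u2])
qed

text \<open>The Duhamel integral is taken after applying the weight, which makes its values elements of
  \<open>L\<^sup>2\<close>; \<open>lift_Hs\<close> undoes the weight.\<close>

definition lift_Hs :: "real \<Rightarrow> 'a::euclidean_space L2 \<Rightarrow> 'a L2" where
  "lift_Hs s = fourier_multiplier (\<lambda>\<xi>. 1 / wt s 1 \<xi>)"

definition duhamel :: "real \<Rightarrow> (real \<Rightarrow> 'a::euclidean_space L2) \<Rightarrow> real \<Rightarrow> 'a L2" where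
  "duhamel s f t = integral {0..t} (\<lambda>\<tau>. fourier_multiplier (\<lambda>\<xi>. wt s 1 \<xi> * K_hat (t - \<tau>) \<xi>) (f \<tau>))"

lemma inverse_wt_measurable [measurable]: "(\<lambda>\<xi>. 1 / wt s h \<xi>) \<in> borel_measurable borel"
  by measurable

lemma bounded_linear_lift_Hs: "s \<ge> 0 \<Longrightarrow> bounded_linear (lift_Hs s)"
  unfolding lift_Hs_def
    by (rule bounded_linear_multiplier[OF inverse_wt_measurable inverse_wt_bounds]) auto

lemma lift_Hs_in_Hs:
  assumes "s \<ge> 0"
  shows "lift_Hs s y \<in> Hs s" "fourier_multiplier (wt s 1) (lift_Hs s y) = y"
proof -
  have eq: "wt s 1 \<xi> * (1 / wt s 1 \<xi>) = 1" for \<xi> :: 'a using wt_pos[of 1 s \<xi>] by simp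
  note c = bounded_multiplier_compose[OF wt_measurable inverse_wt_measurable inverse_wt_bounds, of s
    1 s 1 1 y, unfolded eq]
  show "lift_Hs s y \<in> Hs s" unfolding Hs_eq lift_Hs_def by (rule c(1)) (use assms in auto)
  show "fourier_multiplier (wt s 1) (lift_Hs s y) = y"
    unfolding lift_Hs_def by (subst c(2)) (use assms in \<open>auto simp: weighted_space_one\<close>)
qed

lemma Hs_eq_lift:
  assumes "s \<ge> 0" "u \<in> Hs s"
  shows "u = lift_Hs s (fourier_multiplier (wt s 1) u)"
proof -
  have eq: "1 / wt s 1 \<xi> * wt s 1 \<xi> = 1" for \<xi> :: 'a using wt_pos[of 1 s \<xi>] by simp
  have "u \<in> weighted_space (wt s 1)" using assms by (simp add: Hs_eq)
  from fourier_multiplier_compose(2)[OF inverse_wt_measurable[of s 1] wt_measurable this, unfolded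
    eq, OF weighted_space_one(1)]
  show ?thesis by (simp add: lift_Hs_def weighted_space_one)
qed

lemma nH_lift_Hs:
  assumes s: "s \<ge> 0" and h: "h \<ge> 1"
  shows "fourier_multiplier (wt s h) (lift_Hs s y) = fourier_multiplier (\<lambda>\<xi>. wt s h \<xi> / wt s 1 \<xi>) y"
proof -
  have "\<bar>wt s h \<xi> * (1 / wt s 1 \<xi>)\<bar> \<le> h powr (s / 2)" for \<xi> :: 'a
    using wt_ratio_bounds(1)[OF s h, of \<xi>] by simp
  from bounded_multiplier_compose(2)[OF wt_measurable inverse_wt_measurable inverse_wt_bounds[OF s]
    this]
  show ?thesis by (simp add: lift_Hs_def)
qed

text \<open>With \<open>max 0 (t - \<tau>)\<close> the integrand is jointly continuous for all pairs
  of times and vanishes for \<tau> \<ge> t, because \<open>K_hat\<close> is 0 at time 0.\<close>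

lemma duhamel_integrand_continuous:
  fixes f :: "real \<Rightarrow> 'a::euclidean_space L2"
  assumes s: "0 \<le> s" "s \<le> 1" and f: "continuous_on {0..} f" and T: "U \<subseteq> {0..}"
  shows "continuous_on ({0..} \<times> U) (\<lambda>(t, \<tau>). fourier_multiplier (\<lambda>\<xi>. wt s 1 \<xi>
    * K_hat (max 0 (t - \<tau>)) \<xi>) (f \<tau>))"
proof -
  obtain C where C: "\<And>t \<xi>::'a. t \<ge> 0 \<Longrightarrow> \<bar>wt s 1 \<xi> * K_hat t \<xi>\<bar> \<le> C"
    by (rule wt_times_K_bounded[OF s, where 'a='a]) (rule that)
  have "continuous_on ({0..} \<times> U) (\<lambda>q. fourier_multiplier (\<lambda>\<xi>. wt s 1 \<xi>
    * K_hat (max 0 (fst q - snd q)) \<xi>) (f (snd q)))"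
  proof (rule continuous_on_fourier_multiplier)
    show "\<bar>wt s 1 \<xi> * K_hat (max 0 (fst q - snd q)) \<xi>\<bar> \<le> C" for q and \<xi> :: 'a
      by (rule C) simp
    show "continuous_on ({0..} \<times> U) (\<lambda>q. wt s 1 \<xi> * K_hat (max 0 (fst q - snd q)) \<xi>)" for \<xi> :: 'a
      by (intro continuous_intros continuous_on_compose2[OF continuous_K_hat[of UNIV]]) auto
    show "continuous_on ({0..} \<times> U) (\<lambda>q. f (snd q))"
      using T by (intro continuous_on_compose2[OF f] continuous_intros) auto
  qed measurable
  then show ?thesis by (simp add: split_beta')
qed

lemma duhamel_section_continuous:
  fixes f :: "real \<Rightarrow> 'a::euclidean_space L2"
  assumes s: "0 \<le> s" "s \<le> 1" and f: "continuous_on {0..} f" and t: "t \<ge> 0"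
  shows "continuous_on {0..t} (\<lambda>\<tau>. fourier_multiplier (\<lambda>\<xi>. wt s 1 \<xi> * K_hat (t - \<tau>) \<xi>) (f \<tau>))"
proof -
  have "continuous_on {0..t} (\<lambda>\<tau>. (\<lambda>(t, \<tau>). fourier_multiplier (\<lambda>\<xi>. wt s 1 \<xi>
    * K_hat (max 0 (t - \<tau>)) \<xi>) (f \<tau>)) (t, \<tau>))"
    by (rule continuous_on_compose2[OF duhamel_integrand_continuous[OF s f, of "{0..}"]])
      (use t in \<open>auto intro!: continuous_intros\<close>)
  then show ?thesis by (rule continuous_on_eq) (simp add: max_def)
qed

text \<open>The extension by zero to \<tau> > t makes the interval of integration independent of t,
  and the claim becomes continuity of a parameter integral.\<close>

lemma duhamel_continuous:
  fixes f :: "real \<Rightarrow> 'a::euclidean_space L2"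
  assumes s: "0 \<le> s" "s \<le> 1" and f: "continuous_on {0..} f"
  shows "continuous_on {0..} (duhamel s f)"
proof (rule continuous_on_atLeastI)
  fix T :: real assume T: "T \<ge> 0"
  let ?H = "\<lambda>t \<tau>. fourier_multiplier (\<lambda>\<xi>. wt s 1 \<xi> * K_hat (max 0 (t - \<tau>)) \<xi>) (f \<tau>)"
  have cont: "continuous_on ({0..T} \<times> cbox 0 T) (\<lambda>(t, \<tau>). ?H t \<tau>)"
    by (rule continuous_on_subset[OF duhamel_integrand_continuous[OF s f, of "{0..}"]]) auto
  have "continuous_on {0..T} (\<lambda>t. integral (cbox 0 T) (?H t))"
    by (rule integral_continuous_on_param[OF cont])
  then show "continuous_on {0..T} (duhamel s f)"
  proof (rule continuous_on_eq)
    fix t assume t: "t \<in> {0..T}"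
    have "continuous_on {0..T} (?H t)"
    proof -
      have "continuous_on {0..T} (\<lambda>\<tau>. (\<lambda>(t, \<tau>). ?H t \<tau>) (t, \<tau>))"
        by (rule continuous_on_compose2[OF cont]) (use t in \<open>auto intro!: continuous_intros\<close>)
      then show ?thesis by simp
    qed
    then have int: "?H t integrable_on {0..T}" by (rule integrable_continuous_interval)
    have "integral {0..t} (?H t) + integral {t..T} (?H t) = integral {0..T} (?H t)"
      using t int by (intro Henstock_Kurzweil_Integration.integral_combine) auto
    moreover have "integral {t..T} (?H t) = 0"
    proof -
      have "integral {t..T} (?H t) = integral {t..T} (\<lambda>_. 0)"
        by (intro Henstock_Kurzweil_Integration.integral_cong)
          (simp add: max_absorb1 K_hat_0 fourier_multiplier_zero)
      then show ?thesis by simp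
    qed
    moreover have "integral {0..t} (?H t) = duhamel s f t"
      unfolding duhamel_def by (intro Henstock_Kurzweil_Integration.integral_cong)
        (simp add: max_def)
    ultimately show "integral (cbox 0 T) (?H t) = duhamel s f t" by simp
  qed
qed

text \<open>A bounded operator commutes with the integral, and the symbol of \<open>lift_Hs\<close>
  cancels the weight. This links the weighted construction with the L2 valued integral in
  \<open>mild_solution\<close>.\<close>

lemma duhamel_has_integral:
  fixes f :: "real \<Rightarrow> 'a::euclidean_space L2"
  assumes s: "0 \<le> s" "s \<le> 1" and f: "continuous_on {0..} f" and t: "t \<ge> 0"
  shows "((\<lambda>\<tau>. K_conv (t - \<tau>) (f \<tau>)) has_integral lift_Hs s (duhamel s f t)) {0..t}"
proof -
  obtain C where C: "\<And>t \<xi>::'a. t \<ge> 0 \<Longrightarrow> \<bar>wt s 1 \<xi> * K_hat t \<xi>\<bar> \<le> C"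
    by (rule wt_times_K_bounded[OF s, where 'a='a]) (rule that)
  have KC: "\<bar>K_hat t \<xi>\<bar> \<le> C" if "t \<ge> 0" for t and \<xi> :: 'a
  proof -
    have "1 * \<bar>K_hat t \<xi>\<bar> \<le> wt s 1 \<xi> * \<bar>K_hat t \<xi>\<bar>" using wt_ge_1[of 1 s \<xi>] s
      by (intro mult_right_mono) auto
    also have "\<dots> = \<bar>wt s 1 \<xi> * K_hat t \<xi>\<bar>" using wt_pos[of 1 s \<xi>] by (simp add: abs_mult)
    finally show ?thesis using C[OF that, of \<xi>] by simp
  qed
  let ?H = "\<lambda>\<tau>. fourier_multiplier (\<lambda>\<xi>. wt s 1 \<xi> * K_hat (t - \<tau>) \<xi>) (f \<tau>)"
  have "(?H has_integral duhamel s f t) {0..t}"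
    unfolding duhamel_def
    by (intro integrable_integral integrable_continuous_interval duhamel_section_continuous s f t)
  from has_integral_linear[OF this bounded_linear_lift_Hs[OF s(1)]]
  have "((\<lambda>\<tau>. lift_Hs s (?H \<tau>)) has_integral lift_Hs s (duhamel s f t)) {0..t}"
    by (simp add: comp_def)
  then show ?thesis
  proof (rule has_integral_eq[rotated])
    fix \<tau> assume \<tau>: "\<tau> \<in> {0..t}"
    have eq: "1 / wt s 1 \<xi> * (wt s 1 \<xi> * K_hat (t - \<tau>) \<xi>) = K_hat (t - \<tau>) \<xi>" for \<xi> :: 'a
      using wt_pos[of 1 s \<xi>] by simp
    have m: "(\<lambda>\<xi>::'a. wt s 1 \<xi> * K_hat (t - \<tau>) \<xi>) \<in> borel_measurable borel" by measurable
    have "\<bar>K_hat (t - \<tau>) \<xi>\<bar> \<le> C" for \<xi> :: 'a using \<tau> by (intro KC) auto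
    moreover have "\<bar>wt s 1 \<xi> * K_hat (t - \<tau>) \<xi>\<bar> \<le> C" for \<xi> :: 'a using \<tau> by (intro C) auto
    ultimately show "lift_Hs s (?H \<tau>) = K_conv (t - \<tau>) (f \<tau>)"
      unfolding lift_Hs_def K_conv_def
      using bounded_multiplier_compose(2)[OF inverse_wt_measurable[of s 1] m, of C C "f \<tau>"]
        unfolding eq by simp
  qed
qed

lemma duhamel_diff:
  fixes f g :: "real \<Rightarrow> 'a::euclidean_space L2"
  assumes s: "0 \<le> s" "s \<le> 1" and f: "continuous_on {0..} f" and g: "continuous_on {0..} g"
    and t: "t \<ge> 0"
  shows "duhamel s (\<lambda>\<tau>. f \<tau> - g \<tau>) t = duhamel s f t - duhamel s g t"
proof -
  obtain C where C: "\<And>t \<xi>::'a. t \<ge> 0 \<Longrightarrow> \<bar>wt s 1 \<xi> * K_hat t \<xi>\<bar> \<le> C"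
    by (rule wt_times_K_bounded[OF s, where 'a='a]) (rule that)
  have "duhamel s (\<lambda>\<tau>. f \<tau> - g \<tau>) t
    = integral {0..t} (\<lambda>\<tau>. fourier_multiplier (\<lambda>\<xi>. wt s 1 \<xi> * K_hat (t - \<tau>) \<xi>) (f \<tau>) -
      fourier_multiplier (\<lambda>\<xi>. wt s 1 \<xi> * K_hat (t - \<tau>) \<xi>) (g \<tau>))"
    unfolding duhamel_def
  proof (rule Henstock_Kurzweil_Integration.integral_cong)
    fix \<tau> assume \<tau>: "\<tau> \<in> {0..t}"
    have m: "(\<lambda>\<xi>::'a. wt s 1 \<xi> * K_hat (t - \<tau>) \<xi>) \<in> borel_measurable borel" by measurable
    have b: "\<bar>wt s 1 \<xi> * K_hat (t - \<tau>) \<xi>\<bar> \<le> C" for \<xi> :: 'a using \<tau> by (intro C) auto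
    show "fourier_multiplier (\<lambda>\<xi>. wt s 1 \<xi> * K_hat (t - \<tau>) \<xi>) (f \<tau> - g \<tau>)
      = fourier_multiplier (\<lambda>\<xi>. wt s 1 \<xi> * K_hat (t - \<tau>) \<xi>) (f \<tau>) -
      fourier_multiplier (\<lambda>\<xi>. wt s 1 \<xi> * K_hat (t - \<tau>) \<xi>) (g \<tau>)"
      by (rule weighted_space_diff(2)[OF m bounded_multiplier(1)[OF m b]
        bounded_multiplier(1)[OF m b]])
  qed
  also have "\<dots> = duhamel s f t - duhamel s g t"
    unfolding duhamel_def
    by (intro Henstock_Kurzweil_Integration.integral_diff integrable_continuous_interval
      duhamel_section_continuous s f g t)
  finally show ?thesis .
qed

text \<open>For fixed \<open>h\<close> the quotient of the weights is a bounded symbol and may be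
  moved under the integral. The norm is taken only afterwards, so the growth of that quotient with
  \<open>h\<close> does not enter the bound.\<close>

lemma duhamel_norm_bound:
  fixes f :: "real \<Rightarrow> 'a::euclidean_space L2"
  assumes s: "0 \<le> s" "s \<le> 1" and f: "continuous_on {0..} f" and t: "t \<ge> 0" and h: "h \<ge> 1"
    and g: "(g has_integral G) {0..t}"
    and le: "\<And>\<tau>. \<tau> \<in> {0..t} \<Longrightarrow> norm (fourier_multiplier (\<lambda>\<xi>. wt s h \<xi> * K_hat (t - \<tau>) \<xi>) (f \<tau>))
      \<le> g \<tau>"
  shows "nH s h (lift_Hs s (duhamel s f t)) \<le> G"
proof -
  obtain C where C: "\<And>t \<xi>::'a. t \<ge> 0 \<Longrightarrow> \<bar>wt s 1 \<xi> * K_hat t \<xi>\<bar> \<le> C"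
    by (rule wt_times_K_bounded[OF s, where 'a='a]) (rule that)
  let ?A = "fourier_multiplier (\<lambda>\<xi>::'a. wt s h \<xi> / wt s 1 \<xi>)"
  let ?H = "\<lambda>\<tau>. fourier_multiplier (\<lambda>\<xi>. wt s 1 \<xi> * K_hat (t - \<tau>) \<xi>) (f \<tau>)"
  have Am: "(\<lambda>\<xi>::'a. wt s h \<xi> / wt s 1 \<xi>) \<in> borel_measurable borel" by measurable
  have A: "bounded_linear ?A"
    by (rule bounded_linear_multiplier[OF Am wt_ratio_bounds(1)[OF s(1) h]])
  have H: "(?H has_integral duhamel s f t) {0..t}"
    unfolding duhamel_def
    by (intro integrable_integral integrable_continuous_interval duhamel_section_continuous s f t)
  have "?A (?H \<tau>) = fourier_multiplier (\<lambda>\<xi>. wt s h \<xi> * K_hat (t - \<tau>) \<xi>) (f \<tau>)" if \<tau>: "\<tau> \<in> {0..t}"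
    for \<tau>
  proof -
    have eq: "wt s h \<xi> / wt s 1 \<xi> * (wt s 1 \<xi> * K_hat (t - \<tau>) \<xi>) = wt s h \<xi> * K_hat (t - \<tau>) \<xi>"
      for \<xi> :: 'a
      using wt_pos[of 1 s \<xi>] by simp
    have m: "(\<lambda>\<xi>::'a. wt s 1 \<xi> * K_hat (t - \<tau>) \<xi>) \<in> borel_measurable borel" by measurable
    have b: "\<bar>wt s 1 \<xi> * K_hat (t - \<tau>) \<xi>\<bar> \<le> C" for \<xi> :: 'a using \<tau> by (intro C) auto
    have "\<bar>wt s h \<xi> / wt s 1 \<xi> * (wt s 1 \<xi> * K_hat (t - \<tau>) \<xi>)\<bar> \<le> h powr (s / 2) * C" for \<xi> :: 'a
      unfolding abs_mult[of "wt s h \<xi> / wt s 1 \<xi>"] by (intro mult_mono wt_ratio_bounds s h b) auto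
    from bounded_multiplier_compose(2)[OF Am m b this] show ?thesis unfolding eq .
  qed
  moreover have "(?A \<circ> ?H has_integral ?A (duhamel s f t)) {0..t}"
    by (rule has_integral_linear[OF H A])
  ultimately have *:
    "((\<lambda>\<tau>. fourier_multiplier (\<lambda>\<xi>. wt s h \<xi> * K_hat (t - \<tau>) \<xi>) (f \<tau>)) has_integral ?A
    (duhamel s f t)) {0..t}"
    by (auto intro: has_integral_eq[rotated])
  have "norm (integral {0..t} (\<lambda>\<tau>. fourier_multiplier (\<lambda>\<xi>. wt s h \<xi> * K_hat (t - \<tau>) \<xi>) (f \<tau>)))
    \<le> integral {0..t} g"
    by (rule integral_norm_bound_integral) (use * g le in auto)
  then show ?thesis
    unfolding nH_lift_Hs[OF s(1) h] integral_unique[OF *] integral_unique[OF g] .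
qed

text \<open>By an explicit antiderivative; \<kappa> > 1 makes the bound independent of t.\<close>

lemma two_sided_decay_integral:
  fixes \<kappa> t :: real
  assumes k: "\<kappa> > 1" and t: "t \<ge> 0"
  shows "\<exists>G \<le> 2 / (\<kappa> - 1). ((\<lambda>\<tau>. (1 + \<tau>) powr (- \<kappa>) + (1 + t - \<tau>) powr (- \<kappa>)) has_integral G)
    {0..t}"
proof -
  define F where "F \<tau> = ((1 + t - \<tau>) powr (1 - \<kappa>) - (1 + \<tau>) powr (1 - \<kappa>)) / (\<kappa> - 1)" for \<tau>
  have "((\<lambda>\<tau>. (1 + \<tau>) powr (- \<kappa>) + (1 + t - \<tau>) powr (- \<kappa>)) has_integral (F t - F 0)) {0..t}"
  proof (rule fundamental_theorem_of_calculus[OF t])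
    fix x assume x: "x \<in> {0..t}"
    have "((\<lambda>\<tau>. (1 + t - \<tau>) powr (1 - \<kappa>)) has_real_derivative (\<kappa> - 1)
      * (1 + t - x) powr (- \<kappa>)) (at x within {0..t})"
      using x by (auto intro!: derivative_eq_intros simp: algebra_simps)
    moreover have
      "((\<lambda>\<tau>. (1 + \<tau>) powr (1 - \<kappa>)) has_real_derivative (1 - \<kappa>)
      * (1 + x) powr (- \<kappa>)) (at x within {0..t})"
      using x by (auto intro!: derivative_eq_intros)
    ultimately have
      "(F has_real_derivative ((\<kappa> - 1) * (1 + t - x) powr (- \<kappa>) - (1 - \<kappa>) * (1 + x) powr (- \<kappa>))
      / (\<kappa> - 1)) (at x within {0..t})"
      unfolding F_def by (intro DERIV_cdivide DERIV_diff)
    moreover have "((\<kappa> - 1) * A - (1 - \<kappa>) * B) / (\<kappa> - 1) = B + A" for A B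
    proof -
      have "(\<kappa> - 1) * A - (1 - \<kappa>) * B = (\<kappa> - 1) * (B + A)" by (simp add: algebra_simps)
      then show ?thesis using k by simp
    qed
    ultimately have
      "(F has_real_derivative ((1 + x) powr (- \<kappa>) + (1 + t - x) powr (- \<kappa>))) (at x within {0..t})"
      by simp
    then show
      "(F has_vector_derivative ((1 + x) powr (- \<kappa>) + (1 + t - x) powr (- \<kappa>))) (at x within {0..t})"
      by (simp add: has_real_derivative_iff_has_vector_derivative)
  qed
  moreover have "F t - F 0 \<le> 2 / (\<kappa> - 1)"
  proof -
    have "F t - F 0 = (2 - 2 * (1 + t) powr (1 - \<kappa>)) / (\<kappa> - 1)"
      by (simp add: F_def diff_divide_distrib[symmetric])
    also have "\<dots> \<le> 2 / (\<kappa> - 1)" using k by (intro divide_right_mono) auto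
    finally show ?thesis .
  qed
  ultimately show ?thesis by blast
qed

lemma half_powr: "(y / 2) powr (- b) = 2 powr b * y powr (- b)" for y b :: real
proof -
  have "(y / 2) powr (- b) = y powr (- b) / inverse (2 powr b)"
    by (simp only: powr_divide powr_minus[of 2])
  then show ?thesis
    by (simp only: divide_inverse inverse_inverse_eq mult.commute[of "y powr (- b)"])
qed

text \<open>The quotient of the weights at times t and t-\<tau> has to be paid for. For \<tau> \<le>
  t/2 it is at most 2, and the negative norm provides the rate. For \<tau> > t/2 it is unbounded but
  at most 2((1+\<tau>)/(1+t-\<tau>))^\<kappa> with \<kappa> = \<beta> - \<gamma>/2, since s/2 <
  \<kappa> and the base is at least 1. Writing the L2 decay as (1+\<tau>)^(-\<kappa>)
  (1+\<tau>)^(-\<gamma>/2) cancels the powers of 1+\<tau>; there remain the integrable power of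
  1+t-\<tau> and the rate, as 1+\<tau> is comparable with 1+t.\<close>

lemma kernel_split_bound:
  fixes f :: "'a::euclidean_space L2"
  assumes s: "0 \<le> s" "s \<le> 1" and \<gamma>: "\<gamma> > 0" and k: "\<beta> - \<gamma> / 2 > 1"
    and C: "C > 0" "\<And>t \<xi>::'a. t \<ge> 0 \<Longrightarrow> wt s (1 + t) \<xi> * \<bar>K_hat t \<xi>\<bar> \<le> C"
      "\<And>t \<xi>::'a. t \<ge> 0 \<Longrightarrow> \<xi> \<noteq> 0 \<Longrightarrow> wt s (1 + t) \<xi> * \<bar>K_hat t \<xi>\<bar>
        \<le> C * (1 + t) powr (- \<gamma> / 2) * (norm \<xi> powr (- \<gamma>) + 1)"
    and \<tau>: "0 \<le> \<tau>" "\<tau> \<le> t"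
    and f: "norm f \<le> a * (1 + \<tau>) powr (- \<beta>)" "f \<in> hom_Hs (- \<gamma>)"
      "norm_hom_Hs (- \<gamma>) f \<le> a * (1 + \<tau>) powr (- \<beta> + \<gamma> / 2)"
    and a: "a \<ge> 0"
  shows "norm (fourier_multiplier (\<lambda>\<xi>. wt s (1 + t) \<xi> * K_hat (t - \<tau>) \<xi>) f) \<le>
    4 * C * 2 powr (\<gamma> / 2) * a * (1 + t) powr (- \<gamma> / 2) *
      ((1 + \<tau>) powr (- (\<beta> - \<gamma> / 2)) + (1 + t - \<tau>) powr (- (\<beta> - \<gamma> / 2)))"
proof -
  let ?\<kappa> = "\<beta> - \<gamma> / 2" and ?h = "1 + (t - \<tau>)"
  let ?m = "\<lambda>\<xi>::'a. wt s (1 + t) \<xi> * K_hat (t - \<tau>) \<xi>"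
  \<comment> \<open>The price of replacing the weight at time t by that at time t-\<tau>.\<close>
  define c where "c = ((1 + t) / ?h) powr (s / 2)"
  have h: "?h \<ge> 1" using \<tau> by simp
  have c1: "c \<ge> 0" by (simp add: c_def)
  have m: "?m \<in> borel_measurable borel" by measurable
  have mle: "\<bar>?m \<xi>\<bar> \<le> c * (wt s ?h \<xi> * \<bar>K_hat (t - \<tau>) \<xi>\<bar>)" for \<xi> :: 'a
  proof -
    have "wt s (1 + t) \<xi> \<le> c * wt s ?h \<xi>"
      unfolding c_def using \<tau> s by (intro wt_scale) auto
    from mult_right_mono[OF this, of "\<bar>K_hat (t - \<tau>) \<xi>\<bar>"]
    show ?thesis using wt_pos[of "1 + t" s \<xi>] \<tau> by (simp add: abs_mult mult.assoc)
  qed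
  define R where "R = 4 * C * 2 powr (\<gamma> / 2) * a * (1 + t) powr (- \<gamma> / 2)"
  have R0: "R \<ge> 0" using C a by (simp add: R_def)
  show ?thesis
  proof (cases "\<tau> \<le> t / 2")
    case True
    have hh: "(1 + t) / ?h \<le> 2" using True \<tau> by (simp add: field_simps)
    have "c \<le> 2 powr (s / 2)" unfolding c_def using hh s h \<tau> by (intro powr_mono2) auto
    also have "\<dots> \<le> 2 powr 1" using s by (intro powr_mono) auto
    finally have c2: "c \<le> 2" by simp
    define A where "A = c * (C * ?h powr (- \<gamma> / 2))"
    have A0: "A \<ge> 0" using C c1 by (simp add: A_def)
    have fw: "f \<in> weighted_space (\<lambda>\<xi>. norm \<xi> powr (- \<gamma>))" using f(2) by (simp add: hom_Hs_def)
    have "norm (fourier_multiplier ?m f) \<le> A * norm (fourier_multiplier (\<lambda>\<xi>. norm \<xi> powr (- \<gamma>)) f)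
      + A * norm (fourier_multiplier (\<lambda>\<xi>. 1) f)"
    proof (rule fourier_multiplier_le_add(2)[OF m _ _ fw weighted_space_one(1) _ A0 A0])
      show "AE \<xi>::'a in lborel. \<bar>?m \<xi>\<bar> \<le> A * \<bar>norm \<xi> powr (- \<gamma>)\<bar> + A * \<bar>1\<bar>"
        using AE_lborel_singleton[of "0::'a"]
      proof eventually_elim
        case (elim \<xi>)
        have "\<bar>?m \<xi>\<bar> \<le> c * (C * ?h powr (- \<gamma> / 2) * (norm \<xi> powr (- \<gamma>) + 1))"
          using \<tau> c1 by (intro order_trans[OF mle] mult_left_mono C(3) elim) auto
        then show ?case by (simp add: A_def algebra_simps)
      qed
    qed measurable
    also have "\<dots> = A * (norm_hom_Hs (- \<gamma>) f + norm f)"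
      by (simp add: norm_fourier_multiplier[OF fw] norm_hom_Hs_def weighted_space_one distrib_left)
    also have "\<dots> \<le> A * (a * (1 + \<tau>) powr (- ?\<kappa>) + a * (1 + \<tau>) powr (- ?\<kappa>))"
    proof (intro mult_left_mono add_mono A0)
      show "norm_hom_Hs (- \<gamma>) f \<le> a * (1 + \<tau>) powr (- ?\<kappa>)" using f(3) by simp
      have "a * (1 + \<tau>) powr (- \<beta>) \<le> a * (1 + \<tau>) powr (- ?\<kappa>)"
        using a \<tau> \<gamma> by (intro mult_left_mono powr_mono) auto
      then show "norm f \<le> a * (1 + \<tau>) powr (- ?\<kappa>)" using f(1) by linarith
    qed
    also have "\<dots> = A * (2 * a * (1 + \<tau>) powr (- ?\<kappa>))" by simp
    also have "\<dots> \<le> (2 * (C * (2 powr (\<gamma> / 2) * (1 + t) powr (- \<gamma> / 2))))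
      * (2 * a * (1 + \<tau>) powr (- ?\<kappa>))"
    proof (intro mult_right_mono)
      have "?h powr (- \<gamma> / 2) \<le> ((1 + t) / 2) powr (- \<gamma> / 2)"
        using True \<tau> \<gamma> by (intro powr_mono2') auto
      also have "\<dots> = 2 powr (\<gamma> / 2) * (1 + t) powr (- \<gamma> / 2)"
        using half_powr[of "1 + t" "\<gamma> / 2"] by (simp only: minus_divide_left)
      finally show "A \<le> 2 * (C * (2 powr (\<gamma> / 2) * (1 + t) powr (- \<gamma> / 2)))"
        unfolding A_def using C c1 c2 by (intro mult_mono) auto
    qed (use a in auto)
    also have "\<dots> = R * (1 + \<tau>) powr (- ?\<kappa>)" by (simp add: R_def)
    also have "\<dots> \<le> R * ((1 + \<tau>) powr (- ?\<kappa>) + (1 + t - \<tau>) powr (- ?\<kappa>))"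
      using R0 by (intro mult_left_mono) auto
    finally show ?thesis unfolding R_def .
  next
    case False
    have b: "\<bar>?m \<xi>\<bar> \<le> c * C" for \<xi> :: 'a
      using \<tau> c1 by (intro order_trans[OF mle] mult_left_mono C(2)) auto
    have "norm (fourier_multiplier ?m f) \<le> c * C * norm f" by (rule bounded_multiplier(2)[OF m b])
    also have "\<dots> \<le> c * C * (a * (1 + \<tau>) powr (- \<beta>))" using c1 C by (intro mult_left_mono f) auto
    also have "\<dots> \<le> (2 * ((1 + \<tau>) / ?h) powr ?\<kappa>) * C
      * (a * ((1 + \<tau>) powr (- ?\<kappa>) * (2 powr (\<gamma> / 2) * (1 + t) powr (- \<gamma> / 2))))"
    proof (intro mult_mono)
      have q: "1 \<le> (1 + \<tau>) / ?h" using False \<tau> by (simp add: field_simps)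
      have "1 + t \<le> 2 * (1 + \<tau>)" using False by simp
      from divide_right_mono[OF this, of ?h] h
      have "(1 + t) / ?h \<le> 2 * ((1 + \<tau>) / ?h)" by simp
      then have "c \<le> (2 * ((1 + \<tau>) / ?h)) powr (s / 2)"
        unfolding c_def using s \<tau> by (intro powr_mono2) auto
      also have "\<dots> = 2 powr (s / 2) * ((1 + \<tau>) / ?h) powr (s / 2)" by (rule powr_mult)
      also have "\<dots> \<le> 2 powr 1 * ((1 + \<tau>) / ?h) powr ?\<kappa>"
        using s k q by (intro mult_mono powr_mono) auto
      finally show "c \<le> 2 * ((1 + \<tau>) / ?h) powr ?\<kappa>" by simp
      have "(1 + \<tau>) powr (- \<beta>) = (1 + \<tau>) powr (- ?\<kappa>) * (1 + \<tau>) powr (- \<gamma> / 2)"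
        using \<tau> by (simp add: powr_add[symmetric])
      also have "\<dots> \<le> (1 + \<tau>) powr (- ?\<kappa>) * (2 powr (\<gamma> / 2) * (1 + t) powr (- \<gamma> / 2))"
      proof (intro mult_left_mono)
        have "(1 + \<tau>) powr (- \<gamma> / 2) \<le> ((1 + t) / 2) powr (- \<gamma> / 2)"
          using False \<tau> \<gamma> by (intro powr_mono2') auto
        also have "\<dots> = 2 powr (\<gamma> / 2) * (1 + t) powr (- \<gamma> / 2)"
          using half_powr[of "1 + t" "\<gamma> / 2"] by (simp only: minus_divide_left)
        finally show "(1 + \<tau>) powr (- \<gamma> / 2) \<le> 2 powr (\<gamma> / 2) * (1 + t) powr (- \<gamma> / 2)" .
      qed simp
      finally show "(1 + \<tau>) powr (- \<beta>)
        \<le> (1 + \<tau>) powr (- ?\<kappa>) * (2 powr (\<gamma> / 2) * (1 + t) powr (- \<gamma> / 2))" .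
    qed (use C a c1 in auto)
    also have "((1 + \<tau>) / ?h) powr ?\<kappa> = (1 + \<tau>) powr ?\<kappa> * ?h powr (- ?\<kappa>)"
      unfolding powr_divide powr_minus by (rule divide_inverse)
    also have "(2 * ((1 + \<tau>) powr ?\<kappa> * ?h powr (- ?\<kappa>))) * C
      * (a * ((1 + \<tau>) powr (- ?\<kappa>) * (2 powr (\<gamma> / 2) * (1 + t) powr (- \<gamma> / 2)))) =
      (R / 2) * ?h powr (- ?\<kappa>) * ((1 + \<tau>) powr ?\<kappa> * (1 + \<tau>) powr (- ?\<kappa>))"
      by (simp add: R_def)
    also have "(1 + \<tau>) powr ?\<kappa> * (1 + \<tau>) powr (- ?\<kappa>) = 1" using \<tau> by (simp add: powr_add[symmetric])
    also have "R / 2 * ?h powr (- ?\<kappa>) * 1 \<le> R * ((1 + \<tau>) powr (- ?\<kappa>) + (1 + t - \<tau>) powr (- ?\<kappa>))"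
    proof -
      have "R / 2 * ?h powr (- ?\<kappa>) * 1 \<le> R * ?h powr (- ?\<kappa>)" using R0 by (simp add: mult_right_mono)
      also have "\<dots> \<le> R * ((1 + \<tau>) powr (- ?\<kappa>) + (1 + t - \<tau>) powr (- ?\<kappa>))"
        using R0 by (intro mult_left_mono) (auto simp: add_diff_eq)
      finally show ?thesis .
    qed
    finally show ?thesis unfolding R_def .
  qed
qed

lemma duhamel_decay:
  fixes s \<gamma> \<beta> :: real
  assumes s: "0 \<le> s" "s \<le> 1" and \<gamma>: "\<gamma> > 0" and k: "\<beta> - \<gamma> / 2 > 1"
  shows "\<exists>C>0. \<forall>a\<ge>0. \<forall>f::real \<Rightarrow> 'a::euclidean_space L2. continuous_on {0..} f \<and>
    (\<forall>\<tau>\<ge>0. norm (f \<tau>) \<le> a * (1 + \<tau>) powr (- \<beta>) \<and> f \<tau> \<in> hom_Hs (- \<gamma>) \<and>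
      norm_hom_Hs (- \<gamma>) (f \<tau>) \<le> a * (1 + \<tau>) powr (- \<beta> + \<gamma> / 2)) \<longrightarrow>
    (\<forall>t\<ge>0. nH s (1 + t) (lift_Hs s (duhamel s f t)) \<le> C * a * (1 + t) powr (- \<gamma> / 2))"
proof -
  let ?\<kappa> = "\<beta> - \<gamma> / 2"
  obtain C where C: "C > 0" "\<And>t \<xi>::'a. t \<ge> 0 \<Longrightarrow> wt s (1 + t) \<xi> * \<bar>K_hat t \<xi>\<bar> \<le> C"
      "\<And>t \<xi>::'a. t \<ge> 0 \<Longrightarrow> \<xi> \<noteq> 0 \<Longrightarrow> wt s (1 + t) \<xi> * \<bar>K_hat t \<xi>\<bar>
        \<le> C * (1 + t) powr (- \<gamma> / 2) * (norm \<xi> powr (- \<gamma>) + 1)"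
    using K_hat_weighted_bound[of \<gamma> s, where 'a='a] s \<gamma> by (metis less_imp_le)
  define K where "K = 4 * C * 2 powr (\<gamma> / 2) * (2 / (?\<kappa> - 1))"
  have K: "K > 0" using C k by (simp add: K_def)
  have "nH s (1 + t) (lift_Hs s (duhamel s f t)) \<le> K * a * (1 + t) powr (- \<gamma> / 2)"
    if a: "a \<ge> 0" and f: "continuous_on {0..} f" and t: "t \<ge> 0"
      and fb: "\<forall>\<tau>\<ge>0. norm (f \<tau>) \<le> a * (1 + \<tau>) powr (- \<beta>) \<and> f \<tau> \<in> hom_Hs (- \<gamma>) \<and>
      norm_hom_Hs (- \<gamma>) (f \<tau>) \<le> a * (1 + \<tau>) powr (- \<beta> + \<gamma> / 2)" for a t and f :: "real \<Rightarrow> 'a L2"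
  proof -
    define R where "R = 4 * C * 2 powr (\<gamma> / 2) * a * (1 + t) powr (- \<gamma> / 2)"
    have R0: "R \<ge> 0" using C a by (simp add: R_def)
    obtain G where G: "G \<le> 2 / (?\<kappa> - 1)"
      "((\<lambda>\<tau>. (1 + \<tau>) powr (- ?\<kappa>) + (1 + t - \<tau>) powr (- ?\<kappa>)) has_integral G) {0..t}"
      using two_sided_decay_integral[OF k t] by blast
    have "nH s (1 + t) (lift_Hs s (duhamel s f t)) \<le> R * G"
    proof (rule duhamel_norm_bound[OF s f t])
      show "((\<lambda>\<tau>. R * ((1 + \<tau>) powr (- ?\<kappa>) + (1 + t - \<tau>) powr (- ?\<kappa>))) has_integral (R * G)) {0..t}"
        by (rule has_integral_mult_right[OF G(2)])
      show "norm (fourier_multiplier (\<lambda>\<xi>. wt s (1 + t) \<xi> * K_hat (t - \<tau>) \<xi>) (f \<tau>))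
        \<le> R * ((1 + \<tau>) powr (- ?\<kappa>) + (1 + t - \<tau>) powr (- ?\<kappa>))"
        if "\<tau> \<in> {0..t}" for \<tau>
        unfolding R_def using that fb by (intro kernel_split_bound s \<gamma> k C a) auto
    qed (use t in auto)
    also have "\<dots> \<le> R * (2 / (?\<kappa> - 1))" using R0 G by (intro mult_left_mono)
    also have "\<dots> = K * a * (1 + t) powr (- \<gamma> / 2)" by (simp add: R_def K_def)
    finally show ?thesis .
  qed
  with K show ?thesis by blast
qed

section \<open>The linear flow\<close>

lemma K_hat_bounded:
  obtains C where "C > 0" "\<And>t \<xi>::'a::euclidean_space. t \<ge> 0 \<Longrightarrow> \<bar>K_hat t \<xi>\<bar> \<le> C"
proof -
  have "wt 0 h \<xi> = 1" if "h \<ge> 0" for h and \<xi> :: 'a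
    using that unfolding wt_def by (simp add: add_nonneg_eq_0_iff)
  moreover obtain C where "C > 0" "\<And>t \<xi>::'a. t \<ge> 0 \<Longrightarrow> \<bar>wt 0 1 \<xi> * K_hat t \<xi>\<bar> \<le> C"
    by (rule wt_times_K_bounded[of 0, where 'a='a]) auto
  ultimately show ?thesis using that by simp
qed

definition linear_flow :: "'a::euclidean_space L2 \<Rightarrow> 'a L2 \<Rightarrow> real \<Rightarrow> 'a L2" where
  "linear_flow u0 u1 t = K'_conv t u0 + K_conv t (u0 + u1)"

text \<open>Since the derivative of K is E - K/2, half of the term with \<open>u0\<close> cancels.
  The regrouping separates the part without smoothing, which needs \<open>u0\<close> in H^s, from
  the part that gains a derivative and may act on L2.\<close>

lemma linear_flow_eq:
  assumes t: "t \<ge> 0"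
  shows "linear_flow u0 u1 t = fourier_multiplier (E_hat t) u0
    + fourier_multiplier (K_hat t) ((1 / 2) *\<^sub>R u0 + (u1::'a::euclidean_space L2))"
proof -
  obtain C where C: "\<And>t \<xi>::'a. t \<ge> 0 \<Longrightarrow> \<bar>K_hat t \<xi>\<bar> \<le> C"
    by (rule K_hat_bounded[where 'a='a]) (rule that)
  have Kw: "u \<in> weighted_space (K_hat t)" for u :: "'a L2"
    by (rule bounded_multiplier(1)[OF K_hat_measurable C[OF t]])
  have Ew: "u \<in> weighted_space (E_hat t)" for u :: "'a L2"
    by (rule bounded_multiplier(1)[OF E_hat_measurable E_hat_bounded[OF t]])
  note c = weighted_space_cmult[OF K_hat_measurable Kw[of u0], of "- 1 / 2"]
  have "K'_conv t u0 = fourier_multiplier (\<lambda>\<xi>. E_hat t \<xi> + (- 1 / 2) * K_hat t \<xi>) u0"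
    by (simp add: K'_conv_def deriv_K_hat)
  also have "\<dots> = fourier_multiplier (E_hat t) u0 + (- 1 / 2) *\<^sub>R fourier_multiplier (K_hat t) u0"
    using weighted_space_plus(2)[OF E_hat_measurable _ Ew[of u0] c(1)] c(2) by simp
  finally have 1: "K'_conv t u0 = fourier_multiplier (E_hat t) u0
    + (- 1 / 2) *\<^sub>R fourier_multiplier (K_hat t) u0" .
  interpret K: bounded_linear "fourier_multiplier (K_hat t :: 'a \<Rightarrow> real)"
    by (rule bounded_linear_multiplier[OF K_hat_measurable C[OF t]])
  have "fourier_multiplier (K_hat t) u0 = (1 / 2) *\<^sub>R fourier_multiplier (K_hat t) u0
    + (1 / 2) *\<^sub>R fourier_multiplier (K_hat t) u0"
    by (simp add: scaleR_add_left[symmetric])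
  then show ?thesis
    unfolding linear_flow_def 1 K_conv_def K.add K.scaleR by (simp add: algebra_simps)
qed

lemma linear_flow_weighted:
  fixes u0 u1 :: "'a::euclidean_space L2"
  assumes s: "0 \<le> s" "s \<le> 1" and t: "t \<ge> 0" and h: "h \<ge> 1" and u0: "u0 \<in> Hs s"
  shows "linear_flow u0 u1 t \<in> weighted_space (wt s h)"
    and "fourier_multiplier (wt s h) (linear_flow u0 u1 t) =
      fourier_multiplier (\<lambda>\<xi>. wt s h \<xi> * E_hat t \<xi>) u0 +
      fourier_multiplier (\<lambda>\<xi>. wt s h \<xi> * K_hat t \<xi>) ((1 / 2) *\<^sub>R u0 + u1)"
proof -
  let ?v = "(1 / 2) *\<^sub>R u0 + u1"
  obtain C0 where C0: "\<And>t \<xi>::'a. t \<ge> 0 \<Longrightarrow> \<bar>K_hat t \<xi>\<bar> \<le> C0"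
    by (rule K_hat_bounded[where 'a='a]) (rule that)
  obtain C where C: "\<And>t \<xi>::'a. t \<ge> 0 \<Longrightarrow> \<bar>wt s 1 \<xi> * K_hat t \<xi>\<bar> \<le> C"
    by (rule wt_times_K_bounded[OF s, where 'a='a]) (rule that)
  have Cb: "\<bar>wt s h \<xi> * K_hat t \<xi>\<bar> \<le> h powr (s / 2) * C" for \<xi> :: 'a
  proof -
    have "wt s h \<xi> * K_hat t \<xi> = (wt s h \<xi> / wt s 1 \<xi>) * (wt s 1 \<xi> * K_hat t \<xi>)"
      using wt_pos[of 1 s \<xi>] by simp
    also have "\<bar>\<dots>\<bar> \<le> h powr (s / 2) * C"
      unfolding abs_mult[of "wt s h \<xi> / wt s 1 \<xi>"] by (intro mult_mono wt_ratio_bounds s h C t) auto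
    finally show ?thesis .
  qed
  note K = bounded_multiplier_compose[OF wt_measurable[of s h] K_hat_measurable C0[OF t] Cb, of ?v]
  have Ew: "u0 \<in> weighted_space (E_hat t)"
    by (rule bounded_multiplier(1)[OF E_hat_measurable E_hat_bounded[OF t]])
  have uw: "u0 \<in> weighted_space (wt s h)" by (rule Hs_weighted_space[OF u0 h s(1)])
  have EW: "u0 \<in> weighted_space (\<lambda>\<xi>. wt s h \<xi> * E_hat t \<xi>)"
  proof (rule fourier_multiplier_mono(1)[OF uw])
    show "AE \<xi>::'a in lborel. \<bar>wt s h \<xi> * E_hat t \<xi>\<bar> \<le> \<bar>wt s h \<xi>\<bar>"
      unfolding abs_mult by (intro AE_I2 mult_left_le E_hat_bounded t abs_ge_zero)
  qed measurable
  note E = fourier_multiplier_compose[OF wt_measurable[of s h] E_hat_measurable[of t] Ew]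
  have E1: "fourier_multiplier (E_hat t) u0 \<in> weighted_space (wt s h)" using E(1) EW by simp
  show "linear_flow u0 u1 t \<in> weighted_space (wt s h)"
    unfolding linear_flow_eq[OF t] by (rule weighted_space_add(1)[OF wt_measurable E1 K(1)])
  show "fourier_multiplier (wt s h) (linear_flow u0 u1 t) =
      fourier_multiplier (\<lambda>\<xi>. wt s h \<xi> * E_hat t \<xi>) u0 +
      fourier_multiplier (\<lambda>\<xi>. wt s h \<xi> * K_hat t \<xi>) ((1 / 2) *\<^sub>R u0 + u1)"
    unfolding linear_flow_eq[OF t] weighted_space_add(2)[OF wt_measurable E1 K(1)] E(2)[OF EW] K(2)
      ..
qed

lemma linear_flow_continuous:
  fixes u0 u1 :: "'a::euclidean_space L2"
  assumes s: "0 \<le> s" "s \<le> 1" and u0: "u0 \<in> Hs s"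
  shows "continuous_on {0..} (\<lambda>t. fourier_multiplier (wt s 1) (linear_flow u0 u1 t))"
proof -
  obtain C where C: "\<And>t \<xi>::'a. t \<ge> 0 \<Longrightarrow> \<bar>wt s 1 \<xi> * K_hat t \<xi>\<bar> \<le> C"
    by (rule wt_times_K_bounded[OF s, where 'a='a]) (rule that)
  have uw: "u0 \<in> weighted_space (wt s 1)" using u0 by (simp add: Hs_eq)
  \<comment> \<open>The weight acts on \<open>u0\<close> before E does: the symbols E are uniformly
    bounded, while their products with the weight need not be.\<close>
  have "continuous_on {0..} (\<lambda>t. fourier_multiplier (E_hat t) (fourier_multiplier (wt s 1) u0) +
      fourier_multiplier (\<lambda>\<xi>. wt s 1 \<xi> * K_hat t \<xi>) ((1 / 2) *\<^sub>R u0 + u1))"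
    by (intro continuous_on_add continuous_on_fourier_multiplier[where B=1]
      continuous_on_fourier_multiplier[where B=C]
        continuous_E_hat E_hat_bounded continuous_on_mult continuous_K_hat C continuous_on_const)
          auto
  then show ?thesis
  proof (rule continuous_on_eq)
    fix t :: real assume t: "t \<in> {0..}"
    have "u0 \<in> weighted_space (\<lambda>\<xi>. E_hat t \<xi> * wt s 1 \<xi>)"
    proof (rule fourier_multiplier_mono(1)[OF uw])
      show "AE \<xi>::'a in lborel. \<bar>E_hat t \<xi> * wt s 1 \<xi>\<bar> \<le> \<bar>wt s 1 \<xi>\<bar>"
        unfolding abs_mult using t by (intro AE_I2 mult_left_le_one_le E_hat_bounded abs_ge_zero)
          auto
    qed measurable
    from fourier_multiplier_compose(2)[OF E_hat_measurable wt_measurable uw this]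
    show "fourier_multiplier (E_hat t) (fourier_multiplier (wt s 1) u0) +
        fourier_multiplier (\<lambda>\<xi>. wt s 1 \<xi> * K_hat t \<xi>) ((1 / 2) *\<^sub>R u0 + u1) = fourier_multiplier
          (wt s 1) (linear_flow u0 u1 t)"
      using linear_flow_weighted(2)[OF s _ _ u0, of t 1 u1] t by (simp add: mult.commute)
  qed
qed

text \<open>The decaying kernel bounds with a = \<gamma>: E is measured by the negative and the H^s
  norm of \<open>u0\<close>, K by the negative and the L2 norm of u0/2 + u1. The data norm dominates
  all of these.\<close>

lemma linear_flow_decay:
  assumes s: "0 \<le> s" "s \<le> 1" and \<gamma>: "\<gamma> \<ge> 0"
  shows "\<exists>C>0. \<forall>u0 u1::'a::euclidean_space L2. u0 \<in> hom_Hs (- \<gamma>) \<inter> Hs s \<and> u1 \<in> hom_Hs (- \<gamma>) \<longrightarrow>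
    (\<forall>t\<ge>0. nH s (1 + t) (linear_flow u0 u1 t) \<le> C * data_norm \<gamma> s u0 u1 * (1 + t) powr (- \<gamma> / 2))"
proof -
  let ?hw = "\<lambda>\<xi>::'a. norm \<xi> powr (- \<gamma>)"
  have hm: "?hw \<in> borel_measurable borel" by measurable
  obtain C1 where C1: "C1 > 0" "\<And>t \<xi>::'a. t \<ge> 0 \<Longrightarrow> \<xi> \<noteq> 0
    \<Longrightarrow> wt s (1 + t) \<xi> * \<bar>K_hat t \<xi>\<bar> \<le> C1 * (1 + t) powr (- \<gamma> / 2) * (norm \<xi> powr (- \<gamma>) + 1)"
    using K_hat_weighted_bound[OF \<gamma> s, where 'a='a] by blast
  obtain C2 where C2: "C2 > 0" "\<And>t \<xi>::'a. t \<ge> 0 \<Longrightarrow> \<xi> \<noteq> 0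
    \<Longrightarrow> wt s (1 + t) \<xi> * \<bar>E_hat t \<xi>\<bar> \<le> C2 * (1 + t) powr (- \<gamma> / 2) * (norm \<xi> powr (- \<gamma>) + wt s 1 \<xi>)"
    using E_hat_weighted_bound[OF \<gamma> s, where 'a='a] by blast
  define C where "C = C1 + C2"
  have C: "C > 0" using C1 C2 by (simp add: C_def)
  have "nH s (1 + t) (linear_flow u0 u1 t) \<le> C * data_norm \<gamma> s u0 u1 * (1 + t) powr (- \<gamma> / 2)"
    if u0: "u0 \<in> hom_Hs (- \<gamma>) \<inter> Hs s" and u1: "u1 \<in> hom_Hs (- \<gamma>)" and t: "t \<ge> 0"
      for u0 u1 :: "'a L2" and t
  proof -
    let ?D = "data_norm \<gamma> s u0 u1"
    let ?v = "(1 / 2) *\<^sub>R u0 + u1"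
    have h0: "u0 \<in> weighted_space ?hw" and h1: "u1 \<in> weighted_space ?hw"
      and w0: "u0 \<in> weighted_space (wt s 1)" and H0: "u0 \<in> Hs s"
      using u0 u1 by (auto simp: hom_Hs_def Hs_eq)
    have hh: "(1 / 2) *\<^sub>R u0 \<in> weighted_space ?hw" by (rule weighted_space_scaleR(1)[OF hm h0])
    have hv: "?v \<in> weighted_space ?hw" by (rule weighted_space_add(1)[OF hm hh h1])
    define A where "A = norm (fourier_multiplier ?hw u0)"
    define B where "B = nH s 1 u0"
    define A' where "A' = norm (fourier_multiplier ?hw u1)"
    have nn: "A \<ge> 0" "B \<ge> 0" "A' \<ge> 0" by (auto simp: A_def B_def A'_def)
    have D: "?D = (A + B) + (A' + norm u1)"
      unfolding data_norm_def A_def B_def A'_def norm_hom_Hs_def norm_Hs_eq[OF H0]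
      by (simp add: norm_fourier_multiplier[OF h0] norm_fourier_multiplier[OF h1])
    have hvn: "norm (fourier_multiplier ?hw ?v) \<le> A + A'"
    proof -
      have "fourier_multiplier ?hw ?v = (1 / 2) *\<^sub>R fourier_multiplier ?hw u0
        + fourier_multiplier ?hw u1"
        unfolding weighted_space_add(2)[OF hm hh h1] weighted_space_scaleR(2)[OF hm h0] ..
      also have "norm \<dots> \<le> (1 / 2) * A + A'" unfolding A_def A'_def by (intro norm_triangle_le) simp
      finally show ?thesis using nn by linarith
    qed
    have vn: "norm ?v \<le> B + norm u1"
    proof -
      have "norm ?v \<le> (1 / 2) * norm u0 + norm u1" by (intro norm_triangle_le) simp
      moreover have "norm u0 \<le> B" unfolding B_def by (rule norm_le_nH[OF H0 s(1)]) simp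
      moreover have "norm u0 \<ge> 0" by simp
      ultimately show ?thesis by linarith
    qed
    define q where "q = (1 + t) powr (- \<gamma> / 2)"
    have q: "q \<ge> 0" by (simp add: q_def)
    have E: "norm (fourier_multiplier (\<lambda>\<xi>. wt s (1 + t) \<xi> * E_hat t \<xi>) u0)
      \<le> C2 * q * A + C2 * q * B"
      unfolding A_def B_def
    proof (rule fourier_multiplier_le_add(2)[OF _ hm wt_measurable h0 w0])
      show "AE \<xi>::'a in lborel. \<bar>wt s (1 + t) \<xi> * E_hat t \<xi>\<bar>
        \<le> C2 * q * \<bar>?hw \<xi>\<bar> + C2 * q * \<bar>wt s 1 \<xi>\<bar>"
        using AE_lborel_singleton[of "0::'a"]
      proof eventually_elim
        case (elim \<xi>)
        have "\<bar>wt s (1 + t) \<xi> * E_hat t \<xi>\<bar> = wt s (1 + t) \<xi> * \<bar>E_hat t \<xi>\<bar>"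
          using wt_pos[of "1 + t" s \<xi>] t by (simp add: abs_mult)
        also have "\<dots> \<le> C2 * q * (norm \<xi> powr (- \<gamma>) + wt s 1 \<xi>)" unfolding q_def
          by (rule C2(2)[OF t elim])
        finally show ?case using wt_pos[of 1 s \<xi>] by (simp add: distrib_left)
      qed
    qed (use C2 q in auto)
    have K: "norm (fourier_multiplier (\<lambda>\<xi>. wt s (1 + t) \<xi> * K_hat t \<xi>) ?v) \<le>
        C1 * q * norm (fourier_multiplier ?hw ?v) + C1 * q * norm (fourier_multiplier (\<lambda>\<xi>. 1) ?v)"
    proof (rule fourier_multiplier_le_add(2)[OF _ hm _ hv weighted_space_one(1)])
      show "AE \<xi>::'a in lborel. \<bar>wt s (1 + t) \<xi> * K_hat t \<xi>\<bar> \<le> C1 * q * \<bar>?hw \<xi>\<bar> + C1 * q * \<bar>1\<bar>"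
        using AE_lborel_singleton[of "0::'a"]
      proof eventually_elim
        case (elim \<xi>)
        have "\<bar>wt s (1 + t) \<xi> * K_hat t \<xi>\<bar> = wt s (1 + t) \<xi> * \<bar>K_hat t \<xi>\<bar>"
          using wt_pos[of "1 + t" s \<xi>] t by (simp add: abs_mult)
        also have "\<dots> \<le> C1 * q * (norm \<xi> powr (- \<gamma>) + 1)" unfolding q_def by (rule C1(2)[OF t elim])
        finally show ?case by (simp add: distrib_left)
      qed
    qed (use C1 q in auto)
    have "nH s (1 + t) (linear_flow u0 u1 t)
      \<le> norm (fourier_multiplier (\<lambda>\<xi>. wt s (1 + t) \<xi> * E_hat t \<xi>) u0) +
        norm (fourier_multiplier (\<lambda>\<xi>. wt s (1 + t) \<xi> * K_hat t \<xi>) ?v)"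
      using t by (subst linear_flow_weighted(2)[OF s t _ H0]) (auto intro: norm_triangle_ineq)
    also have "\<dots> \<le> (C2 * q * A + C2 * q * B) + (C1 * q * (A + A') + C1 * q * (B + norm u1))"
    proof (intro add_mono E order_trans[OF K])
      have "C1 * q \<ge> 0" using C1 q by simp
      then show "C1 * q * norm (fourier_multiplier ?hw ?v) \<le> C1 * q * (A + A')"
        "C1 * q * norm (fourier_multiplier (\<lambda>\<xi>. 1) ?v) \<le> C1 * q * (B + norm u1)"
        using hvn vn by (auto simp: weighted_space_one intro: mult_left_mono)
    qed
    also have "\<dots> = C2 * q * (A + B) + C1 * q * ?D" unfolding D by (simp add: algebra_simps)
    also have "\<dots> \<le> C2 * q * ?D + C1 * q * ?D"
    proof -
      have "A + B \<le> ?D" unfolding D using nn by simp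
      moreover have "C2 * q \<ge> 0" using C2 q by simp
      ultimately show ?thesis by (intro add_right_mono mult_left_mono)
    qed
    also have "\<dots> = C * ?D * q" by (simp add: C_def algebra_simps)
    finally show ?thesis unfolding q_def .
  qed
  with C show ?thesis by blast
qed

section \<open>Existence, uniqueness and decay\<close>

definition unweight :: "real \<Rightarrow> real \<Rightarrow> 'a::euclidean_space L2 \<Rightarrow> 'a L2" where
  "unweight s h = fourier_multiplier (\<lambda>\<xi>. 1 / wt s h \<xi>)"

lemma unweight_in_Hs:
  fixes y :: "'a::euclidean_space L2"
  assumes s: "s \<ge> 0" and h: "h \<ge> 1"
  shows "unweight s h y \<in> Hs s" "fourier_multiplier (wt s h) (unweight s h y) = y"
    "fourier_multiplier (wt s 1) (unweight s h y) = fourier_multiplier (\<lambda>\<xi>. wt s 1 \<xi> / wt s h \<xi>) y"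
proof -
  have b: "\<bar>1 / wt s h \<xi>\<bar> \<le> 1" for \<xi> :: 'a using h by (intro inverse_wt_bounds s) auto
  have eq: "wt s h \<xi> * (1 / wt s h \<xi>) = 1" for \<xi> :: 'a using wt_pos[of h s \<xi>] h by simp
  have "\<bar>wt s h \<xi> * (1 / wt s h \<xi>)\<bar> \<le> 1" for \<xi> :: 'a unfolding eq by simp
  from bounded_multiplier_compose(2)[OF wt_measurable inverse_wt_measurable b this, of y]
  show "fourier_multiplier (wt s h) (unweight s h y) = y"
    unfolding unweight_def eq weighted_space_one(2) .
  have "\<bar>wt s 1 \<xi> * (1 / wt s h \<xi>)\<bar> \<le> 1" for \<xi> :: 'a using wt_ratio_bounds(2)[OF s h, of \<xi>] by simp
  note c = bounded_multiplier_compose[OF wt_measurable inverse_wt_measurable b this, of y]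
  show "unweight s h y \<in> Hs s" unfolding Hs_eq unweight_def by (rule c(1))
  show "fourier_multiplier (wt s 1) (unweight s h y)
    = fourier_multiplier (\<lambda>\<xi>. wt s 1 \<xi> / wt s h \<xi>) y"
    unfolding unweight_def c(2) by simp
qed

lemma unweight_weight:
  fixes u :: "'a::euclidean_space L2"
  assumes s: "s \<ge> 0" and h: "h \<ge> 1" and u: "u \<in> Hs s"
  shows "unweight s h (fourier_multiplier (wt s h) u) = u"
proof -
  have eq: "1 / wt s h \<xi> * wt s h \<xi> = 1" for \<xi> :: 'a using wt_pos[of h s \<xi>] h by simp
  from fourier_multiplier_compose(2)[OF inverse_wt_measurable[of s h] wt_measurable
    Hs_weighted_space[OF u h s], unfolded eq, OF weighted_space_one(1)]
  show ?thesis by (simp add: unweight_def weighted_space_one)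
qed

lemma bounded_linear_unweight: "s \<ge> 0 \<Longrightarrow> h \<ge> 1 \<Longrightarrow> bounded_linear (unweight s h)"
  unfolding unweight_def
    by (rule bounded_linear_multiplier[OF inverse_wt_measurable inverse_wt_bounds]) auto

text \<open>Continuity in H^s is encoded as continuity in L2 after applying the weight, an isometry
  of H^s onto L2, because the topology carried by the type is that of L2.\<close>

definition Hs_curve :: "real \<Rightarrow> (real \<Rightarrow> 'a::euclidean_space L2) \<Rightarrow> bool" where
  "Hs_curve s u \<longleftrightarrow> (\<forall>t\<ge>0. u t \<in> Hs s) \<and> continuous_on {0..} (\<lambda>t. fourier_multiplier (wt s 1) (u t))"

lemma Hs_diff: "u \<in> Hs s \<Longrightarrow> v \<in> Hs s \<Longrightarrow> u - v \<in> Hs s"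
  using weighted_space_diff(1)[OF wt_measurable[of s 1]] by (simp add: Hs_eq)

lemma weight_diff:
  "u \<in> Hs s \<Longrightarrow> v \<in> Hs s \<Longrightarrow> h \<ge> 1 \<Longrightarrow> s \<ge> 0 \<Longrightarrow>
    fourier_multiplier (wt s h) (u - v) = fourier_multiplier (wt s h) u - fourier_multiplier
      (wt s h) v"
  by (rule weighted_space_diff(2)[OF wt_measurable]) (auto intro: Hs_weighted_space)

lemma Hs_add: "u \<in> Hs s \<Longrightarrow> v \<in> Hs s \<Longrightarrow> u + v \<in> Hs s"
  using weighted_space_add(1)[OF wt_measurable[of s 1]] by (simp add: Hs_eq)

lemma weight_add:
  "u \<in> Hs s \<Longrightarrow> v \<in> Hs s \<Longrightarrow> h \<ge> 1 \<Longrightarrow> s \<ge> 0 \<Longrightarrow>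
    fourier_multiplier (wt s h) (u + v) = fourier_multiplier (wt s h) u + fourier_multiplier
      (wt s h) v"
  by (rule weighted_space_add(2)[OF wt_measurable]) (auto intro: Hs_weighted_space)

lemma continuous_Hs_iff: "s \<ge> 0 \<Longrightarrow> continuous_Hs s u \<longleftrightarrow> Hs_curve s u"
proof -
  assume s: "s \<ge> 0"
  have "((\<lambda>t'. norm_Hs s (u t' - u t)) \<longlongrightarrow> 0) (at t within {0..}) \<longleftrightarrow>
      ((\<lambda>t'. fourier_multiplier (wt s 1) (u t')) \<longlongrightarrow> fourier_multiplier (wt s 1) (u t))
        (at t within {0..})"
    if u: "\<And>t. t \<ge> 0 \<Longrightarrow> u t \<in> Hs s" and t: "t \<ge> 0" for t
  proof -
    have ev: "\<forall>\<^sub>F t' in at t within {0..}. norm_Hs s (u t' - u t) =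
        norm (fourier_multiplier (wt s 1) (u t') - fourier_multiplier (wt s 1) (u t))"
      unfolding eventually_at_topological
      using u t s by (intro exI[of _ UNIV]) (auto simp: norm_Hs_eq Hs_diff weight_diff)
    show ?thesis
      unfolding tendsto_cong[OF ev] by (simp add: tendsto_norm_zero_iff LIM_zero_iff)
  qed
  then show "continuous_Hs s u \<longleftrightarrow> Hs_curve s u"
    unfolding continuous_Hs_def Hs_curve_def continuous_on_def by auto
qed

text \<open>The weight now moves with t. On a bounded time interval the quotients by the fixed
  weight are uniformly bounded and pointwise continuous in t, so
  \<open>continuous_on_fourier_multiplier\<close> applies.\<close>

lemma Hs_curve_weighted_continuous:
  fixes u :: "real \<Rightarrow> 'a::euclidean_space L2"
  assumes s: "s \<ge> 0" and u: "Hs_curve s u"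
  shows "continuous_on {0..} (\<lambda>t. fourier_multiplier (wt s (1 + t)) (u t))"
proof (rule continuous_on_atLeastI)
  fix T :: real assume T: "T \<ge> 0"
  have uc: "continuous_on {0..T} (\<lambda>t. fourier_multiplier (wt s 1) (u t))"
    by (rule continuous_on_subset[of "{0..}"]) (use u in \<open>auto simp: Hs_curve_def\<close>)
  have "continuous_on {0..T} (\<lambda>t. fourier_multiplier (\<lambda>\<xi>. wt s (1 + t) \<xi>
    / wt s 1 \<xi>) (fourier_multiplier (wt s 1) (u t)))"
  proof (rule continuous_on_fourier_multiplier[OF _ _ _ uc])
    show "\<bar>wt s (1 + t) \<xi> / wt s 1 \<xi>\<bar> \<le> (1 + T) powr (s / 2)" if "t \<in> {0..T}" for t and \<xi> :: 'a
    proof -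
      have "\<bar>wt s (1 + t) \<xi> / wt s 1 \<xi>\<bar> \<le> (1 + t) powr (s / 2)" using that
        by (intro wt_ratio_bounds s) auto
      also have "\<dots> \<le> (1 + T) powr (s / 2)" using that s by (intro powr_mono2) auto
      finally show ?thesis .
    qed
    show "continuous_on {0..T} (\<lambda>t. wt s (1 + t) \<xi> / wt s 1 \<xi>)" for \<xi> :: 'a
      using wt_pos[of 1 s \<xi>] by (intro continuous_on_divide continuous_on_const
        continuous_on_subset[OF continuous_wt]) auto
  qed measurable
  then show "continuous_on {0..T} (\<lambda>t. fourier_multiplier (wt s (1 + t)) (u t))"
  proof (rule continuous_on_eq)
    fix t assume t: "t \<in> {0..T}"
    have "u t \<in> Hs s" using u t by (simp add: Hs_curve_def)
    from Hs_eq_lift[OF s this] nH_lift_Hs[OF s, of "1 + t" "fourier_multiplier (wt s 1) (u t)"] t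
    show "fourier_multiplier (\<lambda>\<xi>. wt s (1 + t) \<xi> / wt s 1 \<xi>) (fourier_multiplier (wt s 1) (u t))
      = fourier_multiplier (wt s (1 + t)) (u t)"
      by simp
  qed
qed

text \<open>A curve of rate \<gamma> written through an L2 valued function \<open>z\<close>: the
  time-dependent norm of the curve at t is (1+t)^(-\<gamma>/2) times the norm of \<open>z t\<close>.
  The solution space thereby becomes the complete space of bounded continuous functions.\<close>

definition profile :: "real \<Rightarrow> real \<Rightarrow> (real \<Rightarrow> 'a::euclidean_space L2) \<Rightarrow> real \<Rightarrow> 'a L2" where
  "profile \<gamma> s z t = (1 + t) powr (- \<gamma> / 2) *\<^sub>R unweight s (1 + t) (z t)"

lemma profile_in_Hs:
  assumes s: "s \<ge> 0" and t: "t \<ge> 0"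
  shows "profile \<gamma> s z t \<in> Hs s" "fourier_multiplier (wt s (1 + t)) (profile \<gamma> s z t)
    = (1 + t) powr (- \<gamma> / 2) *\<^sub>R z t"
    "fourier_multiplier (wt s 1) (profile \<gamma> s z t)
      = (1 + t) powr (- \<gamma> / 2) *\<^sub>R fourier_multiplier (\<lambda>\<xi>. wt s 1 \<xi> / wt s (1 + t) \<xi>) (z t)"
proof -
  have h: "1 + t \<ge> 1" using t by simp
  note U = unweight_in_Hs[OF s h, of "z t"]
  have w: "unweight s (1 + t) (z t) \<in> weighted_space (wt s (1 + t))"
    by (rule Hs_weighted_space[OF U(1) h s])
  have w1: "unweight s (1 + t) (z t) \<in> weighted_space (wt s 1)" using U(1) by (simp add: Hs_eq)
  show "profile \<gamma> s z t \<in> Hs s"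
    unfolding profile_def Hs_eq by (rule weighted_space_scaleR(1)[OF wt_measurable w1])
  show "fourier_multiplier (wt s (1 + t)) (profile \<gamma> s z t) = (1 + t) powr (- \<gamma> / 2) *\<^sub>R z t"
    unfolding profile_def weighted_space_scaleR(2)[OF wt_measurable w] U(2) ..
  show "fourier_multiplier (wt s 1) (profile \<gamma> s z t)
    = (1 + t) powr (- \<gamma> / 2) *\<^sub>R fourier_multiplier (\<lambda>\<xi>. wt s 1 \<xi> / wt s (1 + t) \<xi>) (z t)"
    unfolding profile_def weighted_space_scaleR(2)[OF wt_measurable w1] U(3) ..
qed

lemma Hs_curve_profile:
  fixes z :: "real \<Rightarrow> 'a::euclidean_space L2"
  assumes s: "s \<ge> 0" and z: "continuous_on {0..} z"
  shows "Hs_curve s (profile \<gamma> s z)"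
  unfolding Hs_curve_def
proof (intro conjI allI impI)
  show "profile \<gamma> s z t \<in> Hs s" if "t \<ge> 0" for t by (rule profile_in_Hs(1)[OF s that])
  have pos: "wt s (1 + t) \<xi> \<noteq> 0" if "t \<ge> 0" for t and \<xi> :: 'a
    using wt_pos[of "1 + t" s \<xi>] that by simp
  have "continuous_on {0..} (\<lambda>t. (1 + t) powr (- \<gamma> / 2) *\<^sub>R fourier_multiplier (\<lambda>\<xi>. wt s 1 \<xi>
    / wt s (1 + t) \<xi>) (z t))"
  proof (intro continuous_on_scaleR continuous_on_fourier_multiplier[where B=1] z)
    show "continuous_on {0..} (\<lambda>t. (1 + t) powr (- \<gamma> / 2))"
      by (intro continuous_on_powr continuous_intros) auto
    show "\<bar>wt s 1 \<xi> / wt s (1 + t) \<xi>\<bar> \<le> 1" if "t \<in> {0..}" for t and \<xi> :: 'a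
      using that by (intro wt_ratio_bounds(2) s) auto
    show "continuous_on {0..} (\<lambda>t. wt s 1 \<xi> / wt s (1 + t) \<xi>)" for \<xi> :: 'a
      using pos by (intro continuous_on_divide continuous_on_const continuous_wt) auto
  qed measurable
  then show "continuous_on {0..} (\<lambda>t. fourier_multiplier (wt s 1) (profile \<gamma> s z t))"
    by (rule continuous_on_eq) (simp add: profile_in_Hs(3)[OF s])
qed

lemma profile_diff:
  assumes s: "s \<ge> 0" and t: "t \<ge> 0"
  shows "profile \<gamma> s z t - profile \<gamma> s z' t = profile \<gamma> s (\<lambda>t. z t - z' t) t"
proof -
  interpret U: bounded_linear "unweight s (1 + t) :: 'a L2 \<Rightarrow> 'a L2"
    using t by (intro bounded_linear_unweight s) auto
  show ?thesis by (simp add: profile_def U.diff scaleR_diff_right)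
qed

lemma profile_zero: "s \<ge> 0 \<Longrightarrow> t \<ge> 0 \<Longrightarrow> profile \<gamma> s (\<lambda>_. 0) t = 0"
  using profile_diff[of s t \<gamma> "\<lambda>_. 0" "\<lambda>_. 0"] by simp

section \<open>The nonlinearity along curves, and uniqueness\<close>

lemma nonlin_zero: "p > 0 \<Longrightarrow> nonlin p 0 = 0"
proof -
  assume p: "p > 0"
  have ae: "AE x in lborel. abs_powr p (0 :: 'a::euclidean_space L2) x = 0"
    using L2_fun_zero by eventually_elim (use p in \<open>simp add: abs_powr_def\<close>)
  have "square_integrable (abs_powr p (0 :: 'a L2))"
    by (rule norm_L2_mono(1)[OF square_integrable_zero]) (use ae in \<open>auto elim: eventually_mono\<close>)
  then have "L2_class (abs_powr p (0 :: 'a L2)) = L2_class (\<lambda>x. 0)"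
    by (rule L2_class_eqI[OF _ square_integrable_zero ae])
  then show "nonlin p (0 :: 'a L2) = 0" by (simp add: nonlin_def zero_L2.abs_eq)
qed

lemma nonlin_Lipschitz:
  fixes p s :: real
  assumes p: "p > 1" and ps: "real DIM('a) * (p - 1) / (2 * p) \<le> s"
  shows "\<exists>C>0. \<forall>M>0. \<forall>u v::'a::euclidean_space L2.
     u \<in> Hs s \<and> v \<in> Hs s \<and> nH s 1 u \<le> M \<and> nH s 1 v \<le> M \<longrightarrow>
     norm (nonlin p u - nonlin p v) \<le> C * M powr (p - 1) * nH s 1 (u - v)"
proof -
  have s: "s \<ge> 0" using ps p by (smt (verit) divide_nonneg_nonneg mult_nonneg_nonneg
    of_nat_0_le_iff)
  obtain C where C: "C > 0" and Cb: "\<And>M d u v. M > 0 \<Longrightarrow> d > 0 \<Longrightarrow> (u::'a L2) \<in> Hs s \<Longrightarrow> v \<in> Hs s \<Longrightarrow>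
      nH s 1 u \<le> M \<Longrightarrow> nH s 1 v \<le> M \<Longrightarrow> nH s 1 (u - v) \<le> d \<Longrightarrow>
      norm (nonlin p u - nonlin p v) \<le> C * (d * M powr (p - 1))"
    using nonlin_L2_estimate[OF p ps] by fastforce
  have "norm (nonlin p u - nonlin p v) \<le> C * M powr (p - 1) * nH s 1 (u - v)"
    if M: "M > 0" and u: "u \<in> Hs s" "v \<in> Hs s" "nH s 1 u \<le> M" "nH s 1 v \<le> M" for M
      and u v :: "'a L2"
  proof (cases "nH s 1 (u - v) > 0")
    case True
    from Cb[OF M True u] show ?thesis by (simp add: mult_ac)
  next
    \<comment> \<open>The underlying estimate takes a positive bound \<open>d\<close> on the
      difference, so equal arguments are treated separately.\<close>
    case False
    then have "norm (u - v) \<le> 0" using norm_le_nH[OF Hs_diff[OF u(1,2)] s, of 1] by simp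
    then show ?thesis using C by simp
  qed
  with C show ?thesis by blast
qed

lemma nonlin_continuous:
  fixes u :: "real \<Rightarrow> 'a::euclidean_space L2"
  assumes p: "p > 1" and ps: "real DIM('a) * (p - 1) / (2 * p) \<le> s" and u: "Hs_curve s u"
  shows "continuous_on {0..} (\<lambda>t. nonlin p (u t))"
  unfolding continuous_on_sequentially comp_def
proof (intro allI ballI impI)
  have s: "s \<ge> 0" using ps p by (smt (verit) divide_nonneg_nonneg mult_nonneg_nonneg
    of_nat_0_le_iff)
  obtain C where C: "C > 0" and Cb: "\<And>M u v. M > 0 \<Longrightarrow> (u::'a L2) \<in> Hs s \<Longrightarrow> v \<in> Hs s \<Longrightarrow>
      nH s 1 u \<le> M \<Longrightarrow> nH s 1 v \<le> M \<Longrightarrow> norm (nonlin p u - nonlin p v) \<le> C * M powr (p - 1) * nH s 1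
        (u - v)"
    using nonlin_Lipschitz[OF p ps] by blast
  fix x :: "nat \<Rightarrow> real" and a assume a: "a \<in> {0..}" and "(\<forall>n. x n \<in> {0..}) \<and> x \<longlonglongrightarrow> a"
  then have x: "\<And>n. x n \<ge> 0" and lim: "x \<longlonglongrightarrow> a" by auto
  let ?y = "\<lambda>t. fourier_multiplier (wt s 1) (u t)"
  have uH: "\<And>t. t \<ge> 0 \<Longrightarrow> u t \<in> Hs s" using u by (simp add: Hs_curve_def)
  have ylim: "(\<lambda>n. ?y (x n)) \<longlonglongrightarrow> ?y a"
    using u a x lim unfolding Hs_curve_def continuous_on_sequentially comp_def by auto
  then have "Bseq (\<lambda>n. ?y (x n))" by (intro convergent_imp_Bseq) (auto simp: convergent_def)
  then obtain B where B: "B > 0" "\<And>n. norm (?y (x n)) \<le> B" by (auto simp: Bseq_def)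
  define M where "M = B + norm (?y a)"
  have M: "M > 0" "\<And>n. norm (?y (x n)) \<le> M" "norm (?y a) \<le> M"
    using B unfolding M_def by (auto intro: add_pos_nonneg add_increasing2)
  show "(\<lambda>n. nonlin p (u (x n))) \<longlonglongrightarrow> nonlin p (u a)"
  proof (rule LIM_zero_cancel, rule Lim_null_comparison)
    show "\<forall>\<^sub>F n in sequentially. norm (nonlin p (u (x n)) - nonlin p (u a))
      \<le> C * M powr (p - 1) * norm (?y (x n) - ?y a)"
    proof (intro always_eventually allI)
      fix n
      show "norm (nonlin p (u (x n)) - nonlin p (u a))
        \<le> C * M powr (p - 1) * norm (?y (x n) - ?y a)"
        using Cb[OF M(1) uH[OF x[of n]] uH M(2)[of n] M(3)] a
          weight_diff[OF uH[OF x[of n]] uH, of a 1] s by simp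
    qed
    have "(\<lambda>n. C * M powr (p - 1) * norm (?y (x n) - ?y a))
      \<longlonglongrightarrow> C * M powr (p - 1) * norm (?y a - ?y a)"
      by (intro tendsto_intros ylim)
    then show "(\<lambda>n. C * M powr (p - 1) * norm (?y (x n) - ?y a)) \<longlonglongrightarrow> 0" by simp
  qed
qed

text \<open>The linear part is a parameter: the fixed point argument uses only its regularity and
  decay, and \<epsilon> enters through it alone.\<close>

definition solves :: "real \<Rightarrow> real \<Rightarrow> (real \<Rightarrow> 'a::euclidean_space L2) \<Rightarrow> (real \<Rightarrow> 'a L2) \<Rightarrow> bool" where
  "solves p s L u \<longleftrightarrow> Hs_curve s u \<and> (\<forall>t\<ge>0. u t = L t + lift_Hs s (duhamel s (\<lambda>\<tau>. nonlin p (u \<tau>)) t))"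

text \<open>The distance with weight exp(-l \<tau>) attains its maximum over the interval at some x.
  The Duhamel formula at x bounds this maximum by Q/l < 1 times itself, whatever the size of the two
  solutions, so it cannot be positive.\<close>

lemma solves_unique:
  fixes u v :: "real \<Rightarrow> 'a::euclidean_space L2"
  assumes p: "p > 1" and ps: "real DIM('a) * (p - 1) / (2 * p) \<le> s" and s: "0 \<le> s" "s \<le> 1"
    and u: "solves p s L u" and v: "solves p s L v" and t: "t \<ge> 0"
  shows "u t = v t"
proof (rule ccontr)
  assume ne: "u t \<noteq> v t"
  have uc: "Hs_curve s u" and vc: "Hs_curve s v" using u v by (auto simp: solves_def)
  have uH: "\<And>t. t \<ge> 0 \<Longrightarrow> u t \<in> Hs s" and vH: "\<And>t. t \<ge> 0 \<Longrightarrow> v t \<in> Hs s"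
    using uc vc by (auto simp: Hs_curve_def)
  define y where "y t = fourier_multiplier (wt s 1) (u t - v t)" for t
  have yeq: "y t = fourier_multiplier (wt s 1) (u t) - fourier_multiplier (wt s 1) (v t)" if "t \<ge> 0"
    for t
    unfolding y_def using that by (intro weight_diff uH vH s) auto
  obtain C where C: "C > 0" and Cb: "\<And>M u v. M > 0 \<Longrightarrow> (u::'a L2) \<in> Hs s \<Longrightarrow> v \<in> Hs s \<Longrightarrow>
      nH s 1 u \<le> M \<Longrightarrow> nH s 1 v \<le> M \<Longrightarrow> norm (nonlin p u - nonlin p v) \<le> C * M powr (p - 1) * nH s 1
        (u - v)"
    using nonlin_Lipschitz[OF p ps] by blast
  obtain K where K: "K > 0" "\<And>t \<xi>::'a. t \<ge> 0 \<Longrightarrow> \<bar>wt s 1 \<xi> * K_hat t \<xi>\<bar> \<le> K"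
    by (rule wt_times_K_bounded[OF s, where 'a='a]) (rule that)
  have bdd: "\<exists>M. \<forall>\<tau>\<in>{0..t}. nH s 1 (w \<tau>) \<le> M" if "Hs_curve s w" for w :: "real \<Rightarrow> 'a L2"
  proof -
    have "continuous_on {0..t} (\<lambda>\<tau>. fourier_multiplier (wt s 1) (w \<tau>))"
      by (rule continuous_on_subset[of "{0..}"]) (use that in \<open>auto simp: Hs_curve_def\<close>)
    then have "compact ((\<lambda>\<tau>. fourier_multiplier (wt s 1) (w \<tau>)) ` {0..t})"
      by (rule compact_continuous_image) simp
    then have "bounded ((\<lambda>\<tau>. fourier_multiplier (wt s 1) (w \<tau>)) ` {0..t})"
      by (rule compact_imp_bounded)
    then show ?thesis by (auto simp: bounded_iff)
  qed
  obtain M1 M2 where M1: "\<And>\<tau>. \<tau> \<in> {0..t} \<Longrightarrow> nH s 1 (u \<tau>) \<le> M1"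
    and M2: "\<And>\<tau>. \<tau> \<in> {0..t} \<Longrightarrow> nH s 1 (v \<tau>) \<le> M2"
    using bdd[OF uc] bdd[OF vc] by blast
  define M where "M = max 1 (max M1 M2)"
  define Q where "Q = K * (C * M powr (p - 1))"
  have Q: "Q \<ge> 0" using K C by (simp add: Q_def)
  \<comment> \<open>Keeps Q/l below 1/2 and makes \<open>l\<close> positive.\<close>
  define l where "l = 2 * Q + 1"
  have l: "l > 0" using Q by (simp add: l_def)
  have ycont: "continuous_on {0..t} y"
  proof -
    have "continuous_on {0..t} (\<lambda>\<tau>. fourier_multiplier (wt s 1) (u \<tau>)
      - fourier_multiplier (wt s 1) (v \<tau>))"
      using uc vc unfolding Hs_curve_def
      by (intro continuous_on_diff) (auto elim!: continuous_on_subset)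
    then show ?thesis by (rule continuous_on_eq) (simp add: yeq)
  qed
  define g where "g \<tau> = exp (- l * \<tau>) * norm (y \<tau>)" for \<tau>
  have "continuous_on {0..t} g" unfolding g_def by (intro continuous_intros ycont)
  then obtain x where x: "x \<in> {0..t}" "\<And>\<tau>. \<tau> \<in> {0..t} \<Longrightarrow> g \<tau> \<le> g x"
    using continuous_attains_sup[of "{0..t}" g] t by auto
  have "norm (u t - v t) \<le> norm (y t)"
    unfolding y_def using t by (intro norm_le_nH Hs_diff uH vH s) auto
  moreover have "norm (u t - v t) > 0" using ne by simp
  ultimately have "norm (y t) > 0" by (rule less_le_trans[rotated])
  then have "g t > 0" by (simp add: g_def)
  then have W: "g x > 0" using x(2)[of t] t by auto
  define f where "f \<tau> = nonlin p (u \<tau>) - nonlin p (v \<tau>)" for \<tau>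
  have nuc: "continuous_on {0..} (\<lambda>\<tau>. nonlin p (u \<tau>))"
    and nvc: "continuous_on {0..} (\<lambda>\<tau>. nonlin p (v \<tau>))"
    by (rule nonlin_continuous[OF p ps uc], rule nonlin_continuous[OF p ps vc])
  have fc: "continuous_on {0..} f" unfolding f_def[abs_def] by (rule continuous_on_diff[OF nuc nvc])
  interpret lift: bounded_linear "lift_Hs s :: 'a L2 \<Rightarrow> 'a L2"
    by (rule bounded_linear_lift_Hs[OF s(1)])
  have x0: "x \<ge> 0" using x by simp
  have "u x - v x = lift_Hs s (duhamel s f x)"
    using u v x0 duhamel_diff[OF s nuc nvc x0] unfolding solves_def f_def[abs_def]
      by (simp add: lift.diff)
  then have "norm (y x) = nH s 1 (lift_Hs s (duhamel s f x))" unfolding y_def by simp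
  also have "\<dots> \<le> (Q * g x) * ((exp (l * x) - exp (l * 0)) / l)"
  proof (rule duhamel_norm_bound[OF s fc x0])
    have "((\<lambda>\<tau>. exp (l * \<tau>)) has_integral (exp (l * x) / l - exp (l * 0) / l)) {0..x}"
    proof (rule fundamental_theorem_of_calculus[OF x0])
      fix \<tau>
      have "((\<lambda>\<tau>. exp (l * \<tau>) / l) has_real_derivative exp (l * \<tau>)) (at \<tau> within {0..x})"
        using l by (auto intro!: derivative_eq_intros)
      then show "((\<lambda>\<tau>. exp (l * \<tau>) / l) has_vector_derivative exp (l * \<tau>)) (at \<tau> within {0..x})"
        by (simp add: has_real_derivative_iff_has_vector_derivative)
    qed
    from has_integral_mult_right[OF this, of "Q * g x"]
    show "((\<lambda>\<tau>. (Q * g x) * exp (l * \<tau>)) has_integral (Q * g x)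
      * ((exp (l * x) - exp (l * 0)) / l)) {0..x}"
      by (simp add: diff_divide_distrib)
    fix \<tau> assume \<tau>: "\<tau> \<in> {0..x}"
    then have \<tau>t: "\<tau> \<in> {0..t}" "\<tau> \<ge> 0" using x by auto
    have m: "(\<lambda>\<xi>::'a. wt s 1 \<xi> * K_hat (x - \<tau>) \<xi>) \<in> borel_measurable borel" by measurable
    have "norm (fourier_multiplier (\<lambda>\<xi>. wt s 1 \<xi> * K_hat (x - \<tau>) \<xi>) (f \<tau>)) \<le> K * norm (f \<tau>)"
      using \<tau> by (intro bounded_multiplier(2)[OF m] K(2)) auto
    also have "K * norm (f \<tau>) \<le> K * (C * M powr (p - 1) * norm (y \<tau>))"
    proof (rule mult_left_mono)
      show "norm (f \<tau>) \<le> C * M powr (p - 1) * norm (y \<tau>)"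
        unfolding f_def y_def using M1[OF \<tau>t(1)] M2[OF \<tau>t(1)]
          by (intro Cb uH vH \<tau>t) (auto simp: M_def)
    qed (use K in simp)
    also have "\<dots> = Q * (g \<tau> * exp (l * \<tau>))" by (simp add: Q_def g_def exp_minus)
    also have "\<dots> \<le> Q * (g x * exp (l * \<tau>))"
      using x(2)[OF \<tau>t(1)] Q by (intro mult_left_mono mult_right_mono) auto
    finally show "norm (fourier_multiplier (\<lambda>\<xi>. wt s 1 \<xi> * K_hat (x - \<tau>) \<xi>) (f \<tau>))
      \<le> (Q * g x) * exp (l * \<tau>)"
      by (simp only: mult.assoc)
  qed simp
  also have "\<dots> \<le> (Q * g x) * (exp (l * x) / l)"
    using Q W l by (intro mult_left_mono divide_right_mono) auto
  finally have le: "norm (y x) \<le> (Q / l) * g x * exp (l * x)" by (simp add: mult_ac)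
  have "norm (y x) = g x * exp (l * x)" by (simp add: g_def exp_minus)
  with le have "g x * exp (l * x) \<le> (Q / l) * g x * exp (l * x)" by simp
  then have "g x \<le> (Q / l) * g x" by (rule mult_right_le_imp_le) simp
  then have "1 * g x \<le> (Q / l) * g x" by simp
  then have "1 \<le> Q / l" using W by (simp only: mult_le_cancel_right_pos)
  then show False using l Q by (simp add: l_def field_simps)
qed

text \<open>The known rate \<open>\<gamma>0\<close> and the resulting rate \<gamma> are kept apart:
  equal rates give the contraction, a larger \<gamma> gives the gain in
  \<open>decay_bootstrap\<close>. The known rate enters the nonlinearity p times, once through the
  difference and p-1 times through the amplitude, which is the summand p \<gamma>0/2 of
  \<beta>.\<close>

lemma nonlinear_duhamel_estimate:
  fixes p s \<gamma>0 \<gamma> :: real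
  assumes p: "p > 1" and ps: "real DIM('a) * (p - 1) / (2 * p) \<le> s" and s: "0 \<le> s" "s \<le> 1"
    and \<gamma>: "0 < \<gamma>" "\<gamma> < real DIM('a) / 2" "\<gamma> \<le> real DIM('a) * (p - 1) / 2"
    and k: "real DIM('a) * (p - 1) / 4 + p * \<gamma>0 / 2 - \<gamma> / 2 > 1"
  shows "\<exists>C>0. \<forall>M>0. \<forall>d>0. \<forall>u v::real \<Rightarrow> 'a::euclidean_space L2. Hs_curve s u \<and> Hs_curve s v \<and>
    (\<forall>t\<ge>0. nH s (1 + t) (u t) \<le> M * (1 + t) powr (- \<gamma>0 / 2)) \<and>
    (\<forall>t\<ge>0. nH s (1 + t) (v t) \<le> M * (1 + t) powr (- \<gamma>0 / 2)) \<and>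
    (\<forall>t\<ge>0. nH s (1 + t) (u t - v t) \<le> d * (1 + t) powr (- \<gamma>0 / 2)) \<longrightarrow>
    (\<forall>t\<ge>0. nH s (1 + t) (lift_Hs s (duhamel s (\<lambda>\<tau>. nonlin p (u \<tau>)) t) - lift_Hs s
      (duhamel s (\<lambda>\<tau>. nonlin p (v \<tau>)) t))
      \<le> C * (d * M powr (p - 1)) * (1 + t) powr (- \<gamma> / 2))"
proof -
  let ?b = "real DIM('a) * (p - 1) / 4"
  define \<beta> where "\<beta> = ?b + p * \<gamma>0 / 2"
  obtain C1 where C1: "C1 > 0" and C1': "\<forall>h\<ge>1. \<forall>M>0. \<forall>d>0. \<forall>u v::'a L2.
      u \<in> Hs s \<and> v \<in> Hs s \<and> nH s h u \<le> M \<and> nH s h v \<le> M \<and> nH s h (u - v) \<le> d \<longrightarrow>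
      norm (nonlin p u - nonlin p v) \<le> C1 * h powr (- ?b) * (d * M powr (p - 1))"
    using nonlin_L2_estimate[OF p ps] by (elim exE conjE) (rule that)
  obtain C2 where C2: "C2 > 0" and C2': "\<forall>h\<ge>1. \<forall>M>0. \<forall>d>0. \<forall>u v::'a L2.
      u \<in> Hs s \<and> v \<in> Hs s \<and> nH s h u \<le> M \<and> nH s h v \<le> M \<and> nH s h (u - v) \<le> d \<longrightarrow>
      nonlin p u - nonlin p v \<in> hom_Hs (- \<gamma>) \<and>
      norm_hom_Hs (- \<gamma>) (nonlin p u - nonlin p v) \<le> C2 * h powr (- ?b + \<gamma> / 2) *
        (d * M powr (p - 1))"
    using nonlin_negative_estimate[OF p ps \<gamma>] by (elim exE conjE) (rule that)
  have "\<beta> - \<gamma> / 2 > 1" using k by (simp add: \<beta>_def)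
  from duhamel_decay[OF s \<gamma>(1) this, where 'a='a]
  obtain C3 where C3: "C3 > 0" and C3': "\<forall>a\<ge>0. \<forall>f::real \<Rightarrow> 'a L2. continuous_on {0..} f \<and>
    (\<forall>\<tau>\<ge>0. norm (f \<tau>) \<le> a * (1 + \<tau>) powr (- \<beta>) \<and> f \<tau> \<in> hom_Hs (- \<gamma>) \<and>
      norm_hom_Hs (- \<gamma>) (f \<tau>) \<le> a * (1 + \<tau>) powr (- \<beta> + \<gamma> / 2)) \<longrightarrow>
    (\<forall>t\<ge>0. nH s (1 + t) (lift_Hs s (duhamel s f t)) \<le> C3 * a * (1 + t) powr (- \<gamma> / 2))"
    by (elim exE conjE) (rule that)
  \<comment> \<open>\<open>duhamel_decay\<close> takes one amplitude for both the L2 and the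
    negative norm.\<close>
  define C0 where "C0 = max C1 C2"
  have C0: "C0 > 0" "C1 \<le> C0" "C2 \<le> C0" using C1 by (auto simp: C0_def)
  have "nH s (1 + t) (lift_Hs s (duhamel s (\<lambda>\<tau>. nonlin p (u \<tau>)) t)
    - lift_Hs s (duhamel s (\<lambda>\<tau>. nonlin p (v \<tau>)) t))
      \<le> C3 * C0 * (d * M powr (p - 1)) * (1 + t) powr (- \<gamma> / 2)"
    if M: "M > 0" and d: "d > 0" and uc: "Hs_curve s u" and vc: "Hs_curve s v"
      and ub: "\<And>t. t \<ge> 0 \<Longrightarrow> nH s (1 + t) (u t) \<le> M * (1 + t) powr (- \<gamma>0 / 2)"
      and vb: "\<And>t. t \<ge> 0 \<Longrightarrow> nH s (1 + t) (v t) \<le> M * (1 + t) powr (- \<gamma>0 / 2)"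
      and db: "\<And>t. t \<ge> 0 \<Longrightarrow> nH s (1 + t) (u t - v t) \<le> d * (1 + t) powr (- \<gamma>0 / 2)" and t: "t \<ge> 0"
    for M d t and u v :: "real \<Rightarrow> 'a L2"
  proof -
    have nuc: "continuous_on {0..} (\<lambda>\<tau>. nonlin p (u \<tau>))"
      and nvc: "continuous_on {0..} (\<lambda>\<tau>. nonlin p (v \<tau>))"
      by (rule nonlin_continuous[OF p ps uc], rule nonlin_continuous[OF p ps vc])
    define a where "a = C0 * (d * M powr (p - 1))"
    have a: "a \<ge> 0" using C0 d by (simp add: a_def)
    interpret lift: bounded_linear "lift_Hs s :: 'a L2 \<Rightarrow> 'a L2"
      by (rule bounded_linear_lift_Hs[OF s(1)])
    have "lift_Hs s (duhamel s (\<lambda>\<tau>. nonlin p (u \<tau>)) t)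
      - lift_Hs s (duhamel s (\<lambda>\<tau>. nonlin p (v \<tau>)) t) =
       lift_Hs s (duhamel s (\<lambda>\<tau>. nonlin p (u \<tau>) - nonlin p (v \<tau>)) t)"
      unfolding duhamel_diff[OF s nuc nvc t] lift.diff ..
    also have "nH s (1 + t) \<dots> \<le> C3 * a * (1 + t) powr (- \<gamma> / 2)"
    proof (rule C3'[rule_format, OF a _ t], intro conjI allI impI continuous_on_diff[OF nuc nvc])
      fix \<tau> :: real assume \<tau>: "\<tau> \<ge> 0"
      define h where "h = 1 + \<tau>"
      have h: "h \<ge> 1" using \<tau> by (simp add: h_def)
      let ?q = "h powr (- \<gamma>0 / 2)"
      have q: "?q > 0" using h by simp
      have prod: "(d * ?q) * (M * ?q) powr (p - 1) = (d * M powr (p - 1)) * h powr (- (p * \<gamma>0 / 2))"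
      proof -
        have "?q * ?q powr (p - 1) = h powr (- (p * \<gamma>0 / 2))"
          unfolding powr_powr powr_add[symmetric]
            by (intro arg_cong[where f="\<lambda>x. h powr x"]) (simp add: algebra_simps)
        then show ?thesis by (simp add: powr_mult mult_ac)
      qed
      have uH: "u \<tau> \<in> Hs s" "v \<tau> \<in> Hs s" using uc vc \<tau> by (auto simp: Hs_curve_def)
      have Mq: "M * ?q > 0" "d * ?q > 0" using M d q by auto
      have args: "u \<tau> \<in> Hs s \<and> v \<tau> \<in> Hs s \<and> nH s h (u \<tau>) \<le> M * ?q \<and> nH s h (v \<tau>) \<le> M * ?q
        \<and> nH s h (u \<tau> - v \<tau>) \<le> d * ?q"
        using uH ub[OF \<tau>] vb[OF \<tau>] db[OF \<tau>] unfolding h_def by blast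
      note C1a = C1'[rule_format, OF h Mq args] and C2a = C2'[rule_format, OF h Mq args]
      have w: "d * M powr (p - 1) \<ge> 0" using d by simp
      have "norm (nonlin p (u \<tau>) - nonlin p (v \<tau>))
        \<le> C1 * h powr (- ?b) * ((d * M powr (p - 1)) * h powr (- (p * \<gamma>0 / 2)))"
        using C1a unfolding prod .
      also have "\<dots> = C1 * (d * M powr (p - 1)) * (h powr (- ?b) * h powr (- (p * \<gamma>0 / 2)))"
        by (simp only: mult_ac)
      also have "h powr (- ?b) * h powr (- (p * \<gamma>0 / 2)) = h powr (- \<beta>)"
        unfolding powr_add[symmetric] \<beta>_def by (simp add: algebra_simps)
      also have "C1 * (d * M powr (p - 1)) * h powr (- \<beta>) \<le> a * h powr (- \<beta>)"
        unfolding a_def using C0 w by (intro mult_right_mono) auto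
      finally have 1: "norm (nonlin p (u \<tau>) - nonlin p (v \<tau>)) \<le> a * h powr (- \<beta>)" .
      have "norm_hom_Hs (- \<gamma>) (nonlin p (u \<tau>) - nonlin p (v \<tau>))
        \<le> C2 * h powr (- ?b + \<gamma> / 2) * ((d * M powr (p - 1)) * h powr (- (p * \<gamma>0 / 2)))"
        using C2a unfolding prod by blast
      also have "\<dots> = C2 * (d * M powr (p - 1)) * (h powr (- ?b + \<gamma> / 2) * h powr (- (p * \<gamma>0 / 2)))"
        by (simp only: mult_ac)
      also have "h powr (- ?b + \<gamma> / 2) * h powr (- (p * \<gamma>0 / 2)) = h powr (- \<beta> + \<gamma> / 2)"
        unfolding powr_add[symmetric] \<beta>_def by (simp add: algebra_simps)
      also have "C2 * (d * M powr (p - 1)) * h powr (- \<beta> + \<gamma> / 2) \<le> a * h powr (- \<beta> + \<gamma> / 2)"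
        unfolding a_def using C0 w by (intro mult_right_mono) auto
      finally have 2: "norm_hom_Hs (- \<gamma>) (nonlin p (u \<tau>) - nonlin p (v \<tau>))
        \<le> a * h powr (- \<beta> + \<gamma> / 2)" .
      show "norm (nonlin p (u \<tau>) - nonlin p (v \<tau>)) \<le> a * (1 + \<tau>) powr (- \<beta>)"
        using 1 unfolding h_def .
      show "nonlin p (u \<tau>) - nonlin p (v \<tau>) \<in> hom_Hs (- \<gamma>)" using C2a by blast
      show "norm_hom_Hs (- \<gamma>) (nonlin p (u \<tau>) - nonlin p (v \<tau>)) \<le> a * (1 + \<tau>) powr (- \<beta> + \<gamma> / 2)"
        using 2 unfolding h_def .
    qed
    finally show ?thesis by (simp add: a_def mult.assoc)
  qed
  then show ?thesis using C3 C0(1) by (intro exI[of _ "C3 * C0"]) auto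
qed

section \<open>Fixed point in the space of decaying curves, and the improved rate\<close>

lemma duhamel_zero: "duhamel s (\<lambda>_. 0) t = 0"
proof -
  have "fourier_multiplier (\<lambda>\<xi>. wt s 1 \<xi> * K_hat (t - \<tau>) \<xi>) (0 :: 'a L2) = 0" for \<tau>
  proof (rule sym, rule fourier_multiplier_eqI)
    have z: "AE \<xi> in lborel. L2_fun (fourier (0 :: 'a L2)) \<xi> = 0"
      using L2_fun_zero by (simp add: linear_0[OF bounded_linear.linear[OF bounded_linear_fourier]])
    have m: "(\<lambda>\<xi>::'a. wt s 1 \<xi> * K_hat (t - \<tau>) \<xi>) \<in> borel_measurable borel" by measurable
    show "(0 :: 'a L2) \<in> weighted_space (\<lambda>\<xi>. wt s 1 \<xi> * K_hat (t - \<tau>) \<xi>)"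
      unfolding weighted_space_iff
      by (rule norm_L2_mono(1)[OF square_integrable_zero weighted_space_measurable[OF m]])
        (use z in \<open>auto elim: eventually_mono\<close>)
    show "AE \<xi> in lborel. L2_fun (fourier (0 :: 'a L2)) \<xi>
      = of_real (wt s 1 \<xi> * K_hat (t - \<tau>) \<xi>) * L2_fun (fourier 0) \<xi>"
      using z by eventually_elim simp
  qed
  then show ?thesis by (simp add: duhamel_def)
qed

lemma Hs_curve_duhamel:
  assumes s: "0 \<le> s" "s \<le> 1" and f: "continuous_on {0..} f"
  shows "Hs_curve s (\<lambda>t. lift_Hs s (duhamel s f t))"
  unfolding Hs_curve_def lift_Hs_in_Hs(2)[OF s(1)]
  by (intro conjI allI impI lift_Hs_in_Hs(1) s duhamel_continuous f)

lemma Hs_curve_add: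
  assumes s: "s \<ge> 0" and u: "Hs_curve s u" and v: "Hs_curve s v"
  shows "Hs_curve s (\<lambda>t. u t + v t)"
  unfolding Hs_curve_def
proof (intro conjI allI impI)
  show "u t + v t \<in> Hs s" if "t \<ge> 0" for t using u v that by (simp add: Hs_curve_def Hs_add)
  have "continuous_on {0..} (\<lambda>t. fourier_multiplier (wt s 1) (u t)
    + fourier_multiplier (wt s 1) (v t))"
    using u v by (intro continuous_on_add) (auto simp: Hs_curve_def)
  then show "continuous_on {0..} (\<lambda>t. fourier_multiplier (wt s 1) (u t + v t))"
    by (rule continuous_on_eq) (use u v s in \<open>simp add: Hs_curve_def weight_add\<close>)
qed

text \<open>A contraction with constant 1/2 leaves room for a linear part of size M/2 in the ball of
  radius \<open>M\<close>. At the fixed point |z| \<le> e + |z|/2 gives the bound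
  \<open>2 * e\<close>, so the solution is controlled by the size of the linear part and not merely
  by \<open>M\<close>; this keeps the final estimates linear in \<epsilon>.\<close>

lemma small_data_solution:
  fixes p s \<gamma> :: real
  assumes p: "p > 1" and ps: "real DIM('a) * (p - 1) / (2 * p) \<le> s" and s: "0 \<le> s" "s \<le> 1"
    and \<gamma>: "0 < \<gamma>" "\<gamma> < real DIM('a) / 2" "\<gamma> \<le> real DIM('a) * (p - 1) / 2"
    and k: "real DIM('a) * (p - 1) / 4 + p * \<gamma> / 2 - \<gamma> / 2 > 1"
  shows "\<exists>M>0. \<forall>e\<ge>0. \<forall>L::real \<Rightarrow> 'a::euclidean_space L2. e \<le> M / 2 \<and> Hs_curve s L \<and>
    (\<forall>t\<ge>0. nH s (1 + t) (L t) \<le> e * (1 + t) powr (- \<gamma> / 2)) \<longrightarrow>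
    (\<exists>u. solves p s L u \<and> (\<forall>t\<ge>0. nH s (1 + t) (u t) \<le> 2 * e * (1 + t) powr (- \<gamma> / 2)))"
proof -
  obtain C where C0: "C > 0" and C': "\<forall>M>0. \<forall>d>0. \<forall>u v::real \<Rightarrow> 'a L2. Hs_curve s u \<and> Hs_curve s v \<and>
    (\<forall>t\<ge>0. nH s (1 + t) (u t) \<le> M * (1 + t) powr (- \<gamma> / 2)) \<and>
    (\<forall>t\<ge>0. nH s (1 + t) (v t) \<le> M * (1 + t) powr (- \<gamma> / 2)) \<and>
    (\<forall>t\<ge>0. nH s (1 + t) (u t - v t) \<le> d * (1 + t) powr (- \<gamma> / 2)) \<longrightarrow>
    (\<forall>t\<ge>0. nH s (1 + t) (lift_Hs s (duhamel s (\<lambda>\<tau>. nonlin p (u \<tau>)) t) - lift_Hs s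
      (duhamel s (\<lambda>\<tau>. nonlin p (v \<tau>)) t))
      \<le> C * (d * M powr (p - 1)) * (1 + t) powr (- \<gamma> / 2))"
    using nonlinear_duhamel_estimate[OF p ps s \<gamma> k] by (elim exE conjE) (rule that)
  have C: "nH s (1 + t) (lift_Hs s (duhamel s (\<lambda>\<tau>. nonlin p (u \<tau>)) t)
    - lift_Hs s (duhamel s (\<lambda>\<tau>. nonlin p (v \<tau>)) t))
      \<le> C * (d * M powr (p - 1)) * (1 + t) powr (- \<gamma> / 2)"
    if "M > 0" "d > 0" "Hs_curve s u" "Hs_curve s v"
      "\<And>t. t \<ge> 0 \<Longrightarrow> nH s (1 + t) (u t) \<le> M * (1 + t) powr (- \<gamma> / 2)"
      "\<And>t. t \<ge> 0 \<Longrightarrow> nH s (1 + t) (v t) \<le> M * (1 + t) powr (- \<gamma> / 2)"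
      "\<And>t. t \<ge> 0 \<Longrightarrow> nH s (1 + t) (u t - v t) \<le> d * (1 + t) powr (- \<gamma> / 2)" "t \<ge> 0"
    for M d t and u v :: "real \<Rightarrow> 'a L2"
    by (rule C'[rule_format]) (use that in blast)+
  \<comment> \<open>The solution of C M^(p-1) = 1/2, which makes the contraction constant
    1/2.\<close>
  define M where "M = (1 / (2 * C)) powr (1 / (p - 1))"
  have M: "M > 0" using C0 by (simp add: M_def)
  have "M powr (p - 1) = 1 / (2 * C)" using p C0 by (simp add: M_def powr_powr)
  then have CM: "C * M powr (p - 1) = 1 / 2" using C0 by simp
  have "\<exists>u. solves p s L u \<and> (\<forall>t\<ge>0. nH s (1 + t) (u t) \<le> 2 * e * (1 + t) powr (- \<gamma> / 2))"
    if e: "e \<ge> 0" "e \<le> M / 2" and L: "Hs_curve s L"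
      and Lb: "\<And>t. t \<ge> 0 \<Longrightarrow> nH s (1 + t) (L t) \<le> e * (1 + t) powr (- \<gamma> / 2)"
    for e and L :: "real \<Rightarrow> 'a L2"
  proof -
    let ?D = "\<lambda>u t. lift_Hs s (duhamel s (\<lambda>\<tau>. nonlin p (u \<tau>)) t) :: 'a L2"
    define V where "V z = profile \<gamma> s (apply_bcontfun z)" for z :: "real \<Rightarrow>\<^sub>C 'a L2"
    have Vc: "Hs_curve s (V z)" for z
      unfolding V_def by (rule Hs_curve_profile[OF s(1)]) simp
    have Vn: "nH s (1 + t) (V z t) \<le> norm z * (1 + t) powr (- \<gamma> / 2)" if "t \<ge> 0" for z t
      unfolding V_def profile_in_Hs(2)[OF s(1) that] using norm_bounded[of z t]
        by (simp add: mult.commute mult_right_mono)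
    have Vd: "nH s (1 + t) (V z t - V z' t) \<le> norm (z - z') * (1 + t) powr (- \<gamma> / 2)" if "t \<ge> 0"
      for z z' t
    proof -
      have "V z t - V z' t = profile \<gamma> s (apply_bcontfun (z - z')) t"
        unfolding V_def profile_diff[OF s(1) that] by (simp add: minus_bcontfun.rep_eq)
      then show ?thesis using Vn[OF that, of "z - z'"] by (simp add: V_def)
    qed
    define F where "F z t = L t + ?D (V z) t" for z t
    have Nc: "continuous_on {0..} (\<lambda>\<tau>. nonlin p (V z \<tau>))" for z
      by (rule nonlin_continuous[OF p ps Vc])
    have Dc: "Hs_curve s (?D (V z))" for z by (rule Hs_curve_duhamel[OF s Nc])
    have Fc: "Hs_curve s (F z)" for z
      unfolding F_def[abs_def] by (rule Hs_curve_add[OF s(1) L Dc])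
    have FH: "F z t \<in> Hs s" if "t \<ge> 0" for z t using Fc that by (simp add: Hs_curve_def)
    \<comment> \<open>The type of bounded continuous functions lives on the whole line, so negative
      times get the value at time 0.\<close>
    define G
      where "G z t = (1 + max 0 t) powr (\<gamma> / 2) *\<^sub>R fourier_multiplier (wt s (1
      + max 0 t)) (F z (max 0 t))" for z t
    have Gd: "norm (G z t - G z' t) \<le> 1 / 2 * norm (z - z')" if z: "norm z \<le> M" "norm z' \<le> M"
      for z z' t
    proof (cases "z = z'")
      case False
      define r where "r = max 0 t"
      have r: "r \<ge> 0" by (simp add: r_def)
      have "G z t - G z' t = (1 + r) powr (\<gamma> / 2) *\<^sub>R fourier_multiplier (wt s (1 + r)) (F z r
        - F z' r)"
        unfolding G_def r_def[symmetric] using r s by (simp add: scaleR_diff_right weight_diff FH)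
      also have "F z r - F z' r = ?D (V z) r - ?D (V z') r" by (simp add: F_def)
      also have
        "norm ((1 + r) powr (\<gamma> / 2) *\<^sub>R fourier_multiplier (wt s (1 + r)) (?D (V z) r
        - ?D (V z') r)) =
          (1 + r) powr (\<gamma> / 2) * nH s (1 + r) (?D (V z) r - ?D (V z') r)" by simp
      also have "\<dots> \<le> (1 + r) powr (\<gamma> / 2)
        * (C * (norm (z - z') * M powr (p - 1)) * (1 + r) powr (- \<gamma> / 2))"
      proof (intro mult_left_mono C M Vc Vd r)
        show "norm (z - z') > 0" using False by simp
        show "nH s (1 + t) (V z t) \<le> M * (1 + t) powr (- \<gamma> / 2)" if "t \<ge> 0" for t
          by (rule order_trans[OF Vn[OF that]]) (use z in \<open>simp add: mult_right_mono\<close>)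
        show "nH s (1 + t) (V z' t) \<le> M * (1 + t) powr (- \<gamma> / 2)" if "t \<ge> 0" for t
          by (rule order_trans[OF Vn[OF that]]) (use z in \<open>simp add: mult_right_mono\<close>)
      qed auto
      also have "\<dots> = (C * M powr (p - 1)) * norm (z - z')
        * ((1 + r) powr (\<gamma> / 2) * (1 + r) powr (- \<gamma> / 2))"
        by (simp only: mult_ac)
      also have "(1 + r) powr (\<gamma> / 2) * (1 + r) powr (- \<gamma> / 2) = 1" using r
        by (simp add: powr_add[symmetric])
      finally show ?thesis unfolding CM by simp
    qed simp
    have G0: "norm (G 0 t) \<le> e" for t
    proof -
      define r where "r = max 0 t"
      have r: "r \<ge> 0" by (simp add: r_def)
      have V0: "V 0 \<tau> = 0" if "\<tau> \<ge> 0" for \<tau>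
        using profile_zero[OF s(1) that, of \<gamma>] by (simp add: V_def profile_def)
      have "duhamel s (\<lambda>\<tau>. nonlin p (V 0 \<tau>)) r = duhamel s (\<lambda>_. 0) r"
        unfolding duhamel_def by (rule Henstock_Kurzweil_Integration.integral_cong)
          (use p in \<open>simp add: V0 nonlin_zero\<close>)
      then have "F 0 r = L r"
        by (simp add: F_def duhamel_zero
          linear_0[OF bounded_linear.linear[OF bounded_linear_lift_Hs[OF s(1)]]])
      then have "norm (G 0 t) = (1 + r) powr (\<gamma> / 2) * nH s (1 + r) (L r)"
        unfolding G_def r_def[symmetric] by simp
      also have "\<dots> \<le> (1 + r) powr (\<gamma> / 2) * (e * (1 + r) powr (- \<gamma> / 2))"
        by (intro mult_left_mono Lb r) simp
      also have "\<dots> = e * ((1 + r) powr (\<gamma> / 2) * (1 + r) powr (- \<gamma> / 2))" by (simp only: mult_ac)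
      also have "(1 + r) powr (\<gamma> / 2) * (1 + r) powr (- \<gamma> / 2) = 1" using r
        by (simp add: powr_add[symmetric])
      finally show ?thesis by simp
    qed
    have Gb: "norm (G z t) \<le> e + 1 / 2 * norm z" if z: "norm z \<le> M" for z t
    proof -
      have "norm (G z t) \<le> norm (G 0 t) + norm (G z t - G 0 t)"
        using norm_triangle_sub[of "G z t" "G 0 t"] by simp
      moreover have "norm (G z t - G 0 t) \<le> 1 / 2 * norm (z - 0)" using z M by (intro Gd) auto
      ultimately show ?thesis using G0[of t] by simp
    qed
    have Gc: "continuous_on UNIV (G z)" for z
    proof -
      have "continuous_on {0..} (\<lambda>t. (1
        + t) powr (\<gamma> / 2) *\<^sub>R fourier_multiplier (wt s (1 + t)) (F z t))"
        by (intro continuous_on_scaleR Hs_curve_weighted_continuous s Fc continuous_on_powr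
          continuous_intros) auto
      moreover have "continuous_on UNIV (\<lambda>t::real. max 0 t)" by (intro continuous_intros)
      ultimately show ?thesis
        unfolding G_def[abs_def] by (rule continuous_on_compose2) auto
    qed
    \<comment> \<open>\<open>Bcontfun\<close> is meaningful only when \<open>G z\<close> is bounded,
      which is known for |z| \<le> M; hence the restriction in the facts about
      \<open>\<Psi>\<close>.\<close>
    define \<Psi> where "\<Psi> z = Bcontfun (G z)" for z
    have \<Psi>: "apply_bcontfun (\<Psi> z) = G z" if "norm z \<le> M" for z
      unfolding \<Psi>_def using Gb[OF that] by (intro Bcontfun_inverse bcontfun_normI Gc) auto
    have \<Psi>b: "norm (\<Psi> z) \<le> e + 1 / 2 * norm z" if "norm z \<le> M" for z
      by (rule norm_bound) (simp add: \<Psi>[OF that] Gb[OF that, simplified])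
    have "\<exists>!z\<in>cball 0 M. \<Psi> z = z"
    proof (rule Banach_fix[where c="1 / 2"])
      show "complete (cball (0 :: real \<Rightarrow>\<^sub>C 'a L2) M)" by (simp add: complete_eq_closed)
      show "cball (0 :: real \<Rightarrow>\<^sub>C 'a L2) M \<noteq> {}" using M by auto
      show "\<Psi> ` cball 0 M \<subseteq> cball 0 M"
      proof
        fix y assume "y \<in> \<Psi> ` cball 0 M"
        then obtain z where z: "norm z \<le> M" "y = \<Psi> z" by auto
        then show "y \<in> cball 0 M" using \<Psi>b[OF z(1)] e by simp
      qed
      show "dist (\<Psi> z) (\<Psi> z') \<le> 1 / 2 * dist z z'" if "z \<in> cball 0 M" "z' \<in> cball 0 M" for z z'
      proof (rule dist_bound)
        fix t
        show "dist (apply_bcontfun (\<Psi> z) t) (apply_bcontfun (\<Psi> z') t) \<le> 1 / 2 * dist z z'"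
          using that \<Psi>[of z] \<Psi>[of z'] Gd[of z z' t] by (simp add: dist_norm)
      qed
    qed auto
    then obtain z where z: "norm z \<le> M" "\<Psi> z = z" by auto
    have zb: "norm z \<le> 2 * e" using \<Psi>b[OF z(1)] z(2) by simp
    have zG: "apply_bcontfun z t = G z t" for t using \<Psi>[OF z(1)] z(2) by simp
    have VF: "V z t = F z t" if t: "t \<ge> 0" for t
    proof -
      have "V z t = (1 + t) powr (- \<gamma> / 2) *\<^sub>R unweight s (1
        + t) ((1 + t) powr (\<gamma> / 2) *\<^sub>R fourier_multiplier (wt s (1 + t)) (F z t))"
        unfolding V_def profile_def zG unfolding G_def using t by (simp add: max_absorb2)
      also have "\<dots> = ((1 + t) powr (- \<gamma> / 2) * (1 + t) powr (\<gamma> / 2)) *\<^sub>R unweight s (1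
        + t) (fourier_multiplier (wt s (1 + t)) (F z t))"
        using t by (simp add: linear_scale[OF
          bounded_linear.linear[OF bounded_linear_unweight[OF s(1)]]])
      also have "(1 + t) powr (- \<gamma> / 2) * (1 + t) powr (\<gamma> / 2) = 1" using t
        by (simp add: powr_add[symmetric])
      also have "unweight s (1 + t) (fourier_multiplier (wt s (1 + t)) (F z t)) = F z t"
        using t by (intro unweight_weight s FH) auto
      finally show ?thesis by simp
    qed
    have "solves p s L (V z)" unfolding solves_def using Vc VF by (auto simp: F_def)
    moreover have "nH s (1 + t) (V z t) \<le> 2 * e * (1 + t) powr (- \<gamma> / 2)" if "t \<ge> 0" for t
      by (rule order_trans[OF Vn[OF that] mult_right_mono[OF zb]]) simp
    ultimately show ?thesis by blast
  qed
  with M show ?thesis by blast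
qed

text \<open>The estimate for differences, applied to \<open>u\<close> and the zero curve with both
  bounds equal to \<open>A\<close>. Condition \<open>k\<close> involves the new rate only through
  -\<gamma>/2, so the rate already known can suffice for a larger one.\<close>

lemma decay_bootstrap:
  fixes p s \<gamma>0 \<gamma> :: real
  assumes p: "p > 1" and ps: "real DIM('a) * (p - 1) / (2 * p) \<le> s" and s: "0 \<le> s" "s \<le> 1"
    and \<gamma>: "0 < \<gamma>" "\<gamma> < real DIM('a) / 2" "\<gamma> \<le> real DIM('a) * (p - 1) / 2"
    and k: "real DIM('a) * (p - 1) / 4 + p * \<gamma>0 / 2 - \<gamma> / 2 > 1"
  shows "\<exists>C>0. \<forall>A>0. \<forall>e. \<forall>L u::real \<Rightarrow> 'a::euclidean_space L2. Hs_curve s L \<and> solves p s L u \<and>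
    (\<forall>t\<ge>0. nH s (1 + t) (u t) \<le> A * (1 + t) powr (- \<gamma>0 / 2)) \<and>
    (\<forall>t\<ge>0. nH s (1 + t) (L t) \<le> e * (1 + t) powr (- \<gamma> / 2)) \<longrightarrow>
    (\<forall>t\<ge>0. nH s (1 + t) (u t) \<le> (e + C * A powr p) * (1 + t) powr (- \<gamma> / 2))"
proof -
  obtain C where C0: "C > 0" and C': "\<forall>M>0. \<forall>d>0. \<forall>u v::real \<Rightarrow> 'a L2. Hs_curve s u \<and> Hs_curve s v \<and>
    (\<forall>t\<ge>0. nH s (1 + t) (u t) \<le> M * (1 + t) powr (- \<gamma>0 / 2)) \<and>
    (\<forall>t\<ge>0. nH s (1 + t) (v t) \<le> M * (1 + t) powr (- \<gamma>0 / 2)) \<and>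
    (\<forall>t\<ge>0. nH s (1 + t) (u t - v t) \<le> d * (1 + t) powr (- \<gamma>0 / 2)) \<longrightarrow>
    (\<forall>t\<ge>0. nH s (1 + t) (lift_Hs s (duhamel s (\<lambda>\<tau>. nonlin p (u \<tau>)) t) - lift_Hs s
      (duhamel s (\<lambda>\<tau>. nonlin p (v \<tau>)) t))
      \<le> C * (d * M powr (p - 1)) * (1 + t) powr (- \<gamma> / 2))"
    using nonlinear_duhamel_estimate[OF p ps s \<gamma> k] by (elim exE conjE) (rule that)
  have C: "nH s (1 + t) (lift_Hs s (duhamel s (\<lambda>\<tau>. nonlin p (u \<tau>)) t)
    - lift_Hs s (duhamel s (\<lambda>\<tau>. nonlin p (v \<tau>)) t))
      \<le> C * (d * M powr (p - 1)) * (1 + t) powr (- \<gamma> / 2)"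
    if "M > 0" "d > 0" "Hs_curve s u" "Hs_curve s v"
      "\<And>t. t \<ge> 0 \<Longrightarrow> nH s (1 + t) (u t) \<le> M * (1 + t) powr (- \<gamma>0 / 2)"
      "\<And>t. t \<ge> 0 \<Longrightarrow> nH s (1 + t) (v t) \<le> M * (1 + t) powr (- \<gamma>0 / 2)"
      "\<And>t. t \<ge> 0 \<Longrightarrow> nH s (1 + t) (u t - v t) \<le> d * (1 + t) powr (- \<gamma>0 / 2)" "t \<ge> 0"
    for M d t and u v :: "real \<Rightarrow> 'a L2"
    by (rule C'[rule_format]) (use that in blast)+
  have "nH s (1 + t) (u t) \<le> (e + C * A powr p) * (1 + t) powr (- \<gamma> / 2)"
    if A: "A > 0" and L: "Hs_curve s L" and u: "solves p s L u" and t: "t \<ge> 0"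
      and ub: "\<And>t. t \<ge> 0 \<Longrightarrow> nH s (1 + t) (u t) \<le> A * (1 + t) powr (- \<gamma>0 / 2)"
      and Lb: "\<And>t. t \<ge> 0 \<Longrightarrow> nH s (1 + t) (L t) \<le> e * (1 + t) powr (- \<gamma> / 2)"
    for A e t and L u :: "real \<Rightarrow> 'a L2"
  proof -
    let ?D = "\<lambda>u t. lift_Hs s (duhamel s (\<lambda>\<tau>. nonlin p (u \<tau>)) t) :: 'a L2"
    have uc: "Hs_curve s u" using u by (simp add: solves_def)
    have m0: "fourier_multiplier (wt s h) (0 :: 'a L2) = 0" if "h \<ge> 1" for h
      using weight_diff[OF lift_Hs_in_Hs(1)[OF s(1), of 0] lift_Hs_in_Hs(1)[OF s(1), of 0] that
        s(1)] by simp
    have H0: "(0 :: 'a L2) \<in> Hs s" using lift_Hs_in_Hs(1)[OF s(1), of 0]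
      by (simp add: linear_0[OF bounded_linear.linear[OF bounded_linear_lift_Hs[OF s(1)]]])
    have zc: "Hs_curve s (\<lambda>_. 0 :: 'a L2)"
      unfolding Hs_curve_def using H0 by (simp add: m0)
    have D0: "?D (\<lambda>_. 0) t = 0"
      using p by (simp add: nonlin_zero duhamel_zero
        linear_0[OF bounded_linear.linear[OF bounded_linear_lift_Hs[OF s(1)]]])
    have "nH s (1 + t) (?D u t - ?D (\<lambda>_. 0) t) \<le> C * (A * A powr (p - 1)) * (1 + t) powr (- \<gamma> / 2)"
      using ub A by (intro C uc zc t) (auto simp: m0)
    also have "A * A powr (p - 1) = A powr p" using A powr_add[of A 1 "p - 1"] by simp
    finally have D: "nH s (1 + t) (?D u t) \<le> C * A powr p * (1 + t) powr (- \<gamma> / 2)" unfolding D0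
      by simp
    have DH: "?D u t \<in> Hs s" by (rule lift_Hs_in_Hs(1)[OF s(1)])
    have LH: "L t \<in> Hs s" using L t by (simp add: Hs_curve_def)
    have "u t = L t + ?D u t" using u t by (simp add: solves_def)
    then have "nH s (1 + t) (u t) = norm (fourier_multiplier (wt s (1 + t)) (L t)
      + fourier_multiplier (wt s (1 + t)) (?D u t))"
      using weight_add[OF LH DH _ s(1), of "1 + t"] t by simp
    also have "\<dots> \<le> nH s (1 + t) (L t) + nH s (1 + t) (?D u t)" by (rule norm_triangle_ineq)
    also have "\<dots> \<le> e * (1 + t) powr (- \<gamma> / 2) + C * A powr p * (1 + t) powr (- \<gamma> / 2)"
      by (intro add_mono Lb t D)
    finally show ?thesis by (simp add: distrib_right)
  qed
  with C0 show ?thesis by blast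
qed

text \<open>Along a continuous curve in H^s the integral exists and its value is unique, so the
  existential quantifier in \<open>mild_solution\<close> can be replaced by the lifted Duhamel
  term.\<close>

lemma mild_solution_iff:
  fixes u0 u1 :: "'a::euclidean_space L2"
  assumes p: "p > 1" and ps: "real DIM('a) * (p - 1) / (2 * p) \<le> s" and s: "0 \<le> s" "s \<le> 1"
    and u: "Hs_curve s u"
  shows "mild_solution p \<epsilon> u0 u1 u \<longleftrightarrow> solves p s (\<lambda>t. \<epsilon> *\<^sub>R linear_flow u0 u1 t) u"
proof -
  have uH: "\<And>t. t \<ge> 0 \<Longrightarrow> u t \<in> Hs s" using u by (simp add: Hs_curve_def)
  have sq: "\<forall>t\<ge>0. square_integrable (abs_powr p (u t))" using nonlin_facts[OF p ps uH] by blast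
  have hi:
    "((\<lambda>\<tau>. K_conv (t - \<tau>) (L2_class (abs_powr p (u \<tau>)))) has_integral lift_Hs s
    (duhamel s (\<lambda>\<tau>. nonlin p (u \<tau>)) t)) {0..t}"
    if "t \<ge> 0" for t
    using duhamel_has_integral[OF s nonlin_continuous[OF p ps u] that] by (simp add: nonlin_def)
  have "(\<exists>I. ((\<lambda>\<tau>. K_conv (t - \<tau>) (L2_class (abs_powr p (u \<tau>)))) has_integral I) {0..t} \<and>
        u t = \<epsilon> *\<^sub>R K'_conv t u0 + \<epsilon> *\<^sub>R K_conv t (u0 + u1) + I) \<longleftrightarrow>
      u t = \<epsilon> *\<^sub>R linear_flow u0 u1 t + lift_Hs s (duhamel s (\<lambda>\<tau>. nonlin p (u \<tau>)) t)" if "t \<ge>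
        0" for t
  proof
    assume "\<exists>I. ((\<lambda>\<tau>. K_conv (t - \<tau>) (L2_class (abs_powr p (u \<tau>)))) has_integral I) {0..t} \<and>
        u t = \<epsilon> *\<^sub>R K'_conv t u0 + \<epsilon> *\<^sub>R K_conv t (u0 + u1) + I"
    then obtain I
      where I: "((\<lambda>\<tau>. K_conv (t - \<tau>) (L2_class (abs_powr p (u \<tau>)))) has_integral I) {0..t}"
      "u t = \<epsilon> *\<^sub>R K'_conv t u0 + \<epsilon> *\<^sub>R K_conv t (u0 + u1) + I" by blast
    show "u t = \<epsilon> *\<^sub>R linear_flow u0 u1 t + lift_Hs s (duhamel s (\<lambda>\<tau>. nonlin p (u \<tau>)) t)"
      unfolding I(2) linear_flow_def scaleR_add_right has_integral_unique[OF hi[OF that] I(1)] ..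
  next
    assume u: "u t = \<epsilon> *\<^sub>R linear_flow u0 u1 t + lift_Hs s (duhamel s (\<lambda>\<tau>. nonlin p (u \<tau>)) t)"
    show "\<exists>I. ((\<lambda>\<tau>. K_conv (t - \<tau>) (L2_class (abs_powr p (u \<tau>)))) has_integral I) {0..t} \<and>
        u t = \<epsilon> *\<^sub>R K'_conv t u0 + \<epsilon> *\<^sub>R K_conv t (u0 + u1) + I"
      by (rule exI, rule conjI[OF hi[OF that]]) (rule u[unfolded linear_flow_def scaleR_add_right])
  qed
  then show ?thesis unfolding mild_solution_def solves_def using sq u by auto
qed

text \<open>The rate \<open>\<gamma>\<^sub>0\<close> is the largest admissible one if that is below \<open>n/2\<close>, and otherwise slightly less
  than \<open>n/2\<close>; the second alternative for \<open>\<gamma>'\<close> is the hypothesis of \<open>decay_bootstrap\<close>.\<close>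

lemma exponent_choice:
  fixes n p \<gamma> :: real
  assumes n: "n > 0"
    and \<gamma>: "\<gamma> \<ge> min (n / 2) ((sqrt (n\<^sup>2 + 16 * n) - n) / 4)"
    and p: "p > max (1 + 2 / n) ((sqrt (n\<^sup>2 + 16 * n) + n) / (2 * n))"
  shows "\<exists>\<gamma>0>0. \<gamma>0 < n / 2 \<and> \<gamma>0 \<le> n * (p - 1) / 2 \<and> \<gamma>0 \<le> \<gamma> \<and>
    n * (p - 1) / 4 + p * \<gamma>0 / 2 - \<gamma>0 / 2 > 1 \<and>
    (\<forall>\<gamma>'. \<gamma>' < n / 2 \<and> \<gamma>' \<le> min (n * (p - 1) / 2) \<gamma> \<longrightarrow> \<gamma>' \<le> \<gamma>0 \<or> n * (p - 1) / 4 + p * \<gamma>0 / 2 - \<gamma>' /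
      2 > 1)"
proof -
  define R where "R = sqrt (n\<^sup>2 + 16 * n)"
  have R2: "R\<^sup>2 = n\<^sup>2 + 16 * n" using n by (simp add: R_def)
  have Rn: "R > n"
  proof (rule power2_less_imp_less)
    show "n\<^sup>2 < R\<^sup>2" using R2 n by simp
    show "0 \<le> R" using n by (simp add: R_def)
  qed
  have p1: "p > 1 + 2 / n" and p2: "p > (R + n) / (2 * n)" using p by (auto simp: R_def)
  have np1: "n * (p - 1) > 2" using p1 n by (simp add: field_simps)
  have np2: "2 * n * p - n > R" using p2 n by (simp add: field_simps)
  have pp: "p > 1" using p1 n by (smt (verit) divide_pos_pos)
  have "R\<^sup>2 < (2 * n * p - n)\<^sup>2" using np2 Rn n by (intro power_strict_mono) auto
  then have "16 * n < 4 * n * (n * p * (p - 1))" unfolding R2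
    by (simp add: power2_eq_square algebra_simps)
  then have "4 * n * 4 < 4 * n * (n * p * (p - 1))" by simp
  moreover have "0 < 4 * n" using n by simp
  \<comment> \<open>The second lower bound on \<open>p\<close> in squared form: \<open>p\<close>
    lies beyond the positive root of n p (p-1) = 4.\<close>
  ultimately have F1: "4 < n * p * (p - 1)" by (simp only: mult_less_cancel_left_pos)
  define m where "m = min (n * (p - 1) / 2) \<gamma>"
  have g0: "\<gamma> > 0" using \<gamma> n Rn by (auto simp: R_def[symmetric] min_def split: if_splits)
  have m0: "m > 0" using g0 np1 by (simp add: m_def)
  show ?thesis
  proof (cases "m < n / 2")
    case True
    \<comment> \<open>Four times the integrability condition at rate \<open>m\<close>. If m =
      n(p-1)/2, this is \<open>F1\<close>. If m = \<gamma>, both factors are compared with their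
      values at the critical exponents, (R-n)/(2n) and (n+R)/2, whose product is (R^2-n^2)/(4n) =
      4.\<close>
    have "4 < (p - 1) * (n + 2 * m)"
    proof (cases "n * (p - 1) / 2 \<le> \<gamma>")
      case True
      then have "m = n * (p - 1) / 2" by (simp add: m_def)
      then have "(p - 1) * (n + 2 * m) = n * p * (p - 1)" by (simp add: algebra_simps)
      then show ?thesis using F1 by (simp only:)
    next
      case False
      then have mg: "m = \<gamma>" by (simp add: m_def)
      then have "\<gamma> \<ge> (R - n) / 4" using \<gamma> True
        by (auto simp: R_def[symmetric] min_def split: if_splits)
      then have "(n + R) / 2 \<le> n + 2 * m" using mg by (simp add: field_simps)
      moreover have "(R - n) / (2 * n) < p - 1" using np2 n by (simp add: field_simps)
      moreover have "(R - n) / (2 * n) \<ge> 0" "(n + R) / 2 > 0" using Rn n by auto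
      ultimately have "(R - n) / (2 * n) * ((n + R) / 2) < (p - 1) * (n + 2 * m)"
        by (intro mult_less_le_imp_less)
      moreover have "(R - n) / (2 * n) * ((n + R) / 2) = (R\<^sup>2 - n\<^sup>2) / (4 * n)"
        by (simp add: power2_eq_square algebra_simps)
      ultimately show ?thesis using n by (simp add: R2)
    qed
    moreover have "(p - 1) * (n + 2 * m) = 4 * (n * (p - 1) / 4 + p * m / 2 - m / 2)"
      by (simp add: field_simps)
    ultimately have "4 * 1 < 4 * (n * (p - 1) / 4 + p * m / 2 - m / 2)" by (simp only: mult_1_right)
    then have "n * (p - 1) / 4 + p * m / 2 - m / 2 > 1" by (rule mult_left_less_imp_less) simp
    moreover have "m \<le> n * (p - 1) / 2" "m \<le> \<gamma>" by (auto simp: m_def)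
    ultimately show ?thesis using m0 True by (intro exI[of _ m]) (auto simp: m_def)
  next
    case False
    \<comment> \<open>How far to stay below the excluded rate n/2. The first term keeps n/2 - e
      positive. The second ensures p e \<le> n(p-1)/2 - 1, and since n(p-1) > 2 this leaves n(p-1)/2
      - p e/2 > 1.\<close>
    define e where "e = min (n / 4) ((n * (p - 1) / 2 - 1) / p)"
    have e: "e > 0" "e \<le> n / 4" using n np1 pp by (auto simp: e_def)
    have "e \<le> (n * (p - 1) / 2 - 1) / p" by (simp add: e_def)
    then have pe: "p * e \<le> n * (p - 1) / 2 - 1" using pp by (simp add: field_simps)
    \<comment> \<open>Stated with \<gamma>' replaced by its supremum n/2, so that it covers every
      \<gamma>' < n/2 at once.\<close>
    have key: "n * (p - 1) / 4 + p * (n / 2 - e) / 2 - n / 4 > 1"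
    proof -
      have "n * (p - 1) / 4 + p * (n / 2 - e) / 2 - n / 4 = n * (p - 1) / 2 - p * e / 2"
        by (simp add: field_simps)
      then show ?thesis using pe np1 by simp
    qed
    have "n / 2 - e > 0" using e n by simp
    moreover have "n / 2 - e \<le> n * (p - 1) / 2" "n / 2 - e \<le> \<gamma>" using False e by (auto simp: m_def)
    moreover have "n * (p - 1) / 4 + p * (n / 2 - e) / 2 - \<gamma>' / 2 > 1" if "\<gamma>' < n / 2" for \<gamma>'
      using key that by simp
    ultimately show ?thesis using e by (intro exI[of _ "n / 2 - e"]) auto
  qed
qed

theorem theorem1:
  fixes n :: nat and s \<gamma> p :: real and u0 u1 :: "(real ^ 'n) L2"
  assumes "n = CARD('n)" and "1 \<le> n" and "n \<le> 6"
    and "0 < s" and "s \<le> 1"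
    and "\<gamma> \<ge> min (n / 2) ((sqrt (n\<^sup>2 + 16 * n) - n) / 4)"
    and "p > max (1 + 2 / n) ((sqrt (n\<^sup>2 + 16 * n) + n) / (2 * n))"
    and "n > 2 * s \<longrightarrow> p \<le> n / (n - 2 * s)"
    and "u0 \<in> hom_Hs (- \<gamma>) \<inter> Hs s"
    and "u1 \<in> hom_Hs (- \<gamma>)"
  shows "\<exists>\<epsilon>0>0.
    (\<forall>\<epsilon>. 0 < \<epsilon> \<and> \<epsilon> < \<epsilon>0 \<longrightarrow>
       (\<exists>u. continuous_Hs s u \<and> mild_solution p \<epsilon> u0 u1 u \<and>
          (\<forall>v. continuous_Hs s v \<and> mild_solution p \<epsilon> u0 u1 v \<longrightarrow> (\<forall>t\<ge>0. v t = u t)))) \<and>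
    (\<forall>\<gamma>'. 0 < \<gamma>' \<and> \<gamma>' < n / 2 \<and> \<gamma>' \<le> min (n * (p - 1) / 2) \<gamma> \<longrightarrow>
       (\<exists>C>0. \<forall>\<epsilon> u. 0 < \<epsilon> \<and> \<epsilon> < \<epsilon>0 \<and> continuous_Hs s u \<and> mild_solution p \<epsilon> u0 u1 u \<longrightarrow>
          (\<forall>t\<ge>0.
             norm (u t) \<le> C * \<epsilon> * (1 + t) powr (- \<gamma>' / 2) * data_norm \<gamma> s u0 u1 \<and>
             norm_hom_Hs s (u t) \<le> C * \<epsilon> * (1 + t) powr (- (s + \<gamma>') / 2) * data_norm \<gamma> s u0 u1)))"
proof -
  have dim: "real DIM(real ^ 'n) = real n" using assms(1) by simp
  have n: "real n > 0" using assms(2) by simp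
  have s: "0 \<le> s" "s \<le> 1" using assms by auto
  have p1: "p > 1 + 2 / real n" using assms(7) by simp
  have p: "p > 1" using p1 n by (smt (verit) divide_pos_pos)
  have psn: "real n * (p - 1) / (2 * p) \<le> s"
  proof -
    \<comment> \<open>The upper bound on \<open>p\<close> cleared of its denominator; for n \<le> 2s
      the left side is not positive.\<close>
    have "p * (real n - 2 * s) \<le> real n"
    proof (cases "real n > 2 * s")
      case True
      then show ?thesis using assms(8) by (simp add: field_simps)
    next
      case False
      then have "p * (real n - 2 * s) \<le> 0" using p by (intro mult_nonneg_nonpos) auto
      then show ?thesis using n by linarith
    qed
    then show ?thesis using p by (simp add: field_simps)
  qed
  have "\<exists>\<gamma>0>0. \<gamma>0 < real n / 2 \<and> \<gamma>0 \<le> real n * (p - 1) / 2 \<and> \<gamma>0 \<le> \<gamma> \<and>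
    real n * (p - 1) / 4 + p * \<gamma>0 / 2 - \<gamma>0 / 2 > 1 \<and>
    (\<forall>\<gamma>'. \<gamma>' < real n / 2 \<and> \<gamma>' \<le> min (real n * (p - 1) / 2) \<gamma> \<longrightarrow> \<gamma>' \<le> \<gamma>0 \<or> real n * (p - 1) / 4 + p *
      \<gamma>0 / 2 - \<gamma>' / 2 > 1)"
    using assms(6,7) by (intro exponent_choice[OF n]) simp_all
  then obtain \<gamma>0 where \<gamma>0: "0 < \<gamma>0" "\<gamma>0 < real n / 2" "\<gamma>0 \<le> real n * (p - 1) / 2" "\<gamma>0 \<le> \<gamma>"
    and k0: "real n * (p - 1) / 4 + p * \<gamma>0 / 2 - \<gamma>0 / 2 > 1"
    and step: "\<And>\<gamma>'. \<gamma>' < real n / 2 \<Longrightarrow> \<gamma>' \<le> min (real n * (p - 1) / 2) \<gamma>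
      \<Longrightarrow> \<gamma>' \<le> \<gamma>0 \<or> real n * (p - 1) / 4 + p * \<gamma>0 / 2 - \<gamma>' / 2 > 1"
    by blast
  note ps = psn[folded dim]
  obtain M where M: "M > 0" and sol: "\<forall>e\<ge>0. \<forall>L::real \<Rightarrow> (real ^ 'n) L2. e \<le> M / 2 \<and> Hs_curve s L \<and>
    (\<forall>t\<ge>0. nH s (1 + t) (L t) \<le> e * (1 + t) powr (- \<gamma>0 / 2)) \<longrightarrow>
    (\<exists>u. solves p s L u \<and> (\<forall>t\<ge>0. nH s (1 + t) (u t) \<le> 2 * e * (1 + t) powr (- \<gamma>0 / 2)))"
    using small_data_solution[OF p ps s \<gamma>0(1-3)[folded dim] k0[folded dim]]
      by (elim exE conjE) (rule that)
  have \<gamma>: "\<gamma> \<ge> 0" using \<gamma>0 by simp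
  obtain K where K: "K > 0" and lin: "\<forall>u0 u1::(real ^ 'n) L2. u0 \<in> hom_Hs (- \<gamma>) \<inter> Hs s
    \<and> u1 \<in> hom_Hs (- \<gamma>) \<longrightarrow>
    (\<forall>t\<ge>0. nH s (1 + t) (linear_flow u0 u1 t) \<le> K * data_norm \<gamma> s u0 u1 * (1 + t) powr (- \<gamma> / 2))"
    using linear_flow_decay[OF s \<gamma>] by (elim exE conjE) (rule that)
  define D where "D = data_norm \<gamma> s u0 u1"
  have linD: "nH s (1 + t) (linear_flow u0 u1 t) \<le> K * D * (1 + t) powr (- \<gamma> / 2)" if "t \<ge> 0" for t
    unfolding D_def using lin assms(9,10) that by blast
  have D: "D \<ge> 0" unfolding D_def data_norm_def norm_hom_Hs_def norm_Hs_def weighted_norm_def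
    by simp
  define L where "L \<epsilon> t = \<epsilon> *\<^sub>R linear_flow u0 u1 t" for \<epsilon> t
  have lw: "linear_flow u0 u1 t \<in> weighted_space (wt s h)" if "t \<ge> 0" "h \<ge> 1" for t h
    using assms(9) that by (intro linear_flow_weighted(1) s) auto
  have Lc: "Hs_curve s (L \<epsilon>)" for \<epsilon>
    unfolding Hs_curve_def L_def
  proof (intro conjI allI impI)
    show "\<epsilon> *\<^sub>R linear_flow u0 u1 t \<in> Hs s" if "t \<ge> 0" for t
      unfolding Hs_eq using that by (intro weighted_space_scaleR(1) lw) auto
    have "continuous_on {0..} (\<lambda>t. \<epsilon> *\<^sub>R fourier_multiplier (wt s 1) (linear_flow u0 u1 t))"
      using assms(9) by (intro continuous_on_scaleR continuous_on_const linear_flow_continuous s)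
        auto
    then show "continuous_on {0..} (\<lambda>t. fourier_multiplier (wt s 1) (\<epsilon> *\<^sub>R linear_flow u0 u1 t))"
      by (rule continuous_on_eq) (simp add: weighted_space_scaleR(2)[OF wt_measurable lw])
  qed
  have Lb: "nH s (1 + t) (L \<epsilon> t) \<le> (\<epsilon> * (K * D)) * (1 + t) powr (- g / 2)"
    if \<epsilon>: "\<epsilon> > 0" and t: "t \<ge> 0" and g: "g \<le> \<gamma>" for \<epsilon> t g
  proof -
    have "nH s (1 + t) (L \<epsilon> t) = \<epsilon> * nH s (1 + t) (linear_flow u0 u1 t)"
      unfolding L_def using \<epsilon> t by (simp add: weighted_space_scaleR(2)[OF wt_measurable lw])
    also have "\<dots> \<le> \<epsilon> * (K * D * (1 + t) powr (- \<gamma> / 2))" using \<epsilon> t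
      by (intro mult_left_mono linD) auto
    also have "\<dots> \<le> \<epsilon> * (K * D * (1 + t) powr (- g / 2))"
      using \<epsilon> t g K D by (intro mult_left_mono powr_mono) auto
    finally show ?thesis by (simp add: mult.assoc)
  qed
  \<comment> \<open>D + 1 in place of D, because the data norm may vanish. The smallness refers to
    the rate \<open>\<gamma>0\<close> only, so one threshold serves all the rates \<gamma>'.\<close>
  define \<epsilon>0 where "\<epsilon>0 = M / (2 * (K * (D + 1)))"
  have KD: "K * (D + 1) > 0" using K D by simp
  have \<epsilon>0: "\<epsilon>0 > 0" using M KD by (simp add: \<epsilon>0_def)
  have small: "\<epsilon> * (K * D) \<le> M / 2" if "0 < \<epsilon>" "\<epsilon> < \<epsilon>0" for \<epsilon>
  proof -
    have "\<epsilon> * (K * D) \<le> \<epsilon>0 * (K * (D + 1))" using that K D by (intro mult_mono) auto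
    also have "\<dots> = M / 2"
    proof -
      have "M / (2 * x) * x = M / 2" if "x > 0" for x using that by (simp add: field_simps)
      then show ?thesis using KD unfolding \<epsilon>0_def by blast
    qed
    finally show ?thesis .
  qed
  have ex: "\<exists>u. solves p s (L \<epsilon>) u \<and> (\<forall>t\<ge>0. nH s (1 + t) (u t)
    \<le> 2 * (\<epsilon> * (K * D)) * (1 + t) powr (- \<gamma>0 / 2))"
    if \<epsilon>: "0 < \<epsilon>" "\<epsilon> < \<epsilon>0" for \<epsilon>
    using sol[rule_format, of "\<epsilon> * (K * D)" "L \<epsilon>"] small[OF \<epsilon>] Lc Lb[OF \<epsilon>(1) _ \<gamma>0(4)] \<epsilon> K D by simp
  have mild: "continuous_Hs s u \<and> mild_solution p \<epsilon> u0 u1 u \<longleftrightarrow> solves p s (L \<epsilon>) u" for \<epsilon> u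
    using mild_solution_iff[OF p ps s, of u \<epsilon> u0 u1] continuous_Hs_iff[OF s(1), of u]
    unfolding L_def[abs_def] solves_def by blast
  have exist: "\<exists>u. continuous_Hs s u \<and> mild_solution p \<epsilon> u0 u1 u \<and>
          (\<forall>v. continuous_Hs s v \<and> mild_solution p \<epsilon> u0 u1 v \<longrightarrow> (\<forall>t\<ge>0. v t = u t))"
    if \<epsilon>: "0 < \<epsilon>" "\<epsilon> < \<epsilon>0" for \<epsilon>
  proof -
    obtain u where u: "solves p s (L \<epsilon>) u" using ex[OF \<epsilon>] by blast
    have "\<forall>v. continuous_Hs s v \<and> mild_solution p \<epsilon> u0 u1 v \<longrightarrow> (\<forall>t\<ge>0. v t = u t)"
      unfolding mild using solves_unique[OF p ps s _ u] by blast
    then show ?thesis using u unfolding mild[symmetric] by blast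
  qed
  have decay: "\<exists>C>0. \<forall>\<epsilon> u. 0 < \<epsilon> \<and> \<epsilon> < \<epsilon>0 \<and> solves p s (L \<epsilon>) u \<longrightarrow>
      (\<forall>t\<ge>0. nH s (1 + t) (u t) \<le> C * \<epsilon> * D * (1 + t) powr (- g / 2))"
    if g: "0 < g" "g < real n / 2" "g \<le> min (real n * (p - 1) / 2) \<gamma>" for g
  proof -
    \<comment> \<open>The fixed point argument gives one solution with this decay; uniqueness hands
      it to every mild solution in the continuity class, so that the decay estimates can be claimed
      for all of them.\<close>
    have base: "nH s (1 + t) (u t) \<le> 2 * (\<epsilon> * (K * D)) * (1 + t) powr (- \<gamma>0 / 2)"
      if \<epsilon>: "0 < \<epsilon>" "\<epsilon> < \<epsilon>0" and u: "solves p s (L \<epsilon>) u" and t: "t \<ge> 0" for \<epsilon> u t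
    proof -
      obtain u' where u': "solves p s (L \<epsilon>) u'"
        "\<forall>t\<ge>0. nH s (1 + t) (u' t) \<le> 2 * (\<epsilon> * (K * D)) * (1 + t) powr (- \<gamma>0 / 2)"
        using ex[OF \<epsilon>] by blast
      then show ?thesis using solves_unique[OF p ps s u u'(1) t] t by simp
    qed
    show ?thesis
    proof (cases "g \<le> \<gamma>0")
      case True
      have "nH s (1 + t) (u t) \<le> (2 * K) * \<epsilon> * D * (1 + t) powr (- g / 2)"
        if \<epsilon>: "0 < \<epsilon>" "\<epsilon> < \<epsilon>0" and u: "solves p s (L \<epsilon>) u" and t: "t \<ge> 0" for \<epsilon> u t
      proof -
        have "2 * (\<epsilon> * (K * D)) * (1 + t) powr (- \<gamma>0 / 2)
          \<le> 2 * (\<epsilon> * (K * D)) * (1 + t) powr (- g / 2)"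
          using \<epsilon> K D t True by (intro mult_left_mono powr_mono) auto
        then show ?thesis using base[OF \<epsilon> u t] by (simp add: mult_ac)
      qed
      then show ?thesis using K by (intro exI[of _ "2 * K"]) auto
    next
      case False
      have kg: "real n * (p - 1) / 4 + p * \<gamma>0 / 2 - g / 2 > 1" using step[OF g(2,3)] False by blast
      have g3: "g \<le> real n * (p - 1) / 2" and g4: "g \<le> \<gamma>" using g(3) by auto
      obtain B where B: "B > 0" and Bb: "\<forall>A>0. \<forall>e. \<forall>L u::real \<Rightarrow> (real ^ 'n) L2. Hs_curve s L
        \<and> solves p s L u \<and>
        (\<forall>t\<ge>0. nH s (1 + t) (u t) \<le> A * (1 + t) powr (- \<gamma>0 / 2)) \<and>
        (\<forall>t\<ge>0. nH s (1 + t) (L t) \<le> e * (1 + t) powr (- g / 2)) \<longrightarrow>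
        (\<forall>t\<ge>0. nH s (1 + t) (u t) \<le> (e + B * A powr p) * (1 + t) powr (- g / 2))"
        using decay_bootstrap[OF p ps s g(1) g(2)[folded dim] g3[folded dim] kg[folded dim]]
        by (elim exE conjE) (rule that)
      \<comment> \<open>K stems from the linear part. The other summand stems from A^p \<le> A
        M^(p-1) with A = 2 \<epsilon> K D, which turns the power p into a bound linear in
        \<epsilon>.\<close>
      define C where "C = K + 2 * K * B * M powr (p - 1)"
      have C: "C > 0" using K B by (simp add: C_def add_pos_nonneg)
      have "nH s (1 + t) (u t) \<le> C * \<epsilon> * D * (1 + t) powr (- g / 2)"
        if \<epsilon>: "0 < \<epsilon>" "\<epsilon> < \<epsilon>0" and u: "solves p s (L \<epsilon>) u" and t: "t \<ge> 0" for \<epsilon> u t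
      \<comment> \<open>The bootstrap takes a positive amplitude \<open>A\<close>; for D = 0 the
        bound at rate \<open>\<gamma>0\<close> is already 0.\<close>
      proof (cases "D = 0")
        case True
        then show ?thesis using base[OF \<epsilon> u t] by simp
      next
        case False
        define A where "A = 2 * (\<epsilon> * (K * D))"
        have A: "A > 0" using False D K \<epsilon> by (simp add: A_def)
        have "A \<le> M" using small[OF \<epsilon>] by (simp add: A_def)
        have "A powr p = A * A powr (p - 1)" using A powr_add[of A 1 "p - 1"] by simp
        also have "\<dots> \<le> A * M powr (p - 1)" using A \<open>A \<le> M\<close> p
          by (intro mult_left_mono powr_mono2) auto
        finally have "\<epsilon> * (K * D) + B * A powr p \<le> \<epsilon> * (K * D) + B * (A * M powr (p - 1))" using B
          by simp
        also have "\<dots> = C * \<epsilon> * D" by (simp add: C_def A_def algebra_simps)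
        finally have le: "\<epsilon> * (K * D) + B * A powr p \<le> C * \<epsilon> * D" .
        have "Hs_curve s (L \<epsilon>) \<and> solves p s (L \<epsilon>) u \<and>
          (\<forall>t\<ge>0. nH s (1 + t) (u t) \<le> A * (1 + t) powr (- \<gamma>0 / 2)) \<and>
          (\<forall>t\<ge>0. nH s (1 + t) (L \<epsilon> t) \<le> (\<epsilon> * (K * D)) * (1 + t) powr (- g / 2))"
          using Lc u base[OF \<epsilon> u] Lb[OF \<epsilon>(1) _ g4] unfolding A_def by blast
        from Bb[rule_format, OF A this t]
        have "nH s (1 + t) (u t) \<le> (\<epsilon> * (K * D) + B * A powr p) * (1 + t) powr (- g / 2)" .
        also have "\<dots> \<le> C * \<epsilon> * D * (1 + t) powr (- g / 2)" by (intro mult_right_mono le) simp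
        finally show ?thesis .
      qed
      then show ?thesis using C by blast
    qed
  qed
  have final: "\<exists>C>0. \<forall>\<epsilon> u. 0 < \<epsilon> \<and> \<epsilon> < \<epsilon>0 \<and> continuous_Hs s u \<and> mild_solution p \<epsilon> u0 u1 u \<longrightarrow>
          (\<forall>t\<ge>0.
             norm (u t) \<le> C * \<epsilon> * (1 + t) powr (- g / 2) * D \<and>
             norm_hom_Hs s (u t) \<le> C * \<epsilon> * (1 + t) powr (- (s + g) / 2) * D)"
    if g: "0 < g" "g < real n / 2" "g \<le> min (real n * (p - 1) / 2) \<gamma>" for g
  proof -
    obtain C where C: "C > 0" and Cb: "\<forall>\<epsilon> u. 0 < \<epsilon> \<and> \<epsilon> < \<epsilon>0 \<and> solves p s (L \<epsilon>) u \<longrightarrow>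
      (\<forall>t\<ge>0. nH s (1 + t) (u t) \<le> C * \<epsilon> * D * (1 + t) powr (- g / 2))"
      using decay[OF g] by (elim exE conjE) (rule that)
    have "norm (u t) \<le> C * \<epsilon> * (1 + t) powr (- g / 2) * D \<and>
        norm_hom_Hs s (u t) \<le> C * \<epsilon> * (1 + t) powr (- (s + g) / 2) * D"
      if \<epsilon>: "0 < \<epsilon>" "\<epsilon> < \<epsilon>0" and u: "solves p s (L \<epsilon>) u" and t: "t \<ge> 0" for \<epsilon> u t
    proof
      have uH: "u t \<in> Hs s" using u t unfolding solves_def Hs_curve_def by blast
      have h: "1 + t \<ge> 1" using t by simp
      have b: "nH s (1 + t) (u t) \<le> C * \<epsilon> * D * (1 + t) powr (- g / 2)" using Cb \<epsilon> u t by blast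
      show "norm (u t) \<le> C * \<epsilon> * (1 + t) powr (- g / 2) * D"
        using norm_le_nH[OF uH s(1) h] b by (simp add: mult_ac)
      \<comment> \<open>Taking \<sigma> = s extracts the full factor (1+t)^(-s/2) from the weight:
        the additional decay of the homogeneous norm.\<close>
      have "norm_hom_Hs s (u t) \<le> (1 + t) powr (- s / 2) * nH s (1 + t) (u t)"
        by (rule norm_hom_Hs_le(2)[OF uH s(1) order_refl h])
      also have "\<dots> \<le> (1 + t) powr (- s / 2) * (C * \<epsilon> * D * (1 + t) powr (- g / 2))"
        by (intro mult_left_mono b) simp
      also have "\<dots> = C * \<epsilon> * ((1 + t) powr (- s / 2) * (1 + t) powr (- g / 2)) * D"
        by (simp only: mult_ac)
      also have "(1 + t) powr (- s / 2) * (1 + t) powr (- g / 2) = (1 + t) powr (- (s + g) / 2)"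
        unfolding powr_add[symmetric]
          by (intro arg_cong[where f="\<lambda>x. (1 + t) powr x"]) (simp add: field_simps)
      finally show "norm_hom_Hs s (u t) \<le> C * \<epsilon> * (1 + t) powr (- (s + g) / 2) * D" .
    qed
    then show ?thesis using C unfolding mild by blast
  qed
  show ?thesis
    using \<epsilon>0 exist final unfolding D_def by (intro exI[of _ \<epsilon>0]) blast
qed

end
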